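(* Let $T>0$, $n\ge 1$, $\alpha\in(0,1)$, $\varphi\in BV_{\mathrm{loc}}(\mathbb{R}^n)$, and let $X\in\mathcal{C}^\alpha([0,T],\mathbb{R}^n)$ be $(s,1)$-variable with respect to $\varphi$ for some $s\in(0,1)$. (i) For any $0<\beta<\alpha s$ the composition $\varphi\circ X$ is an element of $W^{\beta,1}_0(0,T)$. (ii) If in addition $Y\in\mathcal{C}^\gamma([0,T],\mathbb{R})$ with $\gamma\in(0,1)$ and $\alpha s+\gamma>1$, then for any $t\in[0,T]$ the generalized Lebesgue-Stieltjes integral $\int_0^t\varphi(X_u)\,dY_u$ exists. (iii) Moreover, if $X$ is $(s,p)$-variable with respect to $\varphi$ for some $p\in(1,+\infty]$, then for any $0<\beta<\alpha s$ we have $\varphi\circ X\in W^{\beta,p}(0,T)$. If in addition $Y\in\mathcal{C}^\gamma([0,T],\mathbb{R})$ with $\frac1p<1-\beta<\gamma$ (where $\frac{1}{+\infty}:=0$), then $$\int_0^{\cdot}\varphi(X_u)\,dY_u\in\mathcal{C}^{1-\beta-1/p}([0,T],\mathbb{R})$$ and $$\left\|\int_0^{\cdot}\varphi(X)\,dY\right\|_{\mathcal{C}^{1-\beta-1/p}([0,T])}\le c\,\|\varphi\circ X\|_{W^{\beta,p}(0,T)}\,\|Y\|_{\mathcal{C}^\gamma([0,T])}$$ with a constant $c>0$ that does not depend on $\varphi$, $X$ and $Y$.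
   Context: **BV and variability.** $\varphi\in L^1_{\mathrm{loc}}(\mathbb{R}^n)$ is in $BV_{\mathrm{loc}}(\mathbb{R}^n)$ if its distributional partial derivatives $D_i\varphi$ are signed Radon measures; $D\varphi=(D_1\varphi,\dots,D_n\varphi)$ and $\|D\varphi\|$ is the total variation measure of $D\varphi$. A path is a continuous function $X:[0,T]\to\mathbb{R}^n$. For $p\in[1,+\infty]$, $s\in(0,1)$, the path $X$ is $(s,p)$-variable w.r.t. $\varphi$ if there is a relatively compact open neighborhood $\mathcal{U}$ of $X([0,T])$ such that $t\mapsto\int_{\mathcal{U}}|X_t-z|^{-n+1-s}\|D\varphi\|(dz)$ is in $L^p(0,T)$. **Composition.** $\varphi\in L^1_{\mathrm{loc}}(\mathbb{R}^n)$ has approximate limit $\lambda_\varphi(x)$ at $x$ if $\lim_{r\to0}\mathcal{L}^n(B(x,r))^{-1}\int_{B(x,r)}|\varphi(y)-\lambda_\varphi(x)|dy=0$; $S_\varphi$ is the set of $x$ where no approximate limit exists. A Lebesgue representative of $\varphi$ is a Borel function $\widetilde\varphi$ with $\widetilde\varphi=\lambda_\varphi$ on $\mathbb{R}^n\setminus S_\varphi$. If $X$ is $(s,1)$-variable w.r.t. $\varphi$, then $\varphi\circ X=\varphi(X)$ is the $\mathcal{L}^1$-equivalence class of $t\mapsto\widetilde\varphi(X_t)$ (independent of the choice of $\widetilde\varphi$). **Function spaces.** $\mathcal{C}^\theta([0,T],\mathbb{R}^m)$, $0<\theta<1$: Hölder functions with norm $\sup_t|f(t)|+\sup_{u<t}|f(t)-f(u)|/|t-u|^\theta$.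 For $p<\infty$, $[f]_{\theta,p}=\big(\int_0^T\int_0^T\frac{|f(t)-f(u)|^p}{|t-u|^{1+\theta p}}du\,dt\big)^{1/p}$ and $\|f\|_{W^{\theta,p}(0,T)}=\|f\|_{L^p(0,T)}+[f]_{\theta,p}$. By (non-standard) convention, $\|f\|_{W^{\theta,\infty}(0,T)}=\|f\|_{L^\infty(0,T)}+\operatorname{ess\,sup}_{t\in[0,T]}\int_0^t\frac{|f(t)-f(u)|}{|t-u|^{1+\theta}}du$. $W^{\theta,1}_0(0,T)$: measurable $f$ with $\|f\|_{W_0^{\theta,1}}=\int_0^T\frac{|f(t)|}{t^\theta}dt+[f]_{\theta,1}<\infty$. $W^{\theta,\infty}_T(0,T)$: measurable $f$ such that $f(T-)$ exists and $\sup_{t}\frac{|f(T-)-f(t)|}{(T-t)^\theta}+\sup_t\int_t^T\frac{|f(t)-f(u)|}{|t-u|^{1+\theta}}du<\infty$. **Integral.** For $f\in W_0^{\theta,1}(0,T)$, $g\in W_T^{1-\theta,\infty}(0,T)$, $\theta\in(0,1)$, the generalized Lebesgue-Stieltjes integral is $$\int_0^Tf_t\,dg_t=(-1)^\theta\int_0^TD^\theta_{0+}f(t)\,D^{1-\theta}_{T-}(g-g(T-))(t)\,dt,$$ where $D^\theta_{0+}f(t)=\frac1{\Gamma(1-\theta)}\Big(\frac{f(t)}{t^\theta}+\theta\int_0^t\frac{f(t)-f(s)}{(t-s)^{\theta+1}}ds\Big)$ and $D^\theta_{T-}g(t)=\frac{(-1)^\theta}{\Gamma(1-\theta)}\Big(\frac{g(t)}{(T-t)^\theta}+\theta\int_t^T\frac{g(t)-g(s)}{(s-t)^{\theta+1}}ds\Big)$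 (so the complex prefactors combine to $(-1)^\theta(-1)^{1-\theta}=-1$). The value does not depend on the admissible $\theta$, and $\int_0^tf\,dg:=\int_0^T\mathbf{1}_{[0,t]}f\,dg$. That the integral exists means that $f\in W_0^{\theta,1}(0,T)$ and $g\in W_T^{1-\theta,\infty}(0,T)$ for some $\theta\in(0,1)$. *)

theory Defs
  imports "HOL-Analysis.Analysis" "HOL-Probability.Essential_Supremum"
begin

section \<open>Functions of locally bounded variation\<close>

text \<open>Elements of $L^1_{\mathrm{loc}}$ are represented by Lebesgue measurable functions.\<close>

definition locally_integrable :: "('a::euclidean_space \<Rightarrow> real) \<Rightarrow> bool" where
  "locally_integrable \<phi> \<longleftrightarrow> (\<forall>K. compact K \<longrightarrow> set_integrable lebesgue K \<phi>)"

primrec C_k :: "nat \<Rightarrow> ('a::euclidean_space \<Rightarrow> real) \<Rightarrow> bool" where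
  "C_k 0 f \<longleftrightarrow> continuous_on UNIV f"
| "C_k (Suc k) f \<longleftrightarrow>
     (\<forall>x. f differentiable (at x)) \<and> (\<forall>i\<in>Basis. C_k k (\<lambda>x. frechet_derivative f (at x) i))"

definition test_function :: "('a::euclidean_space \<Rightarrow> real) \<Rightarrow> bool" where
  "test_function \<psi> \<longleftrightarrow> (\<forall>k. C_k k \<psi>) \<and> compact (closure {x. \<psi> x \<noteq> 0})"

definition radon_measure :: "'a::euclidean_space measure \<Rightarrow> bool" where
  "radon_measure M \<longleftrightarrow> sets M = sets borel \<and> (\<forall>K. compact K \<longrightarrow> emeasure M K < \<infinity>)"

text \<open>
  A signed Radon measure need not have a value on unbounded sets (where it may be
  $\infty - \infty$).  It is a set function on the bounded Borel sets, the difference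
  $P - N$ of two positive Radon measures; its values on other sets are irrelevant.
  The following says that the distributional derivative of \<open>\<phi>\<close> in direction \<open>i\<close> is
  the signed Radon measure \<open>\<nu>\<close>.
\<close>

definition distr_partial_measure ::
    "('a::euclidean_space \<Rightarrow> real) \<Rightarrow> 'a \<Rightarrow> ('a set \<Rightarrow> real) \<Rightarrow> bool" where
  "distr_partial_measure \<phi> i \<nu> \<longleftrightarrow>
     (\<exists>P N. radon_measure P \<and> radon_measure N \<and>
        (\<forall>A\<in>sets borel. bounded A \<longrightarrow> \<nu> A = measure P A - measure N A) \<and>
        (\<forall>\<psi>. test_function \<psi> \<longrightarrow>
           (LINT x|lebesgue. \<phi> x * frechet_derivative \<psi> (at x) i)
             = - ((LINT x|P. \<psi> x) - (LINT x|N. \<psi> x))))"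

definition BV_loc :: "('a::euclidean_space \<Rightarrow> real) set" where
  "BV_loc = {\<phi>. locally_integrable \<phi> \<and> (\<forall>i\<in>Basis. \<exists>\<nu>. distr_partial_measure \<phi> i \<nu>)}"

text \<open>
  The choice of \<open>\<nu>\<close> below is unique on bounded Borel sets, and \<open>total_variation\<close> uses
  no other values.
\<close>

definition distr_gradient :: "('a::euclidean_space \<Rightarrow> real) \<Rightarrow> 'a set \<Rightarrow> 'a" where
  "distr_gradient \<phi> A = (\<Sum>i\<in>Basis. (SOME \<nu>. distr_partial_measure \<phi> i \<nu>) A *\<^sub>R i)"

definition total_variation ::
    "('a::euclidean_space set \<Rightarrow> 'b::real_normed_vector) \<Rightarrow> 'a set \<Rightarrow> ennreal" where
  "total_variation \<nu> B =
     (SUP A\<in>{A :: nat \<Rightarrow> 'a set. (\<forall>k. A k \<in> sets borel \<and> bounded (A k)) \<and>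
                disjoint_family A \<and> (\<Union>k. A k) = B}.
        \<Sum>k. ennreal (norm (\<nu> (A k))))"

definition total_variation_measure ::
    "('a::euclidean_space set \<Rightarrow> 'b::real_normed_vector) \<Rightarrow> 'a measure" where
  "total_variation_measure \<nu> = measure_of UNIV (sets borel) (total_variation \<nu>)"


section \<open>Function spaces on an interval\<close>

text \<open>
  All norms take values in \<open>ennreal\<close>, and a function space consists of the (measurable)
  functions of finite norm.  The interval $[0,T]$ carries the Lebesgue $\sigma$-algebra,
  so each space is closed under changing functions on null sets.

  Power function on $[0,\infty]$, for positive exponents only:
\<close>

definition ennreal_powr :: "ennreal \<Rightarrow> real \<Rightarrow> ennreal" where
  "ennreal_powr x a = (if x = \<infinity> then \<infinity> else ennreal (enn2real x powr a))"

definition Lp_norm :: "real \<Rightarrow> ennreal \<Rightarrow> (real \<Rightarrow> ennreal) \<Rightarrow> ennreal" where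
  "Lp_norm T p F =
     (if p = \<infinity> then esssup (lebesgue_on {0..T}) F
      else ennreal_powr (\<integral>\<^sup>+t. ennreal_powr (F t) (enn2real p) \<partial>lebesgue_on {0..T})
             (1 / enn2real p))"

definition holder_norm :: "real \<Rightarrow> real \<Rightarrow> (real \<Rightarrow> 'a::real_normed_vector) \<Rightarrow> ennreal" where
  "holder_norm \<theta> T f =
     (SUP t\<in>{0..T}. ennreal (norm (f t))) +
     (SUP (u, t)\<in>{(u, t). 0 \<le> u \<and> u < t \<and> t \<le> T}.
        ennreal (norm (f t - f u) / \<bar>t - u\<bar> powr \<theta>))"

definition holder_space :: "real \<Rightarrow> real \<Rightarrow> (real \<Rightarrow> 'a::real_normed_vector) set" where
  "holder_space \<theta> T = {f. holder_norm \<theta> T f < \<infinity>}"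

definition gagliardo :: "real \<Rightarrow> real \<Rightarrow> real \<Rightarrow> (real \<Rightarrow> real) \<Rightarrow> ennreal" where
  "gagliardo \<theta> p T f =
     ennreal_powr
       (\<integral>\<^sup>+t. (\<integral>\<^sup>+u. ennreal (\<bar>f t - f u\<bar> powr p / \<bar>t - u\<bar> powr (1 + \<theta> * p))
          \<partial>lebesgue_on {0..T}) \<partial>lebesgue_on {0..T})
       (1 / p)"

text \<open>For $p = \infty$ the seminorm is deliberately not the usual one: it is
  $\mathrm{ess\,sup}_t \int_0^t |f(t) - f(u)| \, |t - u|^{-1-\theta} \, du$.\<close>

definition W_norm :: "real \<Rightarrow> ennreal \<Rightarrow> real \<Rightarrow> (real \<Rightarrow> real) \<Rightarrow> ennreal" where
  "W_norm \<theta> p T f =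
     Lp_norm T p (\<lambda>t. ennreal \<bar>f t\<bar>) +
     (if p = \<infinity>
      then esssup (lebesgue_on {0..T})
             (\<lambda>t. \<integral>\<^sup>+u. ennreal (\<bar>f t - f u\<bar> / \<bar>t - u\<bar> powr (1 + \<theta>)) \<partial>lebesgue_on {0..t})
      else gagliardo \<theta> (enn2real p) T f)"

definition W_space :: "real \<Rightarrow> ennreal \<Rightarrow> real \<Rightarrow> (real \<Rightarrow> real) set" where
  "W_space \<theta> p T = {f \<in> borel_measurable (lebesgue_on {0..T}). W_norm \<theta> p T f < \<infinity>}"

definition W0_norm :: "real \<Rightarrow> real \<Rightarrow> (real \<Rightarrow> real) \<Rightarrow> ennreal" where
  "W0_norm \<theta> T f =
     (\<integral>\<^sup>+t. ennreal (\<bar>f t\<bar> / t powr \<theta>) \<partial>lebesgue_on {0..T}) + gagliardo \<theta> 1 T f"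

definition W0_space :: "real \<Rightarrow> real \<Rightarrow> (real \<Rightarrow> real) set" where
  "W0_space \<theta> T = {f \<in> borel_measurable (lebesgue_on {0..T}). W0_norm \<theta> T f < \<infinity>}"

definition left_lim :: "(real \<Rightarrow> real) \<Rightarrow> real \<Rightarrow> real" where
  "left_lim g T = Lim (at_left T) g"

definition WT_space :: "real \<Rightarrow> real \<Rightarrow> (real \<Rightarrow> real) set" where
  "WT_space \<theta> T =
     {g \<in> borel_measurable (lebesgue_on {0..T}).
        (\<exists>l. (g \<longlongrightarrow> l) (at_left T)) \<and>
        (SUP t\<in>{0<..<T}. ennreal (\<bar>left_lim g T - g t\<bar> / (T - t) powr \<theta>)) +
        (SUP t\<in>{0<..<T}.
           \<integral>\<^sup>+u. ennreal (\<bar>g t - g u\<bar> / \<bar>t - u\<bar> powr (1 + \<theta>)) \<partial>lebesgue_on {t..T}) < \<infinity>}"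


section \<open>The generalized Lebesgue--Stieltjes integral\<close>

definition frac_deriv_left :: "real \<Rightarrow> (real \<Rightarrow> real) \<Rightarrow> real \<Rightarrow> real" where
  "frac_deriv_left \<theta> f t =
     1 / Gamma (1 - \<theta>) *
     (f t / t powr \<theta> +
      \<theta> * (LINT s|lebesgue_on {0..t}. (f t - f s) / (t - s) powr (\<theta> + 1)))"

text \<open>
  The prefactor $(-1)^\theta$ of the right-sided derivative $D^\theta_{T-}$ is left out here.
  In the integral, $(-1)^\theta$ and the prefactor $(-1)^{1-\theta}$ of $D^{1-\theta}_{T-}$
  combine to $-1$, which is the sign in \<open>gls_formula\<close>.
\<close>

definition frac_deriv_right :: "real \<Rightarrow> real \<Rightarrow> (real \<Rightarrow> real) \<Rightarrow> real \<Rightarrow> real" where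
  "frac_deriv_right \<theta> T g t =
     1 / Gamma (1 - \<theta>) *
     (g t / (T - t) powr \<theta> +
      \<theta> * (LINT s|lebesgue_on {t..T}. (g t - g s) / (s - t) powr (\<theta> + 1)))"

definition gls_formula :: "real \<Rightarrow> real \<Rightarrow> (real \<Rightarrow> real) \<Rightarrow> (real \<Rightarrow> real) \<Rightarrow> real" where
  "gls_formula \<theta> T f g =
     - (LINT t|lebesgue_on {0..T}.
          frac_deriv_left \<theta> f t * frac_deriv_right (1 - \<theta>) T (\<lambda>u. g u - left_lim g T) t)"

definition gls_admissible :: "real \<Rightarrow> (real \<Rightarrow> real) \<Rightarrow> (real \<Rightarrow> real) \<Rightarrow> real \<Rightarrow> bool" where
  "gls_admissible T f g \<theta> \<longleftrightarrow>
     0 < \<theta> \<and> \<theta> < 1 \<and> f \<in> W0_space \<theta> T \<and> g \<in> WT_space (1 - \<theta>) T"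

definition gls_integrable :: "real \<Rightarrow> (real \<Rightarrow> real) \<Rightarrow> (real \<Rightarrow> real) \<Rightarrow> bool" where
  "gls_integrable T f g \<longleftrightarrow> (\<exists>\<theta>. gls_admissible T f g \<theta>)"

text \<open>The definite description reflects that the value is the same for all admissible \<open>\<theta>\<close>.\<close>

definition gls_integral :: "real \<Rightarrow> (real \<Rightarrow> real) \<Rightarrow> (real \<Rightarrow> real) \<Rightarrow> real" where
  "gls_integral T f g = (THE I. \<exists>\<theta>. gls_admissible T f g \<theta> \<and> I = gls_formula \<theta> T f g)"

text \<open>Integrals over $[0,t]$ are integrals over $[0,T]$ of the truncated integrand.\<close>

definition restrict_to :: "real \<Rightarrow> (real \<Rightarrow> real) \<Rightarrow> real \<Rightarrow> real" where
  "restrict_to t f = (\<lambda>u. indicator {0..t} u * f u)"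


section \<open>Variability and composition\<close>

text \<open>
  The kernel $|x - z|^{-n+1-s}$.  It is $\infty$ for $z = x$, as \<open>inverse 0 = \<infinity>\<close> in
  \<open>ennreal\<close>; the real-valued \<open>powr\<close> with a negative exponent would give \<open>0\<close> there.
\<close>

definition riesz_kernel :: "real \<Rightarrow> 'a::euclidean_space \<Rightarrow> 'a \<Rightarrow> ennreal" where
  "riesz_kernel s x z = inverse (ennreal (norm (x - z) powr (real DIM('a) - 1 + s)))"

definition variable_wrt ::
    "real \<Rightarrow> ennreal \<Rightarrow> real \<Rightarrow> ('a::euclidean_space \<Rightarrow> real) \<Rightarrow> (real \<Rightarrow> 'a) \<Rightarrow> bool" where
  "variable_wrt s p T \<phi> X \<longleftrightarrow>
     (\<exists>U. open U \<and> compact (closure U) \<and> X ` {0..T} \<subseteq> U \<and>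
        (let F = (\<lambda>t. \<integral>\<^sup>+z\<in>U. riesz_kernel s (X t) z
                         \<partial>total_variation_measure (distr_gradient \<phi>))
         in F \<in> borel_measurable (lebesgue_on {0..T}) \<and> Lp_norm T p F < \<infinity>))"

definition has_approx_limit :: "('a::euclidean_space \<Rightarrow> real) \<Rightarrow> 'a \<Rightarrow> real \<Rightarrow> bool" where
  "has_approx_limit \<phi> x l \<longleftrightarrow>
     ((\<lambda>r. (LINT y:ball x r|lebesgue. \<bar>\<phi> y - l\<bar>) / measure lebesgue (ball x r)) \<longlongrightarrow> 0)
       (at_right 0)"

definition lebesgue_representative ::
    "('a::euclidean_space \<Rightarrow> real) \<Rightarrow> ('a \<Rightarrow> real) \<Rightarrow> bool" where
  "lebesgue_representative \<phi> \<phi>' \<longleftrightarrow>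
     \<phi>' \<in> borel_measurable borel \<and> (\<forall>x l. has_approx_limit \<phi> x l \<longrightarrow> \<phi>' x = l)"

text \<open>
  The almost everywhere equivalence class of $\widetilde\varphi \circ X$ on $[0,T]$, as a set
  of functions.  For paths that are $(s,1)$-variable with respect to \<open>\<phi>\<close> it is the same
  class for every Lebesgue representative.
\<close>

definition composition ::
    "real \<Rightarrow> ('a::euclidean_space \<Rightarrow> real) \<Rightarrow> (real \<Rightarrow> 'a) \<Rightarrow> (real \<Rightarrow> real) set" where
  "composition T \<phi> X =
     {f. \<exists>\<phi>'. lebesgue_representative \<phi> \<phi>' \<and>
           (AE t in lebesgue_on {0..T}. f t = \<phi>' (X t))}"

end

theory Submission
  imports Defs
begin

text \<open>
  Mollification gives $\int_B |\phi(x+h)-\phi(x)|\,dx \le |h|\,\|D\phi\|(B')$ and hence a Poincare inequality on balls.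
  Summing it over dyadic radii shows that \<open>\<phi>\<close> has an approximate limit $\lambda(x)$ wherever the potential
  $F(x)=\int_U |x-z|^{-n+1-s}\,\|D\phi\|(dz)$ is finite, with
  $|\lambda(x)-\lambda(y)| \le C|x-y|^s(F(x)+F(y))$. Along the path, $f=\phi\circ X$ and $G=1+F\circ X$ therefore satisfy
  $|f| \le C\,G$ and $|f(t)-f(u)| \le C|t-u|^{\alpha s}(G(t)+G(u))$ almost everywhere, and all the seminorms of \<open>f\<close>
  are controlled by $L^p$ norms of \<open>G\<close>; the weight $t^{-\beta}$ at the endpoint is handled by a Hardy inequality.

  The integral does not depend on \<open>\<theta>\<close> because $D^{\theta}f = I^{\theta'-\theta}D^{\theta'}f$ for $\theta<\theta'$ and
  fractional integration is self-adjoint up to reflection. The increment of the integral over $[u,t]$ is the pairing of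
  $D^\theta(1_{(u,t]}f)$ with a bounded function; its $L^1$ norm is estimated by Hoelder's inequality
  for an auxiliary order $1-\gamma<\theta<\beta$, which gives the power $(t-u)^{1-\beta-1/p}$.
\<close>

section \<open>The total variation measure of the gradient\<close>

text \<open>The vector set function \<open>distr_gradient\<close> is meaningful only on bounded
  Borel sets, so its variation has to be proved a measure before any potential can be integrated
  against it. Both \<phi> and the path functions are merely Lebesgue measurable, while the Tonelli
  arguments live on Borel product spaces; both are therefore replaced by Borel representatives. A
  definite description defines the integral, so no value is known before independence of the order
  is settled. The pairing converges absolutely because its Y side is bounded and its f side
  integrable. Time reversal turns the right-sided derivative of Y into a left-sided one, so that one
  theory serves both factors. Cutting f at u and t creates two jumps. They cost integrals of |f|
  against (s - u) powr -\<theta> and (t - s) powr -\<theta>, and 1/p < 1 - \<beta> makes these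
  weights lie in the dual Lebesgue space. The order \<theta> is the midpoint of the interval from 1
  - \<gamma> to \<beta>; it depends on no function, which keeps the constant independent of \<phi>,
  X and Y.\<close>

lemma ennreal_norm_sums_le:
  fixes f :: "nat \<Rightarrow> 'b::real_normed_vector"
  assumes "f sums l"
  shows "ennreal (norm l) \<le> (\<Sum>k. ennreal (norm (f k)))"
proof (rule LIMSEQ_le_const2)
  show "(\<lambda>n. ennreal (norm (\<Sum>k<n. f k))) \<longlonglongrightarrow> ennreal (norm l)"
    using assms unfolding sums_def by (intro tendsto_ennrealI tendsto_norm)
  show "\<exists>N. \<forall>n\<ge>N. ennreal (norm (\<Sum>k<n. f k)) \<le> (\<Sum>k. ennreal (norm (f k)))"
  proof (intro exI[of _ 0] allI impI)
    fix n
    have "ennreal (norm (\<Sum>k<n. f k)) \<le> ennreal (\<Sum>k<n. norm (f k))"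
      by (intro ennreal_leI norm_sum)
    also have "\<dots> = (\<Sum>k<n. ennreal (norm (f k)))" by simp
    also have "\<dots> \<le> (\<Sum>k. ennreal (norm (f k)))" by (intro sum_le_suminf) auto
    finally show "ennreal (norm (\<Sum>k<n. f k)) \<le> (\<Sum>k. ennreal (norm (f k)))" .
  qed
qed

lemma suminf_ennreal_commute:
  fixes f :: "nat \<Rightarrow> nat \<Rightarrow> ennreal"
  shows "(\<Sum>i. \<Sum>j. f i j) = (\<Sum>j. \<Sum>i. f i j)"
proof -
  have "(\<Sum>i. \<Sum>j. f i j) = (\<integral>\<^sup>+i. (\<Sum>j. f i j) \<partial>count_space UNIV)"
    by (simp add: nn_integral_count_space_nat)
  also have "\<dots> = (\<Sum>j. \<integral>\<^sup>+i. f i j \<partial>count_space UNIV)"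
    by (rule nn_integral_suminf) simp
  finally show ?thesis by (simp add: nn_integral_count_space_nat)
qed

text \<open>The pieces are bounded because P - N may be \<open>\<infinity> - \<infinity>\<close> on
  other sets; the union B itself may be unbounded.\<close>

definition bounded_partitions :: "'a::euclidean_space set \<Rightarrow> (nat \<Rightarrow> 'a set) set" where
  "bounded_partitions B =
     {A. (\<forall>k. A k \<in> sets borel \<and> bounded (A k)) \<and> disjoint_family A \<and> (\<Union>k. A k) = B}"

lemma total_variation_partitions:
  "total_variation \<nu> B = (SUP A\<in>bounded_partitions B. \<Sum>k. ennreal (norm (\<nu> (A k))))"
  by (simp add: total_variation_def bounded_partitions_def)

text \<open>A summand can be moved into a supremum over [0,\<infinity>] only if the index set is
  nonempty, which is the use of this fact. Annuli around the origin cut any Borel set into bounded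
  pieces.\<close>

lemma bounded_partitions_nonempty:
  assumes "B \<in> sets borel"
  shows "bounded_partitions (B::'a::euclidean_space set) \<noteq> {}"
proof -
  define C where "C k = ball (0::'a) (real k)" for k
  have U: "(\<Union>k. C k) = UNIV"
    by (auto simp: C_def reals_Archimedean2)
  have "(\<lambda>k. disjointed C k \<inter> B) \<in> bounded_partitions B"
    unfolding bounded_partitions_def
  proof (intro CollectI conjI allI)
    fix k
    have "range C \<subseteq> sets borel" by (auto simp: C_def)
    then have "disjointed C k \<in> sets borel"
      by (meson range_subsetD sets.range_disjointed_sets)
    then show "disjointed C k \<inter> B \<in> sets borel" using assms by auto
    have "disjointed C k \<subseteq> C k" by (rule disjointed_subset)
    then show "bounded (disjointed C k \<inter> B)"
      by (intro bounded_subset[OF bounded_ball, of _ 0 "real k"]) (auto simp: C_def)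
  next
    show "disjoint_family (\<lambda>k. disjointed C k \<inter> B)"
      using disjoint_family_disjointed[of C] by (auto simp: disjoint_family_on_def)
    show "(\<Union>k. disjointed C k \<inter> B) = B"
      using U UN_disjointed_eq[of C] by auto
  qed
  then show ?thesis by blast
qed

text \<open>The form of countable additivity that survives for a difference of two Radon measures,
  whose values on unbounded sets are arbitrary.\<close>

definition bounded_sigma_additive :: "('a::euclidean_space set \<Rightarrow> 'b::real_normed_vector) \<Rightarrow> bool" where
  "bounded_sigma_additive \<nu> \<longleftrightarrow>
     (\<forall>A. range A \<subseteq> sets borel \<and> disjoint_family A \<and> bounded (\<Union>k. A k) \<longrightarrow>
        (\<lambda>k. \<nu> (A k)) sums \<nu> (\<Union>k. A k))"

lemma bounded_sigma_additiveD:
  "\<lbrakk>bounded_sigma_additive \<nu>; \<And>k. A k \<in> sets borel; disjoint_family A; bounded (\<Union>k. A k)\<rbrakk>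
    \<Longrightarrow> (\<lambda>k. \<nu> (A k)) sums \<nu> (\<Union>k. A k)"
  by (auto simp: bounded_sigma_additive_def)

lemma bounded_sigma_additive_empty:
  assumes "bounded_sigma_additive \<nu>"
  shows "\<nu> {} = 0"
proof -
  have "(\<lambda>k::nat. \<nu> {}) sums \<nu> {}"
    using bounded_sigma_additiveD[OF assms, of "\<lambda>_. {}"] by (auto simp: disjoint_family_on_def)
  then have "(\<lambda>k::nat. \<nu> {}) \<longlonglongrightarrow> 0"
    using sums_summable summable_LIMSEQ_zero by blast
  then show ?thesis by (simp add: LIMSEQ_const_iff)
qed

text \<open>Refining each piece \<open>A k\<close> of a partition by the sets \<open>B j\<close> can
  only increase the sum of norms, by countable additivity on the bounded set \<open>A k\<close>.
  After exchanging the two sums, the refined pieces partition each \<open>B j\<close>.\<close>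

lemma total_variation_countably_subadditive:
  fixes \<nu> :: "'a::euclidean_space set \<Rightarrow> 'b::real_normed_vector"
  assumes \<nu>: "bounded_sigma_additive \<nu>"
    and B: "\<And>j. B j \<in> sets borel" "disjoint_family B"
  shows "total_variation \<nu> (\<Union>j. B j) \<le> (\<Sum>j::nat. total_variation \<nu> (B j))"
  unfolding total_variation_partitions[of \<nu> "\<Union>j. B j"]
proof (rule SUP_least)
  fix A assume "A \<in> bounded_partitions (\<Union>j. B j)"
  then have A: "\<And>k. A k \<in> sets borel" "\<And>k. bounded (A k)" "disjoint_family A" "(\<Union>k. A k) = (\<Union>j. B j)"
    by (auto simp: bounded_partitions_def)
  have eq: "(\<Union>j. A k \<inter> B j) = A k" for k using A(4) by auto
  have "ennreal (norm (\<nu> (A k))) \<le> (\<Sum>j. ennreal (norm (\<nu> (A k \<inter> B j))))" for k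
  proof (rule ennreal_norm_sums_le)
    have "(\<lambda>j. \<nu> (A k \<inter> B j)) sums \<nu> (\<Union>j. A k \<inter> B j)"
    proof (rule bounded_sigma_additiveD[OF \<nu>])
      show "disjoint_family (\<lambda>j. A k \<inter> B j)"
        using B(2) unfolding disjoint_family_on_def by blast
    qed (use A B eq in auto)
    then show "(\<lambda>j. \<nu> (A k \<inter> B j)) sums \<nu> (A k)" by (simp only: eq)
  qed
  then have "(\<Sum>k. ennreal (norm (\<nu> (A k)))) \<le> (\<Sum>k. \<Sum>j. ennreal (norm (\<nu> (A k \<inter> B j))))"
    by (intro suminf_le) auto
  also have "\<dots> = (\<Sum>j. \<Sum>k. ennreal (norm (\<nu> (A k \<inter> B j))))" by (rule suminf_ennreal_commute)
  also have "\<dots> \<le> (\<Sum>j. total_variation \<nu> (B j))"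
  proof (intro suminf_le)
    fix j
    have "disjoint_family (\<lambda>k. A k \<inter> B j)"
      using A(3) unfolding disjoint_family_on_def by blast
    then have "(\<lambda>k. A k \<inter> B j) \<in> bounded_partitions (B j)"
      unfolding bounded_partitions_def using A B(1) by auto
    then show "(\<Sum>k. ennreal (norm (\<nu> (A k \<inter> B j)))) \<le> total_variation \<nu> (B j)"
      unfolding total_variation_partitions by (rule SUP_upper)
  qed auto
  finally show "(\<Sum>k. ennreal (norm (\<nu> (A k)))) \<le> (\<Sum>j. total_variation \<nu> (B j))" .
qed

text \<open>A partition of B placed at the even indices and one of C at the odd indices form a
  partition of the union; then take suprema over both independently.\<close>

lemma total_variation_superadditive:
  fixes \<nu> :: "'a::euclidean_space set \<Rightarrow> 'b::real_normed_vector"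
  assumes B: "B \<in> sets borel" "C \<in> sets borel" "B \<inter> C = {}"
  shows "total_variation \<nu> B + total_variation \<nu> C \<le> total_variation \<nu> (B \<union> C)"
proof -
  have pair: "(\<Sum>k. ennreal (norm (\<nu> (A k)))) + (\<Sum>k. ennreal (norm (\<nu> (A' k)))) \<le> total_variation \<nu> (B \<union> C)"
    if A: "A \<in> bounded_partitions B" and A': "A' \<in> bounded_partitions C" for A A'
  proof -
    define D where "D k = (if even k then A (k div 2) else A' (k div 2))" for k
    have "D \<in> bounded_partitions (B \<union> C)"
      unfolding bounded_partitions_def
    proof (intro CollectI conjI allI)
      fix k show "D k \<in> sets borel" "bounded (D k)"
        using A A' by (auto simp: D_def bounded_partitions_def)
    next
      have AA': "A i \<inter> A' j = {}" for i j using A A' B(3) by (auto simp: bounded_partitions_def)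
      show "disjoint_family D"
        unfolding disjoint_family_on_def
      proof (intro ballI impI)
        fix m n :: nat assume "m \<noteq> n"
        \<comment> \<open>A natural number is determined by its parity and its half.\<close>
        have "m div 2 \<noteq> n div 2" if "even m \<longleftrightarrow> even n"
          using \<open>m \<noteq> n\<close> that by (metis bit_eq_rec)
        then show "D m \<inter> D n = {}"
          using A A' AA' by (auto simp: D_def bounded_partitions_def disjoint_family_on_def)
      qed
      show "(\<Union>k. D k) = B \<union> C"
      proof
        show "(\<Union>k. D k) \<subseteq> B \<union> C" using A A' by (auto simp: D_def bounded_partitions_def split: if_splits)
        have "A k = D (2 * k)" "A' k = D (2 * k + 1)" for k by (auto simp: D_def)
        then have "(\<Union>k. A k) \<subseteq> (\<Union>k. D k)" "(\<Union>k. A' k) \<subseteq> (\<Union>k. D k)" by blast+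
        then show "B \<union> C \<subseteq> (\<Union>k. D k)" using A A' by (auto simp: bounded_partitions_def)
      qed
    qed
    then have D: "(\<Sum>k. ennreal (norm (\<nu> (D k)))) \<le> total_variation \<nu> (B \<union> C)"
      unfolding total_variation_partitions by (rule SUP_upper)
    have fin: "(\<Sum>k<N. ennreal (norm (\<nu> (A k)))) + (\<Sum>k<N. ennreal (norm (\<nu> (A' k)))) = (\<Sum>k<2*N. ennreal (norm (\<nu> (D k))))" for N
      by (induction N) (simp_all add: D_def ac_simps del: sum_ennreal)
    have "(\<lambda>N. (\<Sum>k<N. ennreal (norm (\<nu> (A k)))) + (\<Sum>k<N. ennreal (norm (\<nu> (A' k))))) \<longlonglongrightarrow>
       (\<Sum>k. ennreal (norm (\<nu> (A k)))) + (\<Sum>k. ennreal (norm (\<nu> (A' k))))"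
      by (intro tendsto_add summable_LIMSEQ) auto
    then have "(\<Sum>k. ennreal (norm (\<nu> (A k)))) + (\<Sum>k. ennreal (norm (\<nu> (A' k)))) \<le> (\<Sum>k. ennreal (norm (\<nu> (D k))))"
    proof (rule LIMSEQ_le_const2)
      show "\<exists>M. \<forall>N\<ge>M. (\<Sum>k<N. ennreal (norm (\<nu> (A k)))) + (\<Sum>k<N. ennreal (norm (\<nu> (A' k)))) \<le> (\<Sum>k. ennreal (norm (\<nu> (D k))))"
        unfolding fin by (intro exI[of _ 0] allI impI sum_le_suminf) auto
    qed
    then show ?thesis using D by (rule order_trans)
  qed
  let ?v = "\<lambda>A. \<Sum>k. ennreal (norm (\<nu> (A k)))"
  have "total_variation \<nu> B + total_variation \<nu> C
      = (SUP A\<in>bounded_partitions B. ?v A + (SUP A\<in>bounded_partitions C. ?v A))"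
    unfolding total_variation_partitions[of \<nu> B] total_variation_partitions[of \<nu> C]
    by (rule ennreal_SUP_add_left[OF bounded_partitions_nonempty[OF B(1)], symmetric])
  also have "\<dots> \<le> total_variation \<nu> (B \<union> C)"
  proof (rule SUP_least)
    fix A assume A: "A \<in> bounded_partitions B"
    have "?v A + (SUP A\<in>bounded_partitions C. ?v A) = (SUP A'\<in>bounded_partitions C. ?v A + ?v A')"
      by (rule ennreal_SUP_add_right[OF bounded_partitions_nonempty[OF B(2)]])
    also have "\<dots> \<le> total_variation \<nu> (B \<union> C)"
      using pair[OF A] by (rule SUP_least)
    finally show "?v A + (SUP A\<in>bounded_partitions C. ?v A) \<le> total_variation \<nu> (B \<union> C)" .
  qed
  finally show ?thesis .
qed

lemma total_variation_mono:
  fixes \<nu> :: "'a::euclidean_space set \<Rightarrow> 'b::real_normed_vector"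
  assumes "B \<in> sets borel" "C \<in> sets borel" "B \<subseteq> C"
  shows "total_variation \<nu> B \<le> total_variation \<nu> C"
proof -
  have "total_variation \<nu> B \<le> total_variation \<nu> B + total_variation \<nu> (C - B)" by simp
  also have "\<dots> \<le> total_variation \<nu> (B \<union> (C - B))"
    using assms by (intro total_variation_superadditive) auto
  finally show ?thesis using assms(3) by (simp add: Un_absorb1)
qed

lemma total_variation_empty:
  assumes "bounded_sigma_additive (\<nu> :: 'a::euclidean_space set \<Rightarrow> 'b::real_normed_vector)"
  shows "total_variation \<nu> {} = 0"
proof -
  have "total_variation \<nu> {} \<le> 0"
    unfolding total_variation_partitions
  proof (rule SUP_least)
    fix A assume "A \<in> bounded_partitions ({}::'a set)"
    then have "A = (\<lambda>_. {})" by (auto simp: bounded_partitions_def)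
    then show "(\<Sum>k. ennreal (norm (\<nu> (A k)))) \<le> 0" by (simp add: bounded_sigma_additive_empty[OF assms])
  qed
  then show ?thesis by simp
qed

text \<open>Superadditivity bounds every finite partial sum by the variation of the whole union;
  countable subadditivity gives the reverse inequality.\<close>

lemma total_variation_countably_additive:
  fixes \<nu> :: "'a::euclidean_space set \<Rightarrow> 'b::real_normed_vector"
  assumes \<nu>: "bounded_sigma_additive \<nu>"
  shows "countably_additive (sets borel) (total_variation \<nu>)"
  unfolding countably_additive_def
proof (intro allI impI)
  fix B :: "nat \<Rightarrow> 'a set"
  assume B: "range B \<subseteq> sets borel" "disjoint_family B" "(\<Union>i. B i) \<in> sets borel"
  have "(\<Sum>j<N. total_variation \<nu> (B j)) \<le> total_variation \<nu> (\<Union>j<N. B j)" for N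
  proof (induction N)
    case (Suc N)
    have "(\<Sum>j<Suc N. total_variation \<nu> (B j)) \<le> total_variation \<nu> (\<Union>j<N. B j) + total_variation \<nu> (B N)"
      using Suc by (auto intro!: add_mono)
    also have "\<dots> \<le> total_variation \<nu> ((\<Union>j<N. B j) \<union> B N)"
    proof (rule total_variation_superadditive)
      show "(\<Union>j<N. B j) \<inter> B N = {}"
        using B(2) unfolding disjoint_family_on_def by (auto; metis IntI empty_iff less_irrefl)
    qed (use B in auto)
    also have "(\<Union>j<N. B j) \<union> B N = (\<Union>j<Suc N. B j)" by (auto simp: less_Suc_eq)
    finally show ?case .
  qed simp
  moreover have "total_variation \<nu> (\<Union>j<N. B j) \<le> total_variation \<nu> (\<Union>j. B j)" for N
    using B by (intro total_variation_mono) auto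
  ultimately have "(\<Sum>j<N. total_variation \<nu> (B j)) \<le> total_variation \<nu> (\<Union>j. B j)" for N
    using order_trans by blast
  then have "(\<Sum>j. total_variation \<nu> (B j)) \<le> total_variation \<nu> (\<Union>j. B j)"
    by (intro suminf_le_const) auto
  moreover have "total_variation \<nu> (\<Union>j. B j) \<le> (\<Sum>j. total_variation \<nu> (B j))"
    using B by (intro total_variation_countably_subadditive[OF \<nu>]) auto
  ultimately show "(\<Sum>i. total_variation \<nu> (B i)) = total_variation \<nu> (\<Union>i. B i)" by (rule antisym)
qed

lemma sets_total_variation_measure [simp, measurable_cong]:
  "sets (total_variation_measure \<nu>) = sets borel"
  unfolding total_variation_measure_def by (metis sets.sets_measure_of_eq space_borel)

lemma space_total_variation_measure [simp]: "space (total_variation_measure \<nu>) = UNIV"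
  by (simp add: total_variation_measure_def space_measure_of_conv)

lemma emeasure_total_variation_measure:
  fixes \<nu> :: "'a::euclidean_space set \<Rightarrow> 'b::real_normed_vector"
  assumes "bounded_sigma_additive \<nu>" "B \<in> sets borel"
  shows "emeasure (total_variation_measure \<nu>) B = total_variation \<nu> B"
  unfolding total_variation_measure_def
proof (rule emeasure_measure_of_sigma)
  show "sigma_algebra UNIV (sets (borel::'a measure))" by (metis sets.sigma_algebra_axioms space_borel)
  show "positive (sets borel) (total_variation \<nu>)"
    by (simp add: positive_def total_variation_empty assms)
qed (use assms total_variation_countably_additive in auto)

lemma norm_le_total_variation:
  fixes \<nu> :: "'a::euclidean_space set \<Rightarrow> 'b::real_normed_vector"
  assumes "bounded_sigma_additive \<nu>" "B \<in> sets borel" "bounded B"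
  shows "ennreal (norm (\<nu> B)) \<le> total_variation \<nu> B"
proof -
  let ?A = "\<lambda>k::nat. if k = 0 then B else {}"
  have "?A \<in> bounded_partitions B"
    using assms by (auto simp: bounded_partitions_def disjoint_family_on_def split: if_splits)
  then have "(\<Sum>k. ennreal (norm (\<nu> (?A k)))) \<le> total_variation \<nu> B"
    unfolding total_variation_partitions by (rule SUP_upper)
  moreover have "(\<Sum>k. ennreal (norm (\<nu> (?A k)))) = (\<Sum>k\<in>{0}. ennreal (norm (\<nu> (?A k))))"
    by (rule suminf_finite) (auto simp: bounded_sigma_additive_empty[OF assms(1)])
  ultimately show ?thesis by simp
qed

section \<open>The variation measure of a BV gradient and its action on test functions\<close>

text \<open>Stated additively because P - N makes no sense on sets of infinite measure. A partition
  into bounded pieces extends the comparison to all Borel sets, monotone approximation to all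
  nonnegative functions.\<close>

lemma nn_integral_le_add_measure:
  assumes sets: "sets P = sets borel" "sets N = sets borel" "sets M = sets (borel::'a::euclidean_space measure)"
    and le: "\<And>A. A \<in> sets borel \<Longrightarrow> bounded A \<Longrightarrow> emeasure P A \<le> emeasure N A + emeasure M A"
    and f: "f \<in> borel_measurable borel"
  shows "(\<integral>\<^sup>+x. f x \<partial>P) \<le> (\<integral>\<^sup>+x. f x \<partial>N) + (\<integral>\<^sup>+x. f x \<partial>M)"
proof -
  have le_all: "emeasure P B \<le> emeasure N B + emeasure M B" if B: "B \<in> sets borel" for B
  proof -
    obtain A where A: "A \<in> bounded_partitions B" using bounded_partitions_nonempty[OF B] by blast
    then have A': "range A \<subseteq> sets borel" "\<And>k. bounded (A k)" "disjoint_family A" "B = (\<Union>k. A k)"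
      by (auto simp: bounded_partitions_def)
    have "emeasure P B = (\<Sum>k. emeasure P (A k))"
      unfolding A'(4) using A' sets by (intro suminf_emeasure[symmetric]) auto
    also have "\<dots> \<le> (\<Sum>k. emeasure N (A k) + emeasure M (A k))"
      using A' by (intro suminf_le le) auto
    also have "\<dots> = (\<Sum>k. emeasure N (A k)) + (\<Sum>k. emeasure M (A k))"
      by (intro suminf_add[symmetric]) auto
    also have "\<dots> = emeasure N B + emeasure M B"
      unfolding A'(4) using A' sets by (intro arg_cong2[where f="(+)"] suminf_emeasure) auto
    finally show ?thesis .
  qed
  note [measurable_cong] = sets
  show ?thesis using f
  proof (induction rule: borel_measurable_induct)
    case (cong f g)
    then show ?case by (simp add: space_borel)
  next
    case (set A)
    then show ?case using le_all[OF set] sets by simp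
  next
    case (mult u c)
    have [measurable]: "u \<in> borel_measurable borel" by fact
    have "c * (\<integral>\<^sup>+x. u x \<partial>P) \<le> c * ((\<integral>\<^sup>+x. u x \<partial>N) + (\<integral>\<^sup>+x. u x \<partial>M))"
      by (intro mult_left_mono mult.IH) simp
    then show ?case by (simp add: nn_integral_cmult distrib_left)
  next
    case (add u v)
    have [measurable]: "u \<in> borel_measurable borel" "v \<in> borel_measurable borel" by fact+
    show ?case
      using add_mono[OF add.IH] by (simp add: nn_integral_add ac_simps)
  next
    case (seq U)
    have [measurable]: "U i \<in> borel_measurable borel" for i by fact
    have SUP: "(\<integral>\<^sup>+x. (SUP i. U i x) \<partial>Q) = (SUP i. \<integral>\<^sup>+x. U i x \<partial>Q)" if "sets Q = sets borel" for Q
    proof -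
      note [measurable_cong] = that
      show ?thesis using seq(3) by (simp add: nn_integral_monotone_convergence_SUP del: Sup_apply)
    qed
    have Sup: "Sup (range U) = (\<lambda>x. SUP i. U i x)" by (simp add: fun_eq_iff SUP_apply del: Sup_apply)
    have "(SUP i. \<integral>\<^sup>+x. U i x \<partial>P) \<le> (SUP i. \<integral>\<^sup>+x. U i x \<partial>N) + (SUP i. \<integral>\<^sup>+x. U i x \<partial>M)"
      by (intro SUP_least order_trans[OF seq.IH] add_mono SUP_upper) auto
    then show ?case unfolding Sup by (simp add: SUP sets)
  qed
qed

lemma radon_measure_bounded_finite:
  assumes "radon_measure M" "bounded A"
  shows "emeasure M A < \<infinity>"
proof -
  have "emeasure M A \<le> emeasure M (closure A)"
    using assms by (intro emeasure_mono closure_subset) (auto simp: radon_measure_def)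
  also have "\<dots> < \<infinity>" using assms by (auto simp: radon_measure_def)
  finally show ?thesis .
qed

text \<open>Opens the choice operator inside \<open>distr_gradient\<close>: membership in
  \<open>BV_loc\<close> provides a witness in each direction, and orthonormality of the basis picks
  out the i-th component.\<close>

lemma distr_gradient_component:
  fixes \<phi> :: "'a::euclidean_space \<Rightarrow> real"
  assumes "\<phi> \<in> BV_loc" "i \<in> Basis"
  obtains P N where "radon_measure P" "radon_measure N"
    "\<And>A. A \<in> sets borel \<Longrightarrow> bounded A \<Longrightarrow> distr_gradient \<phi> A \<bullet> i = measure P A - measure N A"
    "\<And>\<psi>. test_function \<psi> \<Longrightarrow> (LINT x|lebesgue. \<phi> x * frechet_derivative \<psi> (at x) i)
             = - ((LINT x|P. \<psi> x) - (LINT x|N. \<psi> x))"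
proof -
  have "\<exists>\<nu>. distr_partial_measure \<phi> i \<nu>" using assms by (auto simp: BV_loc_def)
  then have "distr_partial_measure \<phi> i (SOME \<nu>. distr_partial_measure \<phi> i \<nu>)" by (rule someI_ex)
  moreover have "distr_gradient \<phi> A \<bullet> i = (SOME \<nu>. distr_partial_measure \<phi> i \<nu>) A" for A
    unfolding distr_gradient_def using assms(2)
    by (simp add: inner_sum_left inner_Basis if_distrib cong: if_cong)
  ultimately show ?thesis
    unfolding distr_partial_measure_def using that by auto
qed

text \<open>Componentwise; P and N are finite on the bounded union, so their real-valued versions
  are countably additive there and may be subtracted.\<close>

lemma distr_gradient_sigma_additive:
  fixes \<phi> :: "'a::euclidean_space \<Rightarrow> real"
  assumes "\<phi> \<in> BV_loc"
  shows "bounded_sigma_additive (distr_gradient \<phi>)"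
  unfolding bounded_sigma_additive_def
proof (intro allI impI, elim conjE)
  fix A :: "nat \<Rightarrow> 'a set"
  assume A: "range A \<subseteq> sets borel" "disjoint_family A" "bounded (\<Union>k. A k)"
  have bk: "bounded (A k)" for k using A(3) by (rule bounded_subset) auto
  have "(\<lambda>k. distr_gradient \<phi> (A k) \<bullet> i) sums (distr_gradient \<phi> (\<Union>k. A k) \<bullet> i)" if i: "i \<in> Basis" for i
  proof -
    obtain P N where PN: "radon_measure P" "radon_measure N"
      "\<And>A. A \<in> sets borel \<Longrightarrow> bounded A \<Longrightarrow> distr_gradient \<phi> A \<bullet> i = measure P A - measure N A"
      "\<And>\<psi>. test_function \<psi> \<Longrightarrow> (LINT x|lebesgue. \<phi> x * frechet_derivative \<psi> (at x) i)
             = - ((LINT x|P. \<psi> x) - (LINT x|N. \<psi> x))"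
      by (rule distr_gradient_component[OF assms i], rule that)
    have "(\<lambda>k. measure P (A k)) sums measure P (\<Union>k. A k)" "(\<lambda>k. measure N (A k)) sums measure N (\<Union>k. A k)"
      using A PN(1,2) radon_measure_bounded_finite[OF PN(1) A(3)] radon_measure_bounded_finite[OF PN(2) A(3)]
      by (auto intro!: measure_UNION simp: radon_measure_def)
    moreover have "A k \<in> sets borel" "(\<Union>k. A k) \<in> sets borel" for k using A(1) by auto
    ultimately show ?thesis using PN(3) A(3) bk by (auto intro!: sums_diff)
  qed
  then have "(\<lambda>k. \<Sum>i\<in>Basis. (distr_gradient \<phi> (A k) \<bullet> i) *\<^sub>R i) sums (\<Sum>i\<in>Basis. (distr_gradient \<phi> (\<Union>k. A k) \<bullet> i) *\<^sub>R i)"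
    by (intro sums_sum sums_scaleR_left)
  then show "(\<lambda>k. distr_gradient \<phi> (A k)) sums distr_gradient \<phi> (\<Union>k. A k)"
    by (simp add: euclidean_representation)
qed

abbreviation gradient_measure :: "('a::euclidean_space \<Rightarrow> real) \<Rightarrow> 'a measure" where
  "gradient_measure \<phi> \<equiv> total_variation_measure (distr_gradient \<phi>)"

text \<open>The norm of the gradient on A is at most the sum over i of \<open>P i\<close> and
  \<open>N i\<close> on A. This majorant is additive, so summing it over any partition of B returns
  its value on B, which is finite for bounded B.\<close>

lemma gradient_measure_bounded_finite:
  fixes \<phi> :: "'a::euclidean_space \<Rightarrow> real"
  assumes \<phi>: "\<phi> \<in> BV_loc" and B: "B \<in> sets borel" "bounded B"
  shows "emeasure (gradient_measure \<phi>) B < \<infinity>"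
proof -
  have "\<forall>i\<in>Basis. \<exists>P N. radon_measure P \<and> radon_measure N \<and>
    (\<forall>A. A \<in> sets borel \<longrightarrow> bounded A \<longrightarrow> distr_gradient \<phi> A \<bullet> i = measure P A - measure N A)"
    using distr_gradient_component[OF \<phi>] by metis
  then obtain P N where PN: "\<And>i. i \<in> Basis \<Longrightarrow> radon_measure (P i)" "\<And>i. i \<in> Basis \<Longrightarrow> radon_measure (N i)"
    "\<And>i A. i \<in> Basis \<Longrightarrow> A \<in> sets borel \<Longrightarrow> bounded A \<Longrightarrow> distr_gradient \<phi> A \<bullet> i = measure (P i) A - measure (N i) A"
    by metis
  let ?m = "\<lambda>A. \<Sum>i\<in>Basis. emeasure (P i) A + emeasure (N i) A"
  have "ennreal (norm (distr_gradient \<phi> A)) \<le> ?m A" if A: "A \<in> sets borel" "bounded A" for A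
  proof -
    have "norm (distr_gradient \<phi> A) \<le> (\<Sum>i\<in>Basis. \<bar>distr_gradient \<phi> A \<bullet> i\<bar>)" by (rule norm_le_l1)
    also have "\<dots> \<le> (\<Sum>i\<in>Basis. measure (P i) A + measure (N i) A)"
      using PN(3) A by (intro sum_mono) (auto simp: abs_real_def)
    finally have "ennreal (norm (distr_gradient \<phi> A)) \<le> ennreal (\<Sum>i\<in>Basis. measure (P i) A + measure (N i) A)"
      by (rule ennreal_leI)
    also have "\<dots> = (\<Sum>i\<in>Basis. ennreal (measure (P i) A) + ennreal (measure (N i) A))"
      by (subst sum_ennreal[symmetric]) auto
    also have "\<dots> = ?m A"
      using PN(1,2) A radon_measure_bounded_finite
      by (intro sum.cong refl arg_cong2[where f="(+)"] emeasure_eq_ennreal_measure[symmetric]) (auto simp: less_top[symmetric])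
    finally show ?thesis .
  qed
  note m = this
  have "total_variation (distr_gradient \<phi>) B \<le> ?m B"
    unfolding total_variation_partitions
  proof (rule SUP_least)
    fix A assume "A \<in> bounded_partitions B"
    then have A: "range A \<subseteq> sets borel" "\<And>k. bounded (A k)" "disjoint_family A" "B = (\<Union>k. A k)"
      by (auto simp: bounded_partitions_def)
    have "(\<Sum>k. ennreal (norm (distr_gradient \<phi> (A k)))) \<le> (\<Sum>k. ?m (A k))"
      using A by (intro suminf_le m) auto
    also have "\<dots> = (\<Sum>i\<in>Basis. \<Sum>k. emeasure (P i) (A k) + emeasure (N i) (A k))"
      by (rule suminf_sum) auto
    also have "\<dots> = ?m B"
    proof (rule sum.cong[OF refl])
      fix i :: 'a assume i: "i \<in> Basis"
      have "(\<Sum>k. emeasure (P i) (A k) + emeasure (N i) (A k)) = (\<Sum>k. emeasure (P i) (A k)) + (\<Sum>k. emeasure (N i) (A k))"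
        by (intro suminf_add[symmetric]) auto
      also have "\<dots> = emeasure (P i) B + emeasure (N i) B"
        unfolding A(4) using A PN(1,2)[OF i] by (intro arg_cong2[where f="(+)"] suminf_emeasure) (auto simp: radon_measure_def)
      finally show "(\<Sum>k. emeasure (P i) (A k) + emeasure (N i) (A k)) = emeasure (P i) B + emeasure (N i) B" .
    qed
    finally show "(\<Sum>k. ennreal (norm (distr_gradient \<phi> (A k)))) \<le> ?m B" .
  qed
  also have "\<dots> < \<infinity>"
    using radon_measure_bounded_finite[OF PN(1) B(2)] radon_measure_bounded_finite[OF PN(2) B(2)]
    by (simp add: less_top)
  finally show ?thesis
    using emeasure_total_variation_measure[OF distr_gradient_sigma_additive[OF \<phi>] B(1)] by simp
qed

text \<open>Needed for Tonelli between Lebesgue measure and the gradient measure.\<close>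

lemma sigma_finite_gradient_measure:
  fixes \<phi> :: "'a::euclidean_space \<Rightarrow> real"
  assumes "\<phi> \<in> BV_loc"
  shows "sigma_finite_measure (gradient_measure \<phi>)"
proof
  show "\<exists>A. countable A \<and> A \<subseteq> sets (gradient_measure \<phi>) \<and> \<Union> A = space (gradient_measure \<phi>) \<and>
          (\<forall>a\<in>A. emeasure (gradient_measure \<phi>) a \<noteq> \<infinity>)"
  proof (intro exI[of _ "range (\<lambda>k::nat. ball 0 (real k))"] conjI ballI)
    show "\<Union> (range (\<lambda>k::nat. ball (0::'a) (real k))) = space (gradient_measure \<phi>)"
      by (auto simp: reals_Archimedean2)
    show "emeasure (gradient_measure \<phi>) a \<noteq> \<infinity>" if "a \<in> range (\<lambda>k::nat. ball 0 (real k))" for a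
      using that gradient_measure_bounded_finite[OF assms, of a] by auto
  qed auto
qed

text \<open>For nonnegative \<psi> the left side is the difference of the integrals of \<psi>
  against P and N. The two comparisons of P with N + |D\<phi>| and of N with P + |D\<phi>|, valid on
  bounded sets since one component is dominated by the norm, take the place of a polar
  decomposition.\<close>

lemma integral_test_function_derivative_bound:
  fixes \<phi> :: "'a::euclidean_space \<Rightarrow> real"
  assumes \<phi>: "\<phi> \<in> BV_loc" and i: "i \<in> Basis" and \<psi>: "test_function \<psi>" "\<And>x. 0 \<le> \<psi> x"
  shows "ennreal \<bar>LINT x|lebesgue. \<phi> x * frechet_derivative \<psi> (at x) i\<bar> \<le> (\<integral>\<^sup>+x. \<psi> x \<partial>gradient_measure \<phi>)"
proof -
  obtain P N where PN: "radon_measure P" "radon_measure N"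
      "\<And>A. A \<in> sets borel \<Longrightarrow> bounded A \<Longrightarrow> distr_gradient \<phi> A \<bullet> i = measure P A - measure N A"
      "\<And>\<psi>. test_function \<psi> \<Longrightarrow> (LINT x|lebesgue. \<phi> x * frechet_derivative \<psi> (at x) i)
             = - ((LINT x|P. \<psi> x) - (LINT x|N. \<psi> x))"
      by (rule distr_gradient_component[OF \<phi> i], rule that)
  have sets: "sets P = sets borel" "sets N = sets borel" using PN by (auto simp: radon_measure_def)
  have cont: "continuous_on UNIV \<psi>" using \<psi>(1) unfolding test_function_def by (metis C_k.simps(1))
  then have [measurable]: "\<psi> \<in> borel_measurable borel" by (rule borel_measurable_continuous_onI)
  have fin: "(\<integral>\<^sup>+x. \<psi> x \<partial>Q) = ennreal (LINT x|Q. \<psi> x)" if Q: "radon_measure Q" for Q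
  proof -
    let ?K = "closure {x. \<psi> x \<noteq> 0}"
    have K: "compact ?K" using \<psi>(1) by (simp add: test_function_def)
    obtain M where M: "\<And>x. x \<in> ?K \<Longrightarrow> norm (\<psi> x) \<le> M"
      using compact_imp_bounded[OF compact_continuous_image[OF continuous_on_subset[OF cont] K]]
      by (auto simp: bounded_iff)
    have sQ[measurable_cong]: "sets Q = sets borel" using Q by (simp add: radon_measure_def)
    have "integrable Q \<psi>"
    proof (rule Bochner_Integration.integrable_bound)
      show "integrable Q (\<lambda>x. M * indicator ?K x)"
        using Q K sQ by (intro integrable_mult_right integrable_real_indicator) (auto simp: radon_measure_def)
      show "AE x in Q. norm (\<psi> x) \<le> norm (M * indicator ?K x :: real)"
      proof (intro AE_I2)
        fix x show "norm (\<psi> x) \<le> norm (M * indicator ?K x :: real)"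
          using M[of x] closure_subset[of "{x. \<psi> x \<noteq> 0}"] by (cases "x \<in> ?K") auto
      qed
    qed simp
    then show ?thesis using \<psi>(2) by (intro nn_integral_eq_integral) auto
  qed
  have mle: "\<bar>measure P A - measure N A\<bar> \<le> enn2real (emeasure (gradient_measure \<phi>) A)" 
    if A: "A \<in> sets borel" "bounded A" for A
  proof -
    have "\<bar>measure P A - measure N A\<bar> \<le> norm (distr_gradient \<phi> A)"
      using PN(3)[OF A] Basis_le_norm[OF i, of "distr_gradient \<phi> A"] by simp
    moreover have "ennreal (norm (distr_gradient \<phi> A)) \<le> emeasure (gradient_measure \<phi>) A"
      using norm_le_total_variation[OF distr_gradient_sigma_additive[OF \<phi>] A]
        emeasure_total_variation_measure[OF distr_gradient_sigma_additive[OF \<phi>] A(1)] by simp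
    ultimately show ?thesis
      using gradient_measure_bounded_finite[OF \<phi> A]
      by (metis enn2real_ennreal enn2real_mono infinity_ennreal_def norm_ge_zero order_trans)
  qed
  have em: "emeasure Q A = ennreal (measure Q A)" if "radon_measure Q" "bounded A" for Q and A :: "'a set"
    using radon_measure_bounded_finite[OF that] by (simp add: emeasure_eq_ennreal_measure less_top)
  have emg: "emeasure (gradient_measure \<phi>) A = ennreal (enn2real (emeasure (gradient_measure \<phi>) A))" 
    if "A \<in> sets borel" "bounded A" for A
    using gradient_measure_bounded_finite[OF \<phi> that] by (simp add: less_top)
  have "(\<integral>\<^sup>+x. \<psi> x \<partial>P) \<le> (\<integral>\<^sup>+x. \<psi> x \<partial>N) + (\<integral>\<^sup>+x. \<psi> x \<partial>gradient_measure \<phi>)"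
  proof (rule nn_integral_le_add_measure)
    fix A :: "'a set" assume A: "A \<in> sets borel" "bounded A"
    show "emeasure P A \<le> emeasure N A + emeasure (gradient_measure \<phi>) A"
    proof -
      have "measure P A \<le> measure N A + enn2real (emeasure (gradient_measure \<phi>) A)" using mle[OF A] by linarith
      then show ?thesis
        unfolding em[OF PN(1) A(2)] em[OF PN(2) A(2)]
        by (subst emg[OF A]) (simp del: ennreal_enn2real flip: ennreal_plus)
    qed
  qed (use sets in auto)
  moreover have "(\<integral>\<^sup>+x. \<psi> x \<partial>N) \<le> (\<integral>\<^sup>+x. \<psi> x \<partial>P) + (\<integral>\<^sup>+x. \<psi> x \<partial>gradient_measure \<phi>)"
  proof (rule nn_integral_le_add_measure)
    fix A :: "'a set" assume A: "A \<in> sets borel" "bounded A"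
    show "emeasure N A \<le> emeasure P A + emeasure (gradient_measure \<phi>) A"
    proof -
      have "measure N A \<le> measure P A + enn2real (emeasure (gradient_measure \<phi>) A)" using mle[OF A] by linarith
      then show ?thesis
        unfolding em[OF PN(1) A(2)] em[OF PN(2) A(2)]
        by (subst emg[OF A]) (simp del: ennreal_enn2real flip: ennreal_plus)
    qed
  qed (use sets in auto)
  moreover have "0 \<le> (LINT x|P. \<psi> x)" "0 \<le> (LINT x|N. \<psi> x)" using \<psi>(2) by auto
  ultimately show ?thesis
    unfolding PN(4)[OF \<psi>(1)] fin[OF PN(1)] fin[OF PN(2)]
    by (cases "\<integral>\<^sup>+x. \<psi> x \<partial>gradient_measure \<phi>") (auto simp flip: ennreal_plus simp: abs_real_def)
qed

section \<open>Mollification and translation estimates\<close>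

lemma C_k_const [simp]: "C_k k (\<lambda>_. c)"
  by (induction k arbitrary: c) auto

lemma C_k_Suc_imp: "C_k (Suc k) f \<Longrightarrow> C_k k f"
proof (induction k arbitrary: f)
  case 0
  then show ?case
    by (auto simp: continuous_on_eq_continuous_at intro!: differentiable_imp_continuous_within)
qed auto

lemma C_k_add:
  assumes "C_k k f" "C_k k g" shows "C_k k (\<lambda>x. f x + g x)"
  using assms
proof (induction k arbitrary: f g)
  case 0 then show ?case by (auto intro: continuous_intros)
next
  case (Suc k)
  have "frechet_derivative (\<lambda>x. f x + g x) (at x) i = frechet_derivative f (at x) i + frechet_derivative g (at x) i" for x i
    by (rule fun_cong[OF frechet_derivative_at[symmetric, OF has_derivative_add]])
       (use Suc.prems in \<open>simp_all add: frechet_derivative_works\<close>)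
  with Suc show ?case by auto
qed

lemma C_k_mult:
  assumes "C_k k f" "C_k k g" shows "C_k k (\<lambda>x. f x * g x)"
  using assms
proof (induction k arbitrary: f g)
  case 0 then show ?case by (auto intro: continuous_intros)
next
  case (Suc k)
  have "frechet_derivative (\<lambda>x. f x * g x) (at x) i = f x * frechet_derivative g (at x) i + frechet_derivative f (at x) i * g x" for x i
    by (rule fun_cong[OF frechet_derivative_at[symmetric, OF has_derivative_mult]])
       (use Suc.prems in \<open>simp_all add: frechet_derivative_works\<close>)
  with Suc C_k_Suc_imp[OF Suc.prems(1)] C_k_Suc_imp[OF Suc.prems(2)] show ?case
    by (auto intro!: C_k_add)
qed

text \<open>Mollification at x tests \<phi> against y \<mapsto> \<open>mollifier e (x - y)\<close>,
  so smoothness has to survive this reflection.\<close>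

lemma C_k_reflect:
  fixes f :: "'a::euclidean_space \<Rightarrow> real"
  assumes "C_k k f" shows "C_k k (\<lambda>y. f (x - y))"
  using assms
proof (induction k arbitrary: f)
  case 0 then show ?case by (auto intro!: continuous_intros continuous_on_compose2[of UNIV f])
next
  case (Suc k)
  have "((\<lambda>y. f (x - y)) has_derivative (\<lambda>i. - frechet_derivative f (at (x - y)) i)) (at y)" for y
  proof -
    have f: "(f has_derivative frechet_derivative f (at (x - y))) (at (x - y))"
      using Suc.prems by (simp add: frechet_derivative_works)
    have "((\<lambda>y. f (x - y)) has_derivative (\<lambda>i. frechet_derivative f (at (x - y)) (- i))) (at y)"
      by (rule has_derivative_compose[where f = "\<lambda>y. x - y" and g = f, OF _ f]) (auto intro!: derivative_eq_intros)
    moreover have "frechet_derivative f (at (x - y)) (- i) = - frechet_derivative f (at (x - y)) i" for i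
      using has_derivative_linear[OF f] by (simp add: linear_neg)
    ultimately show ?thesis by simp
  qed
  note D = this
  have "frechet_derivative (\<lambda>y. f (x - y)) (at y) i = - 1 * frechet_derivative f (at (x - y)) i" for y i
    using frechet_derivative_at[OF D[of y]] by (metis mult_minus1)
  moreover have "C_k k (\<lambda>y. - 1 * frechet_derivative f (at (x - y)) i)" if "i \<in> Basis" for i
    using Suc that by (intro C_k_mult C_k_const) auto
  moreover have "(\<lambda>y. f (x - y)) differentiable (at y)" for y
    using D differentiable_def by blast
  ultimately show ?case by simp
qed

lemma frechet_derivative_reflect:
  fixes f :: "'a::euclidean_space \<Rightarrow> real"
  assumes "\<And>z. f differentiable (at z)"
  shows "frechet_derivative (\<lambda>y. f (x - y)) (at y) i = - frechet_derivative f (at (x - y)) i"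
proof -
  have f: "(f has_derivative frechet_derivative f (at (x - y))) (at (x - y))"
    using assms by (simp add: frechet_derivative_works)
  have "((\<lambda>y. f (x - y)) has_derivative (\<lambda>i. frechet_derivative f (at (x - y)) (- i))) (at y)"
    by (rule has_derivative_compose[where f = "\<lambda>y. x - y" and g = f, OF _ f]) (auto intro!: derivative_eq_intros)
  then show ?thesis
    using has_derivative_linear[OF f] frechet_derivative_at by (metis linear_neg)
qed

section \<open>The smooth bump function and the mollifier\<close>

text \<open>The case m = 0 is the classical flat function exp (-1 / t). Dividing by powers of t
  makes the family closed under differentiation up to linear combinations (orders m + 1 and m + 2
  occur), as an induction over all derivatives requires.\<close>

definition flat_exp :: "nat \<Rightarrow> real \<Rightarrow> real" where
  "flat_exp m t = (if t > 0 then exp (- 1 / t) / t ^ m else 0)"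

lemma flat_exp_nonneg [simp]: "0 \<le> flat_exp m t"
  by (simp add: flat_exp_def)

lemma flat_exp_tendsto_0: "(flat_exp m \<longlongrightarrow> 0) (at 0)"
proof -
  have "((\<lambda>x::real. x ^ m / exp x) \<longlongrightarrow> 0) at_top" by (rule tendsto_power_div_exp_0)
  then have "((\<lambda>t::real. (inverse t) ^ m / exp (inverse t)) \<longlongrightarrow> 0) (at_right 0)"
    by (rule filterlim_compose[OF _ filterlim_inverse_at_top_right])
  then have "(flat_exp m \<longlongrightarrow> 0) (at_right 0)"
    by (rule Lim_transform_eventually)
       (auto simp: eventually_at_right_field flat_exp_def exp_minus divide_simps power_divide intro!: exI[of _ 1])
  moreover have "(flat_exp m \<longlongrightarrow> 0) (at_left 0)"
    by (rule Lim_transform_eventually[OF tendsto_const])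
       (auto simp: eventually_at_left_field flat_exp_def intro!: exI[of _ "-1"])
  ultimately show ?thesis by (simp add: filterlim_split_at)
qed

lemma DERIV_flat_exp:
  "(flat_exp m has_real_derivative flat_exp (m + 2) t - real m * flat_exp (m + 1) t) (at t)"
proof -
  consider "t > 0" | "t < 0" | "t = 0" by linarith
  then show ?thesis
  proof cases
    case 1
    have "((\<lambda>t. exp (- 1 / t) / t ^ m) has_real_derivative flat_exp (m + 2) t - real m * flat_exp (m + 1) t) (at t)"
    proof (cases m)
      case (Suc j)
      have "real (Suc j) * t ^ (Suc j - Suc 0) / (t ^ Suc j * t ^ Suc j) = real (Suc j) / t ^ (Suc j + 1)"
        using 1 by (simp add: divide_simps)
      then show ?thesis
        using 1 unfolding Suc
        by (auto intro!: derivative_eq_intros simp: flat_exp_def divide_simps power2_eq_square algebra_simps)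
           (metis Suc_pred not_gr0 power_Suc)
    qed (use 1 in \<open>auto intro!: derivative_eq_intros simp: flat_exp_def divide_simps power2_eq_square\<close>)
    then show ?thesis
      by (rule DERIV_cong_ev[THEN iffD1, rotated -1])
         (use 1 eventually_nhds_in_open[of "{0<..}" t] in \<open>auto simp: flat_exp_def elim!: eventually_mono\<close>)
  next
    case 2
    have "((\<lambda>t. 0) has_real_derivative flat_exp (m + 2) t - real m * flat_exp (m + 1) t) (at t)"
      using 2 by (simp add: flat_exp_def)
    then show ?thesis
      by (rule DERIV_cong_ev[THEN iffD1, rotated -1])
         (use 2 eventually_nhds_in_open[of "{..<0}" t] in \<open>auto simp: flat_exp_def elim!: eventually_mono\<close>)
  next
    case 3
    \<comment> \<open>At the origin the difference quotient is itself a member of the family, so its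
      limit 0 is already known.\<close>
    have "(\<lambda>h. (flat_exp m (0 + h) - flat_exp m 0) / h) = flat_exp (m + 1)"
      by (auto simp: flat_exp_def)
    then show ?thesis
      using flat_exp_tendsto_0[of "m + 1"] 3 by (simp add: DERIV_def flat_exp_def[of _ 0])
  qed
qed

text \<open>The induction on k must be uniform in m, since one derivative passes from m to m + 1 and
  m + 2.\<close>

lemma C_k_flat_exp_compose:
  assumes q: "\<And>k. C_k k q"
  shows "C_k k (\<lambda>y::'a::euclidean_space. flat_exp m (q y))"
proof (induction k arbitrary: m)
  case 0
  have "continuous_on UNIV q" using q[of 0] by simp
  moreover have "continuous_on UNIV (flat_exp m)"
    using DERIV_flat_exp DERIV_isCont continuous_at_imp_continuous_on by blast
  ultimately show ?case by (auto intro: continuous_on_compose2)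
next
  case (Suc k)
  have dq: "(q has_derivative frechet_derivative q (at y)) (at y)" for y
    using q[of 1] by (simp add: frechet_derivative_works)
  have D: "((\<lambda>y. flat_exp m (q y)) has_derivative
     (\<lambda>i. (flat_exp (m + 2) (q y) + (- real m) * flat_exp (m + 1) (q y)) * frechet_derivative q (at y) i)) (at y)" for y
    using has_derivative_compose[OF dq DERIV_flat_exp[unfolded has_field_derivative_def]]
    by (simp add: algebra_simps)
  have "frechet_derivative (\<lambda>y. flat_exp m (q y)) (at y) i
     = (flat_exp (m + 2) (q y) + (- real m) * flat_exp (m + 1) (q y)) * frechet_derivative q (at y) i" for y i
    using frechet_derivative_at[OF D[of y]] by metis
  moreover have "C_k k (\<lambda>y. (flat_exp (m + 2) (q y) + (- real m) * flat_exp (m + 1) (q y)) * frechet_derivative q (at y) i)"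
    if "i \<in> Basis" for i
    using that q[of "Suc k"] by (intro C_k_mult C_k_add C_k_const Suc) auto
  moreover have "(\<lambda>y. flat_exp m (q y)) differentiable (at y)" for y
    using D differentiable_def by blast
  ultimately show ?case by simp
qed

lemma C_k_inner_right: "C_k k (\<lambda>y::'a::euclidean_space. c * (y \<bullet> i))"
proof (cases k)
  case (Suc j)
  have D: "((\<lambda>y. c * (y \<bullet> i)) has_derivative (\<lambda>h. c * (h \<bullet> i))) (at y)" for y :: 'a
    by (auto intro!: derivative_eq_intros)
  then have "frechet_derivative (\<lambda>y. c * (y \<bullet> i)) (at y) b = c * (b \<bullet> i)" for y b :: 'a
    using frechet_derivative_at[OF D[of y]] by metis
  then show ?thesis using D by (auto simp: Suc differentiable_def)
qed (auto intro!: continuous_intros)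

lemma C_k_norm_power2: "C_k k (\<lambda>y::'a::euclidean_space. e + - 1 * (norm y)\<^sup>2)"
proof (cases k)
  case (Suc j)
  have D: "((\<lambda>y. e + - 1 * (norm y)\<^sup>2) has_derivative (\<lambda>h. - 2 * (y \<bullet> h))) (at y)" for y :: 'a
    unfolding power2_norm_eq_inner by (auto intro!: derivative_eq_intros simp: inner_commute)
  have "frechet_derivative (\<lambda>y. e + - 1 * (norm y)\<^sup>2) (at y) b = - 2 * (y \<bullet> b)" for y b :: 'a
    using frechet_derivative_at[OF D[of y]] by metis
  then show ?thesis using D C_k_inner_right[of j "- 2"] by (auto simp: Suc differentiable_def simp del: mult_minus_left)
qed (auto intro!: continuous_intros)

text \<open>The function exp (-1 / (e^2 - |z|^2)) on the ball of radius e, extended by zero. Using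
  the square of the norm keeps it smooth at the origin.\<close>

definition bump :: "real \<Rightarrow> 'a::euclidean_space \<Rightarrow> real" where
  "bump e z = flat_exp 0 (e\<^sup>2 - (norm z)\<^sup>2)"

definition mollifier :: "real \<Rightarrow> 'a::euclidean_space \<Rightarrow> real" where
  "mollifier e z = bump e z / (LBINT z. bump e (z::'a))"

lemma C_k_bump: "C_k k (bump e :: 'a::euclidean_space \<Rightarrow> real)"
  using C_k_flat_exp_compose[OF C_k_norm_power2, of k 0 "e\<^sup>2"]
  by (simp add: bump_def[abs_def])

lemma bump_nonneg [simp]: "0 \<le> bump e z" by (simp add: bump_def)

lemma bump_eq_0: "e \<le> norm z \<Longrightarrow> 0 < e \<Longrightarrow> bump e z = 0"
  using power_mono[of e "norm z" 2] by (simp add: bump_def flat_exp_def not_less)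

lemma bump_le_1: "bump e z \<le> 1"
  by (simp add: bump_def flat_exp_def)

lemma continuous_on_bump: "continuous_on UNIV (bump e)"
  using C_k_bump[of 0] by simp

lemma integrable_bump:
  assumes "0 < e" shows "integrable lborel (bump e :: 'a::euclidean_space \<Rightarrow> real)"
proof (rule Bochner_Integration.integrable_bound)
  show "integrable lborel (indicator (ball (0::'a) e) :: 'a \<Rightarrow> real)"
    by (intro integrable_real_indicator) (use emeasure_lborel_ball_finite[of "0::'a" e] in auto)
  show "bump e \<in> borel_measurable (lborel::'a measure)"
    using borel_measurable_continuous_onI[OF continuous_on_bump] by simp
  show "AE x in lborel. norm (bump e x) \<le> norm (indicator (ball (0::'a) e) x :: real)"
    using bump_eq_0[OF _ assms, where ?'a='a] bump_le_1[of e, where ?'a='a] by (intro AE_I2) (auto simp: indicator_def not_less)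
qed

lemma integral_bump_pos:
  assumes "0 < e" shows "0 < (LBINT z. bump e (z::'a::euclidean_space))"
proof (rule ccontr)
  assume "\<not> ?thesis"
  moreover have "0 \<le> (LBINT z. bump e (z::'a))" by simp
  ultimately have "(LBINT z. bump e (z::'a)) = 0" by linarith
  then have "AE z in lborel. bump e (z::'a) = 0"
    using integral_nonneg_eq_0_iff_AE[OF integrable_bump[OF assms, where ?'a='a]] by simp
  then have "AE z in lborel. z \<notin> ball (0::'a) e"
  proof eventually_elim
    case (elim z)
    have "(norm z)\<^sup>2 < e\<^sup>2" if "norm z < e" using that by (intro power_strict_mono) auto
    then show ?case using elim by (auto simp: bump_def flat_exp_def)
  qed
  then have "emeasure lborel (ball (0::'a) e) = 0"
    by (subst (asm) AE_iff_measurable[OF _ refl]) (auto simp: ball_def)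
  then have "ball (0::'a) e = {}"
    using negligible_iff_null_sets[of "ball (0::'a) e"] open_not_negligible[of "ball (0::'a) e"]
    by (auto simp: null_sets_def)
  then show False using assms by simp
qed

lemma mollifier_nonneg [simp]: "0 \<le> mollifier e z"
  by (simp add: mollifier_def)

lemma mollifier_eq_0: "e \<le> norm z \<Longrightarrow> 0 < e \<Longrightarrow> mollifier e z = 0"
  by (simp add: mollifier_def bump_eq_0)

lemma C_k_mollifier: "C_k k (mollifier e :: 'a::euclidean_space \<Rightarrow> real)"
  unfolding mollifier_def[abs_def] divide_inverse by (intro C_k_mult C_k_bump C_k_const)

lemma integrable_mollifier: "0 < e \<Longrightarrow> integrable lborel (mollifier e :: 'a::euclidean_space \<Rightarrow> real)"
  unfolding mollifier_def[abs_def] by (intro integrable_divide integrable_bump) auto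

lemma integral_mollifier: "0 < e \<Longrightarrow> (LBINT z. mollifier e (z::'a::euclidean_space)) = 1"
  using integral_bump_pos[of e, where ?'a='a] by (simp add: mollifier_def)

lemma nn_integral_mollifier:
  assumes "0 < e" shows "(\<integral>\<^sup>+z. ennreal (mollifier e (z::'a::euclidean_space)) \<partial>lborel) = 1"
  by (subst nn_integral_eq_integral) (use assms in \<open>auto simp: integrable_mollifier integral_mollifier\<close>)

lemma borel_measurable_mollifier [measurable]: "mollifier e \<in> borel_measurable borel"
  using borel_measurable_continuous_onI C_k_mollifier[of 0 e] by auto

lemma test_function_mollifier:
  assumes "0 < e" shows "test_function (\<lambda>y. mollifier e (x - y :: 'a::euclidean_space))"
  unfolding test_function_def
proof (intro conjI allI)
  show "C_k k (\<lambda>y. mollifier e (x - y))" for k by (intro C_k_reflect C_k_mollifier)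
  have "{y. mollifier e (x - y) \<noteq> 0} \<subseteq> ball x e"
    using mollifier_eq_0[OF _ assms] by (force simp: dist_norm not_less[symmetric])
  then show "compact (closure {y. mollifier e (x - y) \<noteq> 0})"
    by (meson bounded_ball bounded_subset compact_closure)
qed

section \<open>Continuity of translations in L1\<close>

lemma nn_integral_lborel_translate:
  fixes f :: "'a::euclidean_space \<Rightarrow> ennreal"
  assumes [measurable]: "f \<in> borel_measurable borel"
  shows "(\<integral>\<^sup>+x. f (c + x) \<partial>lborel) = (\<integral>\<^sup>+x. f x \<partial>lborel)"
proof -
  have "(\<integral>\<^sup>+x. f x \<partial>lborel) = (\<integral>\<^sup>+x. f x \<partial>distr lborel borel ((+) c))"
    by (simp add: lborel_distr_plus)
  also have "\<dots> = (\<integral>\<^sup>+x. f (c + x) \<partial>lborel)"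
    by (subst nn_integral_distr) auto
  finally show ?thesis by simp
qed

text \<open>A point of U stays in U under small shifts, so the part of U that is lost has measure
  tending to 0 by dominated convergence. Pointwise convergence may fail outside U, at the boundary;
  but the part gained has the same measure as the part lost, because U and its translate have equal
  finite measure.\<close>

lemma L1_translation_continuous_open:
  fixes U :: "'a::euclidean_space set"
  assumes U: "open U" "emeasure lborel U < \<infinity>" and h: "h \<longlonglongrightarrow> 0"
  shows "(\<lambda>n. \<integral>\<^sup>+x. ennreal \<bar>indicator U (h n + x) - indicator U x\<bar> \<partial>lborel) \<longlonglongrightarrow> 0"
proof -
  have [measurable]: "U \<in> sets borel" using U by simp
  have dom: "(\<lambda>n. \<integral>\<^sup>+x. indicator U x * (1 - indicator U (h n + x)) \<partial>lborel) \<longlonglongrightarrow> (\<integral>\<^sup>+x. 0 \<partial>(lborel::'a measure))"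
  proof (rule nn_integral_dominated_convergence[where w = "indicator U"])
    show "(\<integral>\<^sup>+x. indicator U x \<partial>lborel) < \<infinity>" using U by simp
    show "AE x in lborel. (\<lambda>n. indicator U x * (1 - indicator U (h n + x)) :: ennreal) \<longlonglongrightarrow> 0"
    proof (intro AE_I2)
      fix x
      show "(\<lambda>n. indicator U x * (1 - indicator U (h n + x)) :: ennreal) \<longlonglongrightarrow> 0"
      proof (cases "x \<in> U")
        case True
        have "(\<lambda>n. h n + x) \<longlonglongrightarrow> x" using tendsto_add[OF h tendsto_const[of x]] by simp
        then have "\<forall>\<^sub>F n in sequentially. h n + x \<in> U" using U(1) True by (rule topological_tendstoD)
        then show ?thesis by (intro tendsto_eventually, eventually_elim) (use True in auto)
      qed simp
    qed
  qed (auto simp: indicator_def)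
  have fin: "(\<integral>\<^sup>+x. indicator U (h n + x) \<partial>lborel) = emeasure lborel U" for n
    using nn_integral_lborel_translate[of "indicator U" "h n"] by simp
  have eq: "(\<integral>\<^sup>+x. ennreal \<bar>indicator U (h n + x) - indicator U x\<bar> \<partial>lborel)
     = 2 * (\<integral>\<^sup>+x. indicator U x * (1 - indicator U (h n + x)) \<partial>lborel)" (is "?l = 2 * ?r") for n
  proof -
    let ?q = "\<integral>\<^sup>+x. indicator U (h n + x) * (1 - indicator U x) \<partial>lborel"
    \<comment> \<open>Adding the measure of U to both halves of the symmetric difference gives the
      same total; finiteness of that measure allows cancelling it.\<close>
    have "?q + (\<integral>\<^sup>+x. indicator U x \<partial>lborel) = (\<integral>\<^sup>+x. indicator U (h n + x) * (1 - indicator U x) + indicator U x \<partial>lborel)"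
      by (rule nn_integral_add[symmetric]) auto
    also have "\<dots> = (\<integral>\<^sup>+x. indicator U x * (1 - indicator U (h n + x)) + indicator U (h n + x) \<partial>lborel)"
      by (intro nn_integral_cong) (simp split: split_indicator)
    also have "\<dots> = ?r + (\<integral>\<^sup>+x. indicator U (h n + x) \<partial>lborel)"
      by (rule nn_integral_add) auto
    finally have "?q + emeasure lborel U = ?r + emeasure lborel U" by (simp add: fin)
    then have q: "?q = ?r"
      using U(2) ennreal_add_left_cancel[of "emeasure lborel U" ?q ?r] by (auto simp: add.commute)
    have "?l = (\<integral>\<^sup>+x. indicator U (h n + x) * (1 - indicator U x) + indicator U x * (1 - indicator U (h n + x)) \<partial>lborel)"
      by (intro nn_integral_cong) (simp split: split_indicator)
    also have "\<dots> = ?q + ?r"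
      by (rule nn_integral_add) auto
    finally show ?thesis by (simp add: q mult_2)
  qed
  show ?thesis unfolding eq using tendsto_mult_ennreal[OF tendsto_const[of 2] dom] by simp
qed

lemma nn_integral_abs_triangle:
  assumes "\<And>x. \<bar>f x\<bar> \<le> \<bar>g x\<bar> + \<bar>k x :: real\<bar>" "g \<in> borel_measurable M" "k \<in> borel_measurable M"
  shows "(\<integral>\<^sup>+x. ennreal \<bar>f x\<bar> \<partial>M) \<le> (\<integral>\<^sup>+x. ennreal \<bar>g x\<bar> \<partial>M) + (\<integral>\<^sup>+x. ennreal \<bar>k x\<bar> \<partial>M)"
proof -
  have "(\<integral>\<^sup>+x. ennreal \<bar>f x\<bar> \<partial>M) \<le> (\<integral>\<^sup>+x. ennreal \<bar>g x\<bar> + ennreal \<bar>k x\<bar> \<partial>M)"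
    using assms(1) by (intro nn_integral_mono) (simp flip: ennreal_plus)
  also have "\<dots> = (\<integral>\<^sup>+x. ennreal \<bar>g x\<bar> \<partial>M) + (\<integral>\<^sup>+x. ennreal \<bar>k x\<bar> \<partial>M)"
    using assms by (intro nn_integral_add) auto
  finally show ?thesis .
qed

lemma L1_translation_approx:
  fixes f g :: "'a::euclidean_space \<Rightarrow> real"
  assumes [measurable]: "f \<in> borel_measurable borel" "g \<in> borel_measurable borel"
  shows "(\<integral>\<^sup>+x. ennreal \<bar>f (h + x) - f x\<bar> \<partial>lborel) \<le>
     (\<integral>\<^sup>+x. ennreal \<bar>g (h + x) - g x\<bar> \<partial>lborel) + 2 * (\<integral>\<^sup>+x. ennreal \<bar>f x - g x\<bar> \<partial>lborel)"
proof -
  have "(\<integral>\<^sup>+x. ennreal \<bar>f (h + x) - f x\<bar> \<partial>lborel) \<le>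
     (\<integral>\<^sup>+x. ennreal \<bar>(g (h + x) - g x) - (f x - g x)\<bar> \<partial>lborel) + (\<integral>\<^sup>+x. ennreal \<bar>f (h + x) - g (h + x)\<bar> \<partial>lborel)"
    by (rule nn_integral_abs_triangle) auto
  also have "(\<integral>\<^sup>+x. ennreal \<bar>(g (h + x) - g x) - (f x - g x)\<bar> \<partial>lborel) \<le>
     (\<integral>\<^sup>+x. ennreal \<bar>g (h + x) - g x\<bar> \<partial>lborel) + (\<integral>\<^sup>+x. ennreal \<bar>f x - g x\<bar> \<partial>lborel)"
    by (rule nn_integral_abs_triangle) auto
  also have "(\<integral>\<^sup>+x. ennreal \<bar>f (h + x) - g (h + x)\<bar> \<partial>lborel) = (\<integral>\<^sup>+x. ennreal \<bar>f x - g x\<bar> \<partial>lborel)"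
    using nn_integral_lborel_translate[of "\<lambda>x. ennreal \<bar>f x - g x\<bar>"] by simp
  finally show ?thesis by (simp add: mult_2 ac_simps add_mono)
qed

lemma L1_translation_approx_tendsto:
  fixes f :: "'a::euclidean_space \<Rightarrow> real"
  assumes f: "f \<in> borel_measurable borel"
    and approx: "\<And>\<epsilon>. 0 < \<epsilon> \<Longrightarrow> \<exists>g\<in>borel_measurable borel. (\<integral>\<^sup>+x. ennreal \<bar>f x - g x\<bar> \<partial>lborel) \<le> ennreal \<epsilon> \<and>
        (\<lambda>n::nat. \<integral>\<^sup>+x. ennreal \<bar>g (h n + x) - g x\<bar> \<partial>lborel) \<longlonglongrightarrow> 0"
  shows "(\<lambda>n. \<integral>\<^sup>+x. ennreal \<bar>f (h n + x) - f x\<bar> \<partial>lborel) \<longlonglongrightarrow> 0"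
proof (rule tendsto_0_if_Limsup_eq_0_ennreal)
  have "Limsup sequentially (\<lambda>n. \<integral>\<^sup>+x. ennreal \<bar>f (h n + x) - f x\<bar> \<partial>lborel) \<le> 0"
  proof (rule ennreal_le_epsilon)
    fix \<epsilon> :: real assume e: "0 < \<epsilon>"
    from approx[of "\<epsilon> / 2"] e obtain g where g: "g \<in> borel_measurable borel"
      "(\<integral>\<^sup>+x. ennreal \<bar>f x - g x\<bar> \<partial>lborel) \<le> ennreal (\<epsilon> / 2)"
      "(\<lambda>n. \<integral>\<^sup>+x. ennreal \<bar>g (h n + x) - g x\<bar> \<partial>lborel) \<longlonglongrightarrow> 0" by auto
    have "Limsup sequentially (\<lambda>n. \<integral>\<^sup>+x. ennreal \<bar>f (h n + x) - f x\<bar> \<partial>lborel)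
       \<le> Limsup sequentially (\<lambda>n. (\<integral>\<^sup>+x. ennreal \<bar>g (h n + x) - g x\<bar> \<partial>lborel) + 2 * ennreal (\<epsilon> / 2))"
    proof (intro Limsup_mono always_eventually allI)
      fix n
      show "(\<integral>\<^sup>+x. ennreal \<bar>f (h n + x) - f x\<bar> \<partial>lborel) \<le> (\<integral>\<^sup>+x. ennreal \<bar>g (h n + x) - g x\<bar> \<partial>lborel) + 2 * ennreal (\<epsilon> / 2)"
        by (rule order_trans[OF L1_translation_approx[OF f g(1)]]) (intro add_left_mono mult_left_mono g, simp)
    qed
    also have "\<dots> = 0 + 2 * ennreal (\<epsilon> / 2)"
      by (intro lim_imp_Limsup tendsto_add g tendsto_const) simp
    also have "\<dots> = 0 + ennreal \<epsilon>" by (simp add: ennreal_mult'[symmetric] flip: ennreal_numeral)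
    finally show "Limsup sequentially (\<lambda>n. \<integral>\<^sup>+x. ennreal \<bar>f (h n + x) - f x\<bar> \<partial>lborel) \<le> 0 + ennreal \<epsilon>" .
  qed
  then show "Limsup sequentially (\<lambda>n. \<integral>\<^sup>+x. ennreal \<bar>f (h n + x) - f x\<bar> \<partial>lborel) = 0" by simp
qed

text \<open>Induction over integrable functions: outer regularity reduces indicators to open sets,
  and the limit case is an L1 approximation by simple functions.\<close>

lemma L1_translation_tendsto:
  fixes f :: "'a::euclidean_space \<Rightarrow> real"
  assumes "integrable lborel f" and h: "h \<longlonglongrightarrow> 0"
  shows "(\<lambda>n. \<integral>\<^sup>+x. ennreal \<bar>f (h n + x) - f x\<bar> \<partial>lborel) \<longlonglongrightarrow> 0"
  using assms(1)
proof (induction rule: integrable_induct)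
  case (base A c)
  have [measurable]: "A \<in> sets borel" using base by simp
  have ind: "(\<lambda>n. \<integral>\<^sup>+x. ennreal \<bar>indicator A (h n + x) - indicator A x\<bar> \<partial>lborel) \<longlonglongrightarrow> 0"
  proof (rule L1_translation_approx_tendsto)
    fix \<epsilon> :: real assume "0 < \<epsilon>"
    then obtain U where U: "open U" "A \<subseteq> U" "emeasure lborel (U - A) < ennreal \<epsilon>"
      using outer_regular_lborel[of A \<epsilon>] by auto
    have "emeasure lborel U = emeasure lborel (U - A) + emeasure lborel A"
      using U by (subst plus_emeasure) (auto simp: Un_absorb2)
    also have "\<dots> < \<infinity>" using U(3) base(2) by (auto simp: less_top[symmetric])
    finally have fin: "emeasure lborel U < \<infinity>" .
    have "(\<integral>\<^sup>+x. ennreal \<bar>indicator A x - indicator U x\<bar> \<partial>lborel) = (\<integral>\<^sup>+x. indicator (U - A) x \<partial>lborel)"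
      using U(2) by (intro nn_integral_cong) (auto simp: indicator_def)
    also have "\<dots> \<le> ennreal \<epsilon>" using U by (simp add: less_imp_le)
    finally show "\<exists>g\<in>borel_measurable borel. (\<integral>\<^sup>+x. ennreal \<bar>indicator A x - g x\<bar> \<partial>lborel) \<le> ennreal \<epsilon> \<and>
        (\<lambda>n. \<integral>\<^sup>+x. ennreal \<bar>g (h n + x) - g x\<bar> \<partial>lborel) \<longlonglongrightarrow> 0"
      using L1_translation_continuous_open[OF U(1) fin h] U(1) by (intro bexI[of _ "indicator U"] conjI) auto
  qed simp
  have "(\<integral>\<^sup>+x. ennreal \<bar>indicator A (h n + x) *\<^sub>R c - indicator A x *\<^sub>R c\<bar> \<partial>lborel)
      = ennreal \<bar>c\<bar> * (\<integral>\<^sup>+x. ennreal \<bar>indicator A (h n + x) - indicator A x\<bar> \<partial>lborel)" for n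
    by (subst nn_integral_cmult[symmetric]) (auto intro!: nn_integral_cong simp: indicator_def)
  then show ?case using tendsto_mult_ennreal[OF tendsto_const[of "ennreal \<bar>c\<bar>"] ind] by simp
next
  case (add f g)
  have [measurable]: "f \<in> borel_measurable borel" "g \<in> borel_measurable borel"
    using add.hyps by (auto dest: borel_measurable_integrable)
  show ?case
  proof (rule tendsto_sandwich[OF _ _ tendsto_const])
    show "\<forall>\<^sub>F n in sequentially. (\<integral>\<^sup>+x. ennreal \<bar>f (h n + x) + g (h n + x) - (f x + g x)\<bar> \<partial>lborel)
      \<le> (\<integral>\<^sup>+x. ennreal \<bar>f (h n + x) - f x\<bar> \<partial>lborel) + (\<integral>\<^sup>+x. ennreal \<bar>g (h n + x) - g x\<bar> \<partial>lborel)"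
      by (intro always_eventually allI nn_integral_abs_triangle) auto
    show "(\<lambda>n. (\<integral>\<^sup>+x. ennreal \<bar>f (h n + x) - f x\<bar> \<partial>lborel) + (\<integral>\<^sup>+x. ennreal \<bar>g (h n + x) - g x\<bar> \<partial>lborel)) \<longlonglongrightarrow> 0"
      using tendsto_add[OF add.IH] by simp
  qed simp
next
  case (lim f s)
  have [measurable]: "f \<in> borel_measurable borel" "s i \<in> borel_measurable borel" for i
    using lim.hyps(1)[of i] lim.hyps(4) by (auto dest: borel_measurable_integrable)
  have "(\<lambda>i. \<integral>\<^sup>+x. ennreal \<bar>f x - s i x\<bar> \<partial>lborel) \<longlonglongrightarrow> (\<integral>\<^sup>+x. 0 \<partial>(lborel::'a measure))"
  \<comment> \<open>The approximating simple functions satisfy |s i| \<le> 2 |f|, whence the factor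
    3.\<close>
  proof (rule nn_integral_dominated_convergence[where w = "\<lambda>x. ennreal (3 * \<bar>f x\<bar>)"])
    show "(\<integral>\<^sup>+x. ennreal (3 * \<bar>f x\<bar>) \<partial>lborel) < \<infinity>"
      using integrable_iff_bounded[of lborel "\<lambda>x. 3 * \<bar>f x\<bar>"] lim.hyps(4) by simp
    show "AE x in lborel. (\<lambda>i. ennreal \<bar>f x - s i x\<bar>) \<longlonglongrightarrow> 0"
    proof (intro AE_I2)
      fix x
      have "(\<lambda>i. \<bar>f x - s i x\<bar>) \<longlonglongrightarrow> \<bar>f x - f x\<bar>"
        using lim.hyps(2)[of x] by (intro tendsto_intros) auto
      from tendsto_ennrealI[OF this] show "(\<lambda>i. ennreal \<bar>f x - s i x\<bar>) \<longlonglongrightarrow> 0" by simp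
    qed
    show "AE x in lborel. ennreal \<bar>f x - s i x\<bar> \<le> ennreal (3 * \<bar>f x\<bar>)" for i
      using lim.hyps(3)[of _ i] by (intro AE_I2 ennreal_leI) (smt (verit) UNIV_I real_norm_def space_lborel)
  qed auto
  then have L: "(\<lambda>i. \<integral>\<^sup>+x. ennreal \<bar>f x - s i x\<bar> \<partial>lborel) \<longlonglongrightarrow> 0" by simp
  show ?case
  proof (rule L1_translation_approx_tendsto)
    fix \<epsilon> :: real assume "0 < \<epsilon>"
    then have "\<forall>\<^sub>F i in sequentially. (\<integral>\<^sup>+x. ennreal \<bar>f x - s i x\<bar> \<partial>lborel) < ennreal \<epsilon>"
      using order_tendstoD(2)[OF L] by simp
    then obtain i where "(\<integral>\<^sup>+x. ennreal \<bar>f x - s i x\<bar> \<partial>lborel) < ennreal \<epsilon>"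
      by (meson eventually_sequentially order_refl)
    then show "\<exists>g\<in>borel_measurable borel. (\<integral>\<^sup>+x. ennreal \<bar>f x - g x\<bar> \<partial>lborel) \<le> ennreal \<epsilon> \<and>
        (\<lambda>n. \<integral>\<^sup>+x. ennreal \<bar>g (h n + x) - g x\<bar> \<partial>lborel) \<longlonglongrightarrow> 0"
      using lim.IH[of i] by (intro bexI[of _ "s i"]) (auto simp: less_imp_le)
  qed simp
qed

text \<open>The mollified function averages over all shifts of length below e at once, so the
  sequential statement is turned into a uniform one by contradiction.\<close>

lemma L1_translation_uniform:
  fixes f :: "'a::euclidean_space \<Rightarrow> real"
  assumes f: "integrable lborel f" and "0 < \<epsilon>"
  shows "\<exists>\<delta>>0. \<forall>h. norm h < \<delta> \<longrightarrow> (\<integral>\<^sup>+x. ennreal \<bar>f (h + x) - f x\<bar> \<partial>lborel) \<le> ennreal \<epsilon>"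
proof (rule ccontr)
  assume neg: "\<not> ?thesis"
  have "\<exists>h. norm h < \<delta> \<and> \<not> (\<integral>\<^sup>+x. ennreal \<bar>f (h + x) - f x\<bar> \<partial>lborel) \<le> ennreal \<epsilon>" if "\<delta> > 0" for \<delta>
    using neg that by blast
  then have "\<forall>n::nat. \<exists>h. norm h < 1 / real (Suc n) \<and> \<not> (\<integral>\<^sup>+x. ennreal \<bar>f (h + x) - f x\<bar> \<partial>lborel) \<le> ennreal \<epsilon>"
    by simp
  then obtain h where h: "\<And>n::nat. norm (h n) < 1 / real (Suc n)"
    "\<And>n. \<not> (\<integral>\<^sup>+x. ennreal \<bar>f (h n + x) - f x\<bar> \<partial>lborel) \<le> ennreal \<epsilon>" by metis
  have "h \<longlonglongrightarrow> 0"
    by (rule Lim_null_comparison[OF _ LIMSEQ_inverse_real_of_nat])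
       (use h(1) in \<open>auto simp: inverse_eq_divide less_imp_le\<close>)
  then have "\<forall>\<^sub>F n in sequentially. (\<integral>\<^sup>+x. ennreal \<bar>f (h n + x) - f x\<bar> \<partial>lborel) < ennreal \<epsilon>"
    using order_tendstoD(2)[OF L1_translation_tendsto[OF f]] assms(2) by simp
  then show False using h(2) by (metis (no_types, lifting) eventually_sequentially less_imp_le order_refl)
qed

section \<open>Derivatives of the mollifier\<close>

lemma mollifier_uminus [simp]: "mollifier e (- z) = mollifier e z"
  by (simp add: mollifier_def bump_def)

lemma mollifier_le:
  assumes "0 < e"
  shows "mollifier e (z::'a::euclidean_space) \<le> 1 / (LBINT z. bump e (z::'a))"
  using bump_le_1[of e z] integral_bump_pos[OF assms, where ?'a='a] by (simp add: mollifier_def divide_right_mono)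

lemma mollifier_has_derivative:
  "(mollifier e has_derivative frechet_derivative (mollifier e) (at z)) (at (z::'a::euclidean_space))"
  using C_k_mollifier[of 1 e, where ?'a='a] by (simp add: frechet_derivative_works)

text \<open>\<open>C_k\<close> speaks of basis directions only; linearity of the derivative extends
  continuity to an arbitrary direction h.\<close>

lemma continuous_on_mollifier_derivative:
  "continuous_on UNIV (\<lambda>z::'a::euclidean_space. frechet_derivative (mollifier e) (at z) h)"
proof -
  have "frechet_derivative (mollifier e) (at z) h = (\<Sum>i\<in>Basis. (h \<bullet> i) * frechet_derivative (mollifier e) (at z) i)" for z :: 'a
  proof -
    have lin: "linear (frechet_derivative (mollifier e) (at z))"
      using mollifier_has_derivative by (rule has_derivative_linear)
    have "frechet_derivative (mollifier e) (at z) h = frechet_derivative (mollifier e) (at z) (\<Sum>i\<in>Basis. (h \<bullet> i) *\<^sub>R i)"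
      by (simp add: euclidean_representation)
    also have "\<dots> = (\<Sum>i\<in>Basis. (h \<bullet> i) * frechet_derivative (mollifier e) (at z) i)"
      by (simp add: linear_sum[OF lin] linear_scale[OF lin])
    finally show ?thesis .
  qed
  moreover have "continuous_on UNIV (\<lambda>z::'a. frechet_derivative (mollifier e) (at z) i)" if "i \<in> Basis" for i :: 'a
    using C_k_mollifier[of 1 e, where ?'a='a] that by simp
  ultimately show ?thesis by (auto intro!: continuous_intros)
qed

lemma mollifier_derivative_eq_0:
  assumes "0 < e" "e < norm (z::'a::euclidean_space)"
  shows "frechet_derivative (mollifier e) (at z) h = 0"
proof -
  have "((\<lambda>_. 0::real) has_derivative (\<lambda>_. 0)) (at z)" by simp
  then have "(mollifier e has_derivative (\<lambda>_. 0)) (at z)"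
  proof (rule has_derivative_transform_within_open)
    show "open {z::'a. e < norm z}" by (intro open_Collect_less continuous_intros)
  qed (use assms mollifier_eq_0[of e, where ?'a='a] in auto)
  then show ?thesis using frechet_derivative_at by metis
qed

lemma mollifier_derivative_bounded:
  assumes "0 < e"
  obtains M where "\<And>z::'a::euclidean_space. \<bar>frechet_derivative (mollifier e) (at z) h\<bar> \<le> M * indicator (cball 0 e) z"
proof -
  have "compact ((\<lambda>z::'a. frechet_derivative (mollifier e) (at z) h) ` cball 0 e)"
    by (intro compact_continuous_image continuous_on_subset[OF continuous_on_mollifier_derivative]) auto
  then have "bounded ((\<lambda>z::'a. frechet_derivative (mollifier e) (at z) h) ` cball 0 e)"
    by (rule compact_imp_bounded)
  then obtain M where M: "\<forall>w\<in>(\<lambda>z::'a. frechet_derivative (mollifier e) (at z) h) ` cball 0 e. norm w \<le> M"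
    unfolding bounded_iff by blast
  have "\<bar>frechet_derivative (mollifier e) (at z) h\<bar> \<le> M * indicator (cball 0 e) z" for z :: 'a
    using mollifier_derivative_eq_0[OF assms, of z h] M by (cases "norm z \<le> e") auto
  then show thesis by (rule that)
qed

lemma mollifier_FTC:
  "(LBINT t. frechet_derivative (mollifier e) (at (z + t *\<^sub>R h)) h * indicator {0..1} t)
     = mollifier e (z + h) - mollifier e (z::'a::euclidean_space)"
proof -
  have "(LBINT t. frechet_derivative (mollifier e) (at (z + t *\<^sub>R h)) h * indicator {0..1} t)
    = mollifier e (z + 1 *\<^sub>R h) - mollifier e (z + 0 *\<^sub>R h)"
  proof (rule integral_FTC_Icc_real)
    fix t :: real
    have "((\<lambda>t. z + t *\<^sub>R h) has_derivative (\<lambda>s. s *\<^sub>R h)) (at t)"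
      by (auto intro!: derivative_eq_intros)
    from has_derivative_compose[OF this mollifier_has_derivative, of e]
    have "((\<lambda>t. mollifier e (z + t *\<^sub>R h)) has_derivative (\<lambda>s. frechet_derivative (mollifier e) (at (z + t *\<^sub>R h)) (s *\<^sub>R h))) (at t)" .
    moreover have "frechet_derivative (mollifier e) (at (z + t *\<^sub>R h)) (s *\<^sub>R h) = frechet_derivative (mollifier e) (at (z + t *\<^sub>R h)) h * s" for s
      using has_derivative_linear[OF mollifier_has_derivative, of e "z + t *\<^sub>R h"] by (simp add: linear_scale)
    ultimately show "((\<lambda>t. mollifier e (z + t *\<^sub>R h)) has_real_derivative frechet_derivative (mollifier e) (at (z + t *\<^sub>R h)) h) (at t)"
      by (simp add: has_field_derivative_def)
    have "continuous_on UNIV (\<lambda>t. frechet_derivative (mollifier e) (at (z + t *\<^sub>R h)) h)"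
      by (rule continuous_on_compose2[OF continuous_on_mollifier_derivative]) (auto intro!: continuous_intros)
    then show "isCont (\<lambda>t. frechet_derivative (mollifier e) (at (z + t *\<^sub>R h)) h) t"
      by (simp add: continuous_on_eq_continuous_at)
  qed simp
  then show ?thesis by simp
qed

section \<open>Mollified functions and their increments\<close>

definition mollify :: "real \<Rightarrow> ('a::euclidean_space \<Rightarrow> real) \<Rightarrow> 'a \<Rightarrow> real" where
  "mollify e \<phi> x = (LBINT y. \<phi> y * mollifier e (x - y))"

text \<open>An element of \<open>BV_loc\<close> is only Lebesgue measurable, whereas Tonelli on
  \<open>lborel \<Otimes>\<^sub>M lborel\<close> wants Borel functions. The analysis is done for a
  Borel representative with this property and transferred back almost everywhere.\<close>

definition locally_integrable_borel :: "('a::euclidean_space \<Rightarrow> real) \<Rightarrow> bool" where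
  "locally_integrable_borel \<phi> \<longleftrightarrow> \<phi> \<in> borel_measurable borel \<and>
     (\<forall>A. A \<in> sets borel \<longrightarrow> bounded A \<longrightarrow> integrable lborel (\<lambda>y. indicator A y * \<phi> y))"

lemma locally_integrable_borel_representative:
  fixes \<phi> :: "'a::euclidean_space \<Rightarrow> real"
  assumes "locally_integrable \<phi>"
  obtains \<phi>' where "locally_integrable_borel \<phi>'" "AE x in lebesgue. \<phi> x = \<phi>' x"
proof -
  have int: "set_integrable lebesgue (cball 0 r) \<phi>" for r
    using assms by (simp add: locally_integrable_def)
  have "(\<lambda>x. indicator (cball 0 (real k)) x *\<^sub>R \<phi> x) \<in> borel_measurable lebesgue" for k
    using int[of "real k"] by (simp add: set_integrable_def borel_measurable_integrable)
  moreover have "(\<lambda>k. indicator (cball 0 (real k)) x *\<^sub>R \<phi> x) \<longlonglongrightarrow> \<phi> x" for x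
  proof (rule tendsto_eventually)
    obtain k0 :: nat where "norm x \<le> real k0" using real_arch_simple by blast
    then show "\<forall>\<^sub>F k in sequentially. indicator (cball 0 (real k)) x *\<^sub>R \<phi> x = \<phi> x"
      by (intro eventually_sequentiallyI[of k0]) auto
  qed
  ultimately have "\<phi> \<in> borel_measurable lebesgue" by (rule borel_measurable_LIMSEQ_real[rotated])
  then obtain \<phi>' where \<phi>': "\<phi>' \<in> borel_measurable lborel" "AE x in lborel. \<phi> x = \<phi>' x"
    using completion_ex_borel_measurable_real by blast
  have ae: "AE x in lebesgue. \<phi> x = \<phi>' x" using \<phi>'(2) by (rule AE_completion)
  have [measurable]: "\<phi>' \<in> borel_measurable borel" using \<phi>'(1) by simp
  have [measurable]: "cball (0::'a) r \<in> sets borel" for r by simp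
  have "integrable lborel (\<lambda>y. indicator A y * \<phi>' y)" if A: "A \<in> sets borel" "bounded A" for A
  proof -
    obtain r where "\<forall>x\<in>A. norm x \<le> r" using A(2) unfolding bounded_iff by blast
    then have r: "A \<subseteq> cball 0 r" by auto
    have "integrable lebesgue (\<lambda>y. indicator (cball 0 r) y *\<^sub>R \<phi> y)"
      using int[of r] by (simp add: set_integrable_def)
    then have "integrable lebesgue (\<lambda>y. indicator (cball 0 r) y *\<^sub>R \<phi>' y)"
    proof (rule integrable_cong_AE_imp)
      show "(\<lambda>y. indicator (cball 0 r) y *\<^sub>R \<phi>' y) \<in> borel_measurable lebesgue"
        by (rule measurable_completion) measurable
      show "AE y in lebesgue. indicator (cball 0 r) y *\<^sub>R \<phi> y = indicator (cball 0 r) y *\<^sub>R \<phi>' y"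
        using ae by eventually_elim simp
    qed
    then have "integrable lborel (\<lambda>y. indicator (cball 0 r) y *\<^sub>R \<phi>' y)"
      by (subst (asm) integrable_completion) (use \<phi>'(1) in auto)
    then show ?thesis
    proof (rule Bochner_Integration.integrable_bound)
      show "(\<lambda>y. indicator A y * \<phi>' y) \<in> borel_measurable lborel" using A(1) \<phi>'(1) by measurable
      show "AE y in lborel. norm (indicator A y * \<phi>' y) \<le> norm (indicator (cball 0 r) y *\<^sub>R \<phi>' y)"
        using r by (intro AE_I2) (auto simp: indicator_def)
    qed
  qed
  then have "locally_integrable_borel \<phi>'" by (auto simp: locally_integrable_borel_def)
  then show thesis using ae by (rule that)
qed

text \<open>The increment is the integral over t in [0,1] of the derivative in direction h at x + t
  h. This derivative falls on the mollifier and is a pairing of \<phi> with partial derivatives of a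
  test function, hence controlled by the gradient measure. Treating the components one by one
  produces the l1 norm of h.\<close>

lemma mollify_diff_bound:
  fixes \<phi> \<phi>' :: "'a::euclidean_space \<Rightarrow> real"
  assumes \<phi>: "\<phi> \<in> BV_loc" and \<phi>': "locally_integrable_borel \<phi>'" "AE x in lebesgue. \<phi> x = \<phi>' x"
    and e: "0 < e"
  shows "ennreal \<bar>mollify e \<phi>' (x + h) - mollify e \<phi>' x\<bar> \<le>
    ennreal (\<Sum>i\<in>Basis. \<bar>h \<bullet> i\<bar>) *
      (\<integral>\<^sup>+t. (\<integral>\<^sup>+y. ennreal (mollifier e (x + t *\<^sub>R h - y)) \<partial>gradient_measure \<phi>) * indicator {0..1} t \<partial>lborel)"
proof -
  let ?D = "\<lambda>z. frechet_derivative (mollifier e) (at z)"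
  have [measurable]: "\<phi>' \<in> borel_measurable borel" using \<phi>' by (simp add: locally_integrable_borel_def)
  have [measurable]: "(\<lambda>z::'a. ?D z k) \<in> borel_measurable borel" for k
    using continuous_on_mollifier_derivative by (rule borel_measurable_continuous_onI)
  interpret sf: sigma_finite_measure "gradient_measure \<phi>" using sigma_finite_gradient_measure[OF \<phi>] .
  \<comment> \<open>The closed e-neighbourhood of the segment from x to x + h lies in the ball of
    radius R about 0, so only \<open>\<phi>'\<close> on that ball is involved.\<close>
  define R where "R = norm x + norm h + e"
  have [measurable]: "cball (0::'a) R \<in> sets borel" by simp
  have supp: "norm y \<le> R" if "norm (x + t *\<^sub>R h - y) \<le> e" "t \<in> {0..1}" for y t
  proof -
    have "norm y \<le> norm (x + t *\<^sub>R h) + norm (x + t *\<^sub>R h - y)"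
      by (metis add.commute norm_minus_commute norm_triangle_sub)
    also have "norm (x + t *\<^sub>R h) \<le> norm x + norm (t *\<^sub>R h)" by (rule norm_triangle_ineq)
    also have "norm (t *\<^sub>R h) \<le> norm h" using that(2) by (simp add: mult_left_le_one_le)
    finally show ?thesis using that by (simp add: R_def)
  qed
  have intR: "integrable lborel (\<lambda>y. indicator (cball 0 R) y * \<phi>' y)"
    using \<phi>' by (simp add: locally_integrable_borel_def)
  let ?G = "\<lambda>k t y. indicator {0..1} t * (\<phi>' y * ?D (x + t *\<^sub>R h - y) k)"
  \<comment> \<open>The direction k is general: Fubini uses k = h, the decomposition into partial
    derivatives uses basis vectors.\<close>
  have Gint: "integrable (lborel \<Otimes>\<^sub>M lborel) (\<lambda>(t, y). ?G k t y)" 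
    and Gint2: "\<And>t. t \<in> {0..1} \<Longrightarrow> integrable lborel (\<lambda>y. \<phi>' y * ?D (x + t *\<^sub>R h - y) k)" for k
  proof -
    obtain M where M: "\<And>z::'a. \<bar>?D z k\<bar> \<le> M * indicator (cball 0 e) z"
      using mollifier_derivative_bounded[OF e] by metis
    have M0: "0 \<le> M" using M[of 0] e by simp
    have pw: "\<bar>?G k t y\<bar> \<le> indicator {0..1} t * (M * \<bar>indicator (cball 0 R) y * \<phi>' y\<bar>)" for t y
    proof (cases "t \<in> {0..1} \<and> norm (x + t *\<^sub>R h - y) \<le> e")
      case True
      then have "norm y \<le> R" using supp by blast
      moreover have "\<bar>?D (x + t *\<^sub>R h - y) k\<bar> \<le> M" using M[of "x + t *\<^sub>R h - y"] True by simp
      moreover from this have "\<bar>\<phi>' y\<bar> * \<bar>?D (x + t *\<^sub>R h - y) k\<bar> \<le> \<bar>\<phi>' y\<bar> * M"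
        by (rule mult_left_mono) simp
      ultimately show ?thesis using True by (simp add: abs_mult mult.commute[of M])
    next
      case False
      then have "indicator {0..1} t * (\<phi>' y * ?D (x + t *\<^sub>R h - y) k) = 0" using M[of "x + t *\<^sub>R h - y"] by (auto simp: indicator_def)
      then show ?thesis using M0 by (simp only: abs_zero) simp
    qed
    have prod: "integrable (lborel \<Otimes>\<^sub>M lborel) (\<lambda>(t::real, y). indicator {0..1} t * (M * \<bar>indicator (cball 0 R) y * \<phi>' y\<bar>))"
    proof (rule lborel_pair.Fubini_integrable)
      show "integrable lborel (\<lambda>t::real. \<integral>y. norm (case (t, y) of (t, y) \<Rightarrow> indicator {0..1} t * (M * \<bar>indicator (cball 0 R) y * \<phi>' y\<bar>)) \<partial>lborel)"
        using M0 by (auto simp: abs_mult intro!: integrable_real_indicator)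
      show "AE t::real in lborel. integrable lborel (\<lambda>y. case (t, y) of (t, y) \<Rightarrow> indicator {0..1} t * (M * \<bar>indicator (cball 0 R) y * \<phi>' y\<bar>))"
        using intR by (auto intro!: AE_I2)
    qed measurable
    show "integrable (lborel \<Otimes>\<^sub>M lborel) (\<lambda>(t, y). ?G k t y)"
      using prod
    proof (rule Bochner_Integration.integrable_bound)
      show "AE p in lborel \<Otimes>\<^sub>M lborel. norm (case p of (t, y) \<Rightarrow> ?G k t y)
        \<le> norm (case p of (t::real, y) \<Rightarrow> indicator {0..1} t * (M * \<bar>indicator (cball 0 R) y * \<phi>' y\<bar>))"
      proof (intro AE_I2)
        fix p :: "real \<times> 'a"
        obtain t y where p: "p = (t, y)" by force
        show "norm (case p of (t, y) \<Rightarrow> ?G k t y)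
          \<le> norm (case p of (t, y) \<Rightarrow> indicator {0..1} t * (M * \<bar>indicator (cball 0 R) y * \<phi>' y\<bar>))"
          unfolding p prod.case real_norm_def by (rule order_trans[OF pw abs_ge_self])
      qed
    qed measurable
    show "integrable lborel (\<lambda>y. \<phi>' y * ?D (x + t *\<^sub>R h - y) k)" if t: "t \<in> {0..1}" for t
    proof (rule Bochner_Integration.integrable_bound)
      show "integrable lborel (\<lambda>y. M * \<bar>indicator (cball 0 R) y * \<phi>' y\<bar>)" using intR by simp
      show "AE y in lborel. norm (\<phi>' y * ?D (x + t *\<^sub>R h - y) k) \<le> norm (M * \<bar>indicator (cball 0 R) y * \<phi>' y\<bar>)"
        using pw[of t] t M0 by (intro AE_I2) (auto simp: abs_mult)
    qed measurable
  qed
  have mint: "integrable lborel (\<lambda>y. \<phi>' y * mollifier e (x + t *\<^sub>R h - y))" if "t \<in> {0..1}" for t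
  proof -
    obtain M where M: "\<And>z::'a. mollifier e z \<le> M" using mollifier_le[OF e] by blast
    show ?thesis
    proof (rule Bochner_Integration.integrable_bound)
      show "integrable lborel (\<lambda>y. M * \<bar>indicator (cball 0 R) y * \<phi>' y\<bar>)" using intR by simp
      show "AE y in lborel. norm (\<phi>' y * mollifier e (x + t *\<^sub>R h - y)) \<le> norm (M * \<bar>indicator (cball 0 R) y * \<phi>' y\<bar>)"
      proof (intro AE_I2)
        fix y
        show "norm (\<phi>' y * mollifier e (x + t *\<^sub>R h - y)) \<le> norm (M * \<bar>indicator (cball 0 R) y * \<phi>' y\<bar>)"
        proof (cases "norm (x + t *\<^sub>R h - y) \<le> e")
          case True
          then have "norm y \<le> R" using supp that by blast
          moreover have "mollifier e (x + t *\<^sub>R h - y) \<le> \<bar>M\<bar>" using M[of "x + t *\<^sub>R h - y"] by simp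
          moreover from this have "\<bar>\<phi>' y\<bar> * mollifier e (x + t *\<^sub>R h - y) \<le> \<bar>\<phi>' y\<bar> * \<bar>M\<bar>"
            by (rule mult_left_mono) simp
          ultimately show ?thesis by (simp add: abs_mult mult.commute[of "\<bar>M\<bar>"])
        qed (use mollifier_eq_0[of e "x + t *\<^sub>R h - y"] e in auto)
      qed
    qed measurable
  qed
  have "mollify e \<phi>' (x + h) - mollify e \<phi>' x = (LBINT y. \<phi>' y * mollifier e (x + h - y) - \<phi>' y * mollifier e (x - y))"
    unfolding mollify_def using mint[of 1] mint[of 0] by (intro Bochner_Integration.integral_diff[symmetric]) auto
  also have "\<dots> = (LBINT y. LBINT t. ?G h t y)"
  proof (rule Bochner_Integration.integral_cong[OF refl])
    fix y
    have "\<phi>' y * mollifier e (x + h - y) - \<phi>' y * mollifier e (x - y) = \<phi>' y * (mollifier e ((x - y) + h) - mollifier e (x - y))"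
      by (simp add: algebra_simps)
    also have "\<dots> = \<phi>' y * (LBINT t. ?D ((x - y) + t *\<^sub>R h) h * indicator {0..1} t)"
      by (simp only: mollifier_FTC)
    also have "\<dots> = (LBINT t. \<phi>' y * (?D ((x - y) + t *\<^sub>R h) h * indicator {0..1} t))"
      by simp
    also have "\<dots> = (LBINT t. ?G h t y)"
      by (intro Bochner_Integration.integral_cong refl) (simp add: algebra_simps)
    finally show "\<phi>' y * mollifier e (x + h - y) - \<phi>' y * mollifier e (x - y) = (LBINT t. ?G h t y)" .
  qed
  also have "\<dots> = (LBINT t. LBINT y. ?G h t y)"
    using Gint[of h] by (intro lborel_pair.Fubini_integral) simp
  finally have eq: "mollify e \<phi>' (x + h) - mollify e \<phi>' x = (LBINT t. LBINT y. ?G h t y)" .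
  have inner: "ennreal \<bar>LBINT y. ?G h t y\<bar> \<le> ennreal (\<Sum>i\<in>Basis. \<bar>h \<bullet> i\<bar>) *
      ((\<integral>\<^sup>+y. ennreal (mollifier e (x + t *\<^sub>R h - y)) \<partial>gradient_measure \<phi>) * indicator {0..1} t)" for t
  proof (cases "t \<in> {0..1}")
    case t: True
    let ?\<psi> = "\<lambda>y. mollifier e (x + t *\<^sub>R h - y)"
    let ?I = "\<integral>\<^sup>+y. ennreal (?\<psi> y) \<partial>gradient_measure \<phi>"
    have Dh: "?D z h = (\<Sum>i\<in>Basis. (h \<bullet> i) * ?D z i)" for z
    proof -
      have lin: "linear (?D z)" using mollifier_has_derivative by (rule has_derivative_linear)
      have "?D z h = ?D z (\<Sum>i\<in>Basis. (h \<bullet> i) *\<^sub>R i)" by (simp add: euclidean_representation)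
      then show ?thesis by (simp add: linear_sum[OF lin] linear_scale[OF lin])
    qed
    have "(LBINT y. ?G h t y) = (LBINT y. \<Sum>i\<in>Basis. (h \<bullet> i) * (\<phi>' y * ?D (x + t *\<^sub>R h - y) i))"
      using t by (intro Bochner_Integration.integral_cong refl) (simp add: Dh sum_distrib_left ac_simps)
    also have "\<dots> = (\<Sum>i\<in>Basis. (h \<bullet> i) * (LBINT y. \<phi>' y * ?D (x + t *\<^sub>R h - y) i))"
      using Gint2[OF t] by (subst Bochner_Integration.integral_sum) auto
    finally have sum: "(LBINT y. ?G h t y) = (\<Sum>i\<in>Basis. (h \<bullet> i) * (LBINT y. \<phi>' y * ?D (x + t *\<^sub>R h - y) i))" .
    have comp: "ennreal \<bar>LBINT y. \<phi>' y * ?D (x + t *\<^sub>R h - y) i\<bar> \<le> ?I" if i: "i \<in> Basis" for i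
    proof -
      \<comment> \<open>Reflection changes the sign of the derivative; it disappears in the absolute
        value of \<open>integral_test_function_derivative_bound\<close>.\<close>
      have fd: "frechet_derivative ?\<psi> (at y) i = - ?D (x + t *\<^sub>R h - y) i" for y
        using mollifier_has_derivative by (intro frechet_derivative_reflect) (auto simp: differentiable_def)
      have "(LINT y|lebesgue. \<phi> y * frechet_derivative ?\<psi> (at y) i) = (LINT y|lebesgue. \<phi>' y * frechet_derivative ?\<psi> (at y) i)"
      proof (rule integral_cong_AE)
        have m: "(\<lambda>y. \<phi>' y * frechet_derivative ?\<psi> (at y) i) \<in> borel_measurable lebesgue"
          unfolding fd by (intro measurable_completion) measurable
        show "AE y in lebesgue. \<phi> y * frechet_derivative ?\<psi> (at y) i = \<phi>' y * frechet_derivative ?\<psi> (at y) i"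
          using \<phi>'(2) by eventually_elim simp
        then show "(\<lambda>y. \<phi> y * frechet_derivative ?\<psi> (at y) i) \<in> borel_measurable lebesgue"
          using m by (intro borel_measurable_AE[OF m]) (auto elim: eventually_mono)
      qed (unfold fd, intro measurable_completion, measurable)
      also have "\<dots> = (LBINT y. \<phi>' y * frechet_derivative ?\<psi> (at y) i)"
        unfolding fd by (intro integral_completion) measurable
      also have "\<dots> = - (LBINT y. \<phi>' y * ?D (x + t *\<^sub>R h - y) i)"
        unfolding fd by simp
      finally show ?thesis
        using integral_test_function_derivative_bound[OF \<phi> i test_function_mollifier[OF e], of "x + t *\<^sub>R h"] by simp
    qed
    have "ennreal \<bar>LBINT y. ?G h t y\<bar> \<le> ennreal (\<Sum>i\<in>Basis. \<bar>h \<bullet> i\<bar> * \<bar>LBINT y. \<phi>' y * ?D (x + t *\<^sub>R h - y) i\<bar>)"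
      unfolding sum by (intro ennreal_leI order_trans[OF sum_abs]) (simp add: abs_mult)
    also have "\<dots> = (\<Sum>i\<in>Basis. ennreal \<bar>h \<bullet> i\<bar> * ennreal \<bar>LBINT y. \<phi>' y * ?D (x + t *\<^sub>R h - y) i\<bar>)"
      by (subst sum_ennreal[symmetric]) (auto simp: ennreal_mult)
    also have "\<dots> \<le> (\<Sum>i\<in>Basis. ennreal \<bar>h \<bullet> i\<bar> * ?I)"
      by (intro sum_mono mult_left_mono comp) auto
    also have "\<dots> = ennreal (\<Sum>i\<in>Basis. \<bar>h \<bullet> i\<bar>) * ?I"
    proof -
      have "ennreal (\<Sum>i\<in>Basis. \<bar>h \<bullet> i\<bar>) = (\<Sum>i\<in>Basis. ennreal \<bar>h \<bullet> i\<bar>)"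
        by (rule sum_ennreal[symmetric]) simp
      then show ?thesis by (simp only: sum_distrib_right)
    qed
    finally show ?thesis using t by simp
  qed simp
  have "ennreal \<bar>LBINT t. LBINT y. ?G h t y\<bar> \<le> (\<integral>\<^sup>+t. ennreal \<bar>LBINT y. ?G h t y\<bar> \<partial>lborel)"
    using integral_norm_bound_ennreal[OF lborel_pair.integrable_fst[OF Gint[of h]]] by simp
  also have "\<dots> \<le> (\<integral>\<^sup>+t. ennreal (\<Sum>i\<in>Basis. \<bar>h \<bullet> i\<bar>) *
      ((\<integral>\<^sup>+y. ennreal (mollifier e (x + t *\<^sub>R h - y)) \<partial>gradient_measure \<phi>) * indicator {0..1} t) \<partial>lborel)"
    by (intro nn_integral_mono inner)
  also have "\<dots> = ennreal (\<Sum>i\<in>Basis. \<bar>h \<bullet> i\<bar>) * (\<integral>\<^sup>+t. 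
      (\<integral>\<^sup>+y. ennreal (mollifier e (x + t *\<^sub>R h - y)) \<partial>gradient_measure \<phi>) * indicator {0..1} t \<partial>lborel)"
    by (rule nn_integral_cmult) measurable
  finally show ?thesis unfolding eq .
qed

lemma sets_borel_ball [measurable]: "ball (a::'a::euclidean_space) r \<in> sets borel"
  by simp

lemma nn_integral_mollifier_reflect:
  assumes "0 < e"
  shows "(\<integral>\<^sup>+y. ennreal (mollifier e (x - y :: 'a::euclidean_space)) \<partial>lborel) = 1"
proof -
  have "(\<integral>\<^sup>+y. ennreal (mollifier e (x - y)) \<partial>lborel) = (\<integral>\<^sup>+y. ennreal (mollifier e (- x + y)) \<partial>lborel)"
    by (metis (no_types) minus_diff_eq mollifier_uminus add_uminus_conv_diff add.commute)
  also have "\<dots> = (\<integral>\<^sup>+y. ennreal (mollifier e (y::'a)) \<partial>lborel)"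
    by (rule nn_integral_lborel_translate) measurable
  finally show ?thesis using nn_integral_mollifier[OF assms, where ?'a='a] by simp
qed

text \<open>On the ball the error at x is an average over z of |g(x + z) - g(x)|, where g is
  \<open>\<phi>'\<close> cut off to a larger ball. Exchanging the integrals reduces the claim to the
  uniform smallness of L1 translations of the integrable function g.\<close>

lemma mollify_approx:
  fixes \<phi>' :: "'a::euclidean_space \<Rightarrow> real"
  assumes \<phi>': "locally_integrable_borel \<phi>'" and eps: "0 < \<epsilon>"
  shows "\<exists>\<delta>>0. \<forall>e. 0 < e \<and> e < \<delta> \<longrightarrow>
    (\<integral>\<^sup>+x. indicator (ball a r) x * ennreal \<bar>mollify e \<phi>' x - \<phi>' x\<bar> \<partial>lborel) \<le> ennreal \<epsilon>"
proof -
  \<comment> \<open>With e < 1 and x in the ball of radius r, the mollifier reaches only points of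
    the ball of radius r + 1.\<close>
  define g where "g y = indicator (ball a (r + 1)) y * \<phi>' y" for y
  have [measurable]: "\<phi>' \<in> borel_measurable borel" using \<phi>' by (simp add: locally_integrable_borel_def)
  have [measurable]: "g \<in> borel_measurable borel" unfolding g_def by measurable
  have g: "integrable lborel g" using \<phi>' unfolding g_def[abs_def] by (simp add: locally_integrable_borel_def)
  obtain \<delta> where \<delta>: "0 < \<delta>" "\<And>h. norm h < \<delta> \<Longrightarrow> (\<integral>\<^sup>+x. ennreal \<bar>g (h + x) - g x\<bar> \<partial>lborel) \<le> ennreal \<epsilon>"
    using L1_translation_uniform[OF g eps] by blast
  have "(\<integral>\<^sup>+x. indicator (ball a r) x * ennreal \<bar>mollify e \<phi>' x - \<phi>' x\<bar> \<partial>lborel) \<le> ennreal \<epsilon>"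
    if e: "0 < e" "e < min \<delta> 1" for e
  proof -
    let ?K = "1 / (LBINT z. bump e (z::'a))"
    have mK: "mollifier e z \<le> ?K" for z :: 'a
      using e(1) by (rule mollifier_le)
    have mint: "integrable lborel (\<lambda>y. mollifier e (x - y))" and m1: "(LBINT y. mollifier e (x - y)) = 1" for x :: 'a
    proof -
      have "has_bochner_integral lborel (\<lambda>y. mollifier e (x - y)) 1"
        using nn_integral_mollifier_reflect[OF e(1), of x]
        by (intro has_bochner_integral_nn_integral) auto
      then show "integrable lborel (\<lambda>y. mollifier e (x - y))" "(LBINT y. mollifier e (x - y)) = 1"
        by (auto simp: has_bochner_integral_iff)
    qed
    have pw: "indicator (ball a r) x * ennreal \<bar>mollify e \<phi>' x - \<phi>' x\<bar>
        \<le> (\<integral>\<^sup>+y. ennreal (\<bar>g y - g x\<bar> * mollifier e (x - y)) \<partial>lborel)" for x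
    proof (cases "x \<in> ball a r")
      case x: True
      have gx: "g x = \<phi>' x" using x by (simp add: g_def)
      have gy: "\<phi>' y * mollifier e (x - y) = g y * mollifier e (x - y)" for y
      proof (cases "dist x y < e")
        case True
        then have "dist a y < r + 1" using dist_triangle[of a y x] x e by simp
        then show ?thesis by (simp add: g_def)
      next
        case False
        then have "mollifier e (x - y) = 0" using mollifier_eq_0[OF _ e(1)] by (simp add: dist_norm not_less)
        then show ?thesis by simp
      qed
      have gint: "integrable lborel (\<lambda>y. g y * mollifier e (x - y))"
      proof (rule Bochner_Integration.integrable_bound)
        show "integrable lborel (\<lambda>y. g y * ?K)" using g by simp
        show "AE y in lborel. norm (g y * mollifier e (x - y)) \<le> norm (g y * ?K)"
          unfolding norm_mult
          using mK by (intro AE_I2 mult_left_mono) (auto intro: order_trans[OF _ abs_ge_self] simp del: abs_divide)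
      qed measurable
      have "mollify e \<phi>' x - \<phi>' x = (LBINT y. g y * mollifier e (x - y)) - (LBINT y. g x * mollifier e (x - y))"
        by (simp add: mollify_def gy gx m1)
      also have "\<dots> = (LBINT y. g y * mollifier e (x - y) - g x * mollifier e (x - y))"
        using gint mint by (intro Bochner_Integration.integral_diff[symmetric]) auto
      finally have "ennreal \<bar>mollify e \<phi>' x - \<phi>' x\<bar> = ennreal (norm (LBINT y. g y * mollifier e (x - y) - g x * mollifier e (x - y)))"
        by simp
      also have "\<dots> \<le> (\<integral>\<^sup>+y. ennreal (norm (g y * mollifier e (x - y) - g x * mollifier e (x - y))) \<partial>lborel)"
        using gint mint by (intro integral_norm_bound_ennreal) auto
      also have "\<dots> = (\<integral>\<^sup>+y. ennreal (\<bar>g y - g x\<bar> * mollifier e (x - y)) \<partial>lborel)"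
        by (intro nn_integral_cong) (simp add: abs_mult flip: left_diff_distrib)
      finally show ?thesis using x by simp
    qed simp
    have "(\<integral>\<^sup>+x. indicator (ball a r) x * ennreal \<bar>mollify e \<phi>' x - \<phi>' x\<bar> \<partial>lborel)
        \<le> (\<integral>\<^sup>+x. (\<integral>\<^sup>+y. ennreal (\<bar>g y - g x\<bar> * mollifier e (x - y)) \<partial>lborel) \<partial>lborel)"
      by (intro nn_integral_mono pw)
    also have "\<dots> = (\<integral>\<^sup>+x. (\<integral>\<^sup>+z. ennreal (\<bar>g (z + x) - g x\<bar> * mollifier e z) \<partial>lborel) \<partial>lborel)"
    proof (rule nn_integral_cong)
      fix x
      have "(\<integral>\<^sup>+y. ennreal (\<bar>g y - g x\<bar> * mollifier e (x - y)) \<partial>lborel)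
        = (\<integral>\<^sup>+z. ennreal (\<bar>g (x + z) - g x\<bar> * mollifier e (x - (x + z))) \<partial>lborel)"
        by (rule nn_integral_lborel_translate[symmetric]) measurable
      then show "(\<integral>\<^sup>+y. ennreal (\<bar>g y - g x\<bar> * mollifier e (x - y)) \<partial>lborel)
        = (\<integral>\<^sup>+z. ennreal (\<bar>g (z + x) - g x\<bar> * mollifier e z) \<partial>lborel)" by (simp add: add.commute)
    qed
    also have "\<dots> = (\<integral>\<^sup>+z. (\<integral>\<^sup>+x. ennreal (\<bar>g (z + x) - g x\<bar> * mollifier e z) \<partial>lborel) \<partial>lborel)"
      by (rule lborel_pair.Fubini') measurable
    also have "\<dots> = (\<integral>\<^sup>+z. (\<integral>\<^sup>+x. ennreal \<bar>g (z + x) - g x\<bar> \<partial>lborel) * ennreal (mollifier e z) \<partial>lborel)"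
      by (intro nn_integral_cong) (simp add: ennreal_mult nn_integral_multc)
    also have "\<dots> \<le> (\<integral>\<^sup>+z. ennreal \<epsilon> * ennreal (mollifier e z) \<partial>(lborel::'a measure))"
    proof (rule nn_integral_mono)
      fix z :: 'a
      show "(\<integral>\<^sup>+x. ennreal \<bar>g (z + x) - g x\<bar> \<partial>lborel) * ennreal (mollifier e z) \<le> ennreal \<epsilon> * ennreal (mollifier e z)"
        using \<delta>(2)[of z] mollifier_eq_0[OF _ e(1), of z] e by (cases "norm z < \<delta>") (auto intro!: mult_right_mono)
    qed
    also have "\<dots> = ennreal \<epsilon>"
      by (simp add: nn_integral_cmult nn_integral_mollifier[OF e(1)])
    finally show ?thesis .
  qed
  then show ?thesis using \<delta>(1) by (intro exI[of _ "min \<delta> 1"]) auto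
qed

lemma sum_abs_inner_Basis_le: "(\<Sum>i\<in>Basis. \<bar>h \<bullet> i\<bar>) \<le> real DIM('a) * norm (h::'a::euclidean_space)"
proof -
  have "(\<Sum>i\<in>Basis. \<bar>h \<bullet> i\<bar>) \<le> (\<Sum>i\<in>(Basis::'a set). norm h)" by (intro sum_mono Basis_le_norm)
  then show ?thesis by simp
qed

text \<open>By Tonelli the kernel is integrated in x first, which gives at most 1, and gives 0
  unless y is within r + |h| + e of a.\<close>

lemma mollify_translation_bound:
  fixes \<phi> \<phi>' :: "'a::euclidean_space \<Rightarrow> real"
  assumes \<phi>: "\<phi> \<in> BV_loc" and \<phi>': "locally_integrable_borel \<phi>'" "AE x in lebesgue. \<phi> x = \<phi>' x"
    and e: "0 < e"
  shows "(\<integral>\<^sup>+x. indicator (ball a r) x * ennreal \<bar>mollify e \<phi>' (x + h) - mollify e \<phi>' x\<bar> \<partial>lborel) \<le>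
    ennreal (real DIM('a) * norm h) * emeasure (gradient_measure \<phi>) (ball a (r + norm h + e))"
proof -
  let ?M = "gradient_measure \<phi>"
  let ?L = "ennreal (\<Sum>i\<in>Basis. \<bar>h \<bullet> i\<bar>)"
  interpret sf: sigma_finite_measure ?M using sigma_finite_gradient_measure[OF \<phi>] .
  interpret p: pair_sigma_finite lborel ?M ..
  have "(\<integral>\<^sup>+x. indicator (ball a r) x * ennreal \<bar>mollify e \<phi>' (x + h) - mollify e \<phi>' x\<bar> \<partial>lborel)
    \<le> (\<integral>\<^sup>+x. ?L * (\<integral>\<^sup>+t. (\<integral>\<^sup>+y. indicator (ball a r) x * ennreal (mollifier e (x + t *\<^sub>R h - y)) \<partial>?M) * indicator {0..1} t \<partial>lborel) \<partial>lborel)"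
  proof (rule nn_integral_mono)
    fix x
    show "indicator (ball a r) x * ennreal \<bar>mollify e \<phi>' (x + h) - mollify e \<phi>' x\<bar> 
      \<le> ?L * (\<integral>\<^sup>+t. (\<integral>\<^sup>+y. indicator (ball a r) x * ennreal (mollifier e (x + t *\<^sub>R h - y)) \<partial>?M) * indicator {0..1} t \<partial>lborel)"
      using mollify_diff_bound[OF \<phi> \<phi>' e, of x h] by (cases "x \<in> ball a r") auto
  qed
  also have "\<dots> = ?L * (\<integral>\<^sup>+x. (\<integral>\<^sup>+t. (\<integral>\<^sup>+y. indicator (ball a r) x * ennreal (mollifier e (x + t *\<^sub>R h - y)) \<partial>?M) * indicator {0..1} t \<partial>lborel) \<partial>lborel)"
    by (rule nn_integral_cmult) measurable
  also have "(\<integral>\<^sup>+x. (\<integral>\<^sup>+t. (\<integral>\<^sup>+y. indicator (ball a r) x * ennreal (mollifier e (x + t *\<^sub>R h - y)) \<partial>?M) * indicator {0..1} t \<partial>lborel) \<partial>lborel)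
    = (\<integral>\<^sup>+t. (\<integral>\<^sup>+x. (\<integral>\<^sup>+y. indicator (ball a r) x * ennreal (mollifier e (x + t *\<^sub>R h - y)) \<partial>?M) * indicator {0..1} t \<partial>lborel) \<partial>lborel)"
    by (rule lborel_pair.Fubini'[symmetric]) measurable
  also have "\<dots> \<le> (\<integral>\<^sup>+t. emeasure ?M (ball a (r + norm h + e)) * indicator {0..1::real} t \<partial>lborel)"
  proof (rule nn_integral_mono)
    fix t :: real
    show "(\<integral>\<^sup>+x. (\<integral>\<^sup>+y. indicator (ball a r) x * ennreal (mollifier e (x + t *\<^sub>R h - y)) \<partial>?M) * indicator {0..1} t \<partial>lborel)
      \<le> emeasure ?M (ball a (r + norm h + e)) * indicator {0..1} t"
    proof (cases "t \<in> {0..1}")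
      case t: True
      have "(\<integral>\<^sup>+x. (\<integral>\<^sup>+y. indicator (ball a r) x * ennreal (mollifier e (x + t *\<^sub>R h - y)) \<partial>?M) \<partial>lborel)
        = (\<integral>\<^sup>+y. (\<integral>\<^sup>+x. indicator (ball a r) x * ennreal (mollifier e (x + t *\<^sub>R h - y)) \<partial>lborel) \<partial>?M)"
        by (rule p.Fubini'[symmetric]) measurable
      also have "\<dots> \<le> (\<integral>\<^sup>+y. indicator (ball a (r + norm h + e)) y \<partial>?M)"
      proof (rule nn_integral_mono)
        fix y
        show "(\<integral>\<^sup>+x. indicator (ball a r) x * ennreal (mollifier e (x + t *\<^sub>R h - y)) \<partial>lborel) \<le> indicator (ball a (r + norm h + e)) y"
        proof (cases "dist a y < r + norm h + e")
          case True
          have "(\<integral>\<^sup>+x. indicator (ball a r) x * ennreal (mollifier e (x + t *\<^sub>R h - y)) \<partial>lborel)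
             \<le> (\<integral>\<^sup>+x. ennreal (mollifier e ((t *\<^sub>R h - y) + x)) \<partial>lborel)"
            by (intro nn_integral_mono) (auto simp: indicator_def algebra_simps)
          also have "\<dots> = (\<integral>\<^sup>+x. ennreal (mollifier e (x::'a)) \<partial>lborel)"
            by (rule nn_integral_lborel_translate) measurable
          finally show ?thesis using True by (simp add: nn_integral_mollifier[OF e])
        next
          case False
          have "indicator (ball a r) x * ennreal (mollifier e (x + t *\<^sub>R h - y)) = 0" for x
          proof (cases "dist a x < r")
            case True
            have "dist a y \<le> dist a x + (norm (t *\<^sub>R h) + norm (x + t *\<^sub>R h - y))"
            proof -
              have "dist x y = norm ((x + t *\<^sub>R h - y) - t *\<^sub>R h)" by (simp add: dist_norm)
              also have "\<dots> \<le> norm (x + t *\<^sub>R h - y) + norm (t *\<^sub>R h)" by (rule norm_triangle_ineq4)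
              finally show ?thesis using dist_triangle[of a y x] by linarith
            qed
            moreover have "norm (t *\<^sub>R h) \<le> norm h" using t by (simp add: mult_left_le_one_le)
            ultimately have "e \<le> norm (x + t *\<^sub>R h - y)" using False True by linarith
            then show ?thesis using mollifier_eq_0[OF _ e, of "x + t *\<^sub>R h - y"] by simp
          qed simp
          then show ?thesis by (simp only: nn_integral_const) simp
        qed
      qed
      also have "\<dots> = emeasure ?M (ball a (r + norm h + e))" by simp
      finally show ?thesis using t by simp
    qed simp
  qed
  also have "\<dots> = emeasure ?M (ball a (r + norm h + e))" by (simp add: nn_integral_cmult)
  also have "?L * emeasure ?M (ball a (r + norm h + e)) \<le> ennreal (real DIM('a) * norm h) * emeasure ?M (ball a (r + norm h + e))"
    by (intro mult_right_mono ennreal_leI sum_abs_inner_Basis_le) simp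
  finally show ?thesis by (simp add: mult_left_mono)
qed

text \<open>Limit e to 0 in the mollified estimate. The strict inequality r + |h| < R leaves room
  for e, so that the measure of one fixed ball bounds all small e.\<close>

lemma translation_bound:
  fixes \<phi> \<phi>' :: "'a::euclidean_space \<Rightarrow> real"
  assumes \<phi>: "\<phi> \<in> BV_loc" and \<phi>': "locally_integrable_borel \<phi>'" "AE x in lebesgue. \<phi> x = \<phi>' x"
    and R: "r + norm h < R"
  shows "(\<integral>\<^sup>+x. indicator (ball a r) x * ennreal \<bar>\<phi>' (x + h) - \<phi>' x\<bar> \<partial>lborel) \<le>
    ennreal (real DIM('a) * norm h) * emeasure (gradient_measure \<phi>) (ball a R)" (is "?l \<le> ?r")
proof (rule ennreal_le_epsilon)
  fix \<epsilon> :: real assume "0 < \<epsilon>"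
  then have e2: "0 < \<epsilon> / 2" by simp
  have [measurable]: "\<phi>' \<in> borel_measurable borel" using \<phi>' by (simp add: locally_integrable_borel_def)
  obtain \<delta>1 where \<delta>1: "0 < \<delta>1" "\<And>e. 0 < e \<Longrightarrow> e < \<delta>1 \<Longrightarrow> (\<integral>\<^sup>+x. indicator (ball a r) x * ennreal \<bar>mollify e \<phi>' x - \<phi>' x\<bar> \<partial>lborel) \<le> ennreal (\<epsilon> / 2)"
    using mollify_approx[OF \<phi>'(1) e2, of a r] by blast
  obtain \<delta>2 where \<delta>2: "0 < \<delta>2" "\<And>e. 0 < e \<Longrightarrow> e < \<delta>2 \<Longrightarrow> (\<integral>\<^sup>+x. indicator (ball (a + h) r) x * ennreal \<bar>mollify e \<phi>' x - \<phi>' x\<bar> \<partial>lborel) \<le> ennreal (\<epsilon> / 2)"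
    using mollify_approx[OF \<phi>'(1) e2, of "a + h" r] by blast
  \<comment> \<open>The mollification error is needed on two balls, around a for the values at x and
    around a + h for those at x + h; this gives the two thresholds.\<close>
  define e where "e = min (min (\<delta>1 / 2) (\<delta>2 / 2)) (R - (r + norm h))"
  have e: "0 < e" "e < \<delta>1" "e < \<delta>2" "r + norm h + e \<le> R" using \<delta>1(1) \<delta>2(1) R by (auto simp: e_def)
  have [measurable]: "mollify e \<phi>' \<in> borel_measurable borel"
    unfolding mollify_def[abs_def] by measurable
  have "?l \<le> (\<integral>\<^sup>+x. indicator (ball a r) x * ennreal \<bar>mollify e \<phi>' (x + h) - mollify e \<phi>' x\<bar> +
     (indicator (ball a r) x * ennreal \<bar>mollify e \<phi>' x - \<phi>' x\<bar> + indicator (ball (a + h) r) (h + x) * ennreal \<bar>mollify e \<phi>' (h + x) - \<phi>' (h + x)\<bar>) \<partial>lborel)"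
  proof (rule nn_integral_mono)
    fix x
    have "\<bar>\<phi>' (x + h) - \<phi>' x\<bar> \<le> \<bar>mollify e \<phi>' (x + h) - mollify e \<phi>' x\<bar> + (\<bar>mollify e \<phi>' x - \<phi>' x\<bar> + \<bar>mollify e \<phi>' (h + x) - \<phi>' (h + x)\<bar>)"
      by (simp add: add.commute)
    moreover have "x \<in> ball a r \<Longrightarrow> h + x \<in> ball (a + h) r" by (simp add: dist_norm)
    ultimately show "indicator (ball a r) x * ennreal \<bar>\<phi>' (x + h) - \<phi>' x\<bar> \<le> indicator (ball a r) x * ennreal \<bar>mollify e \<phi>' (x + h) - mollify e \<phi>' x\<bar> +
     (indicator (ball a r) x * ennreal \<bar>mollify e \<phi>' x - \<phi>' x\<bar> + indicator (ball (a + h) r) (h + x) * ennreal \<bar>mollify e \<phi>' (h + x) - \<phi>' (h + x)\<bar>)"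
      by (cases "x \<in> ball a r") (auto simp flip: ennreal_plus)
  qed
  also have "\<dots> = (\<integral>\<^sup>+x. indicator (ball a r) x * ennreal \<bar>mollify e \<phi>' (x + h) - mollify e \<phi>' x\<bar> \<partial>lborel) +
     ((\<integral>\<^sup>+x. indicator (ball a r) x * ennreal \<bar>mollify e \<phi>' x - \<phi>' x\<bar> \<partial>lborel) + 
      (\<integral>\<^sup>+x. indicator (ball (a + h) r) (h + x) * ennreal \<bar>mollify e \<phi>' (h + x) - \<phi>' (h + x)\<bar> \<partial>lborel))"
    by (simp add: nn_integral_add)
  also have "(\<integral>\<^sup>+x. indicator (ball (a + h) r) (h + x) * ennreal \<bar>mollify e \<phi>' (h + x) - \<phi>' (h + x)\<bar> \<partial>lborel)
     = (\<integral>\<^sup>+x. indicator (ball (a + h) r) x * ennreal \<bar>mollify e \<phi>' x - \<phi>' x\<bar> \<partial>lborel)"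
    by (rule nn_integral_lborel_translate) measurable
  also have "(\<integral>\<^sup>+x. indicator (ball a r) x * ennreal \<bar>mollify e \<phi>' (x + h) - mollify e \<phi>' x\<bar> \<partial>lborel) +
     ((\<integral>\<^sup>+x. indicator (ball a r) x * ennreal \<bar>mollify e \<phi>' x - \<phi>' x\<bar> \<partial>lborel) + 
      (\<integral>\<^sup>+x. indicator (ball (a + h) r) x * ennreal \<bar>mollify e \<phi>' x - \<phi>' x\<bar> \<partial>lborel))
    \<le> ?r + (ennreal (\<epsilon> / 2) + ennreal (\<epsilon> / 2))"
  proof (intro add_mono \<delta>1(2) \<delta>2(2) e)
    have "(\<integral>\<^sup>+x. indicator (ball a r) x * ennreal \<bar>mollify e \<phi>' (x + h) - mollify e \<phi>' x\<bar> \<partial>lborel)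
       \<le> ennreal (real DIM('a) * norm h) * emeasure (gradient_measure \<phi>) (ball a (r + norm h + e))"
      by (rule mollify_translation_bound[OF \<phi> \<phi>' e(1)])
    also have "\<dots> \<le> ?r"
      using e(4) by (intro mult_left_mono emeasure_mono) auto
    finally show "(\<integral>\<^sup>+x. indicator (ball a r) x * ennreal \<bar>mollify e \<phi>' (x + h) - mollify e \<phi>' x\<bar> \<partial>lborel) \<le> ?r" .
  qed
  also have "ennreal (\<epsilon> / 2) + ennreal (\<epsilon> / 2) = ennreal \<epsilon>"
    using \<open>0 < \<epsilon>\<close> by (simp flip: ennreal_plus)
  finally show "?l \<le> ?r + ennreal \<epsilon>" .
qed

text \<open>A Poincare inequality on balls, obtained by averaging the translation estimate.\<close>

lemma ball_oscillation_bound: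
  fixes \<phi> \<phi>' :: "'a::euclidean_space \<Rightarrow> real"
  assumes \<phi>: "\<phi> \<in> BV_loc" and \<phi>': "locally_integrable_borel \<phi>'" "AE x in lebesgue. \<phi> x = \<phi>' x"
    and r: "0 < r"
  shows "(\<integral>\<^sup>+x. \<integral>\<^sup>+y. indicator (ball a r) x * indicator (ball a r) y * ennreal \<bar>\<phi>' y - \<phi>' x\<bar> \<partial>lborel \<partial>lborel)
    \<le> emeasure lborel (ball (0::'a) (2 * r)) * ennreal (real DIM('a) * (2 * r)) * emeasure (gradient_measure \<phi>) (ball a (4 * r))"
proof -
  have [measurable]: "\<phi>' \<in> borel_measurable borel" using \<phi>' by (simp add: locally_integrable_borel_def)
  \<comment> \<open>Two points of a ball of radius r differ by a vector shorter than 2 r.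
    Translation by it stays within 3 r < 4 r of the centre, as the strict inequality of
    \<open>translation_bound\<close> demands.\<close>
  let ?c = "ennreal (real DIM('a) * (2 * r)) * emeasure (gradient_measure \<phi>) (ball a (4 * r))"
  have "(\<integral>\<^sup>+x. \<integral>\<^sup>+y. indicator (ball a r) x * indicator (ball a r) y * ennreal \<bar>\<phi>' y - \<phi>' x\<bar> \<partial>lborel \<partial>lborel)
    = (\<integral>\<^sup>+x. \<integral>\<^sup>+h. indicator (ball a r) x * indicator (ball a r) (x + h) * ennreal \<bar>\<phi>' (x + h) - \<phi>' x\<bar> \<partial>lborel \<partial>lborel)"
    by (rule nn_integral_cong, rule nn_integral_lborel_translate[symmetric]) measurable
  also have "\<dots> \<le> (\<integral>\<^sup>+x. \<integral>\<^sup>+h. indicator (ball 0 (2 * r)) h * (indicator (ball a r) x * ennreal \<bar>\<phi>' (x + h) - \<phi>' x\<bar>) \<partial>lborel \<partial>lborel)"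
  proof (intro nn_integral_mono)
    fix x h
    have "norm h < 2 * r" if "dist a x < r" "dist a (x + h) < r"
    proof -
      have "norm h = dist (x + h) x" by (simp add: dist_norm)
      also have "\<dots> \<le> dist a (x + h) + dist a x" by (rule dist_triangle3)
      finally show ?thesis using that by simp
    qed
    then show "indicator (ball a r) x * indicator (ball a r) (x + h) * ennreal \<bar>\<phi>' (x + h) - \<phi>' x\<bar>
      \<le> indicator (ball 0 (2 * r)) h * (indicator (ball a r) x * ennreal \<bar>\<phi>' (x + h) - \<phi>' x\<bar>)"
      by (auto simp: indicator_def)
  qed
  also have "\<dots> = (\<integral>\<^sup>+h. \<integral>\<^sup>+x. indicator (ball 0 (2 * r)) h * (indicator (ball a r) x * ennreal \<bar>\<phi>' (x + h) - \<phi>' x\<bar>) \<partial>lborel \<partial>lborel)"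
    by (rule lborel_pair.Fubini') measurable
  also have "\<dots> = (\<integral>\<^sup>+h. indicator (ball 0 (2 * r)) h * (\<integral>\<^sup>+x. indicator (ball a r) x * ennreal \<bar>\<phi>' (x + h) - \<phi>' x\<bar> \<partial>lborel) \<partial>lborel)"
    by (intro nn_integral_cong nn_integral_cmult) measurable
  also have "\<dots> \<le> (\<integral>\<^sup>+h. indicator (ball 0 (2 * r)) h * ?c \<partial>(lborel::'a measure))"
  proof (rule nn_integral_mono)
    fix h :: 'a
    show "indicator (ball 0 (2 * r)) h * (\<integral>\<^sup>+x. indicator (ball a r) x * ennreal \<bar>\<phi>' (x + h) - \<phi>' x\<bar> \<partial>lborel) \<le> indicator (ball 0 (2 * r)) h * ?c"
    proof (cases "norm h < 2 * r")
      case True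
      have "(\<integral>\<^sup>+x. indicator (ball a r) x * ennreal \<bar>\<phi>' (x + h) - \<phi>' x\<bar> \<partial>lborel)
         \<le> ennreal (real DIM('a) * norm h) * emeasure (gradient_measure \<phi>) (ball a (4 * r))"
        using True r by (intro translation_bound[OF \<phi> \<phi>']) simp
      also have "\<dots> \<le> ?c" using True by (intro mult_right_mono ennreal_leI) auto
      finally show ?thesis by (intro mult_left_mono) simp_all
    qed simp
  qed
  also have "\<dots> = emeasure lborel (ball (0::'a) (2 * r)) * ?c" by (simp add: nn_integral_multc)
  finally show ?thesis by (simp add: mult.assoc)
qed

section \<open>Riesz potentials and approximate limits\<close>

text \<open>Supplies the limit of the local means over dyadic radii together with its rate of
  convergence.\<close>

lemma geometric_Cauchy_limit:
  fixes m :: "nat \<Rightarrow> real"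
  assumes q: "0 < q" "q < 1" and step: "\<And>k. \<bar>m k - m (Suc k)\<bar> \<le> B * q ^ k"
  shows "\<exists>l. \<forall>k. \<bar>m k - l\<bar> \<le> B * q ^ k / (1 - q)"
proof -
  have B: "0 \<le> B" using step[of 0] by simp
  \<comment> \<open>Keeping the exact partial sum q^k - q^(k+j) of the geometric series lets the
    induction on j close.\<close>
  have tele: "\<bar>m k - m (k + j)\<bar> \<le> B * (q ^ k - q ^ (k + j)) / (1 - q)" for k j
  proof (induction j)
    case (Suc j)
    have "\<bar>m k - m (k + Suc j)\<bar> \<le> \<bar>m k - m (k + j)\<bar> + \<bar>m (k + j) - m (Suc (k + j))\<bar>" by simp
    also have "\<dots> \<le> B * (q ^ k - q ^ (k + j)) / (1 - q) + B * q ^ (k + j)" by (intro add_mono Suc step)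
    also have "B * q ^ (k + j) = B * (q ^ (k + j) - q ^ (k + Suc j)) / (1 - q)"
    proof -
      have eq: "B * (q ^ (k + j) - q ^ (k + Suc j)) = B * q ^ (k + j) * (1 - q)" by (simp add: algebra_simps)
      have "1 - q \<noteq> 0" using q by simp
      then show ?thesis unfolding eq by (rule nonzero_mult_div_cancel_right[symmetric])
    qed
    also have "B * (q ^ k - q ^ (k + j)) / (1 - q) + B * (q ^ (k + j) - q ^ (k + Suc j)) / (1 - q) = B * (q ^ k - q ^ (k + Suc j)) / (1 - q)"
      by (simp only: add_divide_distrib[symmetric] distrib_left[symmetric]) simp
    finally show ?case .
  qed simp
  have tele': "\<bar>m k - m l\<bar> \<le> B * q ^ k / (1 - q)" if "k \<le> l" for k l
  proof -
    obtain j where "l = k + j" using le_Suc_ex[OF \<open>k \<le> l\<close>] by blast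
    then have "\<bar>m k - m l\<bar> \<le> B * (q ^ k - q ^ (k + j)) / (1 - q)" using tele[of k j] by (simp only:)
    also have "\<dots> \<le> B * q ^ k / (1 - q)" using q B by (intro divide_right_mono mult_left_mono) auto
    finally show ?thesis .
  qed
  have "(\<lambda>k. B * q ^ k / (1 - q)) \<longlonglongrightarrow> B * 0 / (1 - q)"
    using q by (intro tendsto_intros LIMSEQ_power_zero) auto
  then have lim0: "(\<lambda>k. B * q ^ k / (1 - q)) \<longlonglongrightarrow> 0" by simp
  have "Cauchy m"
  proof (rule metric_CauchyI)
    fix e :: real assume "0 < e"
    then obtain N where N: "\<And>k. k \<ge> N \<Longrightarrow> B * q ^ k / (1 - q) < e / 2"
      using order_tendstoD(2)[OF lim0, of "e / 2"] unfolding eventually_sequentially by auto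
    have "dist (m a) (m b) < e" if "a \<ge> N" "b \<ge> N" for a b
    proof -
      have "dist (m a) (m b) \<le> \<bar>m N - m a\<bar> + \<bar>m N - m b\<bar>" by (simp add: dist_real_def)
      also have "\<dots> < e" using tele'[OF that(1)] tele'[OF that(2)] N[OF order_refl] by linarith
      finally show ?thesis .
    qed
    then show "\<exists>N. \<forall>a\<ge>N. \<forall>b\<ge>N. dist (m a) (m b) < e" by blast
  qed
  then obtain l where l: "m \<longlonglongrightarrow> l" using Cauchy_convergent convergent_def by blast
  have "\<bar>m k - l\<bar> \<le> B * q ^ k / (1 - q)" for k
  proof (rule LIMSEQ_le_const2)
    show "(\<lambda>j. \<bar>m k - m j\<bar>) \<longlonglongrightarrow> \<bar>m k - l\<bar>" by (intro tendsto_intros l)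
  qed (use tele' in blast)
  then show ?thesis by blast
qed

section \<open>Deviation from constants on balls\<close>

text \<open>Left undivided by the volume so that it is monotone under inclusion of balls, with
  different centres allowed. The volume returns in \<open>ball_deviation_separation\<close>.\<close>

definition ball_deviation :: "('a::euclidean_space \<Rightarrow> real) \<Rightarrow> 'a \<Rightarrow> real \<Rightarrow> real \<Rightarrow> real" where
  "ball_deviation \<phi> a r c = (LBINT y:ball a r. \<bar>\<phi> y - c\<bar>)"

abbreviation ball_vol :: "'a::euclidean_space itself \<Rightarrow> real" where
  "ball_vol _ \<equiv> unit_ball_vol (real DIM('a))"

context
  fixes \<phi>' :: "'a::euclidean_space \<Rightarrow> real"
  assumes loc: "locally_integrable_borel \<phi>'"
begin

lemma borel_measurable_loc [measurable]: "\<phi>' \<in> borel_measurable borel"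
  using loc by (simp add: locally_integrable_borel_def)

lemma set_integrable_loc: "set_integrable lborel (ball a r) \<phi>'"
  using loc by (simp add: locally_integrable_borel_def set_integrable_def)

lemma set_integrable_const_ball: "set_integrable lborel (ball (a::'a) r) (\<lambda>_. c::real)"
  unfolding set_integrable_def
  by (simp, intro disjI2 integrable_real_indicator) (use emeasure_lborel_ball_finite in auto)

lemma set_integrable_deviation: "set_integrable lborel (ball a r) (\<lambda>y. \<bar>\<phi>' y - c\<bar>)"
  by (intro set_integrable_abs set_integral_diff set_integrable_loc set_integrable_const_ball)

lemma nn_integral_deviation:
  "(\<integral>\<^sup>+y. indicator (ball a r) y * ennreal \<bar>\<phi>' y - c\<bar> \<partial>lborel) = ennreal (ball_deviation \<phi>' a r c)"
proof -
  have "(\<integral>\<^sup>+y. indicator (ball a r) y * ennreal \<bar>\<phi>' y - c\<bar> \<partial>lborel) = (\<integral>\<^sup>+y. ennreal (indicator (ball a r) y *\<^sub>R \<bar>\<phi>' y - c\<bar>) \<partial>lborel)"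
    by (intro nn_integral_cong) (auto simp: indicator_def)
  also have "\<dots> = ennreal (ball_deviation \<phi>' a r c)"
    unfolding ball_deviation_def set_lebesgue_integral_def
    using set_integrable_deviation unfolding set_integrable_def by (intro nn_integral_eq_integral) auto
  finally show ?thesis .
qed

lemma ball_deviation_nonneg: "0 \<le> ball_deviation \<phi>' a r c"
  unfolding ball_deviation_def set_lebesgue_integral_def by (intro Bochner_Integration.integral_nonneg) auto

lemma ball_deviation_mono:
  assumes "ball a r \<subseteq> ball b R" shows "ball_deviation \<phi>' a r c \<le> ball_deviation \<phi>' b R c"
  unfolding ball_deviation_def set_lebesgue_integral_def
  using set_integrable_deviation assms unfolding set_integrable_def
  by (intro integral_mono) (auto simp: indicator_def)

lemma set_integral_const_ball: "0 \<le> r \<Longrightarrow> (LBINT y:ball (a::'a) r. c) = c * (ball_vol TYPE('a) * r ^ DIM('a))"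
  by (simp add: set_lebesgue_integral_def content_ball mult.commute)

lemma ball_deviation_triangle:
  assumes "0 \<le> r"
  shows "ball_deviation \<phi>' a r c \<le> ball_deviation \<phi>' a r c' + \<bar>c - c'\<bar> * (ball_vol TYPE('a) * r ^ DIM('a))"
proof -
  have "ball_deviation \<phi>' a r c \<le> (LBINT y:ball a r. \<bar>\<phi>' y - c'\<bar> + \<bar>c - c'\<bar>)"
    unfolding ball_deviation_def
    by (intro set_integral_mono set_integrable_deviation set_integral_add set_integrable_const_ball) auto
  also have "\<dots> = ball_deviation \<phi>' a r c' + (LBINT y:ball a r. \<bar>c - c'\<bar>)"
    unfolding ball_deviation_def by (intro set_integral_add set_integrable_deviation set_integrable_const_ball)
  finally show ?thesis using assms by (simp add: set_integral_const_ball)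
qed

text \<open>Two constants close to the same function on the same ball are close to each other. This
  compares consecutive dyadic means, and later the values of \<phi> at two neighbouring
  points.\<close>

lemma ball_deviation_separation:
  assumes "0 \<le> r"
  shows "\<bar>c - c'\<bar> * (ball_vol TYPE('a) * r ^ DIM('a)) \<le> ball_deviation \<phi>' a r c + ball_deviation \<phi>' a r c'"
proof -
  have "\<bar>c - c'\<bar> * (ball_vol TYPE('a) * r ^ DIM('a)) = (LBINT y:ball a r. \<bar>c - c'\<bar>)"
    using assms by (simp add: set_integral_const_ball)
  also have "\<dots> \<le> (LBINT y:ball a r. \<bar>\<phi>' y - c\<bar> + \<bar>\<phi>' y - c'\<bar>)"
    by (intro set_integral_mono set_integrable_deviation set_integral_add set_integrable_const_ball) auto
  also have "\<dots> = ball_deviation \<phi>' a r c + ball_deviation \<phi>' a r c'"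
    unfolding ball_deviation_def by (intro set_integral_add set_integrable_deviation)
  finally show ?thesis .
qed

text \<open>The witness m is the mean over the ball: |\<phi>'(x) - m| is at most the average of
  |\<phi>'(x) - \<phi>'(y)| over y. The volume is multiplied out to stay in \<open>ennreal\<close>
  without division.\<close>

lemma ball_deviation_average:
  assumes r: "0 < r"
  shows "\<exists>m. ennreal (ball_deviation \<phi>' a r m) * ennreal (ball_vol TYPE('a) * r ^ DIM('a)) \<le>
    (\<integral>\<^sup>+x. \<integral>\<^sup>+y. indicator (ball a r) x * indicator (ball a r) y * ennreal \<bar>\<phi>' y - \<phi>' x\<bar> \<partial>lborel \<partial>lborel)"
proof -
  define v where "v = ball_vol TYPE('a) * r ^ DIM('a)"
  have V: "0 < ball_vol TYPE('a)" by simp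
  have v: "0 < v" using r V by (simp add: v_def)
  define m where "m = (LBINT y:ball a r. \<phi>' y) / v"
  have pw: "ennreal \<bar>\<phi>' x - m\<bar> * ennreal v \<le> (\<integral>\<^sup>+y. indicator (ball a r) y * ennreal \<bar>\<phi>' y - \<phi>' x\<bar> \<partial>lborel)" for x
  proof -
    have "(\<phi>' x - m) * v = (LBINT y:ball a r. \<phi>' x) - (LBINT y:ball a r. \<phi>' y)"
      using v r by (simp add: m_def set_integral_const_ball v_def[symmetric] left_diff_distrib)
    also have "\<dots> = (LBINT y:ball a r. \<phi>' x - \<phi>' y)"
      by (intro set_integral_diff(2)[symmetric] set_integrable_loc set_integrable_const_ball)
    finally have eq: "(\<phi>' x - m) * v = (LBINT y:ball a r. \<phi>' x - \<phi>' y)" .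
    have "ennreal \<bar>\<phi>' x - m\<bar> * ennreal v = ennreal (norm ((\<phi>' x - m) * v))"
      using v by (simp add: abs_mult ennreal_mult)
    also have "\<dots> \<le> (\<integral>\<^sup>+y. ennreal (norm (indicator (ball a r) y *\<^sub>R (\<phi>' x - \<phi>' y))) \<partial>lborel)"
      unfolding eq set_lebesgue_integral_def
      using set_integral_diff(1)[OF set_integrable_const_ball[of a r "\<phi>' x"] set_integrable_loc[of a r]]
      unfolding set_integrable_def by (intro integral_norm_bound_ennreal)
    also have "\<dots> = (\<integral>\<^sup>+y. indicator (ball a r) y * ennreal \<bar>\<phi>' y - \<phi>' x\<bar> \<partial>lborel)"
      by (intro nn_integral_cong) (auto simp: indicator_def)
    finally show ?thesis .
  qed
  have "ennreal (ball_deviation \<phi>' a r m) * ennreal v = (\<integral>\<^sup>+x. indicator (ball a r) x * (ennreal \<bar>\<phi>' x - m\<bar> * ennreal v) \<partial>lborel)"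
    unfolding nn_integral_deviation[symmetric] by (subst nn_integral_multc[symmetric]) (auto simp: mult.assoc)
  also have "\<dots> \<le> (\<integral>\<^sup>+x. indicator (ball a r) x * (\<integral>\<^sup>+y. indicator (ball a r) y * ennreal \<bar>\<phi>' y - \<phi>' x\<bar> \<partial>lborel) \<partial>lborel)"
    by (intro nn_integral_mono mult_left_mono pw) simp
  also have "\<dots> = (\<integral>\<^sup>+x. \<integral>\<^sup>+y. indicator (ball a r) x * indicator (ball a r) y * ennreal \<bar>\<phi>' y - \<phi>' x\<bar> \<partial>lborel \<partial>lborel)"
    by (rule nn_integral_cong) (subst nn_integral_cmult[symmetric], auto simp: mult.assoc)
  finally show ?thesis unfolding v_def by blast
qed

end

text \<open>Outside the context, \<open>borel_measurable_loc\<close> would apply to every measurability goal.\<close>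

declare borel_measurable_loc [measurable del]

section \<open>Point values at points of finite Riesz potential\<close>

definition riesz_potential :: "('a::euclidean_space \<Rightarrow> real) \<Rightarrow> 'a set \<Rightarrow> real \<Rightarrow> 'a \<Rightarrow> ennreal" where
  "riesz_potential \<phi> U s x = (\<integral>\<^sup>+z\<in>U. riesz_kernel s x z \<partial>gradient_measure \<phi>)"

text \<open>Chebyshev's inequality: on the ball the kernel is at least \<rho> to the power -(n - 1 +
  s).\<close>

lemma ball_measure_le_riesz_potential:
  fixes \<phi> :: "'a::euclidean_space \<Rightarrow> real"
  assumes "ball x \<rho> \<subseteq> U" "0 < \<rho>" "0 < s" "open U"
  shows "emeasure (gradient_measure \<phi>) (ball x \<rho>) \<le> ennreal (\<rho> powr (real DIM('a) - 1 + s)) * riesz_potential \<phi> U s x"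
proof -
  let ?\<kappa> = "real DIM('a) - 1 + s"
  have \<kappa>: "0 < ?\<kappa>" proof -
    have "1 \<le> real DIM('a)" by (simp add: Suc_leI)
    then show ?thesis using assms(3) by linarith
  qed
  have [measurable]: "U \<in> sets borel" using assms by simp
  have meas [measurable]: "riesz_kernel s x \<in> borel_measurable borel"
    unfolding riesz_kernel_def[abs_def] by measurable
  have "emeasure (gradient_measure \<phi>) (ball x \<rho>) = (\<integral>\<^sup>+z. indicator (ball x \<rho>) z \<partial>gradient_measure \<phi>)"
    by simp
  also have "\<dots> \<le> (\<integral>\<^sup>+z. ennreal (\<rho> powr ?\<kappa>) * (riesz_kernel s x z * indicator U z) \<partial>gradient_measure \<phi>)"
  proof (rule nn_integral_mono)
    fix z
    show "indicator (ball x \<rho>) z \<le> ennreal (\<rho> powr ?\<kappa>) * (riesz_kernel s x z * indicator U z)"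
    proof (cases "z \<in> ball x \<rho>")
      case True
      then have zU: "z \<in> U" using assms(1) by blast
      show ?thesis
      \<comment> \<open>The centre is where the value \<infinity> of the kernel matters: an atom of
        the gradient measure at x must be charged too.\<close>
      proof (cases "z = x")
        case True
        then have "riesz_kernel s x z = \<infinity>" by (simp add: riesz_kernel_def)
        then show ?thesis using zU assms(2) by (simp add: ennreal_mult_top)
      next
        case False
        then have n: "0 < norm (x - z)" by simp
        have "norm (x - z) powr ?\<kappa> \<le> \<rho> powr ?\<kappa>"
          using True \<kappa> by (intro powr_mono2) (auto simp: dist_norm)
        then have "1 \<le> \<rho> powr ?\<kappa> * inverse (norm (x - z) powr ?\<kappa>)"
          using n by (simp add: field_simps)
        then have "ennreal 1 \<le> ennreal (\<rho> powr ?\<kappa> * inverse (norm (x - z) powr ?\<kappa>))" by (rule ennreal_leI)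
        also have "\<dots> = ennreal (\<rho> powr ?\<kappa>) * riesz_kernel s x z"
          using n by (simp add: riesz_kernel_def ennreal_mult inverse_ennreal)
        finally show ?thesis using zU True by simp
      qed
    qed simp
  qed
  also have "\<dots> = ennreal (\<rho> powr ?\<kappa>) * riesz_potential \<phi> U s x"
    unfolding riesz_potential_def by (rule nn_integral_cmult) measurable
  finally show ?thesis .
qed

text \<open>The Poincare factor r and the bound r powr (n - 1 + s) for the measure of the ball
  combine to r^n times r powr s. After division by the volume the mean oscillation decays like r
  powr s, which is what the exponent of the kernel is chosen for.\<close>

lemma ball_deviation_riesz:
  fixes \<phi> \<phi>' :: "'a::euclidean_space \<Rightarrow> real"
  assumes \<phi>: "\<phi> \<in> BV_loc" and \<phi>': "locally_integrable_borel \<phi>'" "AE x in lebesgue. \<phi> x = \<phi>' x"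
    and U: "open U" and s: "0 < s" and r: "0 < r" "ball x (4 * r) \<subseteq> U"
    and fin: "riesz_potential \<phi> U s x < \<infinity>"
  shows "\<exists>m. ball_deviation \<phi>' x r m \<le>
     2 ^ DIM('a) * (2 * real DIM('a)) * 4 powr (real DIM('a) - 1 + s) * r ^ DIM('a) * r powr s * enn2real (riesz_potential \<phi> U s x)"
proof -
  let ?n = "DIM('a)" and ?V = "ball_vol TYPE('a)" and ?F = "enn2real (riesz_potential \<phi> U s x)"
  have V: "0 < ?V" by simp
  have F: "riesz_potential \<phi> U s x = ennreal ?F" using fin by (simp add: less_top)
  obtain m where m: "ennreal (ball_deviation \<phi>' x r m) * ennreal (?V * r ^ ?n) \<le>
    (\<integral>\<^sup>+z. \<integral>\<^sup>+y. indicator (ball x r) z * indicator (ball x r) y * ennreal \<bar>\<phi>' y - \<phi>' z\<bar> \<partial>lborel \<partial>lborel)"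
    using ball_deviation_average[OF \<phi>'(1) r(1)] by blast
  also have "\<dots> \<le> emeasure lborel (ball (0::'a) (2 * r)) * ennreal (real ?n * (2 * r)) * emeasure (gradient_measure \<phi>) (ball x (4 * r))"
    by (rule ball_oscillation_bound[OF \<phi> \<phi>' r(1)])
  also have "\<dots> \<le> ennreal (?V * (2 * r) ^ ?n) * ennreal (real ?n * (2 * r)) * (ennreal ((4 * r) powr (real ?n - 1 + s)) * ennreal ?F)"
    using ball_measure_le_riesz_potential[OF r(2) _ s U, of \<phi>] r(1)
    by (intro mult_mono) (auto simp: emeasure_ball F[symmetric])
  also have "\<dots> = ennreal (?V * (2 * r) ^ ?n * (real ?n * (2 * r)) * ((4 * r) powr (real ?n - 1 + s) * ?F))"
    using r(1) V by (simp add: ennreal_mult)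
  finally have "ennreal (ball_deviation \<phi>' x r m * (?V * r ^ ?n)) \<le> ennreal (?V * (2 * r) ^ ?n * (real ?n * (2 * r)) * ((4 * r) powr (real ?n - 1 + s) * ?F))"
    using r(1) V ball_deviation_nonneg[OF \<phi>'(1)] by (simp add: ennreal_mult)
  then have le: "ball_deviation \<phi>' x r m * (?V * r ^ ?n) \<le> ?V * (2 * r) ^ ?n * (real ?n * (2 * r)) * ((4 * r) powr (real ?n - 1 + s) * ?F)"
    using r(1) V by (subst (asm) ennreal_le_iff) auto
  have pw: "(4 * r) powr (real ?n - 1 + s) * r = 4 powr (real ?n - 1 + s) * (r ^ ?n * r powr s)"
  proof -
    have "r powr (real ?n - 1 + s) * r = r powr (real ?n - 1 + s) * r powr 1"
      by (subst powr_one) (use r in auto)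
    also have "\<dots> = r powr (real ?n + s)" by (simp only: powr_add[symmetric]) simp
    also have "\<dots> = r ^ ?n * r powr s" using r by (simp add: powr_add powr_realpow)
    finally show ?thesis using r by (simp add: powr_mult)
  qed
  have "?V * (2 * r) ^ ?n * (real ?n * (2 * r)) * ((4 * r) powr (real ?n - 1 + s) * ?F)
    = (?V * r ^ ?n) * (2 ^ ?n * (2 * real ?n) * ((4 * r) powr (real ?n - 1 + s) * r) * ?F)"
    by (simp add: power_mult_distrib ac_simps)
  also have "\<dots> = (?V * r ^ ?n) * (2 ^ ?n * (2 * real ?n) * 4 powr (real ?n - 1 + s) * r ^ ?n * r powr s * ?F)"
    unfolding pw by (simp add: ac_simps)
  finally have eq: "?V * (2 * r) ^ ?n * (real ?n * (2 * r)) * ((4 * r) powr (real ?n - 1 + s) * ?F)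
    = (?V * r ^ ?n) * (2 ^ ?n * (2 * real ?n) * 4 powr (real ?n - 1 + s) * r ^ ?n * r powr s * ?F)" .
  have "(?V * r ^ ?n) * ball_deviation \<phi>' x r m \<le> (?V * r ^ ?n) * (2 ^ ?n * (2 * real ?n) * 4 powr (real ?n - 1 + s) * r ^ ?n * r powr s * ?F)"
    using le by (simp only: eq mult.commute[of "ball_deviation \<phi>' x r m"])
  then have "ball_deviation \<phi>' x r m \<le> 2 ^ ?n * (2 * real ?n) * 4 powr (real ?n - 1 + s) * r ^ ?n * r powr s * ?F"
    by (rule mult_left_le_imp_le) (use V r(1) in simp)
  then show ?thesis by blast
qed

text \<open>Means over the balls of radius R / 2^k differ by a geometric sequence of ratio 2 powr
  -s, so they converge and the limit inherits the decay. The constant is uniform in x; the point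
  enters only through its potential.\<close>

lemma riesz_point_value:
  fixes \<phi> \<phi>' :: "'a::euclidean_space \<Rightarrow> real"
  assumes \<phi>: "\<phi> \<in> BV_loc" and \<phi>': "locally_integrable_borel \<phi>'" "AE x in lebesgue. \<phi> x = \<phi>' x"
    and U: "open U" and s: "0 < s" and R: "0 < R"
  shows "\<exists>C\<ge>0. \<forall>x. ball x (4 * R) \<subseteq> U \<longrightarrow> riesz_potential \<phi> U s x < \<infinity> \<longrightarrow>
    (\<exists>l. \<forall>r. 0 < r \<longrightarrow> r \<le> R \<longrightarrow> ball_deviation \<phi>' x r l \<le> C * r ^ DIM('a) * r powr s * enn2real (riesz_potential \<phi> U s x))"
proof -
  let ?n = "DIM('a)" and ?V = "ball_vol TYPE('a)"
  \<comment> \<open>C1 comes from \<open>ball_deviation_riesz\<close>. C2 bounds one step between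
    means: 2 for two deviations, 2^n for halving the ball. C3 adds the distance from the mean to the
    limit. C pays 2^n and 2 powr s for passing from r to a dyadic radius of at most 2 r.\<close>
  define C1 where "C1 = 2 ^ ?n * (2 * real ?n) * 4 powr (real ?n - 1 + s)"
  define q where "q = (1 / 2 :: real) powr s"
  define C2 where "C2 = 2 * C1 * 2 ^ ?n / ?V"
  define C3 where "C3 = C1 + ?V * (C2 / (1 - q))"
  define C where "C = C3 * 2 ^ ?n * 2 powr s"
  have V: "0 < ?V" by simp
  have q: "0 < q" "q < 1" using s powr_less_mono2[of s "1 / 2" 1] by (auto simp: q_def)
  have C1: "0 \<le> C1" by (simp add: C1_def)
  have C2: "0 \<le> C2" using C1 by (simp add: C2_def)
  have C3: "0 \<le> C3" using C1 C2 q by (simp add: C3_def)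
  have "\<exists>l. \<forall>r. 0 < r \<longrightarrow> r \<le> R \<longrightarrow> ball_deviation \<phi>' x r l \<le> C * r ^ ?n * r powr s * enn2real (riesz_potential \<phi> U s x)"
    if xU: "ball x (4 * R) \<subseteq> U" and fin: "riesz_potential \<phi> U s x < \<infinity>" for x
  proof -
    define F where "F = enn2real (riesz_potential \<phi> U s x)"
    have F: "0 \<le> F" by (simp add: F_def)
    define \<rho> where "\<rho> k = R / 2 ^ k" for k :: nat
    have \<rho>: "0 < \<rho> k" "\<rho> k \<le> R" "\<rho> (Suc k) = \<rho> k / 2" for k
      using R by (auto simp: \<rho>_def divide_le_eq intro: mult_right_mono[of 1 _ R, simplified])
    have \<rho>s: "\<rho> k powr s = R powr s * q ^ k" for k
    proof -
      have "\<rho> k = R * (1 / 2) ^ k" by (simp add: \<rho>_def power_one_over)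
      then show ?thesis using R by (simp add: powr_mult q_def powr_power powr_realpow[symmetric] powr_powr mult.commute)
    qed
    have "\<exists>m. ball_deviation \<phi>' x (\<rho> k) m \<le> C1 * \<rho> k ^ ?n * \<rho> k powr s * F" for k
      unfolding C1_def F_def
    proof (rule ball_deviation_riesz[OF \<phi> \<phi>' U s \<rho>(1) _ fin])
      show "ball x (4 * \<rho> k) \<subseteq> U" using xU \<rho>(2)[of k] by (intro order_trans[OF subset_ball xU]) simp
    qed
    then obtain m where m: "\<And>k. ball_deviation \<phi>' x (\<rho> k) (m k) \<le> C1 * \<rho> k ^ ?n * \<rho> k powr s * F" by metis
    have step: "\<bar>m k - m (Suc k)\<bar> \<le> (C2 * R powr s * F) * q ^ k" for k
    proof -
      have "\<bar>m k - m (Suc k)\<bar> * (?V * \<rho> (Suc k) ^ ?n) \<le> ball_deviation \<phi>' x (\<rho> (Suc k)) (m k) + ball_deviation \<phi>' x (\<rho> (Suc k)) (m (Suc k))"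
        using \<rho>(1)[of "Suc k"] by (intro ball_deviation_separation[OF \<phi>'(1)]) simp
      also have "ball_deviation \<phi>' x (\<rho> (Suc k)) (m k) \<le> ball_deviation \<phi>' x (\<rho> k) (m k)"
        using \<rho>[of k] by (intro ball_deviation_mono[OF \<phi>'(1)] subset_ball) simp
      also have "\<dots> \<le> C1 * \<rho> k ^ ?n * \<rho> k powr s * F" by (rule m)
      also have "ball_deviation \<phi>' x (\<rho> (Suc k)) (m (Suc k)) \<le> C1 * \<rho> (Suc k) ^ ?n * \<rho> (Suc k) powr s * F" by (rule m)
      also have "\<dots> \<le> C1 * \<rho> k ^ ?n * \<rho> k powr s * F"
        using \<rho>[of k] C1 F s by (intro mult_right_mono mult_mono power_mono powr_mono2) auto
      finally have "\<bar>m k - m (Suc k)\<bar> * (?V * \<rho> (Suc k) ^ ?n) \<le> 2 * (C1 * \<rho> k ^ ?n * \<rho> k powr s * F)" by (simp only: mult_2)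
      also have "\<rho> k ^ ?n = 2 ^ ?n * \<rho> (Suc k) ^ ?n" by (simp add: \<rho>(3) power_divide)
      finally have "\<bar>m k - m (Suc k)\<bar> * (?V * \<rho> (Suc k) ^ ?n) \<le> (C2 * \<rho> k powr s * F) * (?V * \<rho> (Suc k) ^ ?n)"
        using V by (simp add: C2_def ac_simps)
      then have "\<bar>m k - m (Suc k)\<bar> \<le> C2 * \<rho> k powr s * F"
        by (rule mult_right_le_imp_le) (use V \<rho>(1)[of "Suc k"] in simp)
      then show ?thesis by (simp add: \<rho>s ac_simps)
    qed
    obtain l where l: "\<And>k. \<bar>m k - l\<bar> \<le> (C2 * R powr s * F) * q ^ k / (1 - q)"
      using geometric_Cauchy_limit[OF q step] by blast
    have dk: "ball_deviation \<phi>' x (\<rho> k) l \<le> C3 * \<rho> k ^ ?n * \<rho> k powr s * F" for k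
    proof -
      have "ball_deviation \<phi>' x (\<rho> k) l \<le> ball_deviation \<phi>' x (\<rho> k) (m k) + \<bar>l - m k\<bar> * (?V * \<rho> k ^ ?n)"
        using \<rho>(1)[of k] by (intro ball_deviation_triangle[OF \<phi>'(1)]) simp
      also have "\<dots> \<le> C1 * \<rho> k ^ ?n * \<rho> k powr s * F + ((C2 * R powr s * F) * q ^ k / (1 - q)) * (?V * \<rho> k ^ ?n)"
        using l[of k] V \<rho>(1)[of k] by (intro add_mono m mult_right_mono) (auto simp: abs_minus_commute)
      also have "\<dots> = C3 * \<rho> k ^ ?n * \<rho> k powr s * F"
        by (simp add: C3_def \<rho>s algebra_simps)
      finally show ?thesis .
    qed
    have "ball_deviation \<phi>' x r l \<le> C * r ^ ?n * r powr s * F" if r: "0 < r" "r \<le> R" for r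
    proof -
      have "\<exists>k. \<rho> (Suc k) < r"
      proof -
        obtain k :: nat where "R / r < 2 ^ k" using real_arch_pow[of 2] by auto
        then have "\<rho> k < r" using r R by (simp add: \<rho>_def field_simps)
        then have "\<rho> (Suc k) < r" using \<rho>[of k] by linarith
        then show ?thesis by blast
      qed
      \<comment> \<open>The least such k places r between two consecutive dyadic radii:
        \<open>\<rho> (Suc k) < r \<le> \<rho> k\<close>.\<close>
      define k where "k = (LEAST k. \<rho> (Suc k) < r)"
      have k1: "\<rho> (Suc k) < r" unfolding k_def using \<open>\<exists>k. \<rho> (Suc k) < r\<close> by (rule LeastI_ex)
      have k2: "r \<le> \<rho> k"
      proof (cases k)
        case 0 then show ?thesis using r by (simp add: \<rho>_def)
      next
        case (Suc j)
        then have "\<not> \<rho> (Suc j) < r" unfolding k_def using not_less_Least by (metis lessI)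
        then show ?thesis using Suc by simp
      qed
      have k3: "\<rho> k \<le> 2 * r" using k1 \<rho>(3)[of k] by simp
      have "ball_deviation \<phi>' x r l \<le> ball_deviation \<phi>' x (\<rho> k) l"
        using k2 by (intro ball_deviation_mono[OF \<phi>'(1)] subset_ball)
      also have "\<dots> \<le> C3 * \<rho> k ^ ?n * \<rho> k powr s * F" by (rule dk)
      also have "\<dots> \<le> C3 * (2 * r) ^ ?n * (2 * r) powr s * F"
        using k3 C3 F s \<rho>(1)[of k] r by (intro mult_right_mono mult_mono power_mono powr_mono2) auto
      also have "\<dots> = C * r ^ ?n * r powr s * F"
        using r by (simp add: C_def power_mult_distrib powr_mult ac_simps)
      finally show ?thesis .
    qed
    then show ?thesis unfolding F_def by blast
  qed
  moreover have "0 \<le> C" using C3 by (simp add: C_def)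
  ultimately show ?thesis by blast
qed

text \<open>Division by the volume of the ball leaves r powr s, which tends to 0.\<close>

lemma has_approx_limit_of_deviation:
  fixes \<phi> \<phi>' :: "'a::euclidean_space \<Rightarrow> real"
  assumes \<phi>': "locally_integrable_borel \<phi>'" "AE x in lebesgue. \<phi> x = \<phi>' x"
    and s: "0 < s" and R: "0 < R"
    and dev: "\<And>r. 0 < r \<Longrightarrow> r \<le> R \<Longrightarrow> ball_deviation \<phi>' x r l \<le> K * r ^ DIM('a) * r powr s"
  shows "has_approx_limit \<phi> x l"
  unfolding has_approx_limit_def
proof (rule tendsto_sandwich[OF _ _ tendsto_const])
  let ?n = "DIM('a)" and ?V = "ball_vol TYPE('a)"
  have V: "0 < ?V" by simp
  have [measurable]: "\<phi>' \<in> borel_measurable borel" using \<phi>'(1) unfolding locally_integrable_borel_def by (rule conjunct1)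
  have eq: "(LINT y:ball x r|lebesgue. \<bar>\<phi> y - l\<bar>) = ball_deviation \<phi>' x r l" for r
  proof -
    have m: "(\<lambda>y. indicator (ball x r) y *\<^sub>R \<bar>\<phi>' y - l\<bar>) \<in> borel_measurable lebesgue"
      by (rule measurable_completion) measurable
    have ae: "AE y in lebesgue. indicator (ball x r) y *\<^sub>R \<bar>\<phi>' y - l\<bar> = indicator (ball x r) y *\<^sub>R \<bar>\<phi> y - l\<bar>"
      using \<phi>'(2) by eventually_elim simp
    have "(LINT y:ball x r|lebesgue. \<bar>\<phi> y - l\<bar>) = (LINT y|lebesgue. indicator (ball x r) y *\<^sub>R \<bar>\<phi>' y - l\<bar>)"
      unfolding set_lebesgue_integral_def
      by (rule integral_cong_AE[OF borel_measurable_AE[OF m ae] m]) (use ae in \<open>auto elim: eventually_mono\<close>)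
    also have "\<dots> = ball_deviation \<phi>' x r l"
      unfolding ball_deviation_def set_lebesgue_integral_def by (rule integral_completion) measurable
    finally show ?thesis .
  qed
  show "\<forall>\<^sub>F r in at_right 0. 0 \<le> (LINT y:ball x r|lebesgue. \<bar>\<phi> y - l\<bar>) / measure lebesgue (ball x r)"
    unfolding eq using ball_deviation_nonneg[OF \<phi>'(1)] by (intro always_eventually allI divide_nonneg_nonneg) auto
  have "(LINT y:ball x r|lebesgue. \<bar>\<phi> y - l\<bar>) / measure lebesgue (ball x r) \<le> K / ?V * r powr s"
    if r: "0 < r" "r \<le> R" for r
  proof -
    have "ball_deviation \<phi>' x r l / (?V * r ^ ?n) \<le> (K * r ^ ?n * r powr s) / (?V * r ^ ?n)"
      using V r by (intro divide_right_mono dev) auto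
    also have "\<dots> = K / ?V * r powr s" using r by simp
    finally show ?thesis using r by (simp add: eq content_ball)
  qed
  then show "\<forall>\<^sub>F r in at_right 0. (LINT y:ball x r|lebesgue. \<bar>\<phi> y - l\<bar>) / measure lebesgue (ball x r) \<le> K / ?V * r powr s"
    using R by (auto simp: eventually_at_right_field intro!: exI[of _ R])
  have "((\<lambda>r. r powr s) \<longlongrightarrow> 0 powr s) (at_right 0)"
    using s by (intro tendsto_powr' tendsto_ident_at tendsto_const)
      (auto simp: eventually_at_right_field intro!: exI[of _ 1])
  then show "((\<lambda>r. K / ?V * r powr s) \<longlongrightarrow> 0) (at_right 0)"
    using tendsto_mult_right_zero by fastforce
qed

section \<open>Hoelder paths and the pointwise estimate for the composition\<close>

text \<open>Turns an \<open>ennreal\<close> norm into a real constant fit for arithmetic. The last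
  clause ties this constant back to the norm, as the final estimate requires.\<close>

lemma holder_space_bound:
  assumes "f \<in> holder_space \<theta> T"
  obtains H where "0 \<le> H"
    "\<And>u t. 0 \<le> u \<Longrightarrow> u \<le> T \<Longrightarrow> 0 \<le> t \<Longrightarrow> t \<le> T \<Longrightarrow> norm (f t - f u) \<le> H * \<bar>t - u\<bar> powr \<theta>"
    "ennreal H \<le> holder_norm \<theta> T f"
proof -
  define S where "S = (SUP (u, t)\<in>{(u, t). 0 \<le> u \<and> u < t \<and> t \<le> T}. ennreal (norm (f t - f u) / \<bar>t - u\<bar> powr \<theta>))"
  have S: "S \<le> holder_norm \<theta> T f" by (simp add: holder_norm_def S_def)
  then have Sfin: "S < \<infinity>" using assms by (auto simp: holder_space_def intro: le_less_trans)
  then have SH: "S = ennreal (enn2real S)" by (simp add: less_top)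
  have lt: "norm (f t - f u) \<le> enn2real S * \<bar>t - u\<bar> powr \<theta>" if "0 \<le> u" "u < t" "t \<le> T" for u t
  proof -
    have "ennreal (norm (f t - f u) / \<bar>t - u\<bar> powr \<theta>) \<le> S"
      unfolding S_def using that by (intro SUP_upper2[of "(u, t)"]) auto
    then have "norm (f t - f u) / \<bar>t - u\<bar> powr \<theta> \<le> enn2real S"
      by (subst (asm) SH) (simp add: ennreal_le_iff del: ennreal_enn2real)
    then show ?thesis using that by (simp add: field_simps)
  qed
  show thesis
  proof (rule that[of "enn2real S"])
    fix u t assume "0 \<le> u" "u \<le> T" "0 \<le> t" "t \<le> T"
    then show "norm (f t - f u) \<le> enn2real S * \<bar>t - u\<bar> powr \<theta>"
      using lt[of u t] lt[of t u] by (cases u t rule: linorder_cases) (auto simp: norm_minus_commute abs_minus_commute)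
  qed (use S SH in auto)
qed

lemma holder_space_continuous:
  assumes f: "f \<in> holder_space \<theta> T" and \<theta>: "0 < \<theta>"
  shows "continuous_on {0..T} f"
proof -
  obtain H where H: "0 \<le> H"
    "\<And>u t. 0 \<le> u \<Longrightarrow> u \<le> T \<Longrightarrow> 0 \<le> t \<Longrightarrow> t \<le> T \<Longrightarrow> norm (f t - f u) \<le> H * \<bar>t - u\<bar> powr \<theta>"
    using holder_space_bound[OF f] by metis
  show ?thesis
    unfolding continuous_on_def
  proof
    fix u assume u: "u \<in> {0..T}"
    have "((\<lambda>t. \<bar>t - u\<bar> powr \<theta>) \<longlongrightarrow> \<bar>u - u\<bar> powr \<theta>) (at u within {0..T})"
      using \<theta> by (intro tendsto_powr' tendsto_intros) auto
    then have lim: "((\<lambda>t. H * \<bar>t - u\<bar> powr \<theta>) \<longlongrightarrow> 0) (at u within {0..T})"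
      using tendsto_mult_right_zero by fastforce
    have "((\<lambda>t. f t - f u) \<longlongrightarrow> 0) (at u within {0..T})"
      by (rule Lim_null_comparison[OF _ lim]) (use H(2) u in \<open>auto simp: eventually_at_filter\<close>)
    then show "(f \<longlongrightarrow> f u) (at u within {0..T})" by (rule LIM_zero_cancel)
  qed
qed

text \<open>Elements of \<open>composition\<close> are arbitrary functions that agree almost
  everywhere with a measurable one; completeness of Lebesgue measure makes them measurable.\<close>

lemma measurable_lebesgue_on_AE:
  assumes S: "S \<in> sets lebesgue" and g: "g \<in> borel_measurable (lebesgue_on S)"
    and ae: "AE x in lebesgue_on S. f x = g x"
  shows "f \<in> borel_measurable (lebesgue_on S)"
proof -
  let ?r = "\<lambda>h x. if x \<in> S then h x else undefined"
  have S': "S \<inter> space lebesgue \<in> sets lebesgue" using S by simp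
  have gm: "?r g \<in> borel_measurable lebesgue"
    using g S by (subst (asm) measurable_restrict_space_iff[OF S']) auto
  have ae': "AE x in lebesgue. ?r g x = ?r f x"
    using ae S by (subst (asm) AE_restrict_space_iff) (auto elim: eventually_mono)
  have "?r f \<in> borel_measurable lebesgue"
  proof (rule measurableI)
    fix A :: "'b set" assume A: "A \<in> sets borel"
    show "?r f -` A \<inter> space lebesgue \<in> sets lebesgue"
    proof (rule completion.in_sets_AE)
      show "?r g -` A \<inter> space lebesgue \<in> sets lebesgue" using measurable_sets[OF gm A] .
      show "AE x in lebesgue. x \<in> ?r g -` A \<inter> space lebesgue \<longleftrightarrow> x \<in> ?r f -` A \<inter> space lebesgue"
        using ae' by eventually_elim auto
    qed auto
  qed auto
  then show ?thesis by (subst measurable_restrict_space_iff[OF S']) auto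
qed

lemma composition_measurable:
  fixes \<phi> :: "'a::euclidean_space \<Rightarrow> real"
  assumes X: "continuous_on {0..T} X" and f: "f \<in> composition T \<phi> X"
  shows "f \<in> borel_measurable (lebesgue_on {0..T})"
proof -
  obtain \<phi>' where \<phi>': "lebesgue_representative \<phi> \<phi>'" "AE t in lebesgue_on {0..T}. f t = \<phi>' (X t)"
    using f by (auto simp: composition_def)
  have "X \<in> borel_measurable (lebesgue_on {0..T})"
    using X by (intro continuous_imp_measurable_on_sets_lebesgue) auto
  then have "(\<lambda>t. \<phi>' (X t)) \<in> borel_measurable (lebesgue_on {0..T})"
    using \<phi>'(1) unfolding lebesgue_representative_def by (auto intro: measurable_compose)
  then show ?thesis using \<phi>'(2) by (rule measurable_lebesgue_on_AE[rotated]) auto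
qed

text \<open>Where the potential is finite, f is the approximate limit of \<phi> at the position. Two
  such values are compared on a small ball between the positions if these are close. Otherwise both
  are estimated by their size, the distance being bounded below. The set S collects the times at
  which everything holds.\<close>

lemma composition_estimate:
  fixes \<phi> :: "'a::euclidean_space \<Rightarrow> real"
  assumes \<alpha>: "0 < \<alpha>" and s: "0 < s" and \<phi>: "\<phi> \<in> BV_loc" and X: "X \<in> holder_space \<alpha> T"
    and U: "open U" "bounded U" "X ` {0..T} \<subseteq> U"
    and fin: "AE t in lebesgue_on {0..T}. riesz_potential \<phi> U s (X t) < \<infinity>"
    and f: "f \<in> composition T \<phi> X"
  shows "\<exists>C\<ge>0. \<exists>S. (AE t in lebesgue_on {0..T}. t \<in> S) \<and>
    (\<forall>t\<in>S. riesz_potential \<phi> U s (X t) < \<infinity> \<and> \<bar>f t\<bar> \<le> C * (1 + enn2real (riesz_potential \<phi> U s (X t)))) \<and>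
    (\<forall>t\<in>S. \<forall>u\<in>S. \<bar>f t - f u\<bar> \<le> C * \<bar>t - u\<bar> powr (\<alpha> * s) *
      ((1 + enn2real (riesz_potential \<phi> U s (X t))) + (1 + enn2real (riesz_potential \<phi> U s (X u)))))"
proof -
  let ?n = "DIM('a)" and ?V = "ball_vol TYPE('a)"
  define F where "F x = enn2real (riesz_potential \<phi> U s x)" for x
  have F0: "0 \<le> F x" for x by (simp add: F_def)
  have V: "0 < ?V" by simp
  obtain \<phi>' where \<phi>': "locally_integrable_borel \<phi>'" "AE x in lebesgue. \<phi> x = \<phi>' x"
    using locally_integrable_borel_representative[of \<phi>] \<phi> unfolding BV_loc_def by blast
  obtain \<psi> where \<psi>: "lebesgue_representative \<phi> \<psi>" "AE t in lebesgue_on {0..T}. f t = \<psi> (X t)"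
    using f by (auto simp: composition_def)
  obtain H where H: "0 \<le> H"
    "\<And>u t. 0 \<le> u \<Longrightarrow> u \<le> T \<Longrightarrow> 0 \<le> t \<Longrightarrow> t \<le> T \<Longrightarrow> norm (X t - X u) \<le> H * \<bar>t - u\<bar> powr \<alpha>"
    using holder_space_bound[OF X] by metis
  have K: "compact (X ` {0..T})"
    using holder_space_continuous[OF X \<alpha>] by (intro compact_continuous_image) auto
  obtain \<delta> where \<delta>: "0 < \<delta>" "(\<Union>x\<in>X ` {0..T}. ball x \<delta>) \<subseteq> U"
    using compact_subset_open_imp_ball_epsilon_subset[OF K U(1,3)] by metis
  \<comment> \<open>Deviations up to radius R require the potential to see the ball of radius 4 R,
    which therefore has to lie in U.\<close>
  define R where "R = \<delta> / 4"
  have R: "0 < R" using \<delta>(1) by (simp add: R_def)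
  have RU: "ball (X t) (4 * R) \<subseteq> U" if "t \<in> {0..T}" for t
  proof -
    have "ball (X t) \<delta> \<subseteq> (\<Union>x\<in>X ` {0..T}. ball x \<delta>)" using that by blast
    then show ?thesis using \<delta>(2) by (simp add: R_def)
  qed
  obtain C where C: "0 \<le> C" "\<And>x. ball x (4 * R) \<subseteq> U \<Longrightarrow> riesz_potential \<phi> U s x < \<infinity> \<Longrightarrow>
    \<exists>l. \<forall>r. 0 < r \<longrightarrow> r \<le> R \<longrightarrow> ball_deviation \<phi>' x r l \<le> C * r ^ ?n * r powr s * F x"
    using riesz_point_value[OF \<phi> \<phi>' U(1) s R] unfolding F_def by blast
  define S where "S = {t\<in>{0..T}. riesz_potential \<phi> U s (X t) < \<infinity> \<and> f t = \<psi> (X t)}"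
  have S_AE: "AE t in lebesgue_on {0..T}. t \<in> S"
    using fin \<psi>(2) AE_space[of "lebesgue_on {0..T}"] by eventually_elim (auto simp: S_def)
  have dev: "ball_deviation \<phi>' (X t) r (f t) \<le> C * r ^ ?n * r powr s * F (X t)" if t: "t \<in> S" and r: "0 < r" "r \<le> R" for t r
  proof -
    from C(2)[OF RU[of t]] t obtain l where l: "\<And>r. 0 < r \<Longrightarrow> r \<le> R \<Longrightarrow> ball_deviation \<phi>' (X t) r l \<le> C * r ^ ?n * r powr s * F (X t)"
      unfolding S_def by blast
    have "has_approx_limit \<phi> (X t) l"
      by (rule has_approx_limit_of_deviation[OF \<phi>' s R, of _ _ "C * F (X t)"]) (use l in \<open>simp add: ac_simps\<close>)
    then have "f t = l" using \<psi>(1) t unfolding lebesgue_representative_def S_def by auto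
    then show ?thesis using l r by simp
  qed
  obtain b where b: "U \<subseteq> ball 0 b"
  proof -
    obtain b where "\<forall>x\<in>U. norm x \<le> b" using U(2) unfolding bounded_iff by blast
    then have "U \<subseteq> ball 0 (b + 1)" by fastforce
    then show ?thesis by (rule that)
  qed
  define A where "A = ball_deviation \<phi>' 0 b 0"
  have A: "0 \<le> A" unfolding A_def by (rule ball_deviation_nonneg[OF \<phi>'(1)])
  \<comment> \<open>Compares f t with the constant 0 on the ball of radius R: first the deviation
    from f t, then the L1 norm A of \<open>\<phi>'\<close> on a ball containing U. The 1 in 1 + F
    absorbs the second term.\<close>
  define C1 where "C1 = C * R powr s / ?V + A / (?V * R ^ ?n)"
  have C1: "0 \<le> C1" using C(1) A V R by (simp add: C1_def)
  have size: "\<bar>f t\<bar> \<le> C1 * (1 + F (X t))" if t: "t \<in> S" for t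
  proof -
    have "\<bar>f t - 0\<bar> * (?V * R ^ ?n) \<le> ball_deviation \<phi>' (X t) R (f t) + ball_deviation \<phi>' (X t) R 0"
      using R by (intro ball_deviation_separation[OF \<phi>'(1)]) simp
    also have "ball_deviation \<phi>' (X t) R (f t) \<le> C * R ^ ?n * R powr s * F (X t)" using dev[OF t, of R] R by simp
    also have "ball_deviation \<phi>' (X t) R 0 \<le> A"
    proof -
      have "ball (X t) R \<subseteq> ball (X t) (4 * R)" using R by (intro subset_ball) simp
      then have "ball (X t) R \<subseteq> ball 0 b" using RU[of t] t b unfolding S_def by blast
      then show ?thesis unfolding A_def by (rule ball_deviation_mono[OF \<phi>'(1)])
    qed
    finally have "\<bar>f t\<bar> * (?V * R ^ ?n) \<le> C * R ^ ?n * R powr s * F (X t) + A" by simp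
    then have "\<bar>f t\<bar> \<le> (C * R ^ ?n * R powr s * F (X t) + A) / (?V * R ^ ?n)"
      using V R by (subst pos_le_divide_eq) auto
    also have "\<dots> = (C * R powr s / ?V) * F (X t) + A / (?V * R ^ ?n)"
      using R by (simp add: add_divide_distrib)
    also have "\<dots> \<le> C1 * F (X t) + C1"
      using C(1) A V R F0 by (intro add_mono mult_right_mono) (auto simp: C1_def)
    finally show ?thesis by (simp add: algebra_simps)
  qed
  \<comment> \<open>The first summand serves positions at distance at most R, the second serves
    larger distances, where the size bound is enough.\<close>
  define C2 where "C2 = C * 2 ^ ?n / ?V * H powr s + C1 * (H / R) powr s"
  have near: "\<bar>f t - f u\<bar> \<le> C * 2 ^ ?n / ?V * (dist (X t) (X u)) powr s * (F (X t) + F (X u))"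
    if t: "t \<in> S" and u: "u \<in> S" and d: "0 < dist (X t) (X u)" "dist (X t) (X u) \<le> R" for t u
  proof -
    let ?d = "dist (X t) (X u)"
    \<comment> \<open>The ball around the midpoint with half the distance as radius lies in both
      balls of radius ?d, so the deviations at X t and X u are both available on it. The halved
      radius costs 2^n.\<close>
    define m where "m = midpoint (X t) (X u)"
    have mt: "ball m (?d / 2) \<subseteq> ball (X t) ?d" "ball m (?d / 2) \<subseteq> ball (X u) ?d"
    proof -
      have "dist (X t) m = ?d / 2" "dist (X u) m = ?d / 2" by (auto simp: m_def dist_midpoint)
      then show "ball m (?d / 2) \<subseteq> ball (X t) ?d" "ball m (?d / 2) \<subseteq> ball (X u) ?d"
        by (auto simp: subset_iff intro: le_less_trans[OF dist_triangle[of _ _ m]])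
    qed
    have "\<bar>f t - f u\<bar> * (?V * (?d / 2) ^ ?n) \<le> ball_deviation \<phi>' m (?d / 2) (f t) + ball_deviation \<phi>' m (?d / 2) (f u)"
      using d by (intro ball_deviation_separation[OF \<phi>'(1)]) simp
    also have "\<dots> \<le> ball_deviation \<phi>' (X t) ?d (f t) + ball_deviation \<phi>' (X u) ?d (f u)"
      by (intro add_mono ball_deviation_mono[OF \<phi>'(1)] mt)
    also have "\<dots> \<le> C * ?d ^ ?n * ?d powr s * F (X t) + C * ?d ^ ?n * ?d powr s * F (X u)"
      by (intro add_mono dev t u d)
    also have "\<dots> = (C * 2 ^ ?n / ?V * ?d powr s * (F (X t) + F (X u))) * (?V * (?d / 2) ^ ?n)"
    proof -
      have "2 ^ ?n / ?V * (?V * (?d / 2) ^ ?n) = ?d ^ ?n"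
        using less_imp_neq[OF V] by (simp add: power_divide)
      then have "C * ?d ^ ?n * ?d powr s * F (X t) + C * ?d ^ ?n * ?d powr s * F (X u)
          = C * ?d powr s * (F (X t) + F (X u)) * (2 ^ ?n / ?V * (?V * (?d / 2) ^ ?n))"
        by (simp only:) (simp add: algebra_simps)
      also have "\<dots> = (C * 2 ^ ?n / ?V * ?d powr s * (F (X t) + F (X u))) * (?V * (?d / 2) ^ ?n)"
        by (simp only: divide_inverse ac_simps)
      finally show ?thesis .
    qed
    finally show ?thesis by (rule mult_right_le_imp_le) (use V d in simp)
  qed
  have diff: "\<bar>f t - f u\<bar> \<le> C2 * \<bar>t - u\<bar> powr (\<alpha> * s) * ((1 + F (X t)) + (1 + F (X u)))"
    if t: "t \<in> S" and u: "u \<in> S" for t u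
  proof -
    let ?d = "dist (X t) (X u)" and ?G = "(1 + F (X t)) + (1 + F (X u))"
    have G: "F (X t) + F (X u) \<le> ?G" "0 \<le> ?G" using F0[of "X t"] F0[of "X u"] by linarith+
    have dH: "?d \<le> H * \<bar>t - u\<bar> powr \<alpha>" using H(2)[of u t] t u by (auto simp: dist_norm S_def)
    have ps: "(H * \<bar>t - u\<bar> powr \<alpha>) powr s = H powr s * \<bar>t - u\<bar> powr (\<alpha> * s)"
      using H(1) by (simp add: powr_mult powr_powr)
    consider "?d = 0" | "0 < ?d" "?d \<le> R" | "R < ?d" using zero_le_dist[of "X t" "X u"] by linarith
    then show ?thesis
    proof cases
      case 1
      \<comment> \<open>Equal positions give equal values, because on S the function f is \<psi>
        evaluated at the position.\<close>
      then have "f t = f u" using t u by (simp add: S_def)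
      then show ?thesis using G C(1) C1 V by (simp add: C2_def)
    next
      case 2
      have "\<bar>f t - f u\<bar> \<le> C * 2 ^ ?n / ?V * ?d powr s * (F (X t) + F (X u))" by (rule near[OF t u 2])
      also have "\<dots> \<le> C * 2 ^ ?n / ?V * (H powr s * \<bar>t - u\<bar> powr (\<alpha> * s)) * ?G"
        unfolding ps[symmetric] using C(1) V s G dH F0 by (intro mult_mono powr_mono2) auto
      also have "\<dots> \<le> C2 * \<bar>t - u\<bar> powr (\<alpha> * s) * ?G"
        unfolding C2_def mult.assoc[symmetric] using G C1 by (intro mult_right_mono) auto
      finally show ?thesis .
    next
      case 3
      \<comment> \<open>At large distance the factor (?d / R) powr s is at least 1 and can be
        inserted for free, turning the size bound into an increment bound.\<close>
      have "1 \<le> ?d / R" using 3 R by simp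
      also have "\<dots> \<le> (H / R) * \<bar>t - u\<bar> powr \<alpha>" using dH R by (simp add: divide_right_mono)
      finally have "1 powr s \<le> ((H / R) * \<bar>t - u\<bar> powr \<alpha>) powr s" using s by (intro powr_mono2) auto
      also have "\<dots> = (H / R) powr s * (\<bar>t - u\<bar> powr \<alpha>) powr s" by (rule powr_mult)
      finally have one: "1 \<le> (H / R) powr s * \<bar>t - u\<bar> powr (\<alpha> * s)" by (simp add: powr_powr)
      have "\<bar>f t - f u\<bar> \<le> C1 * ?G * 1" using size[OF t] size[OF u] by (simp add: algebra_simps)
      also have "\<dots> \<le> C1 * ?G * ((H / R) powr s * \<bar>t - u\<bar> powr (\<alpha> * s))"
        using one C1 G by (intro mult_left_mono) auto
      also have "\<dots> = C1 * (H / R) powr s * \<bar>t - u\<bar> powr (\<alpha> * s) * ?G" by (simp add: ac_simps)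
      also have "\<dots> \<le> C2 * \<bar>t - u\<bar> powr (\<alpha> * s) * ?G"
        unfolding C2_def using G C(1) V by (intro mult_right_mono) auto
      finally show ?thesis .
    qed
  qed
  have C2: "0 \<le> C2" using C(1) C1 V by (simp add: C2_def)
  have G0: "0 \<le> (1 + F x) + (1 + F y)" "0 \<le> 1 + F x" for x y using F0[of x] F0[of y] by auto
  show ?thesis
  proof (intro exI[of _ "C1 + C2"] conjI exI[of _ S] S_AE ballI)
    show "0 \<le> C1 + C2" using C1 C2 by simp
    fix t assume t: "t \<in> S"
    show "riesz_potential \<phi> U s (X t) < \<infinity>" using t by (simp add: S_def)
    have "C1 * (1 + F (X t)) \<le> (C1 + C2) * (1 + F (X t))" using C2 G0 by (intro mult_right_mono) auto
    then show "\<bar>f t\<bar> \<le> (C1 + C2) * (1 + enn2real (riesz_potential \<phi> U s (X t)))"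
      using size[OF t] unfolding F_def[symmetric] by linarith
    fix u assume u: "u \<in> S"
    have "C2 * \<bar>t - u\<bar> powr (\<alpha> * s) * ((1 + F (X t)) + (1 + F (X u))) \<le> (C1 + C2) * \<bar>t - u\<bar> powr (\<alpha> * s) * ((1 + F (X t)) + (1 + F (X u)))"
      using C1 G0 by (intro mult_right_mono) auto
    then show "\<bar>f t - f u\<bar> \<le> (C1 + C2) * \<bar>t - u\<bar> powr (\<alpha> * s) * ((1 + enn2real (riesz_potential \<phi> U s (X t))) + (1 + enn2real (riesz_potential \<phi> U s (X u))))"
      using diff[OF t u] unfolding F_def[symmetric] by linarith
  qed
qed

section \<open>Fractional integrals and derivatives\<close>

text \<open>The Riemann-Liouville kernel. Vanishing on the negative axis makes an integral over the
  whole line automatically one over the past of t, so no limits of integration need to be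
  tracked.\<close>

definition frac_kernel :: "real \<Rightarrow> real \<Rightarrow> real" where
  "frac_kernel a x = (if 0 < x then x powr (a - 1) / Gamma a else 0)"

lemma frac_kernel_nonneg [simp]: "0 < a \<Longrightarrow> 0 \<le> frac_kernel a x"
  by (simp add: frac_kernel_def)

lemma borel_measurable_frac_kernel [measurable]: "frac_kernel a \<in> borel_measurable borel"
  unfolding frac_kernel_def[abs_def] by measurable

lemma frac_kernel_1: "frac_kernel 1 x = indicator {0<..} x"
  by (auto simp: frac_kernel_def indicator_def)

lemma nn_integral_Beta:
  assumes "0 < a" "0 < (b::real)"
  shows "(\<integral>\<^sup>+x. ennreal (x powr (a - 1) * (1 - x) powr (b - 1)) * indicator {0<..<1} x \<partial>lborel) = ennreal (Beta a b)"
proof -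
  have "((\<lambda>t. t powr (a - 1) * (1 - t) powr (b - 1)) has_integral Beta a b) {0<..<1}"
    using has_integral_Beta_real[OF assms] by (simp add: has_integral_Icc_iff_Ioo)
  then show ?thesis
    by (intro nn_integral_has_integral_lebesgue'[where \<Omega> = "{0<..<1::real}", THEN trans[rotated]]) (auto simp: mult.commute)
qed

text \<open>The substitution s = r + (t - r) x turns the convolution into a Beta integral. If r is
  not below t, one of the two kernels vanishes at every s.\<close>

lemma frac_kernel_conv:
  assumes a: "0 < a" and b: "0 < b"
  shows "(\<integral>\<^sup>+s. ennreal (frac_kernel a (t - s)) * ennreal (frac_kernel b (s - r)) \<partial>lborel) = ennreal (frac_kernel (a + b) (t - r))"
proof (cases "r < t")
  case True
  define c where "c = t - r"
  have c: "0 < c" using True by (simp add: c_def)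
  have G: "0 < Gamma a" "0 < Gamma b" "0 < Gamma (a + b)" using a b by (auto intro: Gamma_real_pos)
  have "(\<integral>\<^sup>+s. ennreal (frac_kernel a (t - s)) * ennreal (frac_kernel b (s - r)) \<partial>lborel)
      = \<bar>c\<bar> * (\<integral>\<^sup>+x. ennreal (frac_kernel a (t - (r + c * x))) * ennreal (frac_kernel b (r + c * x - r)) \<partial>lborel)"
    using c by (intro nn_integral_real_affine) auto
  also have "(\<integral>\<^sup>+x. ennreal (frac_kernel a (t - (r + c * x))) * ennreal (frac_kernel b (r + c * x - r)) \<partial>lborel)
     = (\<integral>\<^sup>+x. ennreal (c powr (a + b - 2) / (Gamma a * Gamma b)) * (ennreal (x powr (b - 1) * (1 - x) powr (a - 1)) * indicator {0<..<1} x) \<partial>lborel)"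
  proof (rule nn_integral_cong)
    fix x :: real
    have e1: "t - (r + c * x) = c * (1 - x)" by (simp add: c_def algebra_simps)
    show "ennreal (frac_kernel a (t - (r + c * x))) * ennreal (frac_kernel b (r + c * x - r))
      = ennreal (c powr (a + b - 2) / (Gamma a * Gamma b)) * (ennreal (x powr (b - 1) * (1 - x) powr (a - 1)) * indicator {0<..<1} x)"
    proof (cases "0 < x \<and> x < 1")
      case True
      have "(c * (1 - x)) powr (a - 1) / Gamma a * ((c * x) powr (b - 1) / Gamma b)
        = (c powr (a - 1) * c powr (b - 1)) / (Gamma a * Gamma b) * (x powr (b - 1) * (1 - x) powr (a - 1))"
        using True c by (simp add: powr_mult)
      also have "c powr (a - 1) * c powr (b - 1) = c powr (a + b - 2)" by (simp add: powr_add[symmetric] algebra_simps)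
      finally have eq: "frac_kernel a (c * (1 - x)) * frac_kernel b (c * x)
         = c powr (a + b - 2) / (Gamma a * Gamma b) * (x powr (b - 1) * (1 - x) powr (a - 1))"
        using True c by (simp add: frac_kernel_def)
      have "ennreal (frac_kernel a (t - (r + c * x))) * ennreal (frac_kernel b (r + c * x - r)) = ennreal (frac_kernel a (c * (1 - x)) * frac_kernel b (c * x))"
        unfolding e1 using a b by (simp add: ennreal_mult)
      also have "\<dots> = ennreal (c powr (a + b - 2) / (Gamma a * Gamma b)) * ennreal (x powr (b - 1) * (1 - x) powr (a - 1))"
        unfolding eq using G by (intro ennreal_mult) auto
      finally have *: "ennreal (frac_kernel a (t - (r + c * x))) * ennreal (frac_kernel b (r + c * x - r))
         = ennreal (c powr (a + b - 2) / (Gamma a * Gamma b)) * ennreal (x powr (b - 1) * (1 - x) powr (a - 1))" .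
      have "indicator {0<..<1} x = (1::ennreal)" using True by simp
      then show ?thesis by (simp only: * mult_1_right)
    next
      case False
      then have "frac_kernel a (c * (1 - x)) = 0 \<or> frac_kernel b (c * x) = 0"
        using c by (auto simp: frac_kernel_def zero_less_mult_iff)
      then show ?thesis unfolding e1 using False by auto
    qed
  qed
  also have "\<dots> = ennreal (c powr (a + b - 2) / (Gamma a * Gamma b)) * ennreal (Beta b a)"
    using nn_integral_Beta[OF b a] by (simp add: nn_integral_cmult)
  also have "ennreal \<bar>c\<bar> * \<dots> = ennreal (c * (c powr (a + b - 2) / (Gamma a * Gamma b) * Beta b a))"
  proof -
    have "0 \<le> Beta b a" using G by (simp add: Beta_def add.commute)
    moreover have "0 \<le> c powr (a + b - 2) / (Gamma a * Gamma b)" using G by simp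
    ultimately show ?thesis using c by (simp only: ennreal_mult mult_nonneg_nonneg less_imp_le abs_of_pos)
  qed
  also have "c * (c powr (a + b - 2) / (Gamma a * Gamma b) * Beta b a) = frac_kernel (a + b) (t - r)"
  proof -
    have "c * c powr (a + b - 2) = c powr (a + b - 1)"
    proof -
      have "c * c powr (a + b - 2) = c powr 1 * c powr (a + b - 2)" using c by simp
      also have "\<dots> = c powr (a + b - 1)" by (simp only: powr_add[symmetric]) (simp add: algebra_simps)
      finally show ?thesis .
    qed
    moreover have "Beta b a = Gamma a * Gamma b / Gamma (a + b)" by (simp add: Beta_def add.commute mult.commute)
    ultimately show ?thesis using c G by (simp add: frac_kernel_def c_def[symmetric])
  qed
  finally show ?thesis .
next
  case False
  then have "frac_kernel a (t - s) = 0 \<or> frac_kernel b (s - r) = 0" for s by (auto simp: frac_kernel_def)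
  then have "ennreal (frac_kernel a (t - s)) * ennreal (frac_kernel b (s - r)) = 0" for s by (metis ennreal_0 mult_zero_left mult_zero_right)
  then have "(\<integral>\<^sup>+s. ennreal (frac_kernel a (t - s)) * ennreal (frac_kernel b (s - r)) \<partial>lborel) = 0"
    by (simp only: nn_integral_const) simp
  then show ?thesis using False by (simp add: frac_kernel_def)
qed

definition frac_int :: "real \<Rightarrow> (real \<Rightarrow> real) \<Rightarrow> real \<Rightarrow> real" where
  "frac_int a u t = (LBINT s. frac_kernel a (t - s) * u s)"

text \<open>Finiteness expresses absolute convergence of \<open>frac_int\<close>; without it the
  Bochner integral would default to 0 and identities could fail.\<close>

definition frac_int_abs :: "real \<Rightarrow> (real \<Rightarrow> real) \<Rightarrow> real \<Rightarrow> ennreal" where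
  "frac_int_abs a u t = (\<integral>\<^sup>+s. ennreal (frac_kernel a (t - s)) * ennreal \<bar>u s\<bar> \<partial>lborel)"

lemma borel_measurable_frac_int [measurable]:
  assumes [measurable]: "u \<in> borel_measurable borel"
  shows "frac_int a u \<in> borel_measurable borel"
  unfolding frac_int_def[abs_def] by measurable

lemma borel_measurable_frac_int_abs [measurable]:
  assumes [measurable]: "u \<in> borel_measurable borel"
  shows "frac_int_abs a u \<in> borel_measurable borel"
  unfolding frac_int_abs_def[abs_def] by measurable

lemma frac_int_integrable:
  assumes [measurable]: "u \<in> borel_measurable borel" and "0 < a" "frac_int_abs a u t < \<infinity>"
  shows "integrable lborel (\<lambda>s. frac_kernel a (t - s) * u s)"
  using assms(2,3) unfolding integrable_iff_bounded frac_int_abs_def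
  by (auto simp: abs_mult ennreal_mult)

lemma frac_int_abs_conv:
  assumes [measurable]: "u \<in> borel_measurable borel" and a: "0 < a" and b: "0 < b"
  shows "(\<integral>\<^sup>+s. ennreal (frac_kernel a (t - s)) * frac_int_abs b u s \<partial>lborel) = frac_int_abs (a + b) u t"
proof -
  have "(\<integral>\<^sup>+s. ennreal (frac_kernel a (t - s)) * frac_int_abs b u s \<partial>lborel)
    = (\<integral>\<^sup>+s. \<integral>\<^sup>+r. ennreal (frac_kernel a (t - s)) * (ennreal (frac_kernel b (s - r)) * ennreal \<bar>u r\<bar>) \<partial>lborel \<partial>lborel)"
    unfolding frac_int_abs_def by (intro nn_integral_cong nn_integral_cmult[symmetric]) measurable
  also have "\<dots> = (\<integral>\<^sup>+r. \<integral>\<^sup>+s. ennreal (frac_kernel a (t - s)) * (ennreal (frac_kernel b (s - r)) * ennreal \<bar>u r\<bar>) \<partial>lborel \<partial>lborel)"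
    by (rule lborel_pair.Fubini') measurable
  also have "\<dots> = (\<integral>\<^sup>+r. (\<integral>\<^sup>+s. ennreal (frac_kernel a (t - s)) * ennreal (frac_kernel b (s - r)) \<partial>lborel) * ennreal \<bar>u r\<bar> \<partial>lborel)"
    by (intro nn_integral_cong) (subst nn_integral_multc[symmetric], auto simp: mult.assoc)
  also have "\<dots> = frac_int_abs (a + b) u t"
    unfolding frac_kernel_conv[OF a b] frac_int_abs_def ..
  finally show ?thesis .
qed

text \<open>Fubini and the convolution of the kernels, at a point t where the absolute integral
  converges. For integrable u this is almost every t, which is all the semigroup law asks.\<close>

lemma frac_int_conv:
  assumes [measurable]: "u \<in> borel_measurable borel" and a: "0 < a" and b: "0 < b" and fin: "frac_int_abs (a + b) u t < \<infinity>"
  shows "frac_int a (frac_int b u) t = frac_int (a + b) u t"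
proof -
  let ?f = "\<lambda>s r. frac_kernel a (t - s) * (frac_kernel b (s - r) * u r)"
  have int: "integrable (lborel \<Otimes>\<^sub>M lborel) (\<lambda>(s, r). ?f s r)"
  proof (rule integrableI_bounded)
    have "(\<integral>\<^sup>+p. ennreal (norm (case p of (s, r) \<Rightarrow> ?f s r)) \<partial>(lborel \<Otimes>\<^sub>M lborel))
      = (\<integral>\<^sup>+s. \<integral>\<^sup>+r. ennreal (norm (?f s r)) \<partial>lborel \<partial>lborel)"
      by (subst lborel.nn_integral_fst[symmetric]) auto
    also have "\<dots> = (\<integral>\<^sup>+s. ennreal (frac_kernel a (t - s)) * frac_int_abs b u s \<partial>lborel)"
      unfolding frac_int_abs_def
      by (intro nn_integral_cong) (subst nn_integral_cmult[symmetric], auto simp: abs_mult ennreal_mult a b)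
    also have "\<dots> < \<infinity>" using fin by (simp add: frac_int_abs_conv a b)
    finally show "(\<integral>\<^sup>+p. ennreal (norm (case p of (s, r) \<Rightarrow> ?f s r)) \<partial>(lborel \<Otimes>\<^sub>M lborel)) < \<infinity>" .
  qed measurable
  have "frac_int a (frac_int b u) t = (LBINT s. LBINT r. ?f s r)"
    unfolding frac_int_def by (simp add: Bochner_Integration.integral_mult_right_zero)
  also have "\<dots> = (LBINT r. LBINT s. ?f s r)"
    by (rule lborel_pair.Fubini_integral[OF int, symmetric])
  also have "\<dots> = (LBINT r. frac_kernel (a + b) (t - r) * u r)"
  proof (rule Bochner_Integration.integral_cong[OF refl])
    fix r
    have "(LBINT s. frac_kernel a (t - s) * frac_kernel b (s - r)) = enn2real (\<integral>\<^sup>+s. ennreal (frac_kernel a (t - s) * frac_kernel b (s - r)) \<partial>lborel)"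
      using a b by (intro integral_eq_nn_integral) auto
    also have "\<dots> = frac_kernel (a + b) (t - r)"
      using frac_kernel_conv[OF a b, of t r] a b by (simp add: ennreal_mult)
    finally have "(LBINT s. frac_kernel a (t - s) * frac_kernel b (s - r)) = frac_kernel (a + b) (t - r)" .
    moreover have "(LBINT s. ?f s r) = (LBINT s. (frac_kernel a (t - s) * frac_kernel b (s - r)) * u r)"
      by (simp add: mult.assoc)
    ultimately show "(LBINT s. ?f s r) = frac_kernel (a + b) (t - r) * u r" by simp
  qed
  finally show ?thesis unfolding frac_int_def .
qed

text \<open>Functions on $[0,T]$ are extended by zero to the real line.\<close>

definition L1_on :: "real \<Rightarrow> (real \<Rightarrow> real) \<Rightarrow> bool" where
  "L1_on T u \<longleftrightarrow> integrable lborel u \<and> (\<forall>s. s \<notin> {0..T} \<longrightarrow> u s = 0)"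

lemma L1_on_borel: "L1_on T u \<Longrightarrow> u \<in> borel_measurable borel"
  by (auto simp: L1_on_def dest: borel_measurable_integrable)

text \<open>A kernel of order above 1 is bounded on [0,T], so integrability of u suffices at the
  single point T.\<close>

lemma frac_int_abs_at_end_finite:
  assumes a: "0 < a" and u: "L1_on T u"
  shows "frac_int_abs (1 + a) u T < \<infinity>"
proof -
  have [measurable]: "u \<in> borel_measurable borel" using u by (rule L1_on_borel)
  have "frac_int_abs (1 + a) u T \<le> (\<integral>\<^sup>+s. ennreal (T powr a / Gamma (1 + a)) * ennreal \<bar>u s\<bar> \<partial>lborel)"
    unfolding frac_int_abs_def
  proof (rule nn_integral_mono)
    fix s
    have "frac_kernel (1 + a) (T - s) \<le> T powr a / Gamma (1 + a)" if "s \<in> {0..T}"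
      using that a by (auto simp: frac_kernel_def intro!: divide_right_mono powr_mono2)
    then show "ennreal (frac_kernel (1 + a) (T - s)) * ennreal \<bar>u s\<bar> \<le> ennreal (T powr a / Gamma (1 + a)) * ennreal \<bar>u s\<bar>"
      using u by (cases "s \<in> {0..T}") (auto simp: L1_on_def intro!: mult_right_mono ennreal_leI)
  qed
  also have "\<dots> = ennreal (T powr a / Gamma (1 + a)) * (\<integral>\<^sup>+s. ennreal \<bar>u s\<bar> \<partial>lborel)"
    by (rule nn_integral_cmult) measurable
  also have "\<dots> < \<infinity>"
    using u unfolding L1_on_def integrable_iff_bounded by (auto simp: ennreal_mult_less_top)
  finally show ?thesis .
qed

text \<open>Integrating the fractional integral of order a of |u| up to T gives the one of order 1 +
  a at T. That is finite, hence so is the integrand almost everywhere.\<close>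

lemma frac_int_abs_finite:
  assumes a: "0 < a" and u: "L1_on T u"
  shows "AE t in lborel. t \<le> T \<longrightarrow> frac_int_abs a u t < \<infinity>"
proof -
  have [measurable]: "u \<in> borel_measurable borel" using u by (rule L1_on_borel)
  have "(\<integral>\<^sup>+t. ennreal (frac_kernel 1 (T - t)) * frac_int_abs a u t \<partial>lborel) = frac_int_abs (1 + a) u T"
    using a by (intro frac_int_abs_conv) auto
  also have "\<dots> < \<infinity>" by (rule frac_int_abs_at_end_finite[OF a u])
  finally have "AE t in lborel. ennreal (frac_kernel 1 (T - t)) * frac_int_abs a u t \<noteq> \<infinity>"
    by (intro nn_integral_PInf_AE) auto
  moreover have "AE t in lborel. t \<noteq> T" by (rule AE_lborel_singleton)
  ultimately show ?thesis
    by eventually_elim (auto simp: frac_kernel_1 less_top)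
qed

lemma frac_int_semigroup:
  assumes "0 < a" "0 < b" and u: "L1_on T u"
  shows "AE t in lborel. t \<le> T \<longrightarrow> frac_int a (frac_int b u) t = frac_int (a + b) u t"
  using frac_int_abs_finite[of "a + b" T u] assms frac_int_conv[OF L1_on_borel[OF u], of a b]
  by (auto elim!: eventually_mono)

lemma frac_int_cong_AE:
  assumes [measurable]: "u \<in> borel_measurable borel" "v \<in> borel_measurable borel"
    and "AE s in lborel. s \<le> T \<longrightarrow> u s = v s" and "t \<le> T"
  shows "frac_int a u t = frac_int a v t"
  unfolding frac_int_def
proof (rule integral_cong_AE)
  show "AE s in lborel. frac_kernel a (t - s) * u s = frac_kernel a (t - s) * v s"
    using assms(3) by eventually_elim (use assms(4) in \<open>auto simp: frac_kernel_def\<close>)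
qed measurable

lemma L1_on_frac_int:
  assumes a: "0 < a" and u: "L1_on T u"
  shows "L1_on T (\<lambda>t. indicator {0..T} t * frac_int a u t)"
  unfolding L1_on_def
proof (intro conjI allI impI)
  have [measurable]: "u \<in> borel_measurable borel" using u by (rule L1_on_borel)
  have "(\<integral>\<^sup>+t. ennreal (norm (indicator {0..T} t * frac_int a u t)) \<partial>lborel) \<le> (\<integral>\<^sup>+t. ennreal (frac_kernel 1 (T - t)) * frac_int_abs a u t \<partial>lborel)"
  proof (rule nn_integral_mono_AE)
    have "AE t in lborel. t \<noteq> T" by (rule AE_lborel_singleton)
    moreover have "AE t in lborel. t \<le> T \<longrightarrow> frac_int_abs a u t < \<infinity>" by (rule frac_int_abs_finite[OF a u])
    ultimately show "AE t in lborel. ennreal (norm (indicator {0..T} t * frac_int a u t)) \<le> ennreal (frac_kernel 1 (T - t)) * frac_int_abs a u t"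
    proof eventually_elim
      case (elim t)
      show ?case
      proof (cases "t \<in> {0..T}")
        case True
        then have "integrable lborel (\<lambda>s. frac_kernel a (t - s) * u s)" using elim a by (intro frac_int_integrable) auto
        from integral_norm_bound_ennreal[OF this] have "ennreal (norm (frac_int a u t)) \<le> frac_int_abs a u t"
          unfolding frac_int_def frac_int_abs_def using a by (simp add: abs_mult ennreal_mult)
        then show ?thesis using True elim by (auto simp: frac_kernel_1)
      qed simp
    qed
  qed
  also have "\<dots> = frac_int_abs (1 + a) u T"
    using a by (intro frac_int_abs_conv) auto
  also have "\<dots> < \<infinity>" by (rule frac_int_abs_at_end_finite[OF a u])
  finally show "integrable lborel (\<lambda>t. indicator {0..T} t * frac_int a u t)"
    unfolding integrable_iff_bounded by auto
qed auto

section \<open>Fractional derivatives of zero-extended functions\<close>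

text \<open>Borel counterpart of \<open>W0_space\<close>. Only the half s \<le> t of the double
  integral appears, because a left-sided derivative looks only into the past.\<close>

definition W0_ext :: "real \<Rightarrow> real \<Rightarrow> (real \<Rightarrow> real) \<Rightarrow> bool" where
  "W0_ext \<theta> T f \<longleftrightarrow> f \<in> borel_measurable borel \<and> (\<forall>s. s \<notin> {0..T} \<longrightarrow> f s = 0) \<and>
     (\<integral>\<^sup>+t. indicator {0..T} t * ennreal (\<bar>f t\<bar> / t powr \<theta>) \<partial>lborel) < \<infinity> \<and>
     (\<integral>\<^sup>+t. \<integral>\<^sup>+s. indicator {0..T} t * indicator {0..t} s * ennreal (\<bar>f t - f s\<bar> / (t - s) powr (\<theta> + 1)) \<partial>lborel \<partial>lborel) < \<infinity>"

definition frac_deriv_ext :: "real \<Rightarrow> real \<Rightarrow> (real \<Rightarrow> real) \<Rightarrow> real \<Rightarrow> real" where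
  "frac_deriv_ext \<theta> T f t = indicator {0..T} t * (1 / Gamma (1 - \<theta>) *
     (f t / t powr \<theta> + \<theta> * (LBINT s. indicator {0..t} s * ((f t - f s) / (t - s) powr (\<theta> + 1)))))"

lemma W0_ext_borel: "W0_ext \<theta> T f \<Longrightarrow> f \<in> borel_measurable borel"
  by (simp add: W0_ext_def)

lemma L1_on_W0_ext:
  assumes "W0_ext \<theta> T f" "0 < \<theta>"
  shows "L1_on T f"
proof -
  have [measurable]: "f \<in> borel_measurable borel" using assms by (simp add: W0_ext_def)
  have z: "\<And>s. s \<notin> {0..T} \<Longrightarrow> f s = 0" using assms by (simp add: W0_ext_def)
  have "(\<integral>\<^sup>+t. ennreal (norm (f t)) \<partial>lborel) \<le> (\<integral>\<^sup>+t. ennreal (T powr \<theta>) * (indicator {0..T} t * ennreal (\<bar>f t\<bar> / t powr \<theta>)) \<partial>lborel)"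
  proof (rule nn_integral_mono_AE)
    have "AE t in lborel. t \<noteq> (0::real)" by (rule AE_lborel_singleton)
    then show "AE t in lborel. ennreal (norm (f t)) \<le> ennreal (T powr \<theta>) * (indicator {0..T} t * ennreal (\<bar>f t\<bar> / t powr \<theta>))"
    proof eventually_elim
      case (elim t)
      show ?case
      proof (cases "t \<in> {0..T}")
        case True
        then have "1 \<le> T powr \<theta> / t powr \<theta>" using elim assms(2) by (auto simp: powr_mono2)
        then have "\<bar>f t\<bar> * 1 \<le> \<bar>f t\<bar> * (T powr \<theta> / t powr \<theta>)" by (intro mult_left_mono) auto
        then show ?thesis using True by (auto simp: ennreal_mult[symmetric] mult.commute intro!: ennreal_leI)
      qed (use z in auto)
    qed
  qed
  also have "\<dots> = ennreal (T powr \<theta>) * (\<integral>\<^sup>+t. indicator {0..T} t * ennreal (\<bar>f t\<bar> / t powr \<theta>) \<partial>lborel)"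
    by (rule nn_integral_cmult) measurable
  also have "\<dots> < \<infinity>" using assms by (auto simp: W0_ext_def ennreal_mult_less_top)
  finally show ?thesis using z by (simp add: L1_on_def integrable_iff_bounded)
qed

lemma W0_ext_integrable:
  assumes "W0_ext \<theta> T f"
  shows "integrable lborel (\<lambda>t. indicator {0..T} t * (f t / t powr \<theta>))"
    and "integrable (lborel \<Otimes>\<^sub>M lborel) (\<lambda>(t, s). indicator {0..T} t * (indicator {0..t} s * ((f t - f s) / (t - s) powr (\<theta> + 1))))"
proof -
  have [measurable]: "f \<in> borel_measurable borel" using assms by (simp add: W0_ext_def)
  have "(\<integral>\<^sup>+t. ennreal (norm (indicator {0..T} t * (f t / t powr \<theta>))) \<partial>lborel) = (\<integral>\<^sup>+t. indicator {0..T} t * ennreal (\<bar>f t\<bar> / t powr \<theta>) \<partial>lborel)"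
    by (intro nn_integral_cong) (auto simp: indicator_def)
  then show "integrable lborel (\<lambda>t. indicator {0..T} t * (f t / t powr \<theta>))"
    using assms by (simp add: integrable_iff_bounded W0_ext_def)
  have m [measurable]: "(\<lambda>(t, s). indicator {0..T} t * (indicator {0..t} s * ((f t - f s) / (t - s) powr (\<theta> + 1)))) \<in> borel_measurable (lborel \<Otimes>\<^sub>M lborel)"
    unfolding indicator_def atLeastAtMost_iff by measurable
  have "(\<integral>\<^sup>+p. ennreal (norm (case p of (t, s) \<Rightarrow> indicator {0..T} t * (indicator {0..t} s * ((f t - f s) / (t - s) powr (\<theta> + 1))))) \<partial>(lborel \<Otimes>\<^sub>M lborel))
    = (\<integral>\<^sup>+t. \<integral>\<^sup>+s. ennreal (norm (indicator {0..T} t * (indicator {0..t} s * ((f t - f s) / (t - s) powr (\<theta> + 1))))) \<partial>lborel \<partial>lborel)"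
    using lborel.nn_integral_fst[OF measurable_compose[OF measurable_compose[OF m borel_measurable_norm] measurable_ennreal]] by simp
  also have "\<dots> = (\<integral>\<^sup>+t. \<integral>\<^sup>+s. indicator {0..T} t * indicator {0..t} s * ennreal (\<bar>f t - f s\<bar> / (t - s) powr (\<theta> + 1)) \<partial>lborel \<partial>lborel)"
    by (intro nn_integral_cong) (auto simp: indicator_def)
  also have "\<dots> < \<infinity>" using assms by (simp add: W0_ext_def)
  finally show "integrable (lborel \<Otimes>\<^sub>M lborel) (\<lambda>(t, s). indicator {0..T} t * (indicator {0..t} s * ((f t - f s) / (t - s) powr (\<theta> + 1))))"
    by (intro integrableI_bounded m)
qed

text \<open>With the indicator under the integral, the inner integral is a section of the jointly
  integrable function in \<open>W0_ext_integrable\<close>.\<close>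

lemma frac_deriv_ext_altdef:
  "frac_deriv_ext \<theta> T f t = 1 / Gamma (1 - \<theta>) * (indicator {0..T} t * (f t / t powr \<theta>) +
     \<theta> * (LBINT s. indicator {0..T} t * (indicator {0..t} s * ((f t - f s) / (t - s) powr (\<theta> + 1)))))"
  by (cases "t \<in> {0..T}") (auto simp: frac_deriv_ext_def)

lemma L1_on_frac_deriv_ext:
  assumes "W0_ext \<theta> T f"
  shows "L1_on T (frac_deriv_ext \<theta> T f)"
  unfolding L1_on_def
proof
  note int = W0_ext_integrable[OF assms]
  show "integrable lborel (frac_deriv_ext \<theta> T f)"
    unfolding frac_deriv_ext_altdef[abs_def]
    using int(1) lborel_pair.integrable_fst[OF int(2)] by auto
qed (simp add: frac_deriv_ext_def)

text \<open>The same singular kernel integrated in r for fixed s, and in s for fixed r. The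
  divergent part \<eta> powr -\<theta> is the same in both, which makes the later cancellation
  possible.\<close>

lemma truncated_power_integral:
  assumes \<theta>: "0 < \<theta>" and \<eta>: "0 < (\<eta>::real)"
  shows "(LBINT r. \<theta> * (s - r) powr (- \<theta> - 1) * indicator {0..s - \<eta>} r) = (if \<eta> < s then \<eta> powr - \<theta> - s powr - \<theta> else 0)"
    and "(LBINT s. \<theta> * (s - r) powr (- \<theta> - 1) * indicator {r + \<eta>..t} s) = (if \<eta> < t - r then \<eta> powr - \<theta> - (t - r) powr - \<theta> else 0)"
proof -
  show "(LBINT r. \<theta> * (s - r) powr (- \<theta> - 1) * indicator {0..s - \<eta>} r) = (if \<eta> < s then \<eta> powr - \<theta> - s powr - \<theta> else 0)"
  proof (cases "\<eta> \<le> s")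
    case True
    have "(LBINT r. \<theta> * (s - r) powr (- \<theta> - 1) * indicator {0..s - \<eta>} r) = (s - (s - \<eta>)) powr - \<theta> - (s - 0) powr - \<theta>"
    proof (rule integral_FTC_Icc_real)
      fix r assume "0 \<le> r" "r \<le> s - \<eta>"
      then have "0 < s - r" using \<eta> by simp
      then show "((\<lambda>r. (s - r) powr - \<theta>) has_real_derivative \<theta> * (s - r) powr (- \<theta> - 1)) (at r)"
        by (auto intro!: derivative_eq_intros)
      show "isCont (\<lambda>r. \<theta> * (s - r) powr (- \<theta> - 1)) r"
        using \<open>0 < s - r\<close> by (intro continuous_intros) auto
    qed (use True in simp)
    then show ?thesis using True by auto
  qed auto
  show "(LBINT s. \<theta> * (s - r) powr (- \<theta> - 1) * indicator {r + \<eta>..t} s) = (if \<eta> < t - r then \<eta> powr - \<theta> - (t - r) powr - \<theta> else 0)"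
  proof (cases "r + \<eta> \<le> t")
    case True
    have "(LBINT s. \<theta> * (s - r) powr (- \<theta> - 1) * indicator {r + \<eta>..t} s) = - ((t - r) powr - \<theta>) - - (((r + \<eta>) - r) powr - \<theta>)"
    proof (rule integral_FTC_Icc_real)
      fix s assume "r + \<eta> \<le> s" "s \<le> t"
      then have "0 < s - r" using \<eta> by simp
      then show "((\<lambda>s. - ((s - r) powr - \<theta>)) has_real_derivative \<theta> * (s - r) powr (- \<theta> - 1)) (at s)"
        by (auto intro!: derivative_eq_intros)
      show "isCont (\<lambda>s. \<theta> * (s - r) powr (- \<theta> - 1)) s"
        using \<open>0 < s - r\<close> by (intro continuous_intros) auto
    qed (use True in simp)
    moreover have "\<eta> < t - r \<or> t - r = \<eta>" using True by linarith
    ultimately show ?thesis by auto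
  qed auto
qed

text \<open>The singular double integral is truncated to $s - r \ge \eta$, where its two halves can be
  integrated separately; the divergent terms $\eta^{-\theta}$ cancel.\<close>

lemma frac_deriv_double_integral:
  assumes \<theta>: "0 < \<theta>" "\<theta> < 1" and f: "W0_ext \<theta> T f" and t: "0 < t" "t \<le> T"
    and fin: "frac_int_abs (1 - \<theta>) f t < \<infinity>"
  shows "\<theta> * (LINT p|(lborel \<Otimes>\<^sub>M lborel). (case p of (s, r) \<Rightarrow> indicator {0..t} s * (indicator {0..s} r * ((f s - f r) / (s - r) powr (\<theta> + 1)))))
     = (LBINT s. indicator {0..t} s * f s * (t - s) powr - \<theta>) - (LBINT s. indicator {0..t} s * f s * s powr - \<theta>)"
    and "integrable lborel (\<lambda>s. indicator {0..t} s * f s * (t - s) powr - \<theta>)"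
    and "integrable lborel (\<lambda>s. indicator {0..t} s * f s * s powr - \<theta>)"
proof -
  have [measurable]: "f \<in> borel_measurable borel" using f by (rule W0_ext_borel)
  have fL: "L1_on T f" using f \<theta>(1) by (rule L1_on_W0_ext)
  then have fint: "integrable lborel f" by (simp add: L1_on_def)
  let ?I1 = "\<lambda>s. indicator {0..t} s * f s * (t - s) powr - \<theta>" and ?I2 = "\<lambda>s. indicator {0..t} s * f s * s powr - \<theta>"
  show I1: "integrable lborel ?I1"
  proof -
    have "integrable lborel (\<lambda>s. Gamma (1 - \<theta>) * (frac_kernel (1 - \<theta>) (t - s) * f s))"
      using frac_int_integrable[OF _ _ fin] \<theta> by simp
    moreover have "Gamma (1 - \<theta>) \<noteq> 0" using Gamma_real_pos[of "1 - \<theta>"] \<theta> by linarith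
    then have "Gamma (1 - \<theta>) * (frac_kernel (1 - \<theta>) (t - s) * f s) = ?I1 s" for s
      using f by (auto simp: frac_kernel_def indicator_def W0_ext_def)
    ultimately show ?thesis by simp
  qed
  show I2: "integrable lborel ?I2"
  proof -
    have "integrable lborel (\<lambda>s. (indicator {0..T} s * (f s / s powr \<theta>)) * indicator {0..t} s)"
      using W0_ext_integrable(1)[OF f] by (intro integrable_real_mult_indicator) auto
    moreover have "(indicator {0..T} s * (f s / s powr \<theta>)) * indicator {0..t} s = ?I2 s" for s
      using t by (auto simp: indicator_def powr_minus_divide)
    ultimately show ?thesis by simp
  qed
  define \<eta> where "\<eta> k = 1 / real (Suc k)" for k
  have \<eta>: "0 < \<eta> k" for k by (simp add: \<eta>_def)
  have \<eta>0: "\<eta> \<longlonglongrightarrow> 0" unfolding \<eta>_def[abs_def] by (rule LIMSEQ_Suc[OF lim_1_over_n])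
  let ?E = "\<lambda>(s, r). indicator {0..t} s * (indicator {0..s} r * ((f s - f r) / (s - r) powr (\<theta> + 1)))"
  let ?Ek = "\<lambda>k (s, r). indicator {0..s - \<eta> k} r * (indicator {0..t} s * (indicator {0..s} r * ((f s - f r) / (s - r) powr (\<theta> + 1))))"
  \<comment> \<open>The common value of both truncated kernel integrals, as a function of the length
    x of the interval.\<close>
  define m where "m k x = (if \<eta> k < x then \<eta> k powr - \<theta> - x powr - \<theta> else 0)" for k x
  have Emeas [measurable]: "?E \<in> borel_measurable (lborel \<Otimes>\<^sub>M lborel)" unfolding indicator_def atLeastAtMost_iff by measurable
  have Ekmeas [measurable]: "?Ek k \<in> borel_measurable (lborel \<Otimes>\<^sub>M lborel)" for k unfolding indicator_def atLeastAtMost_iff by measurable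
  have Eint: "integrable (lborel \<Otimes>\<^sub>M lborel) ?E"
    by (rule Bochner_Integration.integrable_bound[OF W0_ext_integrable(2)[OF f]])
       (use t in \<open>auto intro!: AE_I2 simp: indicator_def\<close>)
  have lim1: "(\<lambda>k. LINT p|(lborel \<Otimes>\<^sub>M lborel). ?Ek k p) \<longlonglongrightarrow> (LINT p|(lborel \<Otimes>\<^sub>M lborel). ?E p)"
  proof (rule integral_dominated_convergence[where w = "\<lambda>p. norm (?E p)"])
    show "integrable (lborel \<Otimes>\<^sub>M lborel) (\<lambda>p. norm (?E p))" using Eint by (rule integrable_norm)
    show "AE p in lborel \<Otimes>\<^sub>M lborel. (\<lambda>k. ?Ek k p) \<longlonglongrightarrow> ?E p"
    proof (intro AE_I2)
      fix p :: "real \<times> real"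
      obtain s r where p: "p = (s, r)" by force
      show "(\<lambda>k. ?Ek k p) \<longlonglongrightarrow> ?E p"
      proof (cases "0 \<le> r \<and> r < s")
        case True
        then have "\<forall>\<^sub>F k in sequentially. \<eta> k < s - r" using order_tendstoD(2)[OF \<eta>0, of "s - r"] by simp
        then have "\<forall>\<^sub>F k in sequentially. ?Ek k p = ?E p" by eventually_elim (use True in \<open>simp add: p\<close>)
        then show ?thesis by (rule tendsto_eventually)
      next
        case False
        then have "?E p = 0" by (auto simp: p indicator_def)
        moreover from this have "?Ek k p = 0" for k by (auto simp: p)
        ultimately show ?thesis by simp
      qed
    qed
    show "AE p in lborel \<Otimes>\<^sub>M lborel. norm (?Ek k p) \<le> norm (?E p)" for k
      by (intro AE_I2) (auto simp: indicator_def)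
  qed measurable
  have Ek: "\<theta> * (LINT p|(lborel \<Otimes>\<^sub>M lborel). ?Ek k p) = (LBINT s. indicator {0..t} s * f s * (m k s - m k (t - s)))" for k
  proof -
    \<comment> \<open>Away from the diagonal the terms with f s and with f r are separately
      integrable: ?A is integrated in r first, ?B in s first.\<close>
    let ?A = "\<lambda>s r. indicator {0..t} s * f s * (\<theta> * (s - r) powr (- \<theta> - 1) * indicator {0..s - \<eta> k} r)"
    let ?B = "\<lambda>s r. indicator {0..} r * f r * (\<theta> * (s - r) powr (- \<theta> - 1) * indicator {r + \<eta> k..t} s)"
    let ?M = "\<theta> * \<eta> k powr (- \<theta> - 1)"
    have bd: "(s - r) powr (- \<theta> - 1) \<le> \<eta> k powr (- \<theta> - 1)" if "\<eta> k \<le> s - r" for s r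
      using that \<eta>[of k] \<theta> by (intro powr_mono2') auto
    have indint: "integrable lborel (indicator {0..t} :: real \<Rightarrow> real)"
      using t by (intro integrable_real_indicator) (simp_all add: ennreal_less_top)
    have prodint: "integrable (lborel \<Otimes>\<^sub>M lborel) (\<lambda>(s, r). ?M * (\<bar>f s\<bar> * indicator {0..t} r))"
      "integrable (lborel \<Otimes>\<^sub>M lborel) (\<lambda>(s, r). ?M * (indicator {0..t} s * \<bar>f r\<bar>))"
      using fint indint by (auto intro!: lborel_pair.Fubini_integrable simp: abs_mult)
    have Aint: "integrable (lborel \<Otimes>\<^sub>M lborel) (\<lambda>(s, r). ?A s r)"
    proof (rule Bochner_Integration.integrable_bound[OF prodint(1)])
      show "(\<lambda>(s, r). ?A s r) \<in> borel_measurable (lborel \<Otimes>\<^sub>M lborel)" unfolding indicator_def atLeastAtMost_iff by measurable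
      show "AE p in lborel \<Otimes>\<^sub>M lborel. norm (case p of (s, r) \<Rightarrow> ?A s r) \<le> norm (case p of (s, r) \<Rightarrow> ?M * (\<bar>f s\<bar> * indicator {0..t} r))"
        using bd \<theta> \<eta>[of k] by (intro AE_I2) (auto simp: indicator_def abs_mult mult.commute intro!: mult_left_mono)
    qed
    have Bint: "integrable (lborel \<Otimes>\<^sub>M lborel) (\<lambda>(s, r). ?B s r)"
    proof (rule Bochner_Integration.integrable_bound[OF prodint(2)])
      show "(\<lambda>(s, r). ?B s r) \<in> borel_measurable (lborel \<Otimes>\<^sub>M lborel)" unfolding indicator_def atLeastAtMost_iff by measurable
      show "AE p in lborel \<Otimes>\<^sub>M lborel. norm (case p of (s, r) \<Rightarrow> ?B s r) \<le> norm (case p of (s, r) \<Rightarrow> ?M * (indicator {0..t} s * \<bar>f r\<bar>))"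
        using bd \<theta> \<eta>[of k] by (intro AE_I2) (auto simp: indicator_def abs_mult mult.commute intro!: mult_left_mono)
    qed
    have "\<theta> * (LINT p|(lborel \<Otimes>\<^sub>M lborel). ?Ek k p) = (LINT p|(lborel \<Otimes>\<^sub>M lborel). (case p of (s, r) \<Rightarrow> ?A s r) - (case p of (s, r) \<Rightarrow> ?B s r))"
    proof (subst Bochner_Integration.integral_mult_right_zero[symmetric], rule Bochner_Integration.integral_cong[OF refl])
      fix p :: "real \<times> real"
      obtain s r where p: "p = (s, r)" by force
      have pm: "x / y powr (\<theta> + 1) = x * y powr (- \<theta> - 1)" for x y :: real
      proof -
        have "- \<theta> - 1 = - (\<theta> + 1)" by simp
        then show ?thesis by (simp only: powr_minus divide_inverse)
      qed
      show "\<theta> * ?Ek k p = (case p of (s, r) \<Rightarrow> ?A s r) - (case p of (s, r) \<Rightarrow> ?B s r)"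
        unfolding p prod.case pm using \<eta>[of k] by (auto simp: indicator_def algebra_simps)
    qed
    also have "\<dots> = (LINT p|(lborel \<Otimes>\<^sub>M lborel). (case p of (s, r) \<Rightarrow> ?A s r)) - (LINT p|(lborel \<Otimes>\<^sub>M lborel). (case p of (s, r) \<Rightarrow> ?B s r))"
      using Aint Bint by (rule Bochner_Integration.integral_diff)
    also have "(LINT p|(lborel \<Otimes>\<^sub>M lborel). (case p of (s, r) \<Rightarrow> ?A s r)) = (LBINT s. LBINT r. ?A s r)"
      using Aint by (rule lborel_pair.integral_fst[symmetric])
    also have "\<dots> = (LBINT s. indicator {0..t} s * f s * m k s)"
      using truncated_power_integral(1)[OF \<theta>(1) \<eta>[of k]] by (simp add: m_def)
    also have "(LINT p|(lborel \<Otimes>\<^sub>M lborel). (case p of (s, r) \<Rightarrow> ?B s r)) = (LBINT r. LBINT s. ?B s r)"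
      using Bint by (rule lborel_pair.integral_snd[symmetric])
    also have "\<dots> = (LBINT r. indicator {0..} r * f r * m k (t - r))"
      using truncated_power_integral(2)[OF \<theta>(1) \<eta>[of k]] by (simp add: m_def)
    \<comment> \<open>For r > t the argument t - r is negative and hence not above \<eta> k, so
      \<open>m k\<close> vanishes there.\<close>
    also have "\<dots> = (LBINT r. indicator {0..t} r * f r * m k (t - r))"
      using \<eta>[of k] by (intro Bochner_Integration.integral_cong) (auto simp: indicator_def m_def)
    also have "(LBINT s. indicator {0..t} s * f s * m k s) - (LBINT r. indicator {0..t} r * f r * m k (t - r)) = (LBINT s. indicator {0..t} s * f s * m k s - indicator {0..t} s * f s * m k (t - s))"
    proof (rule Bochner_Integration.integral_diff[symmetric])
      have mb: "\<bar>m k x\<bar> \<le> \<eta> k powr - \<theta>" for x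
        using powr_mono2'[of "- \<theta>" "\<eta> k" x] \<theta> \<eta>[of k] by (auto simp: m_def)
      have gen: "integrable lborel (\<lambda>s. indicator {0..t} s * f s * M s)"
        if [measurable]: "M \<in> borel_measurable borel" and M: "\<And>x. \<bar>M x\<bar> \<le> \<eta> k powr - \<theta>" for M
      proof (rule Bochner_Integration.integrable_bound)
        show "integrable lborel (\<lambda>s. \<eta> k powr - \<theta> * f s)" using fint by simp
        show "AE s in lborel. norm (indicator {0..t} s * f s * M s) \<le> norm (\<eta> k powr - \<theta> * f s)"
        proof (intro AE_I2)
          fix s
          have "\<bar>f s\<bar> * \<bar>M s\<bar> \<le> \<bar>f s\<bar> * \<eta> k powr - \<theta>" by (intro mult_left_mono M) simp
          then show "norm (indicator {0..t} s * f s * M s) \<le> norm (\<eta> k powr - \<theta> * f s)"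
            by (simp add: indicator_def abs_mult mult.commute)
        qed
      qed measurable
      have [measurable]: "m k \<in> borel_measurable borel" unfolding m_def[abs_def] by measurable
      show "integrable lborel (\<lambda>s. indicator {0..t} s * f s * m k s)"
        by (rule gen[OF _ mb]) measurable
      show "integrable lborel (\<lambda>s. indicator {0..t} s * f s * m k (t - s))"
        by (rule gen[OF _ mb]) measurable
    qed
    finally show ?thesis by (simp add: right_diff_distrib)
  qed
  have lim2: "(\<lambda>k. LBINT s. indicator {0..t} s * f s * (m k s - m k (t - s))) \<longlonglongrightarrow> (LBINT s. ?I1 s - ?I2 s)"
  proof (rule integral_dominated_convergence[where w = "\<lambda>s. \<bar>?I1 s\<bar> + \<bar>?I2 s\<bar>"])
    show "integrable lborel (\<lambda>s. \<bar>?I1 s\<bar> + \<bar>?I2 s\<bar>)" using I1 I2 by simp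
    have ae: "AE s in lborel. s \<noteq> 0 \<and> s \<noteq> t"
      using AE_lborel_singleton[of 0] AE_lborel_singleton[of t] by eventually_elim simp
    show "AE s in lborel. (\<lambda>k. indicator {0..t} s * f s * (m k s - m k (t - s))) \<longlonglongrightarrow> ?I1 s - ?I2 s"
      using ae
    proof eventually_elim
      case (elim s)
      show ?case
      proof (cases "s \<in> {0..t}")
        case True
        then have "\<forall>\<^sub>F k in sequentially. \<eta> k < min s (t - s)" using elim by (intro order_tendstoD(2)[OF \<eta>0]) auto
        then have "\<forall>\<^sub>F k in sequentially. indicator {0..t} s * f s * (m k s - m k (t - s)) = ?I1 s - ?I2 s"
          by eventually_elim (auto simp: m_def algebra_simps)
        then show ?thesis by (rule tendsto_eventually)
      qed simp
    qed
    show "AE s in lborel. norm (indicator {0..t} s * f s * (m k s - m k (t - s))) \<le> \<bar>?I1 s\<bar> + \<bar>?I2 s\<bar>" for k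
      using ae
    proof eventually_elim
      case (elim s)
      show ?case
      proof (cases "s \<in> {0..t}")
        case True
        \<comment> \<open>Both \<open>m k s\<close> and \<open>m k (t - s)\<close> lie below \<eta>
          powr -\<theta> by at most their own power. Hence their difference has a bound free of
          \<eta>, which serves as integrable majorant.\<close>
        have m1: "m k x \<le> \<eta> k powr - \<theta>" "\<eta> k powr - \<theta> - x powr - \<theta> \<le> m k x" if "0 < x" for x
          using that powr_mono2'[of "- \<theta>" x "\<eta> k"] \<theta> \<eta>[of k] by (auto simp: m_def)
        have "\<bar>m k s - m k (t - s)\<bar> \<le> (t - s) powr - \<theta> + s powr - \<theta>"
        proof -
          have pos: "0 < s" "0 < t - s" using True elim by auto
          have "0 \<le> s powr - \<theta>" "0 \<le> (t - s) powr - \<theta>" by auto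
          then show ?thesis using m1[OF pos(1)] m1[OF pos(2)] by linarith
        qed
        then have "\<bar>f s\<bar> * \<bar>m k s - m k (t - s)\<bar> \<le> \<bar>f s\<bar> * ((t - s) powr - \<theta> + s powr - \<theta>)"
          by (intro mult_left_mono) auto
        then show ?thesis using True by (simp add: abs_mult distrib_left)
      qed simp
    qed
  qed (auto simp: m_def[abs_def])
  have "(LBINT s. ?I1 s - ?I2 s) = \<theta> * (LINT p|(lborel \<Otimes>\<^sub>M lborel). ?E p)"
    using LIMSEQ_unique[OF lim2[folded Ek] tendsto_mult[OF tendsto_const lim1]] .
  then show "\<theta> * (LINT p|(lborel \<Otimes>\<^sub>M lborel). ?E p) = (LBINT s. ?I1 s) - (LBINT s. ?I2 s)"
    using Bochner_Integration.integral_diff[OF I1 I2] by simp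
qed

text \<open>The integrated form of D^\<theta> f = (I^(1-\<theta>) f)', which avoids differentiating
  an almost everywhere defined function. The weight term f(s) s powr -\<theta> cancels against the
  second integral of \<open>frac_deriv_double_integral\<close>.\<close>

lemma frac_int_1_frac_deriv:
  assumes \<theta>: "0 < \<theta>" "\<theta> < 1" and f: "W0_ext \<theta> T f"
  shows "AE t in lborel. t \<le> T \<longrightarrow> frac_int 1 (frac_deriv_ext \<theta> T f) t = frac_int (1 - \<theta>) f t"
proof -
  have [measurable]: "f \<in> borel_measurable borel" using f by (rule W0_ext_borel)
  have G: "0 < Gamma (1 - \<theta>)" using \<theta> by (intro Gamma_real_pos) auto
  have fL: "L1_on T f" using f \<theta>(1) by (rule L1_on_W0_ext)
  have z: "\<And>s. s \<notin> {0..T} \<Longrightarrow> f s = 0" using f by (simp add: W0_ext_def)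
  have fin: "AE t in lborel. t \<le> T \<longrightarrow> frac_int_abs (1 - \<theta>) f t < \<infinity>"
    using \<theta> fL by (intro frac_int_abs_finite) auto
  show ?thesis using fin
  proof eventually_elim
    case (elim t)
    show ?case
    proof (intro impI)
      assume tT: "t \<le> T"
      show "frac_int 1 (frac_deriv_ext \<theta> T f) t = frac_int (1 - \<theta>) f t"
      proof (cases "0 < t")
        case False
        then have e: "frac_kernel 1 (t - s) * frac_deriv_ext \<theta> T f s = 0" "frac_kernel (1 - \<theta>) (t - s) * f s = 0" for s
          using z by (auto simp: frac_kernel_def frac_deriv_ext_def)
        show ?thesis unfolding frac_int_def by (simp only: e)
      next
        case t: True
        note D = frac_deriv_double_integral[OF \<theta> f t tT]
        let ?E = "\<lambda>s r. indicator {0..t} s * (indicator {0..s} r * ((f s - f r) / (s - r) powr (\<theta> + 1)))"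
        have Eint: "integrable (lborel \<Otimes>\<^sub>M lborel) (\<lambda>(s, r). ?E s r)"
        proof (rule Bochner_Integration.integrable_bound[OF W0_ext_integrable(2)[OF f]])
          show "(\<lambda>(s, r). ?E s r) \<in> borel_measurable (lborel \<Otimes>\<^sub>M lborel)"
            unfolding indicator_def atLeastAtMost_iff by measurable
        qed (use tT in \<open>auto intro!: AE_I2 simp: indicator_def\<close>)
        have fin': "frac_int_abs (1 - \<theta>) f t < \<infinity>" using elim tT by simp
        have "frac_int 1 (frac_deriv_ext \<theta> T f) t = (LBINT s. 1 / Gamma (1 - \<theta>) * (indicator {0..t} s * f s * s powr - \<theta> + \<theta> * (LBINT r. ?E s r)))"
          unfolding frac_int_def
        proof (rule integral_cong_AE)
          have [measurable]: "frac_deriv_ext \<theta> T f \<in> borel_measurable borel"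
            using L1_on_borel[OF L1_on_frac_deriv_ext[OF f]] .
          show "(\<lambda>s. frac_kernel 1 (t - s) * frac_deriv_ext \<theta> T f s) \<in> borel_measurable lborel" by measurable
          show "(\<lambda>s. 1 / Gamma (1 - \<theta>) * (indicator {0..t} s * f s * s powr - \<theta> + \<theta> * (LBINT r. ?E s r))) \<in> borel_measurable lborel"
            using borel_measurable_integrable[OF lborel_pair.integrable_fst[OF Eint]] by measurable
          show "AE s in lborel. frac_kernel 1 (t - s) * frac_deriv_ext \<theta> T f s = 1 / Gamma (1 - \<theta>) * (indicator {0..t} s * f s * s powr - \<theta> + \<theta> * (LBINT r. ?E s r))"
            using AE_lborel_singleton[of t]
          proof eventually_elim
            case (elim s)
            show ?case
            proof (cases "s \<in> {0..t}")
              case True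
              then show ?thesis using elim tT by (auto simp: frac_kernel_1 frac_deriv_ext_def powr_minus_divide)
            qed (auto simp: frac_kernel_1 frac_deriv_ext_def)
          qed
        qed
        also have "\<dots> = 1 / Gamma (1 - \<theta>) * ((LBINT s. indicator {0..t} s * f s * s powr - \<theta>) + \<theta> * (LBINT s. LBINT r. ?E s r))"
          using D(3)[OF fin'] lborel_pair.integrable_fst[OF Eint] by simp
        also have "(LBINT s. LBINT r. ?E s r) = (LINT p|(lborel \<Otimes>\<^sub>M lborel). (case p of (s, r) \<Rightarrow> ?E s r))"
          using Eint by (rule lborel_pair.integral_fst)
        also have "1 / Gamma (1 - \<theta>) * ((LBINT s. indicator {0..t} s * f s * s powr - \<theta>) + \<theta> * \<dots>)
          = 1 / Gamma (1 - \<theta>) * (LBINT s. indicator {0..t} s * f s * (t - s) powr - \<theta>)"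
          unfolding D(1)[OF fin'] by simp
        also have "\<dots> = (LBINT s. 1 / Gamma (1 - \<theta>) * (indicator {0..t} s * f s * (t - s) powr - \<theta>))" by simp
        also have "\<dots> = frac_int (1 - \<theta>) f t"
          unfolding frac_int_def
          by (intro Bochner_Integration.integral_cong refl) (use z in \<open>auto simp: frac_kernel_def indicator_def\<close>)
        finally show ?thesis .
      qed
    qed
  qed
qed

lemma exists_left_approximation:
  assumes "AE x in lborel. P (x::real)" and "a < b"
  shows "\<exists>x. a < x \<and> x < b \<and> P x"
proof (rule ccontr)
  assume neg: "\<not> ?thesis"
  have "AE x in lborel. x \<notin> {a<..<b}" using assms(1) by eventually_elim (use neg in auto)
  then have "emeasure lborel {x \<in> space lborel. \<not> x \<notin> {a<..<b}} = 0"
    by (subst (asm) AE_iff_measurable[OF _ refl]) auto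
  moreover have "{x \<in> space lborel. \<not> x \<notin> {a<..<b}} = {a<..<b}" by auto
  ultimately have "emeasure lborel {a<..<b} = 0" by simp
  then show False using assms(2) by simp
qed

text \<open>Left approximation by good points makes the primitive vanish at every t \<le> T. Then
  the positive and negative parts of v are densities of two measures that agree on all half-lines,
  hence coincide.\<close>

lemma frac_int_1_eq_0_imp:
  assumes v: "L1_on T v" and ae: "AE t in lborel. t \<le> T \<longrightarrow> frac_int 1 v t = 0"
  shows "AE t in lborel. v t = 0"
proof -
  have [measurable]: "v \<in> borel_measurable borel" using v by (rule L1_on_borel)
  have vint: "integrable lborel v" and z: "\<And>s. s \<notin> {0..T} \<Longrightarrow> v s = 0" using v by (auto simp: L1_on_def)
  have I: "frac_int 1 v t = (LBINT s. indicator {..<t} s * v s)" for t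
    unfolding frac_int_def by (intro Bochner_Integration.integral_cong refl) (auto simp: frac_kernel_1 indicator_def)
  have zero_le: "(LBINT s. indicator {..<t} s * v s) = 0" if t: "t \<le> T" for t
  proof -
    have "\<exists>x. t - 1 / real (Suc n) < x \<and> x < t \<and> (x \<le> T \<longrightarrow> frac_int 1 v x = 0)" for n
      by (rule exists_left_approximation[OF ae]) simp
    then obtain x where x: "\<And>n. t - 1 / real (Suc n) < x n" "\<And>n. x n < t" "\<And>n. frac_int 1 v (x n) = 0"
      using t by (metis less_le_trans less_imp_le)
    have "(\<lambda>n. t - 1 / real (Suc n)) \<longlonglongrightarrow> t - 0"
      by (intro tendsto_diff tendsto_const LIMSEQ_Suc[OF lim_1_over_n])
    then have lim: "(\<lambda>n. t - 1 / real (Suc n)) \<longlonglongrightarrow> t" by (simp only: diff_zero)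
    have xt: "x \<longlonglongrightarrow> t"
    proof (rule tendsto_sandwich[OF _ _ lim tendsto_const])
      show "\<forall>\<^sub>F n in sequentially. t - 1 / real (Suc n) \<le> x n" using x(1) by (intro always_eventually allI less_imp_le)
      show "\<forall>\<^sub>F n in sequentially. x n \<le> t" using x(2) by (intro always_eventually allI less_imp_le)
    qed
    have "(\<lambda>n. LBINT s. indicator {..<x n} s * v s) \<longlonglongrightarrow> (LBINT s. indicator {..<t} s * v s)"
    proof (rule integral_dominated_convergence[where w = "\<lambda>s. \<bar>v s\<bar>"])
      show "AE s in lborel. (\<lambda>n. indicator {..<x n} s * v s) \<longlonglongrightarrow> indicator {..<t} s * v s"
      proof (intro AE_I2)
        fix s
        show "(\<lambda>n. indicator {..<x n} s * v s) \<longlonglongrightarrow> indicator {..<t} s * v s"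
        proof (cases "s < t")
          case True
          then have "\<forall>\<^sub>F n in sequentially. s < x n" using xt by (intro order_tendstoD(1))
          then show ?thesis by (intro tendsto_eventually, eventually_elim) (use True in auto)
        next
          case False
          then have "indicator {..<x n} s = (0::real)" for n using x(2)[of n] by auto
          then show ?thesis using False by simp
        qed
      qed
    qed (use vint in \<open>auto simp: indicator_def\<close>)
    then show ?thesis using x(3) by (simp add: I LIMSEQ_const_iff)
  qed
  have zero_gt: "(LBINT s. indicator {x<..} s * v s) = 0" for x
  proof -
    have tot: "(LBINT s. v s) = 0"
    proof -
      have "(LBINT s. v s) = (LBINT s. indicator {..<T} s * v s)"
        by (rule integral_cong_AE) (use AE_lborel_singleton[of T] z in \<open>auto elim!: eventually_mono simp: indicator_def\<close>)
      then show ?thesis using zero_le[of T] by simp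
    qed
    have "(LBINT s. indicator {..<min x T} s * v s) = (LBINT s. indicator {..x} s * v s)"
    proof (rule integral_cong_AE)
      show "AE s in lborel. indicator {..<min x T} s * v s = indicator {..x} s * v s"
        using AE_lborel_singleton[of x] AE_lborel_singleton[of T] by eventually_elim (use z in \<open>auto simp: indicator_def\<close>)
    qed measurable
    then have le: "(LBINT s. indicator {..x} s * v s) = 0" using zero_le[of "min x T"] by simp
    have "(LBINT s. v s) = (LBINT s. indicator {..x} s * v s + indicator {x<..} s * v s)"
      by (intro Bochner_Integration.integral_cong refl) (auto simp: indicator_def)
    also have "\<dots> = (LBINT s. indicator {..x} s * v s) + (LBINT s. indicator {x<..} s * v s)"
      using vint integrable_real_mult_indicator[of "{..x}" lborel v] integrable_real_mult_indicator[of "{x<..}" lborel v]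
      by (intro Bochner_Integration.integral_add) (auto simp: mult.commute)
    finally show ?thesis using tot le by simp
  qed
  have em: "emeasure (density lborel (\<lambda>s. ennreal (max 0 (c * v s)))) {x<..} = ennreal (LBINT s. indicator {x<..} s * max 0 (c * v s))" for c x
  proof -
    have "emeasure (density lborel (\<lambda>s. ennreal (max 0 (c * v s)))) {x<..} = (\<integral>\<^sup>+s. ennreal (indicator {x<..} s * max 0 (c * v s)) \<partial>lborel)"
      by (subst emeasure_density) (auto intro!: nn_integral_cong simp: indicator_def)
    also have "\<dots> = ennreal (LBINT s. indicator {x<..} s * max 0 (c * v s))"
    proof (rule nn_integral_eq_integral)
      show "integrable lborel (\<lambda>s. indicator {x<..} s * max 0 (c * v s))"
        by (rule Bochner_Integration.integrable_bound[of _ "\<lambda>s. c * v s"]) (use vint in \<open>auto simp: indicator_def\<close>)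
    qed auto
    finally show ?thesis .
  qed
  have "density lborel (\<lambda>s. ennreal (max 0 (1 * v s))) = density lborel (\<lambda>s. ennreal (max 0 (- 1 * v s)))"
  proof (rule measure_eqI_lessThan)
    fix x :: real
    show "emeasure (density lborel (\<lambda>s. ennreal (max 0 (1 * v s)))) {x<..} < \<infinity>" unfolding em by simp
    have pint: "integrable lborel (\<lambda>s. indicator {x<..} s * max 0 (c * v s))" for c
      by (rule Bochner_Integration.integrable_bound[of _ "\<lambda>s. c * v s"]) (use vint in \<open>auto simp: indicator_def\<close>)
    have "(LBINT s. indicator {x<..} s * max 0 (1 * v s)) - (LBINT s. indicator {x<..} s * max 0 (- 1 * v s))
       = (LBINT s. indicator {x<..} s * max 0 (1 * v s) - indicator {x<..} s * max 0 (- 1 * v s))"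
      by (rule Bochner_Integration.integral_diff[OF pint pint, symmetric])
    also have "\<dots> = (LBINT s. indicator {x<..} s * v s)"
      by (intro Bochner_Integration.integral_cong refl) (auto simp: indicator_def)
    finally show "emeasure (density lborel (\<lambda>s. ennreal (max 0 (1 * v s)))) {x<..} = emeasure (density lborel (\<lambda>s. ennreal (max 0 (- 1 * v s)))) {x<..}"
      unfolding em zero_gt by simp
  qed auto
  then have "AE s in lborel. ennreal (max 0 (1 * v s)) = ennreal (max 0 (- 1 * v s))"
    by (intro sigma_finite_measure.density_unique[OF sigma_finite_lborel]) auto
  then show ?thesis by eventually_elim (auto simp: max_def split: if_splits)
qed

section \<open>Fractional derivatives of different orders and the pairing\<close>

text \<open>Both sides have the same primitive: I^1 I^(b-a) D^b f = I^(b-a) I^1 D^b f = I^(b-a)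
  I^(1-b) f = I^(1-a) f = I^1 D^a f. An integrable function with zero primitive vanishes almost
  everywhere.\<close>

lemma frac_deriv_ext_lower_order:
  assumes a: "0 < a" "a < b" "b < 1" and f: "W0_ext a T f" "W0_ext b T f"
  shows "AE t in lborel. t \<le> T \<longrightarrow> frac_deriv_ext a T f t = frac_int (b - a) (frac_deriv_ext b T f) t"
proof -
  define u where "u = frac_deriv_ext a T f"
  define u' where "u' = frac_deriv_ext b T f"
  \<comment> \<open>The fractional integral of u' does not vanish beyond T, so it is cut off to
    become an \<open>L1_on\<close> function; up to T nothing changes.\<close>
  define w where "w t = indicator {0..T} t * frac_int (b - a) u' t" for t
  have uL: "L1_on T u" "L1_on T u'" unfolding u_def u'_def by (intro L1_on_frac_deriv_ext f)+
  have wL: "L1_on T w" unfolding w_def using a uL by (intro L1_on_frac_int) auto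
  have fL: "L1_on T f" using f(1) a(1) by (rule L1_on_W0_ext)
  have [measurable]: "u \<in> borel_measurable borel" "u' \<in> borel_measurable borel" "w \<in> borel_measurable borel" "f \<in> borel_measurable borel"
    using uL wL fL by (auto intro: L1_on_borel)
  have below: "frac_int c u' t = 0" if "t \<le> 0" for c t
  proof -
    have "frac_kernel c (t - s) * u' s = 0" for s
      using that uL(2) by (auto simp: frac_kernel_def L1_on_def)
    then show ?thesis unfolding frac_int_def by (simp only:) simp
  qed
  have w_eq: "w t = frac_int (b - a) u' t" if "t \<le> T" for t
    using that below[of t "b - a"] by (cases "0 \<le> t") (auto simp: w_def)
  have A1: "AE t in lborel. t \<le> T \<longrightarrow> frac_int 1 u t = frac_int (1 - a) f t"
    unfolding u_def using a f by (intro frac_int_1_frac_deriv) auto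
  have A2: "AE t in lborel. t \<le> T \<longrightarrow> frac_int 1 u' t = frac_int (1 - b) f t"
    unfolding u'_def using a f by (intro frac_int_1_frac_deriv) auto
  have A3: "AE t in lborel. t \<le> T \<longrightarrow> frac_int 1 (frac_int (b - a) u') t = frac_int (1 + (b - a)) u' t"
    using a uL by (intro frac_int_semigroup) auto
  have A4: "AE t in lborel. t \<le> T \<longrightarrow> frac_int (b - a) (frac_int 1 u') t = frac_int ((b - a) + 1) u' t"
    using a uL by (intro frac_int_semigroup) auto
  have A5: "AE t in lborel. t \<le> T \<longrightarrow> frac_int (b - a) (frac_int (1 - b) f) t = frac_int ((b - a) + (1 - b)) f t"
    using a fL by (intro frac_int_semigroup) auto
  have A6: "frac_int (b - a) (frac_int 1 u') t = frac_int (b - a) (frac_int (1 - b) f) t" if "t \<le> T" for t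
    using that A2 by (intro frac_int_cong_AE) auto
  have A7: "frac_int 1 w t = frac_int 1 (frac_int (b - a) u') t" if "t \<le> T" for t
    using that w_eq by (intro frac_int_cong_AE) auto
  define v where "v t = u t - w t" for t
  have vL: "L1_on T v" using uL wL unfolding v_def[abs_def] L1_on_def by auto
  have "AE t in lborel. t \<le> T \<longrightarrow> frac_int 1 v t = 0"
    using A1 A3 A4 A5 frac_int_abs_finite[OF zero_less_one uL(1)] frac_int_abs_finite[OF zero_less_one wL]
  proof eventually_elim
    case (elim t)
    show ?case
    proof
      assume t: "t \<le> T"
      have "frac_int 1 v t = (LBINT s. frac_kernel 1 (t - s) * u s - frac_kernel 1 (t - s) * w s)"
        unfolding frac_int_def v_def by (simp add: right_diff_distrib)
      also have "\<dots> = frac_int 1 u t - frac_int 1 w t"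
        unfolding frac_int_def using elim t by (intro Bochner_Integration.integral_diff frac_int_integrable) auto
      also have "frac_int 1 u t = frac_int 1 w t"
      proof -
        have "frac_int 1 w t = frac_int (1 + (b - a)) u' t" using elim t A7 by simp
        also have "\<dots> = frac_int ((b - a) + 1) u' t" by (simp add: add.commute)
        also have "\<dots> = frac_int (b - a) (frac_int (1 - b) f) t" using elim t A6 by simp
        also have "\<dots> = frac_int (1 - a) f t" using elim t by simp
        finally show ?thesis using elim t by simp
      qed
      finally show "frac_int 1 v t = 0" by simp
    qed
  qed
  then have "AE t in lborel. v t = 0" by (rule frac_int_1_eq_0_imp[OF vL])
  then show ?thesis unfolding u_def[symmetric] u'_def[symmetric]
    by eventually_elim (use w_eq in \<open>auto simp: v_def\<close>)
qed

text \<open>Fubini, then the substitution x = T - t, under which the kernel depends on (T - s) - x.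
  Boundedness of w makes the double integral absolutely convergent; the bound is asked only inside
  the interval, the endpoints being null.\<close>

lemma frac_int_duality:
  assumes a: "0 < a" and u: "L1_on T u" and w: "L1_on T w" and bd: "\<And>s. s \<in> {0<..<T} \<Longrightarrow> \<bar>w s\<bar> \<le> K"
  shows "(LBINT t. frac_int a u t * w (T - t)) = (LBINT s. u s * frac_int a w (T - s))"
proof -
  have [measurable]: "u \<in> borel_measurable borel" "w \<in> borel_measurable borel" using u w by (auto intro: L1_on_borel)
  have wz: "w s = 0" if "s \<notin> {0..T}" for s using w that by (simp add: L1_on_def)
  let ?f = "\<lambda>t s. frac_kernel a (t - s) * u s * w (T - t)"
  have int: "integrable (lborel \<Otimes>\<^sub>M lborel) (\<lambda>(t, s). ?f t s)"
  proof (rule integrableI_bounded)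
    have "(\<integral>\<^sup>+p. ennreal (norm (case p of (t, s) \<Rightarrow> ?f t s)) \<partial>(lborel \<Otimes>\<^sub>M lborel))
      = (\<integral>\<^sup>+t. \<integral>\<^sup>+s. ennreal (norm (?f t s)) \<partial>lborel \<partial>lborel)"
    proof -
      have "(\<lambda>p. ennreal (norm (case p of (t, s) \<Rightarrow> ?f t s))) \<in> borel_measurable (lborel \<Otimes>\<^sub>M lborel)" by measurable
      from lborel.nn_integral_fst[OF this] show ?thesis by simp
    qed
    also have "\<dots> \<le> (\<integral>\<^sup>+t. ennreal \<bar>K\<bar> * (ennreal (frac_kernel 1 (T - t)) * frac_int_abs a u t) \<partial>lborel)"
    proof (rule nn_integral_mono_AE)
      show "AE t in lborel. (\<integral>\<^sup>+s. ennreal (norm (?f t s)) \<partial>lborel) \<le> ennreal \<bar>K\<bar> * (ennreal (frac_kernel 1 (T - t)) * frac_int_abs a u t)"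
        using AE_lborel_singleton[of 0] AE_lborel_singleton[of T]
      proof eventually_elim
        case (elim t)
        have "(\<integral>\<^sup>+s. ennreal (norm (?f t s)) \<partial>lborel) = (\<integral>\<^sup>+s. (ennreal (frac_kernel a (t - s)) * ennreal \<bar>u s\<bar>) * ennreal \<bar>w (T - t)\<bar> \<partial>lborel)"
          using a by (intro nn_integral_cong) (simp add: abs_mult ennreal_mult)
        also have "\<dots> = frac_int_abs a u t * ennreal \<bar>w (T - t)\<bar>"
          unfolding frac_int_abs_def by (rule nn_integral_multc) measurable
        also have "\<dots> \<le> ennreal \<bar>K\<bar> * (ennreal (frac_kernel 1 (T - t)) * frac_int_abs a u t)"
        proof (cases "T - t \<in> {0<..<T}")
          case True
          have "ennreal \<bar>w (T - t)\<bar> \<le> ennreal \<bar>K\<bar>" using bd[OF True] by (intro ennreal_leI) linarith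
          then have "frac_int_abs a u t * ennreal \<bar>w (T - t)\<bar> \<le> frac_int_abs a u t * ennreal \<bar>K\<bar>" by (rule mult_left_mono) simp
          then show ?thesis using True by (simp add: frac_kernel_1 mult.commute)
        next
          case False
          then have "w (T - t) = 0" using elim wz[of "T - t"] by fastforce
          then show ?thesis by simp
        qed
        finally show ?case .
      qed
    qed
    also have "\<dots> = ennreal \<bar>K\<bar> * frac_int_abs (1 + a) u T"
      using a by (subst nn_integral_cmult) (auto simp: frac_int_abs_conv)
    also have "\<dots> < \<infinity>"
      using frac_int_abs_at_end_finite[OF a u] by (simp add: ennreal_mult_less_top)
    finally show "(\<integral>\<^sup>+p. ennreal (norm (case p of (t, s) \<Rightarrow> ?f t s)) \<partial>(lborel \<Otimes>\<^sub>M lborel)) < \<infinity>" .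
  qed measurable
  have "(LBINT t. frac_int a u t * w (T - t)) = (LBINT t. LBINT s. ?f t s)"
    unfolding frac_int_def by simp
  also have "\<dots> = (LBINT s. LBINT t. ?f t s)"
    by (rule lborel_pair.Fubini_integral[OF int, symmetric])
  also have "\<dots> = (LBINT s. u s * frac_int a w (T - s))"
  proof (rule Bochner_Integration.integral_cong[OF refl])
    fix s
    have "(LBINT t. ?f t s) = (LBINT t. u s * (frac_kernel a (t - s) * w (T - t)))" by (simp add: ac_simps)
    also have "\<dots> = u s * (LBINT t. frac_kernel a (t - s) * w (T - t))" by simp
    also have "(LBINT t. frac_kernel a (t - s) * w (T - t)) = (LBINT x. frac_kernel a (T - s - x) * w x)"
      using lborel_integral_real_affine[of "-1" "\<lambda>t. frac_kernel a (t - s) * w (T - t)" T] by (simp add: algebra_simps)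
    finally show "(LBINT t. ?f t s) = u s * frac_int a w (T - s)" by (simp add: frac_int_def)
  qed
  finally show ?thesis .
qed

text \<open>On the left D^\<theta> f = I^\<delta> D^\<theta>' f, on the right D^(1-\<theta>') h =
  I^\<delta> D^(1-\<theta>) h, with the same \<delta> = \<theta>' - \<theta>. Duality moves
  I^\<delta> from one factor to the other.\<close>

lemma frac_deriv_pairing_independent_less:
  assumes \<theta>: "0 < \<theta>" "\<theta> < \<theta>'" "\<theta>' < 1"
    and f: "W0_ext \<theta> T f" "W0_ext \<theta>' T f" and h: "W0_ext (1 - \<theta>) T h" "W0_ext (1 - \<theta>') T h"
    and bd: "\<And>s. s \<in> {0<..<T} \<Longrightarrow> \<bar>frac_deriv_ext (1 - \<theta>) T h s\<bar> \<le> K"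
  shows "(LBINT t. frac_deriv_ext \<theta> T f t * frac_deriv_ext (1 - \<theta>) T h (T - t))
       = (LBINT t. frac_deriv_ext \<theta>' T f t * frac_deriv_ext (1 - \<theta>') T h (T - t))"
proof -
  define u where "u = frac_deriv_ext \<theta>' T f"
  define w where "w = frac_deriv_ext (1 - \<theta>) T h"
  have uL: "L1_on T u" and wL: "L1_on T w" unfolding u_def w_def by (intro L1_on_frac_deriv_ext f h)+
  have [measurable]: "u \<in> borel_measurable borel" "w \<in> borel_measurable borel" using uL wL by (auto intro: L1_on_borel)
  have [measurable]: "frac_deriv_ext \<theta> T f \<in> borel_measurable borel" "frac_deriv_ext (1 - \<theta>') T h \<in> borel_measurable borel"
    using L1_on_borel[OF L1_on_frac_deriv_ext[OF f(1)]] L1_on_borel[OF L1_on_frac_deriv_ext[OF h(2)]] by auto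
  have \<delta>: "1 - \<theta> - (1 - \<theta>') = \<theta>' - \<theta>" by simp
  have 1: "AE t in lborel. t \<le> T \<longrightarrow> frac_deriv_ext \<theta> T f t = frac_int (\<theta>' - \<theta>) u t"
    unfolding u_def using \<theta> f by (intro frac_deriv_ext_lower_order) auto
  have 2: "AE t in lborel. t \<le> T \<longrightarrow> frac_deriv_ext (1 - \<theta>') T h t = frac_int (\<theta>' - \<theta>) w t"
    unfolding w_def \<delta>[symmetric] using \<theta> h by (intro frac_deriv_ext_lower_order) auto
  have 3: "AE t in lborel. T - t \<le> T \<longrightarrow> frac_deriv_ext (1 - \<theta>') T h (T - t) = frac_int (\<theta>' - \<theta>) w (T - t)"
    using AE_borel_affine[OF _ _ 2, of "-1" T] by simp
  have "(LBINT t. frac_deriv_ext \<theta> T f t * w (T - t)) = (LBINT t. frac_int (\<theta>' - \<theta>) u t * w (T - t))"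
  proof (rule integral_cong_AE)
    show "AE t in lborel. frac_deriv_ext \<theta> T f t * w (T - t) = frac_int (\<theta>' - \<theta>) u t * w (T - t)"
      using 1 by eventually_elim (use wL in \<open>force simp: L1_on_def\<close>)
  qed measurable
  also have "\<dots> = (LBINT s. u s * frac_int (\<theta>' - \<theta>) w (T - s))"
    using \<theta> bd unfolding w_def[symmetric] by (intro frac_int_duality[OF _ uL wL]) auto
  also have "\<dots> = (LBINT s. u s * frac_deriv_ext (1 - \<theta>') T h (T - s))"
  proof (rule integral_cong_AE)
    show "AE s in lborel. u s * frac_int (\<theta>' - \<theta>) w (T - s) = u s * frac_deriv_ext (1 - \<theta>') T h (T - s)"
      using 3 by eventually_elim (use uL in \<open>force simp: L1_on_def\<close>)
  qed measurable
  finally show ?thesis unfolding u_def w_def .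
qed

lemma frac_deriv_pairing_independent:
  assumes \<theta>: "0 < \<theta>" "\<theta> < 1" "0 < \<theta>'" "\<theta>' < 1"
    and f: "W0_ext \<theta> T f" "W0_ext \<theta>' T f" and h: "W0_ext (1 - \<theta>) T h" "W0_ext (1 - \<theta>') T h"
    and bd: "\<And>s. s \<in> {0<..<T} \<Longrightarrow> \<bar>frac_deriv_ext (1 - \<theta>) T h s\<bar> \<le> K"
      "\<And>s. s \<in> {0<..<T} \<Longrightarrow> \<bar>frac_deriv_ext (1 - \<theta>') T h s\<bar> \<le> K'"
  shows "(LBINT t. frac_deriv_ext \<theta> T f t * frac_deriv_ext (1 - \<theta>) T h (T - t))
       = (LBINT t. frac_deriv_ext \<theta>' T f t * frac_deriv_ext (1 - \<theta>') T h (T - t))"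
proof (cases \<theta> \<theta>' rule: linorder_cases)
  case less
  show ?thesis by (rule frac_deriv_pairing_independent_less[OF \<theta>(1) less \<theta>(4) f h bd(1)])
next
  case greater
  show ?thesis by (rule frac_deriv_pairing_independent_less[OF \<theta>(3) greater \<theta>(2) f(2,1) h(2,1) bd(2), symmetric])
qed simp

section \<open>The generalized Lebesgue--Stieltjes integral\<close>

text \<open>Holds for every F, since completing a measure does not change nonnegative integrals.
  Expressions in a merely Lebesgue measurable f can thus be rewritten before its Borel
  representative is inserted.\<close>

lemma nn_integral_lebesgue_on:
  assumes "S \<in> sets lebesgue"
  shows "(\<integral>\<^sup>+x. F x \<partial>lebesgue_on S) = (\<integral>\<^sup>+x. indicator S x * F x \<partial>lborel)"
  using assms by (simp add: nn_integral_restrict_space nn_integral_completion mult.commute)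

lemma nn_integral_lebesgue_on_Icc:
  "(\<integral>\<^sup>+x. F x \<partial>lebesgue_on {a..b::real}) = (\<integral>\<^sup>+x. indicator {a..b} x * F x \<partial>lborel)"
  by (rule nn_integral_lebesgue_on) simp

lemma AE_lebesgue_on_iff:
  assumes "S \<in> sets lebesgue"
  shows "(AE x in lebesgue_on S. P x) \<longleftrightarrow> (AE x in lborel. x \<in> S \<longrightarrow> P x)"
  using assms by (simp add: AE_restrict_space_iff AE_completion_iff)

lemma integral_lebesgue_on_cong_AE:
  fixes F G :: "real \<Rightarrow> real"
  assumes S: "S \<in> sets borel" and G: "G \<in> borel_measurable borel" and ae: "AE x in lborel. x \<in> S \<longrightarrow> F x = G x"
  shows "(LINT x|lebesgue_on S. F x) = (LBINT x. indicator S x * G x)"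
proof -
  have m: "(\<lambda>x. indicator S x *\<^sub>R G x) \<in> borel_measurable lebesgue"
    using S G by (intro measurable_completion) auto
  have eq: "AE x in lebesgue. indicator S x *\<^sub>R G x = indicator S x *\<^sub>R F x"
    unfolding AE_completion_iff using ae by eventually_elim auto
  have "(LINT x|lebesgue_on S. F x) = (LINT x|lebesgue. indicator S x *\<^sub>R F x)"
    using S by (subst integral_restrict_space) auto
  also have "\<dots> = (LINT x|lebesgue. indicator S x *\<^sub>R G x)"
    by (rule integral_cong_AE[OF borel_measurable_AE[OF m eq] m]) (use eq in \<open>auto elim: eventually_mono\<close>)
  also have "\<dots> = (LBINT x. indicator S x *\<^sub>R G x)"
    using S G by (intro integral_completion) auto
  finally show ?thesis by simp
qed

lemma borel_representative:
  fixes f :: "real \<Rightarrow> real"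
  assumes "f \<in> borel_measurable (lebesgue_on {0..T})"
  obtains f0 where "f0 \<in> borel_measurable borel" "\<And>s. s \<notin> {0..T} \<Longrightarrow> f0 s = 0"
    "AE s in lborel. s \<in> {0..T} \<longrightarrow> f s = f0 s"
proof -
  have "(\<lambda>x. if x \<in> {0..T} then f x else 0) \<in> borel_measurable lebesgue"
    using assms by (subst borel_measurable_if) auto
  then obtain g where g: "g \<in> borel_measurable lborel" "AE x in lborel. (if x \<in> {0..T} then f x else 0) = g x"
    using completion_ex_borel_measurable_real by blast
  show thesis
  proof (rule that[of "\<lambda>x. indicator {0..T} x * g x"])
    show "AE s in lborel. s \<in> {0..T} \<longrightarrow> f s = indicator {0..T} s * g s"
      using g(2) by eventually_elim (auto split: if_splits)
  qed (use g(1) in auto)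
qed

section \<open>Time reversal of the integrator and independence of the order\<close>

text \<open>The substitution x = T - t turns the right-sided derivative of Y - Y T into a left-sided
  one of this function, so the results on \<open>frac_deriv_ext\<close> cover the integrator as
  well.\<close>

definition reflected_increment :: "real \<Rightarrow> (real \<Rightarrow> real) \<Rightarrow> real \<Rightarrow> real" where
  "reflected_increment T Y x = indicator {0..T} x * (Y (T - x) - Y T)"

lemma borel_measurable_reflected_increment:
  assumes "continuous_on {0..T} Y"
  shows "reflected_increment T Y \<in> borel_measurable borel"
proof -
  have "continuous_on {0..T} (\<lambda>x. Y (T - x) - Y T)"
    by (intro continuous_intros continuous_on_compose2[OF assms]) auto
  then have "(\<lambda>x. indicator {0..T} x *\<^sub>R (Y (T - x) - Y T)) \<in> borel_measurable borel"
    by (intro borel_measurable_continuous_on_indicator) auto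
  then show ?thesis by (simp add: reflected_increment_def[abs_def])
qed

lemma frac_deriv_right_eq:
  assumes Y: "continuous_on {0..T} Y" and t: "t \<in> {0..T}"
  shows "frac_deriv_right \<theta> T (\<lambda>u. Y u - Y T) t = frac_deriv_ext \<theta> T (reflected_increment T Y) (T - t)"
proof -
  let ?h = "reflected_increment T Y"
  have [measurable]: "?h \<in> borel_measurable borel" using Y by (rule borel_measurable_reflected_increment)
  have "(LINT s|lebesgue_on {t..T}. ((Y t - Y T) - (Y s - Y T)) / (s - t) powr (\<theta> + 1))
    = (LBINT s. indicator {t..T} s * ((?h (T - t) - ?h (T - s)) / (s - t) powr (\<theta> + 1)))"
  proof (rule integral_lebesgue_on_cong_AE)
    show "(\<lambda>s. (?h (T - t) - ?h (T - s)) / (s - t) powr (\<theta> + 1)) \<in> borel_measurable borel" by measurable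
    show "AE s in lborel. s \<in> {t..T} \<longrightarrow> ((Y t - Y T) - (Y s - Y T)) / (s - t) powr (\<theta> + 1) = (?h (T - t) - ?h (T - s)) / (s - t) powr (\<theta> + 1)"
      using t by (auto simp: reflected_increment_def)
  qed simp
  also have "\<dots> = (LBINT x. indicator {0..T - t} x * ((?h (T - t) - ?h x) / (T - t - x) powr (\<theta> + 1)))"
    by (subst lborel_integral_real_affine[of "-1" _ T])
       (auto intro!: Bochner_Integration.integral_cong simp: indicator_def algebra_simps)
  finally show ?thesis using t
    by (simp add: frac_deriv_right_def frac_deriv_ext_def reflected_increment_def)
qed

lemma left_lim_continuous:
  assumes "continuous_on {0..T} Y" "0 < T"
  shows "left_lim Y T = Y T" and "(Y \<longlongrightarrow> Y T) (at_left T)"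
proof -
  have "(Y \<longlongrightarrow> Y T) (at T within {0..T})" using assms by (auto simp: continuous_on_def)
  then show lim: "(Y \<longlongrightarrow> Y T) (at_left T)" using assms(2) by (simp add: at_within_Icc_at_left)
  then show "left_lim Y T = Y T" unfolding left_lim_def by (intro tendsto_Lim) auto
qed

lemma frac_deriv_left_eq:
  assumes [measurable]: "f0 \<in> borel_measurable borel" and ae: "AE s in lborel. s \<in> {0..T} \<longrightarrow> f s = f0 s"
  shows "AE t in lborel. t \<in> {0..T} \<longrightarrow> frac_deriv_left \<theta> f t = frac_deriv_ext \<theta> T f0 t"
  using ae
proof eventually_elim
  case (elim t)
  show ?case
  proof
    assume t: "t \<in> {0..T}"
    have "(LINT s|lebesgue_on {0..t}. (f t - f s) / (t - s) powr (\<theta> + 1)) = (LBINT s. indicator {0..t} s * ((f0 t - f0 s) / (t - s) powr (\<theta> + 1)))"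
    proof (rule integral_lebesgue_on_cong_AE)
      show "AE s in lborel. s \<in> {0..t} \<longrightarrow> (f t - f s) / (t - s) powr (\<theta> + 1) = (f0 t - f0 s) / (t - s) powr (\<theta> + 1)"
        using ae by eventually_elim (use elim t in auto)
    qed auto
    then show "frac_deriv_left \<theta> f t = frac_deriv_ext \<theta> T f0 t"
      using t elim by (simp add: frac_deriv_left_def frac_deriv_ext_def)
  qed
qed

lemma gls_formula_eq:
  assumes [measurable]: "f0 \<in> borel_measurable borel"
    and ae: "AE s in lborel. s \<in> {0..T} \<longrightarrow> f s = f0 s"
    and Y: "continuous_on {0..T} Y" and T: "0 < T"
    and m [measurable]: "frac_deriv_ext \<theta> T f0 \<in> borel_measurable borel"
      "frac_deriv_ext (1 - \<theta>) T (reflected_increment T Y) \<in> borel_measurable borel"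
  shows "gls_formula \<theta> T f Y = - (LBINT t. frac_deriv_ext \<theta> T f0 t * frac_deriv_ext (1 - \<theta>) T (reflected_increment T Y) (T - t))"
proof -
  have "(LINT t|lebesgue_on {0..T}. frac_deriv_left \<theta> f t * frac_deriv_right (1 - \<theta>) T (\<lambda>u. Y u - left_lim Y T) t)
    = (LBINT t. indicator {0..T} t * (frac_deriv_ext \<theta> T f0 t * frac_deriv_ext (1 - \<theta>) T (reflected_increment T Y) (T - t)))"
  proof (rule integral_lebesgue_on_cong_AE)
    show "AE t in lborel. t \<in> {0..T} \<longrightarrow> frac_deriv_left \<theta> f t * frac_deriv_right (1 - \<theta>) T (\<lambda>u. Y u - left_lim Y T) t
      = frac_deriv_ext \<theta> T f0 t * frac_deriv_ext (1 - \<theta>) T (reflected_increment T Y) (T - t)"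
      using frac_deriv_left_eq[OF assms(1) ae, of \<theta>]
      by eventually_elim (auto simp: left_lim_continuous(1)[OF Y T] frac_deriv_right_eq[OF Y])
  qed auto
  also have "\<dots> = (LBINT t. frac_deriv_ext \<theta> T f0 t * frac_deriv_ext (1 - \<theta>) T (reflected_increment T Y) (T - t))"
  proof (rule Bochner_Integration.integral_cong[OF refl])
    fix t
    show "indicator {0..T} t * (frac_deriv_ext \<theta> T f0 t * frac_deriv_ext (1 - \<theta>) T (reflected_increment T Y) (T - t))
      = frac_deriv_ext \<theta> T f0 t * frac_deriv_ext (1 - \<theta>) T (reflected_increment T Y) (T - t)"
      by (cases "t \<in> {0..T}") (auto simp: frac_deriv_ext_def[of \<theta>])
  qed
  finally show ?thesis by (simp add: gls_formula_def)
qed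

lemma ennreal_powr_1 [simp]: "ennreal_powr x 1 = x"
  by (cases x) (auto simp: ennreal_powr_def)

lemma W0_space_imp_W0_ext:
  assumes f: "f \<in> W0_space \<theta> T" and f0: "f0 \<in> borel_measurable borel" "\<And>s. s \<notin> {0..T} \<Longrightarrow> f0 s = 0"
    and ae: "AE s in lborel. s \<in> {0..T} \<longrightarrow> f s = f0 s"
  shows "W0_ext \<theta> T f0"
proof -
  have n: "W0_norm \<theta> T f < \<infinity>" using f by (simp add: W0_space_def)
  have "(\<integral>\<^sup>+t. indicator {0..T} t * ennreal (\<bar>f0 t\<bar> / t powr \<theta>) \<partial>lborel) = (\<integral>\<^sup>+t. ennreal (\<bar>f t\<bar> / t powr \<theta>) \<partial>lebesgue_on {0..T})"
    unfolding nn_integral_lebesgue_on_Icc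
    by (intro nn_integral_cong_AE) (use ae in \<open>auto elim!: eventually_mono simp: indicator_def\<close>)
  also have "\<dots> < \<infinity>" using n unfolding W0_norm_def by (simp add: less_top)
  finally have 1: "(\<integral>\<^sup>+t. indicator {0..T} t * ennreal (\<bar>f0 t\<bar> / t powr \<theta>) \<partial>lborel) < \<infinity>" .
  have "(\<integral>\<^sup>+t. \<integral>\<^sup>+s. indicator {0..T} t * indicator {0..t} s * ennreal (\<bar>f0 t - f0 s\<bar> / (t - s) powr (\<theta> + 1)) \<partial>lborel \<partial>lborel)
    \<le> (\<integral>\<^sup>+t. (\<integral>\<^sup>+u. ennreal (\<bar>f t - f u\<bar> powr 1 / \<bar>t - u\<bar> powr (1 + \<theta> * 1)) \<partial>lebesgue_on {0..T}) \<partial>lebesgue_on {0..T})"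
    unfolding nn_integral_lebesgue_on_Icc
  proof (rule nn_integral_mono_AE)
    show "AE t in lborel. (\<integral>\<^sup>+s. indicator {0..T} t * indicator {0..t} s * ennreal (\<bar>f0 t - f0 s\<bar> / (t - s) powr (\<theta> + 1)) \<partial>lborel)
      \<le> indicator {0..T} t * (\<integral>\<^sup>+u. indicator {0..T} u * ennreal (\<bar>f t - f u\<bar> powr 1 / \<bar>t - u\<bar> powr (1 + \<theta> * 1)) \<partial>lborel)"
      using ae
    proof eventually_elim
      case (elim t)
      show ?case
      proof (cases "t \<in> {0..T}")
        case t: True
        have "(\<integral>\<^sup>+s. indicator {0..T} t * indicator {0..t} s * ennreal (\<bar>f0 t - f0 s\<bar> / (t - s) powr (\<theta> + 1)) \<partial>lborel)
          \<le> (\<integral>\<^sup>+u. indicator {0..T} u * ennreal (\<bar>f t - f u\<bar> powr 1 / \<bar>t - u\<bar> powr (1 + \<theta> * 1)) \<partial>lborel)"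
          by (rule nn_integral_mono_AE) (use ae in eventually_elim, use t elim in \<open>auto simp: indicator_def add.commute\<close>)
        then show ?thesis using t by simp
      qed simp
    qed
  qed
  also have "\<dots> < \<infinity>" using n unfolding W0_norm_def gagliardo_def by (simp add: less_top)
  finally have 2: "(\<integral>\<^sup>+t. \<integral>\<^sup>+s. indicator {0..T} t * indicator {0..t} s * ennreal (\<bar>f0 t - f0 s\<bar> / (t - s) powr (\<theta> + 1)) \<partial>lborel \<partial>lborel) < \<infinity>" .
  show ?thesis using 1 2 f0 by (simp add: W0_ext_def)
qed

text \<open>The conditions of \<open>WT_space\<close> are suprema over t, so the derivative is
  bounded and not only integrable. This is the bound on w that \<open>frac_int_duality\<close> asks
  for.\<close>

lemma reflected_increment_W0_ext:
  assumes T: "0 < T" and Y: "continuous_on {0..T} Y" and K: "0 \<le> K1" "0 \<le> K2" and \<theta>: "0 < \<theta>" "\<theta> < 1"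
    and b1: "\<And>t. t \<in> {0<..<T} \<Longrightarrow> \<bar>Y T - Y t\<bar> / (T - t) powr \<theta> \<le> K1"
    and b2: "\<And>t. t \<in> {0<..<T} \<Longrightarrow> (\<integral>\<^sup>+u. ennreal (\<bar>Y t - Y u\<bar> / \<bar>t - u\<bar> powr (1 + \<theta>)) \<partial>lebesgue_on {t..T}) \<le> ennreal K2"
  shows "W0_ext \<theta> T (reflected_increment T Y)"
    and "\<And>x. x \<in> {0<..<T} \<Longrightarrow> \<bar>frac_deriv_ext \<theta> T (reflected_increment T Y) x\<bar> \<le> (K1 + \<theta> * K2) / Gamma (1 - \<theta>)"
proof -
  let ?h = "reflected_increment T Y"
  have [measurable]: "?h \<in> borel_measurable borel" using Y by (rule borel_measurable_reflected_increment)
  have c1: "\<bar>?h x\<bar> / x powr \<theta> \<le> K1" if "x \<in> {0<..<T}" for x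
    using b1[of "T - x"] that by (simp add: reflected_increment_def abs_minus_commute)
  have c2: "(\<integral>\<^sup>+s. indicator {0..x} s * ennreal (\<bar>?h x - ?h s\<bar> / (x - s) powr (\<theta> + 1)) \<partial>lborel) \<le> ennreal K2" if x: "x \<in> {0<..<T}" for x
  proof -
    have "(\<integral>\<^sup>+s. indicator {0..x} s * ennreal (\<bar>?h x - ?h s\<bar> / (x - s) powr (\<theta> + 1)) \<partial>lborel)
      = (\<integral>\<^sup>+u. indicator {0..x} (T - u) * ennreal (\<bar>?h x - ?h (T - u)\<bar> / (x - (T - u)) powr (\<theta> + 1)) \<partial>lborel)"
      by (subst nn_integral_real_affine[of _ "-1" T]) auto
    also have "\<dots> = (\<integral>\<^sup>+u. indicator {T - x..T} u * ennreal (\<bar>Y (T - x) - Y u\<bar> / \<bar>(T - x) - u\<bar> powr (1 + \<theta>)) \<partial>lborel)"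
      using x by (intro nn_integral_cong) (auto simp: indicator_def reflected_increment_def algebra_simps)
    also have "\<dots> = (\<integral>\<^sup>+u. ennreal (\<bar>Y (T - x) - Y u\<bar> / \<bar>(T - x) - u\<bar> powr (1 + \<theta>)) \<partial>lebesgue_on {T - x..T})"
      by (subst nn_integral_lebesgue_on) auto
    also have "\<dots> \<le> ennreal K2" using x by (intro b2) auto
    finally show ?thesis .
  qed
  have endpoints: "AE x in lborel. x \<in> {0..T} \<longrightarrow> x \<in> {0<..<T}"
    using AE_lborel_singleton[of 0] AE_lborel_singleton[of T] by eventually_elim auto
  have fin: "(\<integral>\<^sup>+x. ennreal K * indicator {0..T} x \<partial>lborel) < \<infinity>" for K
    using T by (simp add: nn_integral_cmult ennreal_mult_less_top)
  have "(\<integral>\<^sup>+t. indicator {0..T} t * ennreal (\<bar>?h t\<bar> / t powr \<theta>) \<partial>lborel) \<le> (\<integral>\<^sup>+x. ennreal K1 * indicator {0..T} x \<partial>lborel)"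
    using endpoints c1 by (intro nn_integral_mono_AE) (auto elim!: eventually_mono simp: indicator_def intro!: ennreal_leI)
  then have 1: "(\<integral>\<^sup>+t. indicator {0..T} t * ennreal (\<bar>?h t\<bar> / t powr \<theta>) \<partial>lborel) < \<infinity>" using fin[of K1] by (rule le_less_trans)
  have "(\<integral>\<^sup>+t. \<integral>\<^sup>+s. indicator {0..T} t * indicator {0..t} s * ennreal (\<bar>?h t - ?h s\<bar> / (t - s) powr (\<theta> + 1)) \<partial>lborel \<partial>lborel)
    \<le> (\<integral>\<^sup>+x. ennreal K2 * indicator {0..T} x \<partial>lborel)"
  proof (rule nn_integral_mono_AE)
    show "AE t in lborel. (\<integral>\<^sup>+s. indicator {0..T} t * indicator {0..t} s * ennreal (\<bar>?h t - ?h s\<bar> / (t - s) powr (\<theta> + 1)) \<partial>lborel) \<le> ennreal K2 * indicator {0..T} t"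
      using endpoints
    proof eventually_elim
      case (elim t)
      then show ?case using c2[of t] by (cases "t \<in> {0..T}") auto
    qed
  qed
  then have 2: "(\<integral>\<^sup>+t. \<integral>\<^sup>+s. indicator {0..T} t * indicator {0..t} s * ennreal (\<bar>?h t - ?h s\<bar> / (t - s) powr (\<theta> + 1)) \<partial>lborel \<partial>lborel) < \<infinity>"
    using fin[of K2] by (rule le_less_trans)
  show "W0_ext \<theta> T ?h" using 1 2 by (simp add: W0_ext_def) (simp add: reflected_increment_def)
  show "\<bar>frac_deriv_ext \<theta> T ?h x\<bar> \<le> (K1 + \<theta> * K2) / Gamma (1 - \<theta>)" if x: "x \<in> {0<..<T}" for x
  proof -
    have G: "0 < Gamma (1 - \<theta>)" using \<theta> by (intro Gamma_real_pos) auto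
    let ?g = "\<lambda>s. indicator {0..x} s * ((?h x - ?h s) / (x - s) powr (\<theta> + 1))"
    have "ennreal \<bar>LBINT s. ?g s\<bar> \<le> (\<integral>\<^sup>+s. indicator {0..x} s * ennreal (\<bar>?h x - ?h s\<bar> / (x - s) powr (\<theta> + 1)) \<partial>lborel)"
    \<comment> \<open>If the inner integral does not converge, its Bochner value is 0 and the
      inequality holds trivially.\<close>
    proof (cases "integrable lborel ?g")
      case True
      have "ennreal \<bar>LBINT s. ?g s\<bar> \<le> (\<integral>\<^sup>+s. ennreal (norm (?g s)) \<partial>lborel)"
        using integral_norm_bound_ennreal[OF True] by simp
      also have "\<dots> = (\<integral>\<^sup>+s. indicator {0..x} s * ennreal (\<bar>?h x - ?h s\<bar> / (x - s) powr (\<theta> + 1)) \<partial>lborel)"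
        by (intro nn_integral_cong) (auto simp: indicator_def)
      finally show ?thesis .
    qed (simp add: not_integrable_integral_eq)
    also have "\<dots> \<le> ennreal K2" by (rule c2[OF x])
    finally have i: "\<bar>LBINT s. ?g s\<bar> \<le> K2" using K by simp
    have h: "\<bar>?h x / x powr \<theta>\<bar> \<le> K1" using c1[OF x] by simp
    have "\<bar>?h x / x powr \<theta> + \<theta> * (LBINT s. ?g s)\<bar> \<le> K1 + \<theta> * K2"
    proof -
      have "\<bar>\<theta> * (LBINT s. ?g s)\<bar> \<le> \<theta> * K2" using i \<theta> by (simp add: abs_mult)
      then show ?thesis using h by linarith
    qed
    then have "\<bar>?h x / x powr \<theta> + \<theta> * (LBINT s. ?g s)\<bar> / Gamma (1 - \<theta>) \<le> (K1 + \<theta> * K2) / Gamma (1 - \<theta>)"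
      using G by (intro divide_right_mono) auto
    then show ?thesis using x G by (simp add: frac_deriv_ext_def abs_mult)
  qed
qed

lemma WT_space_bounds:
  assumes Y: "continuous_on {0..T} Y" "Y \<in> WT_space \<theta> T" and T: "0 < T"
  obtains K1 K2 where "0 \<le> K1" "0 \<le> K2"
    "\<And>t. t \<in> {0<..<T} \<Longrightarrow> \<bar>Y T - Y t\<bar> / (T - t) powr \<theta> \<le> K1"
    "\<And>t. t \<in> {0<..<T} \<Longrightarrow> (\<integral>\<^sup>+u. ennreal (\<bar>Y t - Y u\<bar> / \<bar>t - u\<bar> powr (1 + \<theta>)) \<partial>lebesgue_on {t..T}) \<le> ennreal K2"
proof -
  let ?A = "SUP t\<in>{0<..<T}. ennreal (\<bar>left_lim Y T - Y t\<bar> / (T - t) powr \<theta>)"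
  let ?B = "SUP t\<in>{0<..<T}. \<integral>\<^sup>+u. ennreal (\<bar>Y t - Y u\<bar> / \<bar>t - u\<bar> powr (1 + \<theta>)) \<partial>lebesgue_on {t..T}"
  have "?A + ?B < \<infinity>" using Y(2) by (simp add: WT_space_def)
  then have A: "?A = ennreal (enn2real ?A)" and B: "?B = ennreal (enn2real ?B)" by (auto simp: less_top)
  show thesis
  proof (rule that[of "enn2real ?A" "enn2real ?B"])
    fix t assume t: "t \<in> {0<..<T}"
    have "ennreal (\<bar>left_lim Y T - Y t\<bar> / (T - t) powr \<theta>) \<le> ?A" using t by (rule SUP_upper)
    then have "ennreal (\<bar>left_lim Y T - Y t\<bar> / (T - t) powr \<theta>) \<le> ennreal (enn2real ?A)" using A by simp
    then show "\<bar>Y T - Y t\<bar> / (T - t) powr \<theta> \<le> enn2real ?A"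
      by (simp only: ennreal_le_iff enn2real_nonneg left_lim_continuous(1)[OF Y(1) T])
    have "(\<integral>\<^sup>+u. ennreal (\<bar>Y t - Y u\<bar> / \<bar>t - u\<bar> powr (1 + \<theta>)) \<partial>lebesgue_on {t..T}) \<le> ?B" using t by (rule SUP_upper)
    then show "(\<integral>\<^sup>+u. ennreal (\<bar>Y t - Y u\<bar> / \<bar>t - u\<bar> powr (1 + \<theta>)) \<partial>lebesgue_on {t..T}) \<le> ennreal (enn2real ?B)"
      using B by simp
  qed auto
qed

text \<open>Makes the definite description in \<open>gls_integral\<close> well defined, so that any
  convenient admissible order may be used to compute it.\<close>

lemma gls_formula_independent:
  assumes T: "0 < T" and Y: "continuous_on {0..T} Y"
    and adm: "gls_admissible T f Y \<theta>" "gls_admissible T f Y \<theta>'"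
  shows "gls_formula \<theta> T f Y = gls_formula \<theta>' T f Y"
proof -
  have \<theta>: "0 < \<theta>" "\<theta> < 1" "0 < \<theta>'" "\<theta>' < 1" and f: "f \<in> W0_space \<theta> T" "f \<in> W0_space \<theta>' T"
    and Yw: "Y \<in> WT_space (1 - \<theta>) T" "Y \<in> WT_space (1 - \<theta>') T"
    using adm by (auto simp: gls_admissible_def)
  have fm: "f \<in> borel_measurable (lebesgue_on {0..T})" using f(1) by (simp add: W0_space_def)
  obtain f0 where f0: "f0 \<in> borel_measurable borel" "\<And>s. s \<notin> {0..T} \<Longrightarrow> f0 s = 0" "AE s in lborel. s \<in> {0..T} \<longrightarrow> f s = f0 s"
    by (rule borel_representative[OF fm], rule that)
  have W: "W0_ext \<theta> T f0" "W0_ext \<theta>' T f0" using f f0 by (auto intro!: W0_space_imp_W0_ext)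
  let ?h = "reflected_increment T Y"
  obtain K where K: "W0_ext (1 - \<theta>) T ?h" "\<And>x. x \<in> {0<..<T} \<Longrightarrow> \<bar>frac_deriv_ext (1 - \<theta>) T ?h x\<bar> \<le> K"
  proof -
    obtain K1 K2 where K12: "0 \<le> K1" "0 \<le> K2"
      "\<And>t. t \<in> {0<..<T} \<Longrightarrow> \<bar>Y T - Y t\<bar> / (T - t) powr (1 - \<theta>) \<le> K1"
      "\<And>t. t \<in> {0<..<T} \<Longrightarrow> (\<integral>\<^sup>+u. ennreal (\<bar>Y t - Y u\<bar> / \<bar>t - u\<bar> powr (1 + (1 - \<theta>))) \<partial>lebesgue_on {t..T}) \<le> ennreal K2"
      by (rule WT_space_bounds[OF Y Yw(1) T], rule that)
    show ?thesis
      by (rule that[OF reflected_increment_W0_ext[OF T Y K12(1,2) _ _ K12(3,4)]]) (use \<theta> in auto)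
  qed
  obtain K' where K': "W0_ext (1 - \<theta>') T ?h" "\<And>x. x \<in> {0<..<T} \<Longrightarrow> \<bar>frac_deriv_ext (1 - \<theta>') T ?h x\<bar> \<le> K'"
  proof -
    obtain K1 K2 where K12: "0 \<le> K1" "0 \<le> K2"
      "\<And>t. t \<in> {0<..<T} \<Longrightarrow> \<bar>Y T - Y t\<bar> / (T - t) powr (1 - \<theta>') \<le> K1"
      "\<And>t. t \<in> {0<..<T} \<Longrightarrow> (\<integral>\<^sup>+u. ennreal (\<bar>Y t - Y u\<bar> / \<bar>t - u\<bar> powr (1 + (1 - \<theta>'))) \<partial>lebesgue_on {t..T}) \<le> ennreal K2"
      by (rule WT_space_bounds[OF Y Yw(2) T], rule that)
    show ?thesis
      by (rule that[OF reflected_increment_W0_ext[OF T Y K12(1,2) _ _ K12(3,4)]]) (use \<theta> in auto)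
  qed
  note b = L1_on_borel[OF L1_on_frac_deriv_ext]
  show ?thesis
    unfolding gls_formula_eq[OF f0(1,3) Y T b[OF W(1)] b[OF K(1)]] gls_formula_eq[OF f0(1,3) Y T b[OF W(2)] b[OF K'(1)]]
    using frac_deriv_pairing_independent[OF \<theta> W K(1) K'(1) K(2) K'(2)] by simp
qed

lemma gls_integral_eq_formula:
  assumes "0 < T" "continuous_on {0..T} Y" "gls_admissible T f Y \<theta>"
  shows "gls_integral T f Y = gls_formula \<theta> T f Y"
  unfolding gls_integral_def using gls_formula_independent[OF assms(1,2)] assms(3)
  by (intro the_equality) blast+

section \<open>Truncated integrands\<close>

lemma nn_integral_powr_left:
  assumes "- 1 < e" "u \<le> (t::real)"
  shows "(\<integral>\<^sup>+s. indicator {u..t} s * ennreal ((s - u) powr e) \<partial>lborel) = ennreal ((t - u) powr (e + 1) / (e + 1))"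
proof -
  have "(\<integral>\<^sup>+x. indicator {0..t - u} x * ennreal (x powr e) \<partial>lborel) = ennreal ((t - u) powr (e + 1) / (e + 1))"
    using nn_integral_has_integral_lebesgue'[OF _ has_integral_powr_from_0[of e "t - u"]] assms
    by (simp add: mult.commute)
  moreover have "(\<integral>\<^sup>+s. indicator {u..t} s * ennreal ((s - u) powr e) \<partial>lborel) = (\<integral>\<^sup>+x. indicator {0..t - u} x * ennreal (x powr e) \<partial>lborel)"
    by (subst nn_integral_real_affine[of _ 1 u]) (auto intro!: nn_integral_cong simp: indicator_def)
  ultimately show ?thesis by simp
qed

lemma nn_integral_powr_right:
  assumes "- 1 < e" "u \<le> (t::real)"
  shows "(\<integral>\<^sup>+s. indicator {u..t} s * ennreal ((t - s) powr e) \<partial>lborel) = ennreal ((t - u) powr (e + 1) / (e + 1))"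
proof -
  have "(\<integral>\<^sup>+s. indicator {u..t} s * ennreal ((t - s) powr e) \<partial>lborel) = (\<integral>\<^sup>+s. indicator {u..t} s * ennreal ((s - u) powr e) \<partial>lborel)"
    by (subst nn_integral_real_affine[of _ "-1" "u + t"]) (auto intro!: nn_integral_cong simp: indicator_def algebra_simps)
  then show ?thesis using nn_integral_powr_left[OF assms] by simp
qed

lemma nn_integral_powr_above_le:
  assumes \<theta>: "0 < \<theta>" and "s < (t::real)"
  shows "(\<integral>\<^sup>+r. indicator {t..T} r * ennreal ((r - s) powr (- \<theta> - 1)) \<partial>lborel) \<le> ennreal ((t - s) powr - \<theta> / \<theta>)"
proof (cases "t \<le> T")
  case True
  have "(\<integral>\<^sup>+r. ennreal ((r - s) powr (- \<theta> - 1)) * indicator {t..T} r \<partial>lborel)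
    = ennreal (- ((T - s) powr - \<theta> / \<theta>) - - ((t - s) powr - \<theta> / \<theta>))"
  proof (rule nn_integral_FTC_Icc)
    fix r assume "r \<in> {t..T}"
    then have "0 < r - s" using assms by simp
    then show "((\<lambda>r. - ((r - s) powr - \<theta> / \<theta>)) has_real_derivative (r - s) powr (- \<theta> - 1)) (at r)"
      using \<theta> by (auto intro!: derivative_eq_intros)
  qed (use True in auto)
  also have "\<dots> \<le> ennreal ((t - s) powr - \<theta> / \<theta>)" using \<theta> by (intro ennreal_leI) simp
  finally show ?thesis by (simp add: mult.commute)
qed simp

lemma nn_integral_powr_below_le:
  assumes \<theta>: "0 < \<theta>" and "(u::real) < r"
  shows "(\<integral>\<^sup>+s. indicator {0..u} s * ennreal ((r - s) powr (- \<theta> - 1)) \<partial>lborel) \<le> ennreal ((r - u) powr - \<theta> / \<theta>)"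
proof -
  have "(\<integral>\<^sup>+s. indicator {0..u} s * ennreal ((r - s) powr (- \<theta> - 1)) \<partial>lborel)
     = (\<integral>\<^sup>+x. indicator {r - u..r} x * ennreal ((x - 0) powr (- \<theta> - 1)) \<partial>lborel)"
    by (subst nn_integral_real_affine[of _ "-1" r]) (auto intro!: nn_integral_cong simp: indicator_def)
  also have "\<dots> \<le> ennreal ((r - u - 0) powr - \<theta> / \<theta>)"
    by (rule nn_integral_powr_above_le) (use assms in auto)
  finally show ?thesis by simp
qed

text \<open>Up to the factor 1 / \<theta>, \<open>left_weight\<close> and
  \<open>right_weight\<close> are what the jumps of the truncated function at u and at t add to its
  seminorm.\<close>

definition left_weight :: "real \<Rightarrow> real \<Rightarrow> real \<Rightarrow> (real \<Rightarrow> real) \<Rightarrow> ennreal" where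
  "left_weight \<theta> u t f = (\<integral>\<^sup>+s. indicator {u<..t} s * ennreal (\<bar>f s\<bar> * (s - u) powr - \<theta>) \<partial>lborel)"

definition right_weight :: "real \<Rightarrow> real \<Rightarrow> real \<Rightarrow> (real \<Rightarrow> real) \<Rightarrow> ennreal" where
  "right_weight \<theta> u t f = (\<integral>\<^sup>+s. indicator {u<..t} s * ennreal (\<bar>f s\<bar> * (t - s) powr - \<theta>) \<partial>lborel)"

definition half_seminorm :: "real \<Rightarrow> real \<Rightarrow> real \<Rightarrow> (real \<Rightarrow> real) \<Rightarrow> ennreal" where
  "half_seminorm \<theta> u t f = (\<integral>\<^sup>+r. \<integral>\<^sup>+s. indicator {u<..t} r * indicator {u<..r} s * ennreal (\<bar>f r - f s\<bar> / (r - s) powr (\<theta> + 1)) \<partial>lborel \<partial>lborel)"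

text \<open>The interval is half open so that \<open>truncate 0 t f - truncate 0 u f\<close> is
  exactly \<open>truncate u t f\<close>.\<close>

definition truncate :: "real \<Rightarrow> real \<Rightarrow> (real \<Rightarrow> real) \<Rightarrow> real \<Rightarrow> real" where
  "truncate u t f s = indicator {u<..t} s * f s"

lemma borel_measurable_truncate [measurable]:
  "f \<in> borel_measurable borel \<Longrightarrow> truncate u t f \<in> borel_measurable borel"
  unfolding truncate_def[abs_def] by measurable

text \<open>Besides the seminorm of \<open>f\<close> on $(u,t]$, truncation contributes the two jumps at \<open>u\<close> and \<open>t\<close>.\<close>

lemma truncate_seminorm_le:
  assumes [measurable]: "f \<in> borel_measurable borel" and \<theta>: "0 < \<theta>" and ut: "0 \<le> u" "u \<le> t" "t \<le> T"
  shows "(\<integral>\<^sup>+r. \<integral>\<^sup>+s. indicator {0..T} r * indicator {0..r} s * ennreal (\<bar>truncate u t f r - truncate u t f s\<bar> / (r - s) powr (\<theta> + 1)) \<partial>lborel \<partial>lborel)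
    \<le> half_seminorm \<theta> u t f + (ennreal (1 / \<theta>) * left_weight \<theta> u t f + ennreal (1 / \<theta>) * right_weight \<theta> u t f)"
proof -
  let ?k = "truncate u t f"
  \<comment> \<open>?P has both arguments in (u,t]. In ?Q only the later one is, the earlier one
    lying in [0,u]. In ?R only the earlier one is, the later one lying in [t,T].\<close>
  let ?P = "\<lambda>r s. indicator {u<..t} r * indicator {u<..r} s * ennreal (\<bar>f r - f s\<bar> / (r - s) powr (\<theta> + 1))"
  let ?Q = "\<lambda>r s. indicator {u<..t} r * ennreal \<bar>f r\<bar> * (indicator {0..u} s * ennreal ((r - s) powr (- \<theta> - 1)))"
  let ?R = "\<lambda>r s. indicator {u<..t} s * ennreal \<bar>f s\<bar> * (indicator {t..T} r * ennreal ((r - s) powr (- \<theta> - 1)))"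
  have Pm [measurable]: "(\<lambda>(r, s). ?P r s) \<in> borel_measurable (lborel \<Otimes>\<^sub>M lborel)"
    unfolding indicator_def greaterThanAtMost_iff by measurable
  have pm: "x / y powr (\<theta> + 1) = x * y powr (- \<theta> - 1)" for x y :: real
  proof -
    have "- \<theta> - 1 = - (\<theta> + 1)" by simp
    then show ?thesis by (simp only: powr_minus divide_inverse)
  qed
  have "(\<integral>\<^sup>+r. \<integral>\<^sup>+s. indicator {0..T} r * indicator {0..r} s * ennreal (\<bar>?k r - ?k s\<bar> / (r - s) powr (\<theta> + 1)) \<partial>lborel \<partial>lborel)
    \<le> (\<integral>\<^sup>+r. \<integral>\<^sup>+s. ?P r s + (?Q r s + ?R r s) \<partial>lborel \<partial>lborel)"
  proof (intro nn_integral_mono)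
    fix r s :: real
    show "indicator {0..T} r * indicator {0..r} s * ennreal (\<bar>?k r - ?k s\<bar> / (r - s) powr (\<theta> + 1)) \<le> ?P r s + (?Q r s + ?R r s)"
    proof (cases "0 \<le> s \<and> s \<le> r \<and> r \<le> T")
      case True
      consider "u < s" "r \<le> t" | "u < s" "s \<le> t" "t < r" | "s \<le> u" "u < r" "r \<le> t" | "s \<le> u" "r \<le> u \<or> t < r" | "t < s"
        by linarith
      then show ?thesis
        by cases (use True ut in \<open>auto simp: truncate_def indicator_def pm ennreal_mult\<close>)
    qed (auto simp: indicator_def)
  qed
  also have "\<dots> = (\<integral>\<^sup>+r. (\<integral>\<^sup>+s. ?P r s \<partial>lborel) + ((\<integral>\<^sup>+s. ?Q r s \<partial>lborel) + (\<integral>\<^sup>+s. ?R r s \<partial>lborel)) \<partial>lborel)"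
  proof (rule nn_integral_cong)
    fix r
    have [measurable]: "(\<lambda>s. ?P r s) \<in> borel_measurable lborel"
      unfolding indicator_def greaterThanAtMost_iff by measurable
    show "(\<integral>\<^sup>+s. ?P r s + (?Q r s + ?R r s) \<partial>lborel) = (\<integral>\<^sup>+s. ?P r s \<partial>lborel) + ((\<integral>\<^sup>+s. ?Q r s \<partial>lborel) + (\<integral>\<^sup>+s. ?R r s \<partial>lborel))"
      by (subst nn_integral_add, measurable, subst nn_integral_add, measurable)
  qed
  also have "\<dots> = (\<integral>\<^sup>+r. \<integral>\<^sup>+s. ?P r s \<partial>lborel \<partial>lborel) + ((\<integral>\<^sup>+r. \<integral>\<^sup>+s. ?Q r s \<partial>lborel \<partial>lborel) + (\<integral>\<^sup>+r. \<integral>\<^sup>+s. ?R r s \<partial>lborel \<partial>lborel))"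
  proof -
    have [measurable]: "(\<lambda>r. \<integral>\<^sup>+s. ?P r s \<partial>lborel) \<in> borel_measurable lborel"
      using lborel.borel_measurable_nn_integral_fst[OF Pm] by simp
    show ?thesis by (subst nn_integral_add, measurable, subst nn_integral_add, measurable)
  qed
  also have "(\<integral>\<^sup>+r. \<integral>\<^sup>+s. ?Q r s \<partial>lborel \<partial>lborel) \<le> (\<integral>\<^sup>+r. ennreal (1 / \<theta>) * (indicator {u<..t} r * ennreal (\<bar>f r\<bar> * (r - u) powr - \<theta>)) \<partial>lborel)"
  proof (rule nn_integral_mono)
    fix r
    have "(\<integral>\<^sup>+s. ?Q r s \<partial>lborel) = indicator {u<..t} r * ennreal \<bar>f r\<bar> * (\<integral>\<^sup>+s. indicator {0..u} s * ennreal ((r - s) powr (- \<theta> - 1)) \<partial>lborel)"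
      by (rule nn_integral_cmult) measurable
    also have "\<dots> \<le> indicator {u<..t} r * ennreal \<bar>f r\<bar> * ennreal ((r - u) powr - \<theta> / \<theta>)"
    proof (cases "u < r")
      case True
      then show ?thesis by (intro mult_left_mono nn_integral_powr_below_le \<theta>) auto
    qed (simp add: indicator_def)
    also have "\<dots> = ennreal (1 / \<theta>) * (indicator {u<..t} r * ennreal (\<bar>f r\<bar> * (r - u) powr - \<theta>))"
      using \<theta> by (simp add: indicator_def ennreal_mult[symmetric] mult.commute)
    finally show "(\<integral>\<^sup>+s. ?Q r s \<partial>lborel) \<le> ennreal (1 / \<theta>) * (indicator {u<..t} r * ennreal (\<bar>f r\<bar> * (r - u) powr - \<theta>))" .
  qed
  also have "\<dots> = ennreal (1 / \<theta>) * left_weight \<theta> u t f"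
    unfolding left_weight_def by (rule nn_integral_cmult) measurable
  also have "(\<integral>\<^sup>+r. \<integral>\<^sup>+s. ?R r s \<partial>lborel \<partial>lborel) = (\<integral>\<^sup>+s. \<integral>\<^sup>+r. ?R r s \<partial>lborel \<partial>lborel)"
    by (rule lborel_pair.Fubini'[symmetric]) measurable
  also have "\<dots> \<le> (\<integral>\<^sup>+s. ennreal (1 / \<theta>) * (indicator {u<..t} s * ennreal (\<bar>f s\<bar> * (t - s) powr - \<theta>)) \<partial>lborel)"
  proof (rule nn_integral_mono_AE)
    show "AE s in lborel. (\<integral>\<^sup>+r. ?R r s \<partial>lborel) \<le> ennreal (1 / \<theta>) * (indicator {u<..t} s * ennreal (\<bar>f s\<bar> * (t - s) powr - \<theta>))"
      using AE_lborel_singleton[of t]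
    proof eventually_elim
      case (elim s)
      have "(\<integral>\<^sup>+r. ?R r s \<partial>lborel) = indicator {u<..t} s * ennreal \<bar>f s\<bar> * (\<integral>\<^sup>+r. indicator {t..T} r * ennreal ((r - s) powr (- \<theta> - 1)) \<partial>lborel)"
        by (rule nn_integral_cmult) measurable
      also have "\<dots> \<le> indicator {u<..t} s * ennreal \<bar>f s\<bar> * ennreal ((t - s) powr - \<theta> / \<theta>)"
      proof (cases "s < t")
        case True
        then show ?thesis by (intro mult_left_mono nn_integral_powr_above_le \<theta>) auto
      qed (use elim in \<open>simp add: indicator_def\<close>)
      also have "\<dots> = ennreal (1 / \<theta>) * (indicator {u<..t} s * ennreal (\<bar>f s\<bar> * (t - s) powr - \<theta>))"
        using \<theta> by (simp add: indicator_def ennreal_mult[symmetric] mult.commute)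
      finally show ?case .
    qed
  qed
  also have "\<dots> = ennreal (1 / \<theta>) * right_weight \<theta> u t f"
    unfolding right_weight_def by (rule nn_integral_cmult) measurable
  finally show ?thesis unfolding half_seminorm_def by (simp add: add_left_mono add_mono)
qed

lemma truncate_weight_le:
  assumes [measurable]: "f \<in> borel_measurable borel" and \<theta>: "0 < \<theta>" and ut: "0 \<le> u" "t \<le> T"
  shows "(\<integral>\<^sup>+r. indicator {0..T} r * ennreal (\<bar>truncate u t f r\<bar> / r powr \<theta>) \<partial>lborel) \<le> left_weight \<theta> u t f"
  unfolding left_weight_def
proof (rule nn_integral_mono)
  fix r
  show "indicator {0..T} r * ennreal (\<bar>truncate u t f r\<bar> / r powr \<theta>) \<le> indicator {u<..t} r * ennreal (\<bar>f r\<bar> * (r - u) powr - \<theta>)"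
  proof (cases "u < r \<and> r \<le> t")
    case True
    have "r powr - \<theta> \<le> (r - u) powr - \<theta>" using True ut \<theta> by (intro powr_mono2') auto
    then have "\<bar>f r\<bar> * r powr - \<theta> \<le> \<bar>f r\<bar> * (r - u) powr - \<theta>" by (intro mult_left_mono) auto
    then show ?thesis using True ut by (simp add: truncate_def powr_minus_divide ennreal_leI)
  qed (auto simp: truncate_def indicator_def)
qed

text \<open>Times 1 / Gamma (1 - \<theta>) this bounds the L1 norm of the fractional derivative of
  the truncated function. As a value in [0,\<infinity>] it serves both as a quantitative bound and,
  when finite, as a criterion for admissibility.\<close>

definition truncation_bound :: "real \<Rightarrow> real \<Rightarrow> real \<Rightarrow> (real \<Rightarrow> real) \<Rightarrow> ennreal" where
  "truncation_bound \<theta> u t f = left_weight \<theta> u t f + ennreal \<theta> * (half_seminorm \<theta> u t f +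
     (ennreal (1 / \<theta>) * left_weight \<theta> u t f + ennreal (1 / \<theta>) * right_weight \<theta> u t f))"

lemma truncation_bound_finite:
  "truncation_bound \<theta> u t f < \<infinity>" if "left_weight \<theta> u t f < \<infinity>" "right_weight \<theta> u t f < \<infinity>" "half_seminorm \<theta> u t f < \<infinity>"
  using that by (simp add: truncation_bound_def ennreal_mult_less_top)

lemma truncation_bound_finiteD:
  assumes "truncation_bound \<theta> u t f < \<infinity>" "0 < \<theta>"
  shows "left_weight \<theta> u t f < \<infinity>" "right_weight \<theta> u t f < \<infinity>" "half_seminorm \<theta> u t f < \<infinity>"
  using assms by (auto simp: truncation_bound_def ennreal_mult_less_top)

lemma truncate_W0_ext:
  assumes f: "f \<in> borel_measurable borel" and \<theta>: "0 < \<theta>" and ut: "0 \<le> u" "u \<le> t" "t \<le> T"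
    and fin: "truncation_bound \<theta> u t f < \<infinity>"
  shows "W0_ext \<theta> T (truncate u t f)"
  unfolding W0_ext_def
proof (intro conjI)
  note fin' = truncation_bound_finiteD[OF fin \<theta>]
  show "truncate u t f \<in> borel_measurable borel" using f by measurable
  show "\<forall>s. s \<notin> {0..T} \<longrightarrow> truncate u t f s = 0" using ut by (auto simp: truncate_def)
  show "(\<integral>\<^sup>+r. indicator {0..T} r * ennreal (\<bar>truncate u t f r\<bar> / r powr \<theta>) \<partial>lborel) < \<infinity>"
    using truncate_weight_le[OF f \<theta> ut(1,3)] fin'(1) by (rule le_less_trans)
  show "(\<integral>\<^sup>+r. \<integral>\<^sup>+s. indicator {0..T} r * indicator {0..r} s * ennreal (\<bar>truncate u t f r - truncate u t f s\<bar> / (r - s) powr (\<theta> + 1)) \<partial>lborel \<partial>lborel) < \<infinity>"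
    using truncate_seminorm_le[OF f \<theta> ut] by (rule le_less_trans) (use fin' in \<open>simp add: ennreal_mult_less_top\<close>)
qed

lemma nn_integral_frac_deriv_ext_le:
  assumes f: "W0_ext \<theta> T f" and \<theta>: "0 < \<theta>" "\<theta> < 1"
  shows "(\<integral>\<^sup>+t. ennreal \<bar>frac_deriv_ext \<theta> T f t\<bar> \<partial>lborel) \<le> ennreal (1 / Gamma (1 - \<theta>)) *
    ((\<integral>\<^sup>+t. indicator {0..T} t * ennreal (\<bar>f t\<bar> / t powr \<theta>) \<partial>lborel) +
     ennreal \<theta> * (\<integral>\<^sup>+t. \<integral>\<^sup>+s. indicator {0..T} t * indicator {0..t} s * ennreal (\<bar>f t - f s\<bar> / (t - s) powr (\<theta> + 1)) \<partial>lborel \<partial>lborel))"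
proof -
  have [measurable]: "f \<in> borel_measurable borel" using f by (rule W0_ext_borel)
  have G: "0 < Gamma (1 - \<theta>)" using \<theta> by (intro Gamma_real_pos) auto
  let ?E = "\<lambda>t s. indicator {0..T} t * indicator {0..t} s * ennreal (\<bar>f t - f s\<bar> / (t - s) powr (\<theta> + 1))"
  have Em: "(\<lambda>(t, s). ?E t s) \<in> borel_measurable (lborel \<Otimes>\<^sub>M lborel)"
    unfolding indicator_def atLeastAtMost_iff by measurable
  have [measurable]: "(\<lambda>t. \<integral>\<^sup>+s. ?E t s \<partial>lborel) \<in> borel_measurable lborel"
    using lborel.borel_measurable_nn_integral_fst[OF Em] by simp
  have "(\<integral>\<^sup>+t. ennreal \<bar>frac_deriv_ext \<theta> T f t\<bar> \<partial>lborel) \<le> (\<integral>\<^sup>+t. ennreal (1 / Gamma (1 - \<theta>)) *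
    (indicator {0..T} t * ennreal (\<bar>f t\<bar> / t powr \<theta>) + ennreal \<theta> * (\<integral>\<^sup>+s. ?E t s \<partial>lborel)) \<partial>lborel)"
  proof (rule nn_integral_mono)
    fix t
    let ?g = "\<lambda>s. indicator {0..T} t * (indicator {0..t} s * ((f t - f s) / (t - s) powr (\<theta> + 1)))"
    have "ennreal \<bar>LBINT s. ?g s\<bar> \<le> (\<integral>\<^sup>+s. ?E t s \<partial>lborel)"
    proof (cases "integrable lborel ?g")
      case True
      have "ennreal \<bar>LBINT s. ?g s\<bar> \<le> (\<integral>\<^sup>+s. ennreal (norm (?g s)) \<partial>lborel)"
        using integral_norm_bound_ennreal[OF True] by simp
      also have "\<dots> = (\<integral>\<^sup>+s. ?E t s \<partial>lborel)"
        by (intro nn_integral_cong) (auto simp: indicator_def)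
      finally show ?thesis .
    qed (simp add: not_integrable_integral_eq)
    note i = this
    have "\<bar>frac_deriv_ext \<theta> T f t\<bar> \<le> 1 / Gamma (1 - \<theta>) * (indicator {0..T} t * (\<bar>f t\<bar> / t powr \<theta>) + \<theta> * \<bar>LBINT s. ?g s\<bar>)"
    proof -
      have "\<bar>indicator {0..T} t * (f t / t powr \<theta>) + \<theta> * (LBINT s. ?g s)\<bar> \<le> indicator {0..T} t * (\<bar>f t\<bar> / t powr \<theta>) + \<theta> * \<bar>LBINT s. ?g s\<bar>"
        using abs_triangle_ineq[of "indicator {0..T} t * (f t / t powr \<theta>)" "\<theta> * (LBINT s. ?g s)"] \<theta> by (simp add: abs_mult)
      then have "1 / Gamma (1 - \<theta>) * \<bar>indicator {0..T} t * (f t / t powr \<theta>) + \<theta> * (LBINT s. ?g s)\<bar> \<le> 1 / Gamma (1 - \<theta>) * (indicator {0..T} t * (\<bar>f t\<bar> / t powr \<theta>) + \<theta> * \<bar>LBINT s. ?g s\<bar>)"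
        using G by (intro mult_left_mono) auto
      then show ?thesis using G unfolding frac_deriv_ext_altdef by (simp only: abs_mult) simp
    qed
    then have "ennreal \<bar>frac_deriv_ext \<theta> T f t\<bar> \<le> ennreal (1 / Gamma (1 - \<theta>) * (indicator {0..T} t * (\<bar>f t\<bar> / t powr \<theta>) + \<theta> * \<bar>LBINT s. ?g s\<bar>))"
      by (rule ennreal_leI)
    also have "\<dots> = ennreal (1 / Gamma (1 - \<theta>)) * ennreal (indicator {0..T} t * (\<bar>f t\<bar> / t powr \<theta>) + \<theta> * \<bar>LBINT s. ?g s\<bar>)"
      using G \<theta> by (intro ennreal_mult) auto
    also have "ennreal (indicator {0..T} t * (\<bar>f t\<bar> / t powr \<theta>) + \<theta> * \<bar>LBINT s. ?g s\<bar>) = ennreal (indicator {0..T} t * (\<bar>f t\<bar> / t powr \<theta>)) + ennreal (\<theta> * \<bar>LBINT s. ?g s\<bar>)"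
      using \<theta> by (intro ennreal_plus) auto
    also have "ennreal (indicator {0..T} t * (\<bar>f t\<bar> / t powr \<theta>)) = indicator {0..T} t * ennreal (\<bar>f t\<bar> / t powr \<theta>)"
      by (simp add: indicator_def)
    also have "ennreal (\<theta> * \<bar>LBINT s. ?g s\<bar>) = ennreal \<theta> * ennreal \<bar>LBINT s. ?g s\<bar>"
      using \<theta> by (intro ennreal_mult) auto
    also have "ennreal (1 / Gamma (1 - \<theta>)) * (indicator {0..T} t * ennreal (\<bar>f t\<bar> / t powr \<theta>) + ennreal \<theta> * ennreal \<bar>LBINT s. ?g s\<bar>)
      \<le> ennreal (1 / Gamma (1 - \<theta>)) * (indicator {0..T} t * ennreal (\<bar>f t\<bar> / t powr \<theta>) + ennreal \<theta> * (\<integral>\<^sup>+s. ?E t s \<partial>lborel))"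
      by (intro mult_left_mono add_left_mono i) auto
    finally show "ennreal \<bar>frac_deriv_ext \<theta> T f t\<bar> \<le> ennreal (1 / Gamma (1 - \<theta>)) * (indicator {0..T} t * ennreal (\<bar>f t\<bar> / t powr \<theta>) + ennreal \<theta> * (\<integral>\<^sup>+s. ?E t s \<partial>lborel))" .
  qed
  also have "\<dots> = ennreal (1 / Gamma (1 - \<theta>)) * ((\<integral>\<^sup>+t. indicator {0..T} t * ennreal (\<bar>f t\<bar> / t powr \<theta>) \<partial>lborel) + ennreal \<theta> * (\<integral>\<^sup>+t. \<integral>\<^sup>+s. ?E t s \<partial>lborel \<partial>lborel))"
    by (simp add: nn_integral_cmult nn_integral_add)
  finally show ?thesis .
qed

lemma nn_integral_frac_deriv_truncate_le:
  assumes f: "f \<in> borel_measurable borel" and \<theta>: "0 < \<theta>" "\<theta> < 1" and ut: "0 \<le> u" "u \<le> t" "t \<le> T"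
    and fin: "truncation_bound \<theta> u t f < \<infinity>"
  shows "(\<integral>\<^sup>+r. ennreal \<bar>frac_deriv_ext \<theta> T (truncate u t f) r\<bar> \<partial>lborel) \<le> ennreal (1 / Gamma (1 - \<theta>)) * truncation_bound \<theta> u t f"
  unfolding truncation_bound_def
  by (rule order_trans[OF nn_integral_frac_deriv_ext_le[OF truncate_W0_ext[OF f \<theta>(1) ut fin] \<theta>]])
     (intro mult_left_mono add_mono truncate_weight_le truncate_seminorm_le f \<theta> ut, auto)

text \<open>Linearity holds only almost everywhere, where both inner integrals converge.\<close>

lemma frac_deriv_ext_diff:
  assumes f: "W0_ext \<theta> T f" and g: "W0_ext \<theta> T g"
  shows "AE t in lborel. frac_deriv_ext \<theta> T (\<lambda>s. f s - g s) t = frac_deriv_ext \<theta> T f t - frac_deriv_ext \<theta> T g t"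
  using lborel_pair.AE_integrable_fst[OF W0_ext_integrable(2)[OF f]] lborel_pair.AE_integrable_fst[OF W0_ext_integrable(2)[OF g]]
proof eventually_elim
  case (elim t)
  have "(LBINT s. indicator {0..T} t * (indicator {0..t} s * (((f t - g t) - (f s - g s)) / (t - s) powr (\<theta> + 1))))
    = (LBINT s. indicator {0..T} t * (indicator {0..t} s * ((f t - f s) / (t - s) powr (\<theta> + 1))) - indicator {0..T} t * (indicator {0..t} s * ((g t - g s) / (t - s) powr (\<theta> + 1))))"
    by (intro Bochner_Integration.integral_cong refl) (auto simp: indicator_def diff_divide_distrib)
  also have "\<dots> = (LBINT s. indicator {0..T} t * (indicator {0..t} s * ((f t - f s) / (t - s) powr (\<theta> + 1)))) - (LBINT s. indicator {0..T} t * (indicator {0..t} s * ((g t - g s) / (t - s) powr (\<theta> + 1))))"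
    using elim by (rule Bochner_Integration.integral_diff)
  finally have eq: "(LBINT s. indicator {0..T} t * (indicator {0..t} s * (((f t - g t) - (f s - g s)) / (t - s) powr (\<theta> + 1)))) = \<dots>" .
  show ?case unfolding frac_deriv_ext_altdef eq by (simp add: algebra_simps diff_divide_distrib)
qed

text \<open>The Gagliardo seminorm runs over the whole square, \<open>W0_ext\<close> only over a
  triangle. The missing half is the same integral with r and s exchanged.\<close>

lemma W0_space_truncate:
  assumes f0 [measurable]: "f0 \<in> borel_measurable borel" and \<theta>: "0 < \<theta>" and t: "0 \<le> t" "t \<le> T"
    and fin: "truncation_bound \<theta> 0 t f0 < \<infinity>"
    and g: "AE s in lborel. s \<in> {0..T} \<longrightarrow> g s = truncate 0 t f0 s"
  shows "g \<in> W0_space \<theta> T"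
proof -
  let ?k = "truncate 0 t f0"
  have W: "W0_ext \<theta> T ?k" by (rule truncate_W0_ext[OF f0 \<theta> order_refl t fin])
  let ?E = "\<lambda>r s. indicator {0..T} r * indicator {0..r} s * ennreal (\<bar>?k r - ?k s\<bar> / (r - s) powr (\<theta> + 1))"
  have Em [measurable]: "(\<lambda>(r, s). ?E r s) \<in> borel_measurable (lborel \<Otimes>\<^sub>M lborel)"
    unfolding indicator_def atLeastAtMost_iff by measurable
  have Em2 [measurable]: "(\<lambda>(s, r). ?E r s) \<in> borel_measurable (lborel \<Otimes>\<^sub>M lborel)"
    unfolding indicator_def atLeastAtMost_iff by measurable
  have m: "g \<in> borel_measurable (lebesgue_on {0..T})"
  proof (rule measurable_lebesgue_on_AE)
    show "?k \<in> borel_measurable (lebesgue_on {0..T})"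
      by (intro measurable_restrict_space1 measurable_completion) measurable
    show "AE s in lebesgue_on {0..T}. g s = ?k s" using g by (subst AE_lebesgue_on_iff) auto
  qed auto
  have "(\<integral>\<^sup>+s. ennreal (\<bar>g s\<bar> / s powr \<theta>) \<partial>lebesgue_on {0..T}) = (\<integral>\<^sup>+s. indicator {0..T} s * ennreal (\<bar>?k s\<bar> / s powr \<theta>) \<partial>lborel)"
    unfolding nn_integral_lebesgue_on_Icc
    by (intro nn_integral_cong_AE) (use g in \<open>auto elim!: eventually_mono simp: indicator_def\<close>)
  then have 1: "(\<integral>\<^sup>+s. ennreal (\<bar>g s\<bar> / s powr \<theta>) \<partial>lebesgue_on {0..T}) < \<infinity>" using W by (simp add: W0_ext_def)
  have "(\<integral>\<^sup>+r. (\<integral>\<^sup>+s. ennreal (\<bar>g r - g s\<bar> powr 1 / \<bar>r - s\<bar> powr (1 + \<theta> * 1)) \<partial>lebesgue_on {0..T}) \<partial>lebesgue_on {0..T})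
    \<le> (\<integral>\<^sup>+r. (\<integral>\<^sup>+s. ?E r s \<partial>lborel) + (\<integral>\<^sup>+s. ?E s r \<partial>lborel) \<partial>lborel)"
    unfolding nn_integral_lebesgue_on_Icc
  proof (rule nn_integral_mono_AE)
    show "AE r in lborel. indicator {0..T} r * (\<integral>\<^sup>+s. indicator {0..T} s * ennreal (\<bar>g r - g s\<bar> powr 1 / \<bar>r - s\<bar> powr (1 + \<theta> * 1)) \<partial>lborel)
      \<le> (\<integral>\<^sup>+s. ?E r s \<partial>lborel) + (\<integral>\<^sup>+s. ?E s r \<partial>lborel)"
      using g
    proof eventually_elim
      case (elim r)
      show ?case
      proof (cases "r \<in> {0..T}")
        case r: True
        have "(\<integral>\<^sup>+s. indicator {0..T} s * ennreal (\<bar>g r - g s\<bar> powr 1 / \<bar>r - s\<bar> powr (1 + \<theta> * 1)) \<partial>lborel)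
          \<le> (\<integral>\<^sup>+s. ?E r s + ?E s r \<partial>lborel)"
        proof (rule nn_integral_mono_AE)
          show "AE s in lborel. indicator {0..T} s * ennreal (\<bar>g r - g s\<bar> powr 1 / \<bar>r - s\<bar> powr (1 + \<theta> * 1)) \<le> ?E r s + ?E s r"
            using g
          proof eventually_elim
            case (elim s)
            show ?case
            proof (cases "s \<in> {0..T}")
              case True
              then have gs: "g r = ?k r" "g s = ?k s" using r \<open>r \<in> {0..T} \<longrightarrow> g r = ?k r\<close> elim by auto
              show ?thesis
              proof (cases "s \<le> r")
                case True
                then show ?thesis using r \<open>s \<in> {0..T}\<close> by (simp add: gs add.commute)
              next
                case False
                then show ?thesis using r \<open>s \<in> {0..T}\<close> by (simp add: gs add.commute abs_minus_commute)
              qed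
            qed simp
          qed
        qed
        also have "\<dots> = (\<integral>\<^sup>+s. ?E r s \<partial>lborel) + (\<integral>\<^sup>+s. ?E s r \<partial>lborel)"
          by (rule nn_integral_add) (unfold indicator_def atLeastAtMost_iff, measurable)
        finally show ?thesis using r by simp
      qed simp
    qed
  qed
  also have "\<dots> = (\<integral>\<^sup>+r. \<integral>\<^sup>+s. ?E r s \<partial>lborel \<partial>lborel) + (\<integral>\<^sup>+r. \<integral>\<^sup>+s. ?E s r \<partial>lborel \<partial>lborel)"
    using lborel.borel_measurable_nn_integral_fst[OF Em] lborel.borel_measurable_nn_integral_fst[OF Em2]
    by (intro nn_integral_add) auto
  also have "(\<integral>\<^sup>+r. \<integral>\<^sup>+s. ?E s r \<partial>lborel \<partial>lborel) = (\<integral>\<^sup>+s. \<integral>\<^sup>+r. ?E s r \<partial>lborel \<partial>lborel)"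
    using Em by (rule lborel_pair.Fubini')
  also have "(\<integral>\<^sup>+r. \<integral>\<^sup>+s. ?E r s \<partial>lborel \<partial>lborel) + (\<integral>\<^sup>+s. \<integral>\<^sup>+r. ?E s r \<partial>lborel \<partial>lborel) < \<infinity>"
    using W by (simp add: W0_ext_def)
  finally have 2: "gagliardo \<theta> 1 T g < \<infinity>" by (simp add: gagliardo_def)
  show ?thesis using 1 2 m by (simp add: W0_space_def W0_norm_def)
qed

section \<open>Hoelder continuous integrators\<close>

text \<open>Keeps the Hoelder constant explicit, because it must enter the final estimate
  linearly.\<close>

definition holder_bound :: "real \<Rightarrow> real \<Rightarrow> real \<Rightarrow> (real \<Rightarrow> real) \<Rightarrow> bool" where
  "holder_bound T \<gamma> H Y \<longleftrightarrow> 0 \<le> H \<and> (\<forall>u\<in>{0..T}. \<forall>t\<in>{0..T}. \<bar>Y t - Y u\<bar> \<le> H * \<bar>t - u\<bar> powr \<gamma>)"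

text \<open>The gap \<theta> < \<gamma> leaves the bounded power (T - t) powr (\<gamma> - \<theta>)
  at the endpoint and the integrable power (u - t) powr (\<gamma> - \<theta> - 1) in the tail
  integral.\<close>

lemma holder_WT_space:
  assumes T: "0 < T" and H: "holder_bound T \<gamma> H Y"
    and Y: "continuous_on {0..T} Y" and \<theta>: "0 < \<theta>" "\<theta> < \<gamma>"
  shows "\<And>t. t \<in> {0<..<T} \<Longrightarrow> \<bar>Y T - Y t\<bar> / (T - t) powr \<theta> \<le> H * T powr (\<gamma> - \<theta>)"
    and "\<And>t. t \<in> {0<..<T} \<Longrightarrow> (\<integral>\<^sup>+u. ennreal (\<bar>Y t - Y u\<bar> / \<bar>t - u\<bar> powr (1 + \<theta>)) \<partial>lebesgue_on {t..T}) \<le> ennreal (H * T powr (\<gamma> - \<theta>) / (\<gamma> - \<theta>))"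
    and "Y \<in> WT_space \<theta> T"
proof -
  have H: "0 \<le> H" "\<And>u t. 0 \<le> u \<Longrightarrow> u \<le> T \<Longrightarrow> 0 \<le> t \<Longrightarrow> t \<le> T \<Longrightarrow> \<bar>Y t - Y u\<bar> \<le> H * \<bar>t - u\<bar> powr \<gamma>"
    using H by (auto simp: holder_bound_def)
  show b1: "\<bar>Y T - Y t\<bar> / (T - t) powr \<theta> \<le> H * T powr (\<gamma> - \<theta>)" if t: "t \<in> {0<..<T}" for t
  proof -
    have "\<bar>Y T - Y t\<bar> \<le> H * (T - t) powr \<gamma>" using H(2)[of t T] t by simp
    also have "\<dots> = H * (T - t) powr (\<gamma> - \<theta>) * (T - t) powr \<theta>" by (simp flip: powr_add)
    also have "\<dots> \<le> H * T powr (\<gamma> - \<theta>) * (T - t) powr \<theta>"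
      using t H(1) \<theta> by (intro mult_right_mono mult_left_mono powr_mono2) auto
    finally show ?thesis using t by (simp add: pos_divide_le_eq)
  qed
  show b2: "(\<integral>\<^sup>+u. ennreal (\<bar>Y t - Y u\<bar> / \<bar>t - u\<bar> powr (1 + \<theta>)) \<partial>lebesgue_on {t..T}) \<le> ennreal (H * T powr (\<gamma> - \<theta>) / (\<gamma> - \<theta>))" if t: "t \<in> {0<..<T}" for t
  proof -
    have "(\<integral>\<^sup>+u. ennreal (\<bar>Y t - Y u\<bar> / \<bar>t - u\<bar> powr (1 + \<theta>)) \<partial>lebesgue_on {t..T})
      \<le> (\<integral>\<^sup>+u. ennreal H * (indicator {t..T} u * ennreal ((u - t) powr (\<gamma> - \<theta> - 1))) \<partial>lborel)"
      unfolding nn_integral_lebesgue_on_Icc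
    proof (rule nn_integral_mono)
      fix u
      show "indicator {t..T} u * ennreal (\<bar>Y t - Y u\<bar> / \<bar>t - u\<bar> powr (1 + \<theta>)) \<le> ennreal H * (indicator {t..T} u * ennreal ((u - t) powr (\<gamma> - \<theta> - 1)))"
      proof (cases "t < u \<and> u \<le> T")
        case True
        have "\<bar>Y t - Y u\<bar> \<le> H * (u - t) powr \<gamma>" using H(2)[of u t] t True by (simp add: abs_minus_commute)
        also have "(u - t) powr \<gamma> = (u - t) powr (\<gamma> - \<theta> - 1) * (u - t) powr (1 + \<theta>)" by (simp flip: powr_add)
        finally have "\<bar>Y t - Y u\<bar> / (u - t) powr (1 + \<theta>) \<le> H * (u - t) powr (\<gamma> - \<theta> - 1)"
          using True by (simp add: pos_divide_le_eq mult.assoc)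
        then show ?thesis using True H(1) by (simp add: ennreal_mult[symmetric] abs_minus_commute ennreal_leI)
      next
        case False
        then show ?thesis by (cases "u = t") (auto simp: indicator_def)
      qed
    qed
    also have "\<dots> = ennreal H * ennreal ((T - t) powr (\<gamma> - \<theta>) / (\<gamma> - \<theta>))"
      using nn_integral_powr_left[of "\<gamma> - \<theta> - 1" t T] t \<theta> by (subst nn_integral_cmult) auto
    also have "\<dots> = ennreal (H * (T - t) powr (\<gamma> - \<theta>) / (\<gamma> - \<theta>))"
      using H(1) \<theta> by (simp add: ennreal_mult[symmetric])
    also have "\<dots> \<le> ennreal (H * T powr (\<gamma> - \<theta>) / (\<gamma> - \<theta>))"
      using t H(1) \<theta> by (intro ennreal_leI divide_right_mono mult_left_mono powr_mono2) auto
    finally show ?thesis .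
  qed
  have "(SUP t\<in>{0<..<T}. ennreal (\<bar>left_lim Y T - Y t\<bar> / (T - t) powr \<theta>)) \<le> ennreal (H * T powr (\<gamma> - \<theta>))"
    unfolding left_lim_continuous(1)[OF Y T] by (intro SUP_least ennreal_leI b1)
  moreover have "(SUP t\<in>{0<..<T}. \<integral>\<^sup>+u. ennreal (\<bar>Y t - Y u\<bar> / \<bar>t - u\<bar> powr (1 + \<theta>)) \<partial>lebesgue_on {t..T}) \<le> ennreal (H * T powr (\<gamma> - \<theta>) / (\<gamma> - \<theta>))"
    by (intro SUP_least b2)
  ultimately have "(SUP t\<in>{0<..<T}. ennreal (\<bar>left_lim Y T - Y t\<bar> / (T - t) powr \<theta>)) +
        (SUP t\<in>{0<..<T}. \<integral>\<^sup>+u. ennreal (\<bar>Y t - Y u\<bar> / \<bar>t - u\<bar> powr (1 + \<theta>)) \<partial>lebesgue_on {t..T})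
      \<le> ennreal (H * T powr (\<gamma> - \<theta>)) + ennreal (H * T powr (\<gamma> - \<theta>) / (\<gamma> - \<theta>))"
    by (rule add_mono)
  also have "\<dots> < \<infinity>" by simp
  finally have "(SUP t\<in>{0<..<T}. ennreal (\<bar>left_lim Y T - Y t\<bar> / (T - t) powr \<theta>)) +
        (SUP t\<in>{0<..<T}. \<integral>\<^sup>+u. ennreal (\<bar>Y t - Y u\<bar> / \<bar>t - u\<bar> powr (1 + \<theta>)) \<partial>lebesgue_on {t..T}) < \<infinity>" .
  moreover have "Y \<in> borel_measurable (lebesgue_on {0..T})"
    using Y by (intro continuous_imp_measurable_on_sets_lebesgue) auto
  ultimately show "Y \<in> WT_space \<theta> T"
    using left_lim_continuous(2)[OF Y T] unfolding WT_space_def by blast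
qed

lemma holder_reflected_increment:
  assumes T: "0 < T" and H: "holder_bound T \<gamma> H Y"
    and Y: "continuous_on {0..T} Y" and \<theta>: "0 < \<theta>" "\<theta> < \<gamma>" "\<theta> < 1"
  shows "W0_ext \<theta> T (reflected_increment T Y)"
    and "x \<in> {0<..<T} \<Longrightarrow> \<bar>frac_deriv_ext \<theta> T (reflected_increment T Y) x\<bar>
      \<le> (H * T powr (\<gamma> - \<theta>) + \<theta> * (H * T powr (\<gamma> - \<theta>) / (\<gamma> - \<theta>))) / Gamma (1 - \<theta>)"
proof -
  have K: "0 \<le> H * T powr (\<gamma> - \<theta>)" "0 \<le> H * T powr (\<gamma> - \<theta>) / (\<gamma> - \<theta>)"
    using H \<theta>(2) by (auto simp: holder_bound_def)
  note HW = holder_WT_space(1,2)[OF T H Y \<theta>(1,2)]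
  show "W0_ext \<theta> T (reflected_increment T Y)"
    by (rule reflected_increment_W0_ext(1)[OF T Y K \<theta>(1,3)]) (fact HW)+
  show "\<bar>frac_deriv_ext \<theta> T (reflected_increment T Y) x\<bar>
      \<le> (H * T powr (\<gamma> - \<theta>) + \<theta> * (H * T powr (\<gamma> - \<theta>) / (\<gamma> - \<theta>))) / Gamma (1 - \<theta>)" if "x \<in> {0<..<T}"
    by (rule reflected_increment_W0_ext(2)[OF T Y K \<theta>(1,3)]) (fact HW that)+
qed

text \<open>\<open>restrict_to\<close> uses the closed interval [0,t] and \<open>truncate\<close>
  the half-open one; they differ only at 0.\<close>

lemma restrict_to_AE_truncate:
  assumes "AE s in lborel. s \<in> {0..T} \<longrightarrow> f s = f0 s"
  shows "AE s in lborel. s \<in> {0..T} \<longrightarrow> restrict_to t f s = truncate 0 t f0 s"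
  using assms AE_lborel_singleton[of 0]
  by eventually_elim (auto simp: restrict_to_def truncate_def indicator_def)

lemma gls_admissible_restrict_to:
  assumes T: "0 < T" and H: "holder_bound T \<gamma> H Y"
    and Y: "continuous_on {0..T} Y" and \<theta>: "0 < \<theta>" "\<theta> < 1" "1 - \<theta> < \<gamma>"
    and f0: "f0 \<in> borel_measurable borel" "AE s in lborel. s \<in> {0..T} \<longrightarrow> f s = f0 s"
    and t: "0 \<le> t" "t \<le> T" and fin: "truncation_bound \<theta> 0 t f0 < \<infinity>"
  shows "gls_admissible T (restrict_to t f) Y \<theta>"
  unfolding gls_admissible_def
  using W0_space_truncate[OF f0(1) \<theta>(1) t fin restrict_to_AE_truncate[OF f0(2)]]
    holder_WT_space(3)[OF T H Y, of "1 - \<theta>"] \<theta> by auto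

text \<open>The bounds for [0,u] and [0,t] make the two integrals admissible, so both are pairings
  with the same bounded function w. Their difference pairs w with the derivative of
  \<open>truncate u t f0\<close>, and is at most the supremum of |w| times an L1 norm.\<close>

lemma gls_integral_difference:
  assumes T: "0 < T" and H: "holder_bound T \<gamma> H Y"
    and Y: "continuous_on {0..T} Y" and \<theta>: "0 < \<theta>" "\<theta> < 1" "1 - \<theta> < \<gamma>"
    and f0: "f0 \<in> borel_measurable borel" "AE s in lborel. s \<in> {0..T} \<longrightarrow> f s = f0 s"
    and ut: "0 \<le> u" "u \<le> t" "t \<le> T"
    and fin: "truncation_bound \<theta> 0 u f0 < \<infinity>" "truncation_bound \<theta> 0 t f0 < \<infinity>" "truncation_bound \<theta> u t f0 < \<infinity>"
  shows "ennreal \<bar>gls_integral T (restrict_to t f) Y - gls_integral T (restrict_to u f) Y\<bar> \<le>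
    ennreal (H * (T powr (\<gamma> + \<theta> - 1) * (1 + (1 - \<theta>) / (\<gamma> + \<theta> - 1)) / Gamma \<theta> / Gamma (1 - \<theta>))) * truncation_bound \<theta> u t f0"
proof -
  let ?h = "reflected_increment T Y"
  \<comment> \<open>The bound of \<open>holder_reflected_increment\<close> at order 1 - \<theta>;
    \<open>Gamma \<theta>\<close> is Gamma (1 - (1 - \<theta>)).\<close>
  define K where "K = H * (T powr (\<gamma> + \<theta> - 1) * (1 + (1 - \<theta>) / (\<gamma> + \<theta> - 1)) / Gamma \<theta>)"
  have G: "0 < Gamma \<theta>" "0 < Gamma (1 - \<theta>)" using \<theta> by (auto intro!: Gamma_real_pos)
  have H0: "0 \<le> H" using H by (simp add: holder_bound_def)
  have K0: "0 \<le> K" using H0 \<theta> G by (simp add: K_def)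
  have \<theta>': "0 < 1 - \<theta>" "1 - \<theta> < 1" using \<theta> by auto
  note R = holder_reflected_increment[OF T H Y \<theta>'(1) \<theta>(3) \<theta>'(2)]
  have Keq: "(H * T powr (\<gamma> - (1 - \<theta>)) + (1 - \<theta>) * (H * T powr (\<gamma> - (1 - \<theta>)) / (\<gamma> - (1 - \<theta>)))) / Gamma (1 - (1 - \<theta>)) = K"
  proof -
    have e: "\<gamma> - (1 - \<theta>) = \<gamma> + \<theta> - 1" by simp
    show ?thesis unfolding e K_def by (simp add: distrib_left ac_simps)
  qed
  define w where "w = frac_deriv_ext (1 - \<theta>) T ?h"
  have hW: "W0_ext (1 - \<theta>) T ?h" by (rule R(1))
  have wK: "\<bar>w x\<bar> \<le> K" if "x \<in> {0<..<T}" for x using R(2)[OF that] Keq unfolding w_def by simp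
  have [measurable]: "w \<in> borel_measurable borel" unfolding w_def by (rule L1_on_borel[OF L1_on_frac_deriv_ext[OF hW]])
  define D where "D a b = frac_deriv_ext \<theta> T (truncate a b f0)" for a b
  have W: "W0_ext \<theta> T (truncate 0 u f0)" "W0_ext \<theta> T (truncate 0 t f0)" "W0_ext \<theta> T (truncate u t f0)"
    using ut fin by (auto intro!: truncate_W0_ext f0 \<theta>)
  have DL: "L1_on T (D 0 u)" "L1_on T (D 0 t)" "L1_on T (D u t)" unfolding D_def by (intro L1_on_frac_deriv_ext W)+
  have Dm [measurable]: "D 0 u \<in> borel_measurable borel" "D 0 t \<in> borel_measurable borel" "D u t \<in> borel_measurable borel"
    using DL by (auto intro: L1_on_borel)
  have I: "gls_integral T (restrict_to b f) Y = - (LBINT s. D 0 b s * w (T - s))"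
    if b: "0 \<le> b" "b \<le> T" "truncation_bound \<theta> 0 b f0 < \<infinity>" "W0_ext \<theta> T (truncate 0 b f0)" for b
  proof -
    have "gls_integral T (restrict_to b f) Y = gls_formula \<theta> T (restrict_to b f) Y"
      by (rule gls_integral_eq_formula[OF T Y gls_admissible_restrict_to[OF T H Y \<theta> f0 b(1,2,3)]])
    also have "\<dots> = - (LBINT s. D 0 b s * w (T - s))"
      unfolding D_def w_def
      by (rule gls_formula_eq[OF _ restrict_to_AE_truncate[OF f0(2)] Y T])
         (use f0(1) in \<open>auto intro!: L1_on_borel[OF L1_on_frac_deriv_ext] b(4) hW borel_measurable_truncate\<close>)
    finally show ?thesis .
  qed
  have wK': "\<bar>D a b s * w (T - s)\<bar> \<le> K * \<bar>D a b s\<bar>" if "s \<noteq> 0" "s \<noteq> T" for a b s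
  proof (cases "s \<in> {0..T}")
    case True
    then have "\<bar>w (T - s)\<bar> \<le> K" using that by (intro wK) auto
    then have "\<bar>D a b s\<bar> * \<bar>w (T - s)\<bar> \<le> \<bar>D a b s\<bar> * K" by (intro mult_left_mono) auto
    then show ?thesis by (simp add: abs_mult mult.commute[of K])
  qed (simp add: D_def frac_deriv_ext_def)
  have ends: "AE s in lborel. s \<noteq> 0 \<and> s \<noteq> T"
    using AE_lborel_singleton[of 0] AE_lborel_singleton[of T] by eventually_elim simp
  have int: "integrable lborel (\<lambda>s. D a b s * w (T - s))" if "L1_on T (D a b)" for a b
  proof (rule Bochner_Integration.integrable_bound)
    show "integrable lborel (\<lambda>s. K * D a b s)" using that by (simp add: L1_on_def)
    have [measurable]: "D a b \<in> borel_measurable borel" using that by (rule L1_on_borel)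
    show "(\<lambda>s. D a b s * w (T - s)) \<in> borel_measurable lborel" by measurable
    show "AE s in lborel. norm (D a b s * w (T - s)) \<le> norm (K * D a b s)"
      using ends by eventually_elim (use wK' K0 in \<open>auto simp: abs_mult\<close>)
  qed
  have tr: "(\<lambda>s. truncate 0 t f0 s - truncate 0 u f0 s) = truncate u t f0"
    using ut by (auto simp: truncate_def indicator_def fun_eq_iff)
  have "gls_integral T (restrict_to t f) Y - gls_integral T (restrict_to u f) Y
    = - ((LBINT s. D 0 t s * w (T - s)) - (LBINT s. D 0 u s * w (T - s)))"
    using I[of t] I[of u] ut fin W by simp
  also have "(LBINT s. D 0 t s * w (T - s)) - (LBINT s. D 0 u s * w (T - s)) = (LBINT s. D 0 t s * w (T - s) - D 0 u s * w (T - s))"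
    using int DL by (intro Bochner_Integration.integral_diff[symmetric]) auto
  also have "\<dots> = (LBINT s. D u t s * w (T - s))"
  proof (rule integral_cong_AE)
    show "AE s in lborel. D 0 t s * w (T - s) - D 0 u s * w (T - s) = D u t s * w (T - s)"
      using frac_deriv_ext_diff[OF W(2,1)] unfolding tr D_def by eventually_elim (simp add: left_diff_distrib)
  qed measurable
  finally have "ennreal \<bar>gls_integral T (restrict_to t f) Y - gls_integral T (restrict_to u f) Y\<bar> = ennreal (norm (LBINT s. D u t s * w (T - s)))"
    by simp
  also have "\<dots> \<le> (\<integral>\<^sup>+s. ennreal (norm (D u t s * w (T - s))) \<partial>lborel)"
    using int[OF DL(3)] by (rule integral_norm_bound_ennreal)
  also have "\<dots> \<le> (\<integral>\<^sup>+s. ennreal K * ennreal \<bar>D u t s\<bar> \<partial>lborel)"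
    using ends by (intro nn_integral_mono_AE, eventually_elim) (use wK' K0 in \<open>auto simp: ennreal_mult[symmetric] intro!: ennreal_leI\<close>)
  also have "\<dots> = ennreal K * (\<integral>\<^sup>+s. ennreal \<bar>D u t s\<bar> \<partial>lborel)"
    by (rule nn_integral_cmult) measurable
  also have "\<dots> \<le> ennreal K * (ennreal (1 / Gamma (1 - \<theta>)) * truncation_bound \<theta> u t f0)"
    unfolding D_def by (intro mult_left_mono nn_integral_frac_deriv_truncate_le f0 \<theta> ut fin) auto
  also have "\<dots> = ennreal (K * (1 / Gamma (1 - \<theta>))) * truncation_bound \<theta> u t f0"
    using K0 G by (subst ennreal_mult) (auto simp: mult.assoc)
  finally show ?thesis by (simp add: K_def)
qed

text \<open>Anchors the integral at time 0, so that the increment estimate also bounds the supremum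
  part of the Hoelder norm.\<close>

lemma gls_integral_0:
  assumes T: "0 < T" and H: "holder_bound T \<gamma> H Y"
    and Y: "continuous_on {0..T} Y" and \<theta>: "0 < \<theta>" "\<theta> < 1" "1 - \<theta> < \<gamma>"
    and f0: "f0 \<in> borel_measurable borel" "AE s in lborel. s \<in> {0..T} \<longrightarrow> f s = f0 s"
  shows "gls_integral T (restrict_to 0 f) Y = 0"
proof -
  have z: "truncate 0 0 f0 = (\<lambda>_. 0)" by (auto simp: truncate_def)
  have fin: "truncation_bound \<theta> 0 0 f0 < \<infinity>"
    by (simp add: truncation_bound_def left_weight_def right_weight_def half_seminorm_def)
  have W: "W0_ext \<theta> T (truncate 0 0 f0)" using T by (intro truncate_W0_ext f0 \<theta> fin) auto
  have \<theta>': "0 < 1 - \<theta>" "1 - \<theta> < 1" using \<theta> by auto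
  note hW = holder_reflected_increment(1)[OF T H Y \<theta>'(1) \<theta>(3) \<theta>'(2)]
  have D0: "frac_deriv_ext \<theta> T (truncate 0 0 f0) s = 0" for s
    by (simp add: z frac_deriv_ext_def)
  have "gls_integral T (restrict_to 0 f) Y = gls_formula \<theta> T (restrict_to 0 f) Y"
    using T by (intro gls_integral_eq_formula[OF T Y gls_admissible_restrict_to[OF T H Y \<theta> f0 _ _ fin]]) auto
  also have "\<dots> = - (LBINT s. frac_deriv_ext \<theta> T (truncate 0 0 f0) s * frac_deriv_ext (1 - \<theta>) T (reflected_increment T Y) (T - s))"
    by (rule gls_formula_eq[OF _ restrict_to_AE_truncate[OF f0(2)] Y T])
       (use f0(1) in \<open>auto intro!: L1_on_borel[OF L1_on_frac_deriv_ext] W hW borel_measurable_truncate\<close>)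
  also have "\<dots> = 0" by (simp add: D0)
  finally show ?thesis .
qed

section \<open>Bounds in terms of the fractional Sobolev norms\<close>

lemma conjugate_exponent:
  assumes p: "1 < (p::real)" "q = p / (p - 1)"
  shows "1 < q" "0 < q" "1 / p + 1 / q = 1" "q * (1 / p - 1) = - 1" "1 / q = 1 - 1 / p"
proof -
  show q: "1 < q" using p by (simp add: less_divide_eq)
  then show "0 < q" by simp
  show e: "1 / q = 1 - 1 / p" using p by (simp add: diff_divide_distrib)
  then show "1 / p + 1 / q = 1" by simp
  have "q * (1 / p - 1) = - (q * (1 / q))" unfolding e by (simp add: algebra_simps)
  then show "q * (1 / p - 1) = - 1" using q by simp
qed

text \<open>Young's inequality for a / A and b / B. Formulated with given bounds A and B instead of
  norms, it avoids roots of possibly infinite integrals.\<close>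

lemma Holder_nn_integral_pos:
  assumes p: "1 < p" "q = p / (p - 1)" and [measurable]: "a \<in> borel_measurable M" "b \<in> borel_measurable M"
    and nonneg: "\<And>x. 0 \<le> a x" "\<And>x. 0 \<le> b x" and AB: "0 < A" "0 < B"
    and a: "(\<integral>\<^sup>+x. ennreal (a x powr p) \<partial>M) \<le> ennreal (A powr p)" and b: "(\<integral>\<^sup>+x. ennreal (b x powr q) \<partial>M) \<le> ennreal (B powr q)"
  shows "(\<integral>\<^sup>+x. ennreal (a x * b x) \<partial>M) \<le> ennreal (A * B)"
proof -
  note q = conjugate_exponent(1,3)[OF p]
  let ?\<alpha> = "A * B / p / A powr p" and ?\<beta> = "A * B / q / B powr q"
  have \<alpha>\<beta>: "0 \<le> ?\<alpha>" "0 \<le> ?\<beta>" using AB p q by auto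
  have "(\<integral>\<^sup>+x. ennreal (a x * b x) \<partial>M) \<le> (\<integral>\<^sup>+x. ennreal ?\<alpha> * ennreal (a x powr p) + ennreal ?\<beta> * ennreal (b x powr q) \<partial>M)"
  proof (rule nn_integral_mono)
    fix x
    have "a x / A * (b x / B) \<le> (a x / A) powr p / p + (b x / B) powr q / q"
      using p q nonneg AB by (intro Youngs_inequality) auto
    then have "A * B * (a x / A * (b x / B)) \<le> A * B * ((a x / A) powr p / p + (b x / B) powr q / q)"
      using AB by (intro mult_left_mono) auto
    moreover have "A * B * (a x / A * (b x / B)) = a x * b x" using AB by simp
    moreover have "(a x / A) powr p = a x powr p / A powr p" "(b x / B) powr q = b x powr q / B powr q"
      using nonneg AB by (auto simp: powr_divide)
    ultimately have "a x * b x \<le> ?\<alpha> * a x powr p + ?\<beta> * b x powr q"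
      by (simp add: distrib_left ac_simps)
    then show "ennreal (a x * b x) \<le> ennreal ?\<alpha> * ennreal (a x powr p) + ennreal ?\<beta> * ennreal (b x powr q)"
      using \<alpha>\<beta> by (simp only: ennreal_mult[symmetric] ennreal_plus[symmetric] powr_ge_zero mult_nonneg_nonneg ennreal_leI)
  qed
  also have "\<dots> = ennreal ?\<alpha> * (\<integral>\<^sup>+x. ennreal (a x powr p) \<partial>M) + ennreal ?\<beta> * (\<integral>\<^sup>+x. ennreal (b x powr q) \<partial>M)"
    by (simp add: nn_integral_add nn_integral_cmult)
  also have "\<dots> \<le> ennreal ?\<alpha> * ennreal (A powr p) + ennreal ?\<beta> * ennreal (B powr q)"
    by (intro add_mono mult_left_mono a b) auto
  also have "\<dots> = ennreal (?\<alpha> * A powr p + ?\<beta> * B powr q)"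
    using \<alpha>\<beta> by (simp only: ennreal_mult[symmetric] ennreal_plus[symmetric] powr_ge_zero mult_nonneg_nonneg)
  also have "?\<alpha> * A powr p + ?\<beta> * B powr q = A * B * (1 / p + 1 / q)"
    using AB by (simp add: distrib_left)
  finally show ?thesis using q by simp
qed

text \<open>A vanishing bound makes the scaling in Young's inequality degenerate; the bounds are
  enlarged by 1 / (n + 1) and n tends to infinity.\<close>

lemma Holder_nn_integral:
  assumes p: "1 < p" "q = p / (p - 1)" and m: "a \<in> borel_measurable M" "b \<in> borel_measurable M"
    and nonneg: "\<And>x. 0 \<le> a x" "\<And>x. 0 \<le> b x" and AB: "0 \<le> A" "0 \<le> B"
    and a: "(\<integral>\<^sup>+x. ennreal (a x powr p) \<partial>M) \<le> ennreal (A powr p)" and b: "(\<integral>\<^sup>+x. ennreal (b x powr q) \<partial>M) \<le> ennreal (B powr q)"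
  shows "(\<integral>\<^sup>+x. ennreal (a x * b x) \<partial>M) \<le> ennreal (A * B)"
proof (rule LIMSEQ_le_const)
  have "(\<lambda>n. (A + 1 / real (Suc n)) * (B + 1 / real (Suc n))) \<longlonglongrightarrow> (A + 0) * (B + 0)"
    by (intro tendsto_intros LIMSEQ_Suc[OF lim_1_over_n])
  then show "(\<lambda>n. ennreal ((A + 1 / real (Suc n)) * (B + 1 / real (Suc n)))) \<longlonglongrightarrow> ennreal (A * B)"
    by (intro tendsto_ennrealI) simp
  have "(\<integral>\<^sup>+x. ennreal (a x * b x) \<partial>M) \<le> ennreal ((A + 1 / real (Suc n)) * (B + 1 / real (Suc n)))" for n
  proof (rule Holder_nn_integral_pos[OF p m nonneg])
    note q = conjugate_exponent(2)[OF p]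
    show "0 < A + 1 / real (Suc n)" "0 < B + 1 / real (Suc n)" using AB by (auto intro: add_nonneg_pos)
    show "(\<integral>\<^sup>+x. ennreal (a x powr p) \<partial>M) \<le> ennreal ((A + 1 / real (Suc n)) powr p)"
      by (rule order_trans[OF a]) (use AB p in \<open>auto intro!: ennreal_leI powr_mono2\<close>)
    show "(\<integral>\<^sup>+x. ennreal (b x powr q) \<partial>M) \<le> ennreal ((B + 1 / real (Suc n)) powr q)"
      by (rule order_trans[OF b]) (use AB q in \<open>auto intro!: ennreal_leI powr_mono2\<close>)
  qed
  then show "\<exists>N. \<forall>n\<ge>N. (\<integral>\<^sup>+x. ennreal (a x * b x) \<partial>M) \<le> ennreal ((A + 1 / real (Suc n)) * (B + 1 / real (Suc n)))"
    by blast
qed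

lemma truncation_bound_le:
  assumes "0 < \<theta>" "0 \<le> L" "0 \<le> R" "0 \<le> S" "left_weight \<theta> u t f \<le> ennreal L" "right_weight \<theta> u t f \<le> ennreal R" "half_seminorm \<theta> u t f \<le> ennreal S"
  shows "truncation_bound \<theta> u t f \<le> ennreal (2 * L + R + \<theta> * S)"
proof -
  have "truncation_bound \<theta> u t f \<le> ennreal L + ennreal \<theta> * (ennreal S + (ennreal (1 / \<theta>) * ennreal L + ennreal (1 / \<theta>) * ennreal R))"
    unfolding truncation_bound_def by (intro add_mono mult_left_mono assms) auto
  also have "\<dots> = ennreal (L + \<theta> * (S + (1 / \<theta> * L + 1 / \<theta> * R)))"
    using assms(1-4) by (simp only: ennreal_mult[symmetric] ennreal_plus[symmetric] mult_nonneg_nonneg add_nonneg_nonneg less_imp_le zero_le_divide_1_iff)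
  also have "L + \<theta> * (S + (1 / \<theta> * L + 1 / \<theta> * R)) = 2 * L + R + \<theta> * S"
    using assms(1) by (simp add: field_simps)
  finally show ?thesis .
qed

text \<open>Here w is the distance to one end of (u,t]. The condition \<theta> q < 1 puts the weight
  in the dual space L^q, and its norm there is a multiple of d powr (1 / q - \<theta>).\<close>

lemma weight_le_Lp:
  fixes f w :: "real \<Rightarrow> real" and u t T :: real
  assumes [measurable]: "f \<in> borel_measurable borel" "w \<in> borel_measurable borel" and p: "1 < p" "q = p / (p - 1)" and n: "0 \<le> n"
    and \<theta>: "\<theta> * q < 1" and d: "0 \<le> d" and ut: "0 \<le> u" "t \<le> T"
    and w: "(\<integral>\<^sup>+s. indicator {u<..t} s * ennreal (w s powr (- \<theta> * q)) \<partial>lborel) \<le> ennreal (d powr (1 - \<theta> * q) / (1 - \<theta> * q))"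
    and f: "(\<integral>\<^sup>+s. indicator {0..T} s * ennreal (\<bar>f s\<bar> powr p) \<partial>lborel) \<le> ennreal (n powr p)"
  shows "(\<integral>\<^sup>+s. indicator {u<..t} s * ennreal (\<bar>f s\<bar> * w s powr - \<theta>) \<partial>lborel) \<le> ennreal (n * (d powr (1 / q - \<theta>) / (1 - \<theta> * q) powr (1 / q)))"
proof -
  note q = conjugate_exponent(2)[OF p]
  have "(\<integral>\<^sup>+s. ennreal ((indicator {u<..t} s * \<bar>f s\<bar>) * (indicator {u<..t} s * w s powr - \<theta>)) \<partial>lborel) \<le> ennreal (n * (d powr (1 / q - \<theta>) / (1 - \<theta> * q) powr (1 / q)))"
  proof (rule Holder_nn_integral[OF p])
    have "(\<integral>\<^sup>+s. ennreal ((indicator {u<..t} s * \<bar>f s\<bar>) powr p) \<partial>lborel) \<le> (\<integral>\<^sup>+s. indicator {0..T} s * ennreal (\<bar>f s\<bar> powr p) \<partial>lborel)"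
    proof (rule nn_integral_mono)
      fix s
      show "ennreal ((indicator {u<..t} s * \<bar>f s\<bar>) powr p) \<le> indicator {0..T} s * ennreal (\<bar>f s\<bar> powr p)"
        proof (cases "u < s \<and> s \<le> t")
        case True
        then have "0 \<le> s" "s \<le> T" using ut by auto
        then show ?thesis using True by simp
      qed (auto simp: indicator_def)
    qed
    then show "(\<integral>\<^sup>+s. ennreal ((indicator {u<..t} s * \<bar>f s\<bar>) powr p) \<partial>lborel) \<le> ennreal (n powr p)" using f by (rule order_trans)
    have "(\<integral>\<^sup>+s. ennreal ((indicator {u<..t} s * w s powr - \<theta>) powr q) \<partial>lborel) = (\<integral>\<^sup>+s. indicator {u<..t} s * ennreal (w s powr (- \<theta> * q)) \<partial>lborel)"
      by (intro nn_integral_cong) (auto simp: indicator_def powr_powr)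
    also have "\<dots> \<le> ennreal (d powr (1 - \<theta> * q) / (1 - \<theta> * q))" by (rule w)
    also have "d powr (1 - \<theta> * q) / (1 - \<theta> * q) = (d powr (1 / q - \<theta>) / (1 - \<theta> * q) powr (1 / q)) powr q"
    proof -
      have "(1 / q - \<theta>) * q = 1 - \<theta> * q" using q by (simp add: left_diff_distrib)
      moreover have "((1 - \<theta> * q) powr (1 / q)) powr q = 1 - \<theta> * q" using q \<theta> by (simp add: powr_powr)
      ultimately show ?thesis by (simp add: powr_divide powr_powr)
    qed
    finally show "(\<integral>\<^sup>+s. ennreal ((indicator {u<..t} s * w s powr - \<theta>) powr q) \<partial>lborel) \<le> ennreal ((d powr (1 / q - \<theta>) / (1 - \<theta> * q) powr (1 / q)) powr q)" .
  qed (use n in auto)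
  moreover have "(\<integral>\<^sup>+s. ennreal ((indicator {u<..t} s * \<bar>f s\<bar>) * (indicator {u<..t} s * w s powr - \<theta>)) \<partial>lborel) = (\<integral>\<^sup>+s. indicator {u<..t} s * ennreal (\<bar>f s\<bar> * w s powr - \<theta>) \<partial>lborel)"
    by (intro nn_integral_cong) (auto simp: indicator_def)
  ultimately show ?thesis by simp
qed

text \<open>Since \<open>W\<^sup>\<beta>\<^sup>,\<^sup>p\<close> does not embed into \<open>W\<^sup>\<beta>\<^sup>,\<^sup>1\<close>, a smaller order \<open>\<theta> < \<beta>\<close> is needed here: for \<open>\<theta> = \<beta>\<close> the
  dual weight \<open>(r - s) powr - 1\<close> is not integrable.\<close>

lemma half_seminorm_le_gagliardo:
  assumes [measurable]: "f \<in> borel_measurable borel" and p: "1 < p" "q = p / (p - 1)" and n: "0 \<le> n"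
    and \<theta>: "\<theta> < \<beta>" and ut: "0 \<le> u" "u \<le> t" "t \<le> T"
    and f: "(\<integral>\<^sup>+r. \<integral>\<^sup>+s. indicator {0..T} r * indicator {0..T} s * ennreal (\<bar>f r - f s\<bar> powr p / \<bar>r - s\<bar> powr (1 + \<beta> * p)) \<partial>lborel \<partial>lborel) \<le> ennreal (n powr p)"
  shows "half_seminorm \<theta> u t f \<le> ennreal (n * ((t - u) powr (1 / q + (\<beta> - \<theta>)) / (q * (\<beta> - \<theta>)) powr (1 / q)))"
proof -
  note q = conjugate_exponent(2,4)[OF p]
  let ?P = "lborel \<Otimes>\<^sub>M (lborel :: real measure)"
  let ?i = "\<lambda>(r, s). if u < s \<and> s < r \<and> r \<le> t then 1 else 0 :: real"
  \<comment> \<open>The kernel is split so that ?a to the power p is the Gagliardo integrand; the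
    rest, ?b to the power q, has the exponent q (\<beta> - \<theta>) - 1 > -1.\<close>
  let ?a = "\<lambda>(r, s). ?i (r, s) * (\<bar>f r - f s\<bar> / (r - s) powr (1 / p + \<beta>))"
  let ?b = "\<lambda>(r, s). ?i (r, s) * (r - s) powr (1 / p + \<beta> - (\<theta> + 1))"
  let ?B = "(t - u) powr (1 / q + (\<beta> - \<theta>)) / (q * (\<beta> - \<theta>)) powr (1 / q)"
  have am: "?a \<in> borel_measurable ?P" and bm: "?b \<in> borel_measurable ?P" by measurable
  have "(\<integral>\<^sup>+x. ennreal (?a x * ?b x) \<partial>?P) \<le> ennreal (n * ?B)"
  proof (rule Holder_nn_integral[OF p am bm])
    have "(\<integral>\<^sup>+x. ennreal (?a x powr p) \<partial>?P) = (\<integral>\<^sup>+r. \<integral>\<^sup>+s. ennreal (?a (r, s) powr p) \<partial>lborel \<partial>lborel)"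
      using am by (intro lborel.nn_integral_fst[symmetric]) measurable
    also have "\<dots> \<le> (\<integral>\<^sup>+r. \<integral>\<^sup>+s. indicator {0..T} r * indicator {0..T} s * ennreal (\<bar>f r - f s\<bar> powr p / \<bar>r - s\<bar> powr (1 + \<beta> * p)) \<partial>lborel \<partial>lborel)"
    proof (intro nn_integral_mono)
      fix r s
      have "(1 / p + \<beta>) * p = 1 + \<beta> * p" using p by (simp add: distrib_right)
      then show "ennreal (?a (r, s) powr p) \<le> indicator {0..T} r * indicator {0..T} s * ennreal (\<bar>f r - f s\<bar> powr p / \<bar>r - s\<bar> powr (1 + \<beta> * p))"
        using ut by (auto simp: powr_divide powr_powr)
    qed
    finally show "(\<integral>\<^sup>+x. ennreal (?a x powr p) \<partial>?P) \<le> ennreal (n powr p)" using f by (rule order_trans)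
    \<comment> \<open>Rests on q (1 / p - 1) = -1 for conjugate exponents.\<close>
    have e: "(1 / p + \<beta> - (\<theta> + 1)) * q = q * (\<beta> - \<theta>) - 1" using q(2) by (simp add: algebra_simps)
    have qb: "0 < q * (\<beta> - \<theta>)" using q \<theta> by simp
    have "(\<integral>\<^sup>+x. ennreal (?b x powr q) \<partial>?P) = (\<integral>\<^sup>+r. \<integral>\<^sup>+s. ennreal (?b (r, s) powr q) \<partial>lborel \<partial>lborel)"
      using bm by (intro lborel.nn_integral_fst[symmetric]) measurable
    also have "\<dots> \<le> (\<integral>\<^sup>+r. ennreal ((t - u) powr (q * (\<beta> - \<theta>)) / (q * (\<beta> - \<theta>))) * indicator {u..t} r \<partial>lborel)"
    proof (rule nn_integral_mono)
      fix r
      show "(\<integral>\<^sup>+s. ennreal (?b (r, s) powr q) \<partial>lborel) \<le> ennreal ((t - u) powr (q * (\<beta> - \<theta>)) / (q * (\<beta> - \<theta>))) * indicator {u..t} r"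
      proof (cases "u \<le> r \<and> r \<le> t")
        case True
        have "(\<integral>\<^sup>+s. ennreal (?b (r, s) powr q) \<partial>lborel) \<le> (\<integral>\<^sup>+s. indicator {u..r} s * ennreal ((r - s) powr (q * (\<beta> - \<theta>) - 1)) \<partial>lborel)"
          by (intro nn_integral_mono) (auto simp: powr_powr e)
        also have "\<dots> = ennreal ((r - u) powr (q * (\<beta> - \<theta>)) / (q * (\<beta> - \<theta>)))"
          using nn_integral_powr_right[of "q * (\<beta> - \<theta>) - 1" u r] True qb by simp
        also have "\<dots> \<le> ennreal ((t - u) powr (q * (\<beta> - \<theta>)) / (q * (\<beta> - \<theta>)))"
          using True qb by (intro ennreal_leI divide_right_mono powr_mono2) auto
        finally show ?thesis using True by simp
      next
        case False
        then have "(if u < s \<and> s < r \<and> r \<le> t then 1 else 0 :: real) = 0" for s by auto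
        then show ?thesis by (simp only: prod.case mult_zero_left powr_0 ennreal_0 nn_integral_const) simp
      qed
    qed
    also have "\<dots> = ennreal ((t - u) powr (q * (\<beta> - \<theta>)) / (q * (\<beta> - \<theta>)) * (t - u))"
      using ut qb by (simp add: nn_integral_cmult ennreal_mult[symmetric])
    also have "(t - u) powr (q * (\<beta> - \<theta>)) / (q * (\<beta> - \<theta>)) * (t - u) = ?B powr q"
    proof -
      have "(1 / q + (\<beta> - \<theta>)) * q = q * (\<beta> - \<theta>) + 1" using q by (simp add: distrib_right)
      moreover have "((q * (\<beta> - \<theta>)) powr (1 / q)) powr q = q * (\<beta> - \<theta>)" using q qb by (simp add: powr_powr)
      moreover have "(t - u) powr (q * (\<beta> - \<theta>) + 1) = (t - u) powr (q * (\<beta> - \<theta>)) * (t - u)"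
        using ut by (simp add: powr_add)
      ultimately show ?thesis by (simp add: powr_divide powr_powr)
    qed
    finally show "(\<integral>\<^sup>+x. ennreal (?b x powr q) \<partial>?P) \<le> ennreal (?B powr q)" .
  qed (use n in auto)
  moreover have "half_seminorm \<theta> u t f = (\<integral>\<^sup>+x. ennreal (?a x * ?b x) \<partial>?P)"
  proof -
    have "(\<integral>\<^sup>+x. ennreal (?a x * ?b x) \<partial>?P) = (\<integral>\<^sup>+r. \<integral>\<^sup>+s. ennreal (?a (r, s) * ?b (r, s)) \<partial>lborel \<partial>lborel)"
      using am bm by (intro lborel.nn_integral_fst[symmetric]) measurable
    also have "\<dots> = half_seminorm \<theta> u t f"
      unfolding half_seminorm_def
    proof (intro nn_integral_cong)
      fix r s :: real
      have pw: "x / y powr (1 / p + \<beta>) * y powr (1 / p + \<beta> - (\<theta> + 1)) = x / y powr (\<theta> + 1)" if "0 < y" for x y :: real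
        using that by (simp add: powr_diff)
      show "ennreal (?a (r, s) * ?b (r, s)) = indicator {u<..t} r * indicator {u<..r} s * ennreal (\<bar>f r - f s\<bar> / (r - s) powr (\<theta> + 1))"
      proof (cases "u < s \<and> s < r \<and> r \<le> t")
        case True
        then show ?thesis using pw[of "r - s" "\<bar>f r - f s\<bar>"] by simp
      next
        case False
        then show ?thesis by (cases "r = s") (auto simp: indicator_def)
      qed
    qed
    finally show ?thesis by simp
  qed
  ultimately show ?thesis by simp
qed

lemma ennreal_powr_inverse_le:
  assumes "ennreal_powr X (1 / p) \<le> ennreal n" "0 < p" "0 \<le> n"
  shows "X \<le> ennreal (n powr p)"
proof (cases X)
  case (real x)
  then have "x powr (1 / p) \<le> n" using assms by (simp add: ennreal_powr_def)
  then have "(x powr (1 / p)) powr p \<le> n powr p" using assms by (intro powr_mono2) auto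
  then show ?thesis using real assms by (simp add: powr_powr ennreal_leI)
qed (use assms in \<open>simp add: ennreal_powr_def top_unique\<close>)

text \<open>The quantifiers put c before f, n, u and t. The target exponent 1 - \<beta> - 1 / p
  equals 1 / q - \<beta>; all three terms carry a larger power of t - u, and the surplus is traded
  for a power of T.\<close>

lemma truncation_bound_W_norm_finite_exponent:
  assumes T: "0 < T" and p: "1 < p" and \<theta>: "0 < \<theta>" "\<theta> < \<beta>" and \<beta>: "1 / p < 1 - \<beta>"
  shows "\<exists>c\<ge>0. \<forall>f f0 n u t. f0 \<in> borel_measurable borel \<longrightarrow> (AE s in lborel. s \<in> {0..T} \<longrightarrow> f s = f0 s) \<longrightarrow>
    0 \<le> n \<longrightarrow> W_norm \<beta> (ennreal p) T f \<le> ennreal n \<longrightarrow> 0 \<le> u \<longrightarrow> u \<le> t \<longrightarrow> t \<le> T \<longrightarrow>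
    truncation_bound \<theta> u t f0 \<le> ennreal (c * n * (t - u) powr (1 - \<beta> - 1 / p))"
proof -
  define q where "q = p / (p - 1)"
  note q = conjugate_exponent(2,5)[OF p q_def]
  \<comment> \<open>From \<theta> < \<beta> < 1 - 1 / p = 1 / q.\<close>
  have \<theta>q: "\<theta> * q < 1"
  proof -
    have "\<theta> < 1 / q" using \<theta> \<beta> q(2) by simp
    then show ?thesis using q(1) by (simp add: pos_less_divide_eq)
  qed
  define c1 where "c1 = 1 / (1 - \<theta> * q) powr (1 / q)"
  define c2 where "c2 = 1 / (q * (\<beta> - \<theta>)) powr (1 / q)"
  \<comment> \<open>The 3 counts two left weights and one right weight, as in
    \<open>truncation_bound_le\<close>. The surplus exponents over 1 / q - \<beta> are \<beta> -
    \<theta> for the weights and 2 \<beta> - \<theta> for the seminorm.\<close>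
  define c where "c = 3 * (c1 * T powr (\<beta> - \<theta>)) + \<theta> * (c2 * T powr (2 * \<beta> - \<theta>))"
  have c12: "0 \<le> c1" "0 \<le> c2" by (auto simp: c1_def c2_def)
  have c0: "0 \<le> c" using c12 \<theta> by (simp add: c_def)
  show ?thesis
  proof (intro exI[of _ c] conjI c0 allI impI)
    fix f f0 :: "real \<Rightarrow> real" and n u t :: real
    assume f0 [measurable]: "f0 \<in> borel_measurable borel" and ae: "AE s in lborel. s \<in> {0..T} \<longrightarrow> f s = f0 s"
      and n: "0 \<le> n" and W: "W_norm \<beta> (ennreal p) T f \<le> ennreal n" and ut: "0 \<le> u" "u \<le> t" "t \<le> (T::real)"
    have W': "Lp_norm T (ennreal p) (\<lambda>t. ennreal \<bar>f t\<bar>) + gagliardo \<beta> p T f \<le> ennreal n"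
      using W p by (simp add: W_norm_def)
    have "Lp_norm T (ennreal p) (\<lambda>t. ennreal \<bar>f t\<bar>) \<le> ennreal n" by (rule order_trans[OF _ W']) simp
    then have "ennreal_powr (\<integral>\<^sup>+s. ennreal_powr (ennreal \<bar>f s\<bar>) p \<partial>lebesgue_on {0..T}) (1 / p) \<le> ennreal n"
      using p by (simp add: Lp_norm_def)
    then have "(\<integral>\<^sup>+s. ennreal_powr (ennreal \<bar>f s\<bar>) p \<partial>lebesgue_on {0..T}) \<le> ennreal (n powr p)"
      using p n by (intro ennreal_powr_inverse_le) auto
    moreover have "(\<integral>\<^sup>+s. ennreal_powr (ennreal \<bar>f s\<bar>) p \<partial>lebesgue_on {0..T}) = (\<integral>\<^sup>+s. indicator {0..T} s * ennreal (\<bar>f0 s\<bar> powr p) \<partial>lborel)"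
      unfolding nn_integral_lebesgue_on_Icc
      by (intro nn_integral_cong_AE) (use ae in \<open>auto elim!: eventually_mono simp: indicator_def ennreal_powr_def\<close>)
    ultimately have Lp: "(\<integral>\<^sup>+s. indicator {0..T} s * ennreal (\<bar>f0 s\<bar> powr p) \<partial>lborel) \<le> ennreal (n powr p)" by simp
    have "gagliardo \<beta> p T f \<le> ennreal n" by (rule order_trans[OF _ W']) simp
    then have "(\<integral>\<^sup>+r. (\<integral>\<^sup>+s. ennreal (\<bar>f r - f s\<bar> powr p / \<bar>r - s\<bar> powr (1 + \<beta> * p)) \<partial>lebesgue_on {0..T}) \<partial>lebesgue_on {0..T}) \<le> ennreal (n powr p)"
      using p n unfolding gagliardo_def by (intro ennreal_powr_inverse_le) auto
    moreover have "(\<integral>\<^sup>+r. \<integral>\<^sup>+s. indicator {0..T} r * indicator {0..T} s * ennreal (\<bar>f0 r - f0 s\<bar> powr p / \<bar>r - s\<bar> powr (1 + \<beta> * p)) \<partial>lborel \<partial>lborel)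
      = (\<integral>\<^sup>+r. (\<integral>\<^sup>+s. ennreal (\<bar>f r - f s\<bar> powr p / \<bar>r - s\<bar> powr (1 + \<beta> * p)) \<partial>lebesgue_on {0..T}) \<partial>lebesgue_on {0..T})"
      unfolding nn_integral_lebesgue_on_Icc
    proof (rule nn_integral_cong_AE)
      show "AE r in lborel. (\<integral>\<^sup>+s. indicator {0..T} r * indicator {0..T} s * ennreal (\<bar>f0 r - f0 s\<bar> powr p / \<bar>r - s\<bar> powr (1 + \<beta> * p)) \<partial>lborel)
        = indicator {0..T} r * (\<integral>\<^sup>+s. indicator {0..T} s * ennreal (\<bar>f r - f s\<bar> powr p / \<bar>r - s\<bar> powr (1 + \<beta> * p)) \<partial>lborel)"
        using ae
      proof eventually_elim
        case (elim r)
        show ?case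
        proof (cases "r \<in> {0..T}")
          case True
          have "(\<integral>\<^sup>+s. indicator {0..T} s * ennreal (\<bar>f0 r - f0 s\<bar> powr p / \<bar>r - s\<bar> powr (1 + \<beta> * p)) \<partial>lborel)
            = (\<integral>\<^sup>+s. indicator {0..T} s * ennreal (\<bar>f r - f s\<bar> powr p / \<bar>r - s\<bar> powr (1 + \<beta> * p)) \<partial>lborel)"
            using ae by (intro nn_integral_cong_AE, eventually_elim) (use True elim in \<open>auto simp: indicator_def\<close>)
          then show ?thesis using True by simp
        qed simp
      qed
    qed
    ultimately have gag: "(\<integral>\<^sup>+r. \<integral>\<^sup>+s. indicator {0..T} r * indicator {0..T} s * ennreal (\<bar>f0 r - f0 s\<bar> powr p / \<bar>r - s\<bar> powr (1 + \<beta> * p)) \<partial>lborel \<partial>lborel) \<le> ennreal (n powr p)"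
      by simp
    define d where "d = t - u"
    have d: "0 \<le> d" "d \<le> T" using ut by (auto simp: d_def)
    have e1: "- 1 < - \<theta> * q" using \<theta>q by simp
    have L: "left_weight \<theta> u t f0 \<le> ennreal (n * (d powr (1 / q - \<theta>) / (1 - \<theta> * q) powr (1 / q)))"
      unfolding left_weight_def
    proof (rule weight_le_Lp[OF _ _ p q_def n \<theta>q d(1) ut(1,3) _ Lp])
      have "(\<integral>\<^sup>+s. indicator {u<..t} s * ennreal ((s - u) powr (- \<theta> * q)) \<partial>lborel) \<le> (\<integral>\<^sup>+s. indicator {u..t} s * ennreal ((s - u) powr (- \<theta> * q)) \<partial>lborel)"
        by (intro nn_integral_mono) (auto simp: indicator_def)
      also have "\<dots> = ennreal ((t - u) powr (- \<theta> * q + 1) / (- \<theta> * q + 1))" by (rule nn_integral_powr_left[OF e1 ut(2)])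
      finally show "(\<integral>\<^sup>+s. indicator {u<..t} s * ennreal ((s - u) powr (- \<theta> * q)) \<partial>lborel) \<le> ennreal (d powr (1 - \<theta> * q) / (1 - \<theta> * q))"
        by (simp add: d_def)
    qed auto
    have R: "right_weight \<theta> u t f0 \<le> ennreal (n * (d powr (1 / q - \<theta>) / (1 - \<theta> * q) powr (1 / q)))"
      unfolding right_weight_def
    proof (rule weight_le_Lp[OF _ _ p q_def n \<theta>q d(1) ut(1,3) _ Lp])
      have "(\<integral>\<^sup>+s. indicator {u<..t} s * ennreal ((t - s) powr (- \<theta> * q)) \<partial>lborel) \<le> (\<integral>\<^sup>+s. indicator {u..t} s * ennreal ((t - s) powr (- \<theta> * q)) \<partial>lborel)"
        by (intro nn_integral_mono) (auto simp: indicator_def)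
      also have "\<dots> = ennreal ((t - u) powr (- \<theta> * q + 1) / (- \<theta> * q + 1))" by (rule nn_integral_powr_right[OF e1 ut(2)])
      finally show "(\<integral>\<^sup>+s. indicator {u<..t} s * ennreal ((t - s) powr (- \<theta> * q)) \<partial>lborel) \<le> ennreal (d powr (1 - \<theta> * q) / (1 - \<theta> * q))"
        by (simp add: d_def)
    qed auto
    have S: "half_seminorm \<theta> u t f0 \<le> ennreal (n * (d powr (1 / q + (\<beta> - \<theta>)) / (q * (\<beta> - \<theta>)) powr (1 / q)))"
      unfolding d_def by (rule half_seminorm_le_gagliardo[OF f0 p q_def n \<theta>(2) ut gag])
    have p1: "d powr (1 / q - \<theta>) \<le> d powr (1 / q - \<beta>) * T powr (\<beta> - \<theta>)"
    proof -
      have "d powr (1 / q - \<theta>) = d powr (1 / q - \<beta>) * d powr (\<beta> - \<theta>)" by (simp flip: powr_add)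
      also have "\<dots> \<le> d powr (1 / q - \<beta>) * T powr (\<beta> - \<theta>)" using d \<theta> by (intro mult_left_mono powr_mono2) auto
      finally show ?thesis .
    qed
    have p2: "d powr (1 / q + (\<beta> - \<theta>)) \<le> d powr (1 / q - \<beta>) * T powr (2 * \<beta> - \<theta>)"
    proof -
      have "d powr (1 / q + (\<beta> - \<theta>)) = d powr (1 / q - \<beta>) * d powr (2 * \<beta> - \<theta>)"
        unfolding powr_add[symmetric] by (simp add: algebra_simps)
      also have "\<dots> \<le> d powr (1 / q - \<beta>) * T powr (2 * \<beta> - \<theta>)" using d \<theta> by (intro mult_left_mono powr_mono2) auto
      finally show ?thesis .
    qed
    have "truncation_bound \<theta> u t f0 \<le> ennreal (2 * (n * (d powr (1 / q - \<theta>) / (1 - \<theta> * q) powr (1 / q))) + n * (d powr (1 / q - \<theta>) / (1 - \<theta> * q) powr (1 / q))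
      + \<theta> * (n * (d powr (1 / q + (\<beta> - \<theta>)) / (q * (\<beta> - \<theta>)) powr (1 / q))))"
      using n by (intro truncation_bound_le \<theta> L R S) auto
    also have "\<dots> = ennreal (3 * (n * (c1 * d powr (1 / q - \<theta>))) + \<theta> * (n * (c2 * d powr (1 / q + (\<beta> - \<theta>)))))"
      by (simp add: c1_def c2_def)
    also have "\<dots> \<le> ennreal (3 * (n * (c1 * (d powr (1 / q - \<beta>) * T powr (\<beta> - \<theta>)))) + \<theta> * (n * (c2 * (d powr (1 / q - \<beta>) * T powr (2 * \<beta> - \<theta>)))))"
      using n c12 \<theta> by (intro ennreal_leI add_mono mult_left_mono p1 p2) auto
    also have "3 * (n * (c1 * (d powr (1 / q - \<beta>) * T powr (\<beta> - \<theta>)))) + \<theta> * (n * (c2 * (d powr (1 / q - \<beta>) * T powr (2 * \<beta> - \<theta>)))) = c * n * d powr (1 / q - \<beta>)"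
      by (simp add: c_def algebra_simps)
    also have "1 / q - \<beta> = 1 - \<beta> - 1 / p" by (simp add: q(2))
    finally show "truncation_bound \<theta> u t f0 \<le> ennreal (c * n * (t - u) powr (1 - \<beta> - 1 / p))" unfolding d_def .
  qed
qed

lemma truncation_bound_W_norm_infinite_exponent:
  fixes T :: real
  assumes T: "0 < T" and \<theta>: "0 < \<theta>" "\<theta> < \<beta>" "\<beta> < 1"
  shows "\<exists>c\<ge>0. \<forall>f f0 n u t. f0 \<in> borel_measurable borel \<longrightarrow> (AE s in lborel. s \<in> {0..T} \<longrightarrow> f s = f0 s) \<longrightarrow>
    0 \<le> n \<longrightarrow> W_norm \<beta> \<infinity> T f \<le> ennreal n \<longrightarrow> 0 \<le> u \<longrightarrow> u \<le> t \<longrightarrow> t \<le> T \<longrightarrow>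
    truncation_bound \<theta> u t f0 \<le> ennreal (c * n * (t - u) powr (1 - \<beta>))"
proof -
  define c where "c = 3 * (1 / (1 - \<theta>) * T powr (\<beta> - \<theta>)) + \<theta> * (T powr (\<beta> - \<theta>) * T powr \<beta>)"
  have c0: "0 \<le> c" using \<theta> by (simp add: c_def)
  show ?thesis
  proof (intro exI[of _ c] conjI c0 allI impI)
    fix f f0 :: "real \<Rightarrow> real" and n u t :: real
    assume f0 [measurable]: "f0 \<in> borel_measurable borel" and ae: "AE s in lborel. s \<in> {0..T} \<longrightarrow> f s = f0 s"
      and n: "0 \<le> n" and W: "W_norm \<beta> \<infinity> T f \<le> ennreal n" and ut: "0 \<le> u" "u \<le> t" "t \<le> (T::real)"
    let ?A = "esssup (lebesgue_on {0..T}) (\<lambda>t. ennreal \<bar>f t\<bar>)"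
    let ?J = "\<lambda>t. \<integral>\<^sup>+u. ennreal (\<bar>f t - f u\<bar> / \<bar>t - u\<bar> powr (1 + \<beta>)) \<partial>lebesgue_on {0..t}"
    have W': "?A + esssup (lebesgue_on {0..T}) ?J \<le> ennreal n"
      using W by (simp add: W_norm_def Lp_norm_def)
    have A: "?A \<le> ennreal n" by (rule order_trans[OF _ W']) simp
    have J: "esssup (lebesgue_on {0..T}) ?J \<le> ennreal n" by (rule order_trans[OF _ W']) simp
    have "AE s in lebesgue_on {0..T}. ennreal \<bar>f s\<bar> \<le> ennreal n"
      using esssup_AE[of "\<lambda>t. ennreal \<bar>f t\<bar>" "lebesgue_on {0..T}"] by eventually_elim (use A in auto)
    then have bd: "AE s in lborel. s \<in> {0..T} \<longrightarrow> \<bar>f0 s\<bar> \<le> n"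
      using ae by (subst (asm) AE_lebesgue_on_iff) (use n in \<open>auto elim!: eventually_elim2\<close>)
    have "AE r in lebesgue_on {0..T}. ?J r \<le> ennreal n"
      using esssup_AE[of ?J "lebesgue_on {0..T}"] by eventually_elim (use J in auto)
    then have Jb: "AE r in lborel. r \<in> {0..T} \<longrightarrow> ?J r \<le> ennreal n"
      by (subst (asm) AE_lebesgue_on_iff) auto
    define d where "d = t - u"
    have d: "0 \<le> d" "d \<le> T" using ut by (auto simp: d_def)
    have e1: "- 1 < - \<theta>" using \<theta> by simp
    have p1: "d powr (1 - \<theta>) \<le> d powr (1 - \<beta>) * T powr (\<beta> - \<theta>)"
    proof -
      have "d powr (1 - \<theta>) = d powr (1 - \<beta>) * d powr (\<beta> - \<theta>)" by (simp flip: powr_add)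
      also have "\<dots> \<le> d powr (1 - \<beta>) * T powr (\<beta> - \<theta>)" using d \<theta> by (intro mult_left_mono powr_mono2) auto
      finally show ?thesis .
    qed
    have p2: "d \<le> d powr (1 - \<beta>) * T powr \<beta>"
    proof -
      have "d = d powr (1 - \<beta>) * d powr \<beta>" using d by (simp flip: powr_add)
      also have "\<dots> \<le> d powr (1 - \<beta>) * T powr \<beta>" using d \<theta> by (intro mult_left_mono powr_mono2) auto
      finally show ?thesis .
    qed
    have L: "left_weight \<theta> u t f0 \<le> ennreal (n * (1 / (1 - \<theta>) * d powr (1 - \<theta>)))"
    proof -
      have "left_weight \<theta> u t f0 \<le> (\<integral>\<^sup>+s. ennreal n * (indicator {u..t} s * ennreal ((s - u) powr - \<theta>)) \<partial>lborel)"
        unfolding left_weight_def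
        by (rule nn_integral_mono_AE, use bd in eventually_elim)
           (use ut n in \<open>auto simp: indicator_def ennreal_mult[symmetric] intro!: ennreal_leI mult_right_mono\<close>)
      also have "\<dots> = ennreal n * ennreal ((t - u) powr (- \<theta> + 1) / (- \<theta> + 1))"
        using nn_integral_powr_left[OF e1 ut(2)] by (subst nn_integral_cmult) auto
      finally show ?thesis using n \<theta> by (simp add: ennreal_mult[symmetric] d_def)
    qed
    have R: "right_weight \<theta> u t f0 \<le> ennreal (n * (1 / (1 - \<theta>) * d powr (1 - \<theta>)))"
    proof -
      have "right_weight \<theta> u t f0 \<le> (\<integral>\<^sup>+s. ennreal n * (indicator {u..t} s * ennreal ((t - s) powr - \<theta>)) \<partial>lborel)"
        unfolding right_weight_def
        by (rule nn_integral_mono_AE, use bd in eventually_elim)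
           (use ut n in \<open>auto simp: indicator_def ennreal_mult[symmetric] intro!: ennreal_leI mult_right_mono\<close>)
      also have "\<dots> = ennreal n * ennreal ((t - u) powr (- \<theta> + 1) / (- \<theta> + 1))"
        using nn_integral_powr_right[OF e1 ut(2)] by (subst nn_integral_cmult) auto
      finally show ?thesis using n \<theta> by (simp add: ennreal_mult[symmetric] d_def)
    qed
    have S: "half_seminorm \<theta> u t f0 \<le> ennreal (n * (T powr (\<beta> - \<theta>) * d))"
    proof -
      have "half_seminorm \<theta> u t f0 \<le> (\<integral>\<^sup>+r. ennreal (T powr (\<beta> - \<theta>)) * (ennreal n * indicator {u..t} r) \<partial>lborel)"
        unfolding half_seminorm_def
      proof (rule nn_integral_mono_AE)
        show "AE r in lborel. (\<integral>\<^sup>+s. indicator {u<..t} r * indicator {u<..r} s * ennreal (\<bar>f0 r - f0 s\<bar> / (r - s) powr (\<theta> + 1)) \<partial>lborel) \<le> ennreal (T powr (\<beta> - \<theta>)) * (ennreal n * indicator {u..t} r)"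
          using Jb ae
        proof eventually_elim
          case (elim r)
          show ?case
          proof (cases "u < r \<and> r \<le> t")
            case True
            then have r: "r \<in> {0..T}" using ut by auto
            have "(\<integral>\<^sup>+s. indicator {u<..t} r * indicator {u<..r} s * ennreal (\<bar>f0 r - f0 s\<bar> / (r - s) powr (\<theta> + 1)) \<partial>lborel)
              \<le> (\<integral>\<^sup>+s. ennreal (T powr (\<beta> - \<theta>)) * (indicator {0..r} s * ennreal (\<bar>f r - f0 s\<bar> / \<bar>r - s\<bar> powr (1 + \<beta>))) \<partial>lborel)"
            proof (rule nn_integral_mono)
              fix s
              show "indicator {u<..t} r * indicator {u<..r} s * ennreal (\<bar>f0 r - f0 s\<bar> / (r - s) powr (\<theta> + 1))
                \<le> ennreal (T powr (\<beta> - \<theta>)) * (indicator {0..r} s * ennreal (\<bar>f r - f0 s\<bar> / \<bar>r - s\<bar> powr (1 + \<beta>)))"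
              proof (cases "u < s \<and> s < r")
                case s: True
                have "(r - s) powr (1 + \<beta>) = (r - s) powr (\<theta> + 1) * (r - s) powr (\<beta> - \<theta>)" by (simp flip: powr_add add: ac_simps)
                also have "\<dots> \<le> (r - s) powr (\<theta> + 1) * T powr (\<beta> - \<theta>)"
                  using s True ut \<theta> by (intro mult_left_mono powr_mono2) auto
                finally have le: "(r - s) powr (1 + \<beta>) \<le> (r - s) powr (\<theta> + 1) * T powr (\<beta> - \<theta>)" .
                have "\<bar>f0 r - f0 s\<bar> / (r - s) powr (\<theta> + 1) \<le> T powr (\<beta> - \<theta>) * (\<bar>f0 r - f0 s\<bar> / (r - s) powr (1 + \<beta>))"
                proof -
                  have "\<bar>f0 r - f0 s\<bar> * (r - s) powr (1 + \<beta>) \<le> \<bar>f0 r - f0 s\<bar> * ((r - s) powr (\<theta> + 1) * T powr (\<beta> - \<theta>))"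
                    by (intro mult_left_mono le) simp
                  then show ?thesis using s by (simp add: field_simps)
                qed
                then show ?thesis using s True ut elim(2) r by (simp add: ennreal_mult[symmetric] ennreal_leI)
              next
                case False
                then show ?thesis by (cases "r = s") (auto simp: indicator_def)
              qed
            qed
            also have "\<dots> = ennreal (T powr (\<beta> - \<theta>)) * (\<integral>\<^sup>+s. indicator {0..r} s * ennreal (\<bar>f r - f0 s\<bar> / \<bar>r - s\<bar> powr (1 + \<beta>)) \<partial>lborel)"
              by (rule nn_integral_cmult) measurable
            also have "(\<integral>\<^sup>+s. indicator {0..r} s * ennreal (\<bar>f r - f0 s\<bar> / \<bar>r - s\<bar> powr (1 + \<beta>)) \<partial>lborel) = ?J r"
              unfolding nn_integral_lebesgue_on_Icc
              using ae by (intro nn_integral_cong_AE, eventually_elim) (use r in \<open>auto simp: indicator_def\<close>)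
            also have "ennreal (T powr (\<beta> - \<theta>)) * ?J r \<le> ennreal (T powr (\<beta> - \<theta>)) * ennreal n"
              using elim(1) r by (intro mult_left_mono) auto
            finally show ?thesis using True by simp
          next
            case False
            then have "indicator {u<..t} r = (0::ennreal)" by auto
            then show ?thesis by simp
          qed
        qed
      qed
      also have "\<dots> = ennreal (T powr (\<beta> - \<theta>)) * (ennreal n * ennreal d)"
        using ut by (simp add: nn_integral_cmult d_def)
      also have "\<dots> = ennreal (n * (T powr (\<beta> - \<theta>) * d))"
        using n d by (simp add: ennreal_mult[symmetric] ac_simps)
      finally show ?thesis .
    qed
    have "truncation_bound \<theta> u t f0 \<le> ennreal (2 * (n * (1 / (1 - \<theta>) * d powr (1 - \<theta>))) + n * (1 / (1 - \<theta>) * d powr (1 - \<theta>)) + \<theta> * (n * (T powr (\<beta> - \<theta>) * d)))"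
      using n \<theta> d by (intro truncation_bound_le \<theta> L R S) auto
    also have "\<dots> = ennreal (3 * (n * (1 / (1 - \<theta>) * d powr (1 - \<theta>))) + \<theta> * (n * (T powr (\<beta> - \<theta>) * d)))"
      by simp
    also have "\<dots> \<le> ennreal (3 * (n * (1 / (1 - \<theta>) * (d powr (1 - \<beta>) * T powr (\<beta> - \<theta>)))) + \<theta> * (n * (T powr (\<beta> - \<theta>) * (d powr (1 - \<beta>) * T powr \<beta>))))"
      using n \<theta> by (intro ennreal_leI add_mono mult_left_mono p1 p2) auto
    also have "3 * (n * (1 / (1 - \<theta>) * (d powr (1 - \<beta>) * T powr (\<beta> - \<theta>)))) + \<theta> * (n * (T powr (\<beta> - \<theta>) * (d powr (1 - \<beta>) * T powr \<beta>))) = c * n * d powr (1 - \<beta>)"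
      by (simp add: c_def distrib_left distrib_right ac_simps)
    finally show "truncation_bound \<theta> u t f0 \<le> ennreal (c * n * (t - u) powr (1 - \<beta>))" unfolding d_def .
  qed
qed

section \<open>Compositions in fractional Sobolev spaces\<close>

text \<open>For fixed r the kernel has integral at most 2 K, one K for each side of the diagonal,
  and by symmetry the summands g r and g s contribute equally; hence the 4.\<close>

lemma nn_integral_power_kernel_le:
  assumes g [measurable]: "g \<in> borel_measurable borel" and e: "- 1 < e" and T: "0 \<le> (T::real)"
  shows "(\<integral>\<^sup>+r. \<integral>\<^sup>+s. indicator {0..T} r * indicator {0..T} s * ((g r + g s) * ennreal (\<bar>r - s\<bar> powr e)) \<partial>lborel \<partial>lborel)
    \<le> ennreal (4 * (T powr (e + 1) / (e + 1))) * (\<integral>\<^sup>+r. indicator {0..T} r * g r \<partial>lborel)"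
proof -
  let ?A = "\<lambda>r s. indicator {0..T} r * indicator {0..T} s * (g r * ennreal (\<bar>r - s\<bar> powr e))"
  let ?B = "\<lambda>r s. indicator {0..T} r * indicator {0..T} s * (g s * ennreal (\<bar>r - s\<bar> powr e))"
  let ?K = "T powr (e + 1) / (e + 1)"
  have K: "0 \<le> ?K" using e by simp
  have [measurable]: "(\<lambda>(r, s). ?A r s) \<in> borel_measurable (lborel \<Otimes>\<^sub>M lborel)"
    "(\<lambda>(r, s). ?B r s) \<in> borel_measurable (lborel \<Otimes>\<^sub>M lborel)"
    unfolding indicator_def atLeastAtMost_iff by measurable
  have kernel: "(\<integral>\<^sup>+s. indicator {0..T} s * ennreal (\<bar>r - s\<bar> powr e) \<partial>lborel) \<le> ennreal (2 * ?K)" if r: "r \<in> {0..T}" for r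
  proof -
    have "(\<integral>\<^sup>+s. indicator {0..T} s * ennreal (\<bar>r - s\<bar> powr e) \<partial>lborel)
      \<le> (\<integral>\<^sup>+s. indicator {0..r} s * ennreal ((r - s) powr e) + indicator {r..T} s * ennreal ((s - r) powr e) \<partial>lborel)"
    proof (rule nn_integral_mono)
      fix s
      show "indicator {0..T} s * ennreal (\<bar>r - s\<bar> powr e) \<le> indicator {0..r} s * ennreal ((r - s) powr e) + indicator {r..T} s * ennreal ((s - r) powr e)"
        by (cases s r rule: linorder_cases) (auto simp: indicator_def)
    qed
    also have "\<dots> = ennreal ((r - 0) powr (e + 1) / (e + 1)) + ennreal ((T - r) powr (e + 1) / (e + 1))"
      using nn_integral_powr_right[OF e, of 0 r] nn_integral_powr_left[OF e, of r T] r by (subst nn_integral_add) auto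
    also have "\<dots> \<le> ennreal ?K + ennreal ?K"
      using r e by (intro add_mono ennreal_leI divide_right_mono powr_mono2) auto
    also have "\<dots> = ennreal (2 * ?K)" using K by (simp flip: ennreal_plus)
    finally show ?thesis .
  qed
  have A: "(\<integral>\<^sup>+r. \<integral>\<^sup>+s. ?A r s \<partial>lborel \<partial>lborel) \<le> ennreal (2 * ?K) * (\<integral>\<^sup>+r. indicator {0..T} r * g r \<partial>lborel)"
  proof -
    have "(\<integral>\<^sup>+r. \<integral>\<^sup>+s. ?A r s \<partial>lborel \<partial>lborel) \<le> (\<integral>\<^sup>+r. ennreal (2 * ?K) * (indicator {0..T} r * g r) \<partial>lborel)"
    proof (rule nn_integral_mono)
      fix r
      have "(\<integral>\<^sup>+s. ?A r s \<partial>lborel) = (\<integral>\<^sup>+s. (indicator {0..T} r * g r) * (indicator {0..T} s * ennreal (\<bar>r - s\<bar> powr e)) \<partial>lborel)"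
        by (simp add: ac_simps)
      also have "\<dots> = (indicator {0..T} r * g r) * (\<integral>\<^sup>+s. indicator {0..T} s * ennreal (\<bar>r - s\<bar> powr e) \<partial>lborel)"
        by (rule nn_integral_cmult) measurable
      also have "\<dots> \<le> (indicator {0..T} r * g r) * ennreal (2 * ?K)"
        using kernel[of r] by (cases "r \<in> {0..T}") (auto intro!: mult_left_mono)
      finally show "(\<integral>\<^sup>+s. ?A r s \<partial>lborel) \<le> ennreal (2 * ?K) * (indicator {0..T} r * g r)"
        by (simp only: mult.commute)
    qed
    then show ?thesis by (subst (asm) nn_integral_cmult) auto
  qed
  have "(\<integral>\<^sup>+r. \<integral>\<^sup>+s. ?B r s \<partial>lborel \<partial>lborel) = (\<integral>\<^sup>+s. \<integral>\<^sup>+r. ?B r s \<partial>lborel \<partial>lborel)"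
    by (rule lborel_pair.Fubini') measurable
  also have "\<dots> = (\<integral>\<^sup>+r. \<integral>\<^sup>+s. ?A r s \<partial>lborel \<partial>lborel)"
    by (simp add: ac_simps abs_minus_commute)
  finally have BA: "(\<integral>\<^sup>+r. \<integral>\<^sup>+s. ?B r s \<partial>lborel \<partial>lborel) = (\<integral>\<^sup>+r. \<integral>\<^sup>+s. ?A r s \<partial>lborel \<partial>lborel)" .
  have "(\<integral>\<^sup>+r. \<integral>\<^sup>+s. indicator {0..T} r * indicator {0..T} s * ((g r + g s) * ennreal (\<bar>r - s\<bar> powr e)) \<partial>lborel \<partial>lborel)
    = (\<integral>\<^sup>+r. (\<integral>\<^sup>+s. ?A r s \<partial>lborel) + (\<integral>\<^sup>+s. ?B r s \<partial>lborel) \<partial>lborel)"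
    by (intro nn_integral_cong) (subst nn_integral_add[symmetric]; measurable?; simp add: distrib_left distrib_right)
  also have "\<dots> = (\<integral>\<^sup>+r. \<integral>\<^sup>+s. ?A r s \<partial>lborel \<partial>lborel) + (\<integral>\<^sup>+r. \<integral>\<^sup>+s. ?B r s \<partial>lborel \<partial>lborel)"
    by (rule nn_integral_add) measurable
  also have "\<dots> \<le> ennreal (2 * ?K) * (\<integral>\<^sup>+r. indicator {0..T} r * g r \<partial>lborel) + ennreal (2 * ?K) * (\<integral>\<^sup>+r. indicator {0..T} r * g r \<partial>lborel)"
    unfolding BA by (intro add_mono A)
  also have "\<dots> = (ennreal (2 * ?K) + ennreal (2 * ?K)) * (\<integral>\<^sup>+r. indicator {0..T} r * g r \<partial>lborel)"
    by (simp only: distrib_right)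
  also have "ennreal (2 * ?K) + ennreal (2 * ?K) = ennreal (4 * ?K)" using K by (simp flip: ennreal_plus)
  finally show ?thesis .
qed

section \<open>Functions with an increment majorant\<close>

text \<open>A pointwise condition of Hajlasz type of order a, with G in the role of the generalized
  gradient, together with a size bound. The good set S is Borel so that it can be transported by
  affine maps of the line.\<close>

definition increment_bound :: "real \<Rightarrow> real \<Rightarrow> real \<Rightarrow> (real \<Rightarrow> real) \<Rightarrow> (real \<Rightarrow> real) \<Rightarrow> bool" where
  "increment_bound T a C G f \<longleftrightarrow> 0 \<le> C \<and> f \<in> borel_measurable borel \<and> G \<in> borel_measurable borel \<and> (\<forall>t. 0 \<le> G t) \<and>
    (\<exists>S\<in>sets borel. (AE t in lborel. t \<in> {0..T} \<longrightarrow> t \<in> S) \<and> (\<forall>t\<in>S. \<bar>f t\<bar> \<le> C * G t) \<and>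
      (\<forall>t\<in>S. \<forall>u\<in>S. \<bar>f t - f u\<bar> \<le> C * \<bar>t - u\<bar> powr a * (G t + G u)))"

lemma increment_bound_subinterval:
  assumes "increment_bound T a C G f" "t \<le> T"
  shows "increment_bound t a C G f"
proof -
  obtain S where S: "S \<in> sets borel" "AE t in lborel. t \<in> {0..T} \<longrightarrow> t \<in> S" "(\<forall>t\<in>S. \<bar>f t\<bar> \<le> C * G t) \<and>
      (\<forall>t\<in>S. \<forall>u\<in>S. \<bar>f t - f u\<bar> \<le> C * \<bar>t - u\<bar> powr a * (G t + G u))"
    using assms(1) by (auto simp: increment_bound_def)
  have "AE s in lborel. s \<in> {0..t} \<longrightarrow> s \<in> S" using S(2) by eventually_elim (use assms(2) in auto)
  then show ?thesis using assms(1) S unfolding increment_bound_def by blast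
qed

text \<open>Reversing [0,t] exchanges its ends, so the estimate at the left end also yields the one
  at the right end.\<close>

lemma increment_bound_reflect:
  assumes "increment_bound t a C G f"
  shows "increment_bound t a C (\<lambda>s. G (t - s)) (\<lambda>s. f (t - s))"
proof -
  have [measurable]: "f \<in> borel_measurable borel" "G \<in> borel_measurable borel"
    using assms by (auto simp: increment_bound_def)
  obtain S where S [measurable]: "S \<in> sets borel" and ae: "AE s in lborel. s \<in> {0..t} \<longrightarrow> s \<in> S" and b: "\<forall>s\<in>S. \<bar>f s\<bar> \<le> C * G s"
      "\<forall>s\<in>S. \<forall>u\<in>S. \<bar>f s - f u\<bar> \<le> C * \<bar>s - u\<bar> powr a * (G s + G u)"
    using assms by (auto simp: increment_bound_def)
  have "AE s in lborel. t + (- 1) * s \<in> {0..t} \<longrightarrow> t + (- 1) * s \<in> S"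
    by (rule AE_borel_affine[OF _ _ ae]) (simp, measurable)
  then have ae': "AE s in lborel. s \<in> {0..t} \<longrightarrow> s \<in> (\<lambda>s. t - s) -` S" by eventually_elim auto
  have "(\<lambda>s. t - s) -` S \<in> sets borel"
    using measurable_sets[of "\<lambda>s. t - s" borel borel S] by simp
  moreover have "\<bar>f (t - s) - f (t - u)\<bar> \<le> C * \<bar>s - u\<bar> powr a * (G (t - s) + G (t - u))" if "t - s \<in> S" "t - u \<in> S" for s u
    using b(2) that by (force simp: abs_minus_commute)
  moreover have "(\<lambda>s. G (t - s)) \<in> borel_measurable borel" "(\<lambda>s. f (t - s)) \<in> borel_measurable borel" by measurable
  ultimately show ?thesis using assms ae' b(1) unfolding increment_bound_def by (intro conjI bexI[of _ "(\<lambda>s. t - s) -` S"]) auto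
qed

text \<open>The increment bound turns the integrand into (G r + G s) times |r - s| powr (a -
  \<theta> - 1), an integrable kernel because \<theta> < a.\<close>

lemma half_seminorm_increment_bound:
  assumes b: "increment_bound t a C G f" and G: "(\<integral>\<^sup>+s. indicator {0..t} s * ennreal (G s) \<partial>lborel) < \<infinity>" and \<theta>: "\<theta> < a" and t: "0 \<le> t"
  shows "half_seminorm \<theta> 0 t f < \<infinity>"
proof -
  have [measurable]: "f \<in> borel_measurable borel" "G \<in> borel_measurable borel" and G0: "\<And>s. 0 \<le> G s" and C: "0 \<le> C"
    using b by (auto simp: increment_bound_def)
  obtain S where S: "AE s in lborel. s \<in> {0..t} \<longrightarrow> s \<in> S"
      "\<And>s u. s \<in> S \<Longrightarrow> u \<in> S \<Longrightarrow> \<bar>f s - f u\<bar> \<le> C * \<bar>s - u\<bar> powr a * (G s + G u)"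
    using b by (auto simp: increment_bound_def)
  let ?k = "\<lambda>r s. indicator {0..t} r * indicator {0..t} s * ((ennreal (G r) + ennreal (G s)) * ennreal (\<bar>r - s\<bar> powr (a - \<theta> - 1)))"
  have km: "(\<lambda>(r, s). ?k r s) \<in> borel_measurable (lborel \<Otimes>\<^sub>M lborel)"
    unfolding indicator_def atLeastAtMost_iff by measurable
  have [measurable]: "(\<lambda>r. \<integral>\<^sup>+s. ?k r s \<partial>lborel) \<in> borel_measurable lborel"
    using lborel.borel_measurable_nn_integral_fst[OF km] by simp
  have "half_seminorm \<theta> 0 t f \<le> (\<integral>\<^sup>+r. ennreal C * (\<integral>\<^sup>+s. ?k r s \<partial>lborel) \<partial>lborel)"
    unfolding half_seminorm_def
  proof (rule nn_integral_mono_AE, use S(1) in eventually_elim)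
    case (elim r)
    have "(\<integral>\<^sup>+s. indicator {0<..t} r * indicator {0<..r} s * ennreal (\<bar>f r - f s\<bar> / (r - s) powr (\<theta> + 1)) \<partial>lborel)
      \<le> (\<integral>\<^sup>+s. ennreal C * ?k r s \<partial>lborel)"
    proof (rule nn_integral_mono_AE, use S(1) in eventually_elim)
      case s: (elim s)
      show ?case
      proof (cases "0 < s \<and> s < r \<and> r \<le> t")
        case True
        then have rs: "r \<in> S" "s \<in> S" "0 < r - s" using s elim by auto
        have "\<bar>f r - f s\<bar> / (r - s) powr (\<theta> + 1) \<le> C * \<bar>r - s\<bar> powr a * (G r + G s) / (r - s) powr (\<theta> + 1)"
          using S(2)[OF rs(1,2)] by (rule divide_right_mono) simp
        also have "\<dots> = C * ((G r + G s) * \<bar>r - s\<bar> powr (a - \<theta> - 1))"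
          using rs(3) by (simp add: powr_diff powr_add)
        finally have "ennreal (\<bar>f r - f s\<bar> / (r - s) powr (\<theta> + 1)) \<le> ennreal (C * ((G r + G s) * \<bar>r - s\<bar> powr (a - \<theta> - 1)))"
          by (rule ennreal_leI)
        also have "\<dots> = ennreal C * ((ennreal (G r) + ennreal (G s)) * ennreal (\<bar>r - s\<bar> powr (a - \<theta> - 1)))"
          using C G0 by (simp add: ennreal_mult)
        finally show ?thesis using True by simp
      next
        case False
        then show ?thesis by (cases "r = s") (auto simp: indicator_def)
      qed
    qed
    also have "\<dots> = ennreal C * (\<integral>\<^sup>+s. ?k r s \<partial>lborel)"
      by (rule nn_integral_cmult) (unfold indicator_def atLeastAtMost_iff, measurable)
    finally show ?case .
  qed
  also have "\<dots> = ennreal C * (\<integral>\<^sup>+r. \<integral>\<^sup>+s. ?k r s \<partial>lborel \<partial>lborel)"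
    by (rule nn_integral_cmult) measurable
  also have "\<dots> \<le> ennreal C * (ennreal (4 * (t powr (a - \<theta> - 1 + 1) / (a - \<theta> - 1 + 1))) * (\<integral>\<^sup>+r. indicator {0..t} r * ennreal (G r) \<partial>lborel))"
    using \<theta> t by (intro mult_left_mono nn_integral_power_kernel_le) auto
  also have "\<dots> < \<infinity>" using G by (simp add: ennreal_mult_less_top)
  finally show ?thesis .
qed

text \<open>The term k x can be moved to the left only if x is known to be finite; the Hardy
  argument arranges this by a cutoff near 0.\<close>

lemma ennreal_le_absorb:
  assumes "x \<le> D + ennreal k * x" "x < \<infinity>" "D < \<infinity>" "0 \<le> k" "k < 1"
  shows "x \<le> ennreal (enn2real D / (1 - k))"
proof -
  define y d where "y = enn2real x" and "d = enn2real D"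
  have xy: "x = ennreal y" "D = ennreal d" and yd: "0 \<le> y" "0 \<le> d" using assms(2,3) by (auto simp: y_def d_def less_top)
  have "ennreal y \<le> ennreal (d + k * y)"
    using assms(1,4) yd unfolding xy by (simp add: ennreal_mult)
  then have "y \<le> d + k * y" using assms(4) yd by (subst (asm) ennreal_le_iff) auto
  then have "y \<le> d / (1 - k)" using assms(5) by (simp add: pos_le_divide_eq algebra_simps)
  then show ?thesis using yd by (simp add: xy ennreal_leI)
qed

text \<open>A Hardy inequality: comparing \<open>f\<close> at \<open>s\<close> and \<open>2 s\<close> bounds the weighted integral by \<open>2 powr (\<theta> - 1)\<close>
  times itself plus a finite remainder.\<close>

lemma left_weight_increment_bound:
  assumes b: "increment_bound t a C G f" and G: "(\<integral>\<^sup>+s. indicator {0..t} s * ennreal (G s) \<partial>lborel) < \<infinity>"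
    and \<theta>: "0 < \<theta>" "\<theta> < 1" "\<theta> < a" and t: "0 < t"
  shows "left_weight \<theta> 0 t f < \<infinity>"
proof -
  have [measurable]: "f \<in> borel_measurable borel" "G \<in> borel_measurable borel" and G0: "\<And>s. 0 \<le> G s" and C: "0 \<le> C"
    using b by (auto simp: increment_bound_def)
  obtain S where Sb [measurable]: "S \<in> sets borel" and S: "AE s in lborel. s \<in> {0..t} \<longrightarrow> s \<in> S"
      "\<And>s. s \<in> S \<Longrightarrow> \<bar>f s\<bar> \<le> C * G s"
      "\<And>s u. s \<in> S \<Longrightarrow> u \<in> S \<Longrightarrow> \<bar>f s - f u\<bar> \<le> C * \<bar>s - u\<bar> powr a * (G s + G u)"
    using b by (auto simp: increment_bound_def)
  \<comment> \<open>Dilation preserves null sets, so the increment bound is available for the pair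
    s, 2 s at almost every s. The form 0 + 2 * s fits the affine substitution rule.\<close>
  have "AE s in lborel. 0 + 2 * s \<in> {0..t} \<longrightarrow> 0 + 2 * s \<in> S"
    by (rule AE_borel_affine[OF _ _ S(1)]) (simp, measurable)
  then have S2: "AE s in lborel. 2 * s \<in> {0..t} \<longrightarrow> 2 * s \<in> S" by simp
  define GI where "GI = (\<integral>\<^sup>+s. indicator {0..t} s * ennreal (G s) \<partial>lborel)"
  define FI where "FI = (\<integral>\<^sup>+s. indicator {0..t} s * ennreal \<bar>f s\<bar> \<partial>lborel)"
  have "FI \<le> (\<integral>\<^sup>+s. ennreal C * (indicator {0..t} s * ennreal (G s)) \<partial>lborel)"
    unfolding FI_def
    by (rule nn_integral_mono_AE, use S(1) in eventually_elim)
       (use S(2) C in \<open>auto simp: indicator_def ennreal_mult'[symmetric] intro!: ennreal_leI\<close>)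
  also have "\<dots> = ennreal C * GI" unfolding GI_def by (rule nn_integral_cmult) measurable
  also have "\<dots> < \<infinity>" using G by (simp add: GI_def ennreal_mult_less_top)
  finally have FI: "FI < \<infinity>" .
  \<comment> \<open>The first term covers s > t / 2, where the weight is bounded. The others come
    from the increment between s and 2 s; the 1 / 2 belongs to G at 2 s after substitution.\<close>
  define D where "D = ennreal ((t / 2) powr - \<theta>) * FI + ennreal (C * t powr (a - \<theta>)) * (GI + ennreal (1 / 2) * GI)"
  have "inverse (2::ennreal) < top" using ennreal_less_top[of "1 / 2"] by simp
  then have D: "D < \<infinity>" using FI G by (simp add: D_def GI_def ennreal_mult_less_top)
  \<comment> \<open>Cutting at \<epsilon> makes the weighted integral finite beforehand, so that it
    can be absorbed; the resulting bound does not depend on \<epsilon>.\<close>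
  define w where "w \<epsilon> s = indicator {\<epsilon><..t} s * ennreal (\<bar>f s\<bar> * s powr - \<theta>)" for \<epsilon> s
  have wm [measurable]: "w \<epsilon> \<in> borel_measurable borel" for \<epsilon> unfolding w_def by measurable
  have bound: "(\<integral>\<^sup>+s. w \<epsilon> s \<partial>lborel) \<le> ennreal (enn2real D / (1 - 2 powr (\<theta> - 1)))" if \<epsilon>: "0 < \<epsilon>" for \<epsilon>
  proof (rule ennreal_le_absorb)
    show "2 powr (\<theta> - 1) < 1" using \<theta> by (simp add: powr_less_one)
    have "(\<integral>\<^sup>+s. w \<epsilon> s \<partial>lborel) \<le> (\<integral>\<^sup>+s. ennreal (\<epsilon> powr - \<theta>) * (indicator {0..t} s * ennreal \<bar>f s\<bar>) \<partial>lborel)"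
    proof (rule nn_integral_mono)
      fix s
      show "w \<epsilon> s \<le> ennreal (\<epsilon> powr - \<theta>) * (indicator {0..t} s * ennreal \<bar>f s\<bar>)"
      proof (cases "\<epsilon> < s \<and> s \<le> t")
        case True
        then have "s powr - \<theta> \<le> \<epsilon> powr - \<theta>" using \<epsilon> \<theta> by (intro powr_mono2') auto
        then have "\<bar>f s\<bar> * s powr - \<theta> \<le> \<epsilon> powr - \<theta> * \<bar>f s\<bar>" by (subst mult.commute) (intro mult_right_mono, auto)
        then show ?thesis using True \<epsilon> by (simp add: w_def ennreal_mult[symmetric] ennreal_leI)
      qed (auto simp: w_def)
    qed
    also have "\<dots> = ennreal (\<epsilon> powr - \<theta>) * FI" unfolding FI_def by (rule nn_integral_cmult) measurable
    finally show "(\<integral>\<^sup>+s. w \<epsilon> s \<partial>lborel) < \<infinity>" by (rule le_less_trans) (use FI in \<open>simp add: ennreal_mult_less_top\<close>)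
    let ?P = "\<lambda>s. ennreal ((t / 2) powr - \<theta>) * (indicator {0..t} s * ennreal \<bar>f s\<bar>)"
    let ?Q = "\<lambda>s. ennreal (C * t powr (a - \<theta>)) * (indicator {0..t} s * ennreal (G s))"
    let ?R = "\<lambda>s. ennreal (C * t powr (a - \<theta>)) * (indicator {0..t} (0 + 2 * s) * ennreal (G (0 + 2 * s)))"
    let ?W = "\<lambda>s. ennreal (2 powr \<theta>) * w \<epsilon> (0 + 2 * s)"
    have dil: "(\<integral>\<^sup>+s. g (0 + 2 * s) \<partial>lborel) = ennreal (1 / 2) * (\<integral>\<^sup>+s. g s \<partial>lborel)" if "g \<in> borel_measurable borel" for g :: "real \<Rightarrow> ennreal"
    proof -
      have h: "ennreal (1 / 2) * ennreal 2 = 1" by (subst ennreal_mult[symmetric]) auto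
      have "(\<integral>\<^sup>+s. g s \<partial>lborel) = ennreal 2 * (\<integral>\<^sup>+s. g (0 + 2 * s) \<partial>lborel)"
        using that nn_integral_real_affine[of g 2 0] by simp
      then show ?thesis by (simp only: mult.assoc[symmetric] h mult_1)
    qed
    have "(\<integral>\<^sup>+s. w \<epsilon> s \<partial>lborel) \<le> (\<integral>\<^sup>+s. ?P s + (?Q s + ?R s) + ?W s \<partial>lborel)"
    proof (rule nn_integral_mono_AE, use S(1) S2 in eventually_elim)
      case (elim s)
      consider "s \<le> \<epsilon> \<or> t < s" | "\<epsilon> < s" "s \<le> t" "t / 2 < s" | "\<epsilon> < s" "s \<le> t / 2" by linarith
      then show ?case
      proof cases
        case 1
        then show ?thesis by (auto simp: w_def)
      next
        case 2
        have "s powr - \<theta> \<le> (t / 2) powr - \<theta>" using 2 t \<theta> by (intro powr_mono2') auto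
        then have "\<bar>f s\<bar> * s powr - \<theta> \<le> (t / 2) powr - \<theta> * \<bar>f s\<bar>" by (subst mult.commute) (intro mult_right_mono, auto)
        then have "w \<epsilon> s \<le> ?P s" using 2 \<epsilon> by (simp add: w_def ennreal_mult[symmetric] ennreal_leI)
        then show ?thesis by (simp add: add_increasing2 add.assoc)
      next
        case 3
        have s: "0 < s" "s \<in> S" "2 * s \<in> S" using 3 \<epsilon> elim by auto
        have "\<bar>f s - f (2 * s)\<bar> \<le> C * s powr a * (G s + G (2 * s))"
          using S(3)[OF s(2,3)] s(1) by simp
        then have "\<bar>f s\<bar> \<le> \<bar>f (2 * s)\<bar> + C * s powr a * (G s + G (2 * s))" by linarith
        then have "\<bar>f s\<bar> * s powr - \<theta> \<le> (\<bar>f (2 * s)\<bar> + C * s powr a * (G s + G (2 * s))) * s powr - \<theta>"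
          by (rule mult_right_mono) simp
        also have "\<dots> = \<bar>f (2 * s)\<bar> * s powr - \<theta> + C * (G s + G (2 * s)) * (s powr a * s powr - \<theta>)"
          by (simp add: distrib_left distrib_right ac_simps)
        also have "s powr a * s powr - \<theta> = s powr (a - \<theta>)" by (simp flip: powr_add)
        \<comment> \<open>Rewriting the weight at the point 2 s costs a factor 2 powr
          \<theta>.\<close>
        also have "\<bar>f (2 * s)\<bar> * s powr - \<theta> = 2 powr \<theta> * (\<bar>f (2 * s)\<bar> * (2 * s) powr - \<theta>)"
        proof -
          have "(2 * s) powr - \<theta> = 2 powr - \<theta> * s powr - \<theta>" using s by (simp add: powr_mult)
          moreover have "2 powr \<theta> * 2 powr - \<theta> = (1::real)" by (simp flip: powr_add)
          ultimately show ?thesis by (simp add: mult.left_commute)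
        qed
        also have "C * (G s + G (2 * s)) * s powr (a - \<theta>) \<le> C * (G s + G (2 * s)) * t powr (a - \<theta>)"
          using 3 s t \<theta> C G0 by (intro mult_left_mono powr_mono2) auto
        finally have "ennreal (\<bar>f s\<bar> * s powr - \<theta>) \<le>
          ennreal (2 powr \<theta> * (\<bar>f (2 * s)\<bar> * (2 * s) powr - \<theta>) + (C * t powr (a - \<theta>) * G s + C * t powr (a - \<theta>) * G (2 * s)))"
          by (intro ennreal_leI) (simp add: algebra_simps)
        also have "\<dots> = ennreal (2 powr \<theta>) * ennreal (\<bar>f (2 * s)\<bar> * (2 * s) powr - \<theta>)
          + (ennreal (C * t powr (a - \<theta>)) * ennreal (G s) + ennreal (C * t powr (a - \<theta>)) * ennreal (G (2 * s)))"
          using C G0 by (simp add: ennreal_mult)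
        also have "\<dots> = ?W s + (?Q s + ?R s)" using 3 s by (simp add: w_def)
        also have "\<dots> \<le> ?P s + (?Q s + ?R s) + ?W s" by (simp add: add.commute add.left_commute add_increasing2)
        finally show ?thesis using 3 s by (simp add: w_def)
      qed
    qed
    also have "\<dots> = (\<integral>\<^sup>+s. ?P s \<partial>lborel) + ((\<integral>\<^sup>+s. ?Q s \<partial>lborel) + (\<integral>\<^sup>+s. ?R s \<partial>lborel)) + (\<integral>\<^sup>+s. ?W s \<partial>lborel)"
      by (simp add: nn_integral_add)
    also have "(\<integral>\<^sup>+s. ?P s \<partial>lborel) = ennreal ((t / 2) powr - \<theta>) * FI"
      unfolding FI_def by (rule nn_integral_cmult) measurable
    also have "(\<integral>\<^sup>+s. ?Q s \<partial>lborel) = ennreal (C * t powr (a - \<theta>)) * GI"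
      unfolding GI_def by (rule nn_integral_cmult) measurable
    also have "(\<integral>\<^sup>+s. ?R s \<partial>lborel) = ennreal (C * t powr (a - \<theta>)) * (ennreal (1 / 2) * GI)"
      unfolding GI_def by (subst nn_integral_cmult; measurable?) (subst dil; measurable?; simp)
    also have "(\<integral>\<^sup>+s. ?W s \<partial>lborel) = ennreal (2 powr \<theta>) * (ennreal (1 / 2) * (\<integral>\<^sup>+s. w \<epsilon> s \<partial>lborel))"
      by (subst nn_integral_cmult; measurable?) (subst dil; measurable?; simp)
    \<comment> \<open>2 powr \<theta> from the weight times 1 / 2 from the substitution; this is
      below 1 because \<theta> < 1, which makes absorption possible.\<close>
    also have "\<dots> = ennreal (2 powr (\<theta> - 1)) * (\<integral>\<^sup>+s. w \<epsilon> s \<partial>lborel)"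
    proof -
      have "ennreal (2 powr \<theta>) * ennreal (1 / 2) = ennreal (2 powr (\<theta> - 1))"
        by (simp only: ennreal_mult'[symmetric] powr_ge_zero) (simp add: powr_diff)
      then show ?thesis by (simp only: mult.assoc[symmetric])
    qed
    finally show "(\<integral>\<^sup>+s. w \<epsilon> s \<partial>lborel) \<le> D + ennreal (2 powr (\<theta> - 1)) * (\<integral>\<^sup>+s. w \<epsilon> s \<partial>lborel)"
      by (simp only: D_def distrib_left)
  qed (use D in auto)
  \<comment> \<open>The cutoff is removed by monotone convergence along \<epsilon> = 1 / (n +
    1).\<close>
  have "(\<lambda>n. \<integral>\<^sup>+s. w (1 / real (Suc n)) s \<partial>lborel) \<longlonglongrightarrow> left_weight \<theta> 0 t f"
    unfolding left_weight_def
  proof (rule nn_integral_LIMSEQ)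
    show "incseq (\<lambda>n. w (1 / real (Suc n)))"
    proof (rule incseq_SucI, rule le_funI)
      fix n s
      have "1 / real (Suc (Suc n)) \<le> 1 / real (Suc n)" by (simp add: frac_le)
      then show "w (1 / real (Suc n)) s \<le> w (1 / real (Suc (Suc n))) s"
        unfolding w_def by (intro mult_right_mono) (auto simp: indicator_def)
    qed
    fix s
    show "(\<lambda>n. w (1 / real (Suc n)) s) \<longlonglongrightarrow> indicator {0<..t} s * ennreal (\<bar>f s\<bar> * (s - 0) powr - \<theta>)"
    proof (rule tendsto_eventually)
      show "\<forall>\<^sub>F n in sequentially. w (1 / real (Suc n)) s = indicator {0<..t} s * ennreal (\<bar>f s\<bar> * (s - 0) powr - \<theta>)"
      proof (cases "0 < s")
        case True
        have "\<forall>\<^sub>F n in sequentially. 1 / real (Suc n) < s"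
          using order_tendstoD(2)[OF LIMSEQ_inverse_real_of_nat True] by (simp add: inverse_eq_divide)
        then show ?thesis by eventually_elim (use True in \<open>auto simp: w_def indicator_def\<close>)
      next
        case False
        then have "\<not> 1 / real (Suc n) < s" for n using less_trans[of 0 "1 / real (Suc n)" s] by auto
        then show ?thesis using False by (simp add: w_def indicator_def)
      qed
    qed
  qed measurable
  then have "left_weight \<theta> 0 t f \<le> ennreal (enn2real D / (1 - 2 powr (\<theta> - 1)))"
    by (rule LIMSEQ_le_const2) (intro exI[of _ 0] allI impI bound, simp)
  then show ?thesis by (rule le_less_trans) simp
qed

text \<open>Under s \<mapsto> t - s this becomes the left weight of the reversed function, whose
  majorant has the same integral.\<close>

lemma right_weight_increment_bound:
  assumes b: "increment_bound t a C G f" and G: "(\<integral>\<^sup>+s. indicator {0..t} s * ennreal (G s) \<partial>lborel) < \<infinity>"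
    and \<theta>: "0 < \<theta>" "\<theta> < 1" "\<theta> < a" and t: "0 < t"
  shows "right_weight \<theta> 0 t f < \<infinity>"
proof -
  have [measurable]: "f \<in> borel_measurable borel" "G \<in> borel_measurable borel"
    using b by (auto simp: increment_bound_def)
  have "right_weight \<theta> 0 t f = (\<integral>\<^sup>+s. indicator {0<..t} (t + (-1) * s) * ennreal (\<bar>f (t + (-1) * s)\<bar> * (t - (t + (-1) * s)) powr - \<theta>) \<partial>lborel)"
    unfolding right_weight_def by (subst nn_integral_real_affine[of _ "-1" t]) auto
  also have "\<dots> \<le> left_weight \<theta> 0 t (\<lambda>s. f (t - s))"
    unfolding left_weight_def
  proof (rule nn_integral_mono)
    fix s
    show "indicator {0<..t} (t + (-1) * s) * ennreal (\<bar>f (t + (-1) * s)\<bar> * (t - (t + (-1) * s)) powr - \<theta>)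
      \<le> indicator {0<..t} s * ennreal (\<bar>f (t - s)\<bar> * (s - 0) powr - \<theta>)"
      by (cases "s = 0") (auto simp: indicator_def)
  qed
  also have "\<dots> < \<infinity>"
  proof (rule left_weight_increment_bound[OF increment_bound_reflect[OF b] _ \<theta> t])
    have "(\<integral>\<^sup>+s. indicator {0..t} s * ennreal (G s) \<partial>lborel) = (\<integral>\<^sup>+s. indicator {0..t} s * ennreal (G (t - s)) \<partial>lborel)"
      by (subst nn_integral_real_affine[of _ "-1" t]) (auto intro!: nn_integral_cong simp: indicator_def)
    then show "(\<integral>\<^sup>+s. indicator {0..t} s * ennreal (G (t - s)) \<partial>lborel) < \<infinity>" using G by simp
  qed
  finally show ?thesis .
qed

lemma truncation_bound_increment_bound:
  assumes b: "increment_bound T a C G f" and G: "(\<integral>\<^sup>+s. indicator {0..T} s * ennreal (G s) \<partial>lborel) < \<infinity>"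
    and \<theta>: "0 < \<theta>" "\<theta> < 1" "\<theta> < a" and t: "0 \<le> t" "t \<le> T"
  shows "truncation_bound \<theta> 0 t f < \<infinity>"
proof (cases "t = 0")
  case True
  then show ?thesis
    by (simp add: truncation_bound_def left_weight_def right_weight_def half_seminorm_def)
next
  case False
  then have t0: "0 < t" using t by simp
  have bt: "increment_bound t a C G f" by (rule increment_bound_subinterval[OF b t(2)])
  have "(\<integral>\<^sup>+s. indicator {0..t} s * ennreal (G s) \<partial>lborel) \<le> (\<integral>\<^sup>+s. indicator {0..T} s * ennreal (G s) \<partial>lborel)"
    using t by (intro nn_integral_mono mult_right_mono) (auto simp: indicator_def)
  then have Gt: "(\<integral>\<^sup>+s. indicator {0..t} s * ennreal (G s) \<partial>lborel) < \<infinity>" using G by (rule le_less_trans)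
  show ?thesis
    by (intro truncation_bound_finite left_weight_increment_bound[OF bt Gt \<theta> t0]
        right_weight_increment_bound[OF bt Gt \<theta> t0] half_seminorm_increment_bound[OF bt Gt \<theta>(3) t(1)])
qed

lemma ennreal_powr_less_top: "x < \<infinity> \<Longrightarrow> ennreal_powr x a < \<infinity>"
  by (auto simp: ennreal_powr_def)

lemma powr_add_le:
  assumes "0 \<le> x" "0 \<le> y" "0 \<le> (p::real)"
  shows "(x + y) powr p \<le> 2 powr p * (x powr p + y powr p)"
proof -
  have "(x + y) powr p \<le> (2 * max x y) powr p" using assms by (intro powr_mono2) auto
  also have "\<dots> = 2 powr p * max x y powr p" using assms by (simp add: powr_mult)
  also have "\<dots> \<le> 2 powr p * (x powr p + y powr p)" by (intro mult_left_mono) (auto simp: max_def)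
  finally show ?thesis .
qed

lemma increment_bound_AE:
  assumes b: "increment_bound T a C G f0" and ae: "AE s in lborel. s \<in> {0..T} \<longrightarrow> f s = f0 s"
  obtains S where "AE s in lborel. s \<in> {0..T} \<longrightarrow> s \<in> S" "\<And>s. s \<in> S \<Longrightarrow> f s = f0 s" "\<And>s. s \<in> S \<Longrightarrow> \<bar>f s\<bar> \<le> C * G s"
    "\<And>s u. s \<in> S \<Longrightarrow> u \<in> S \<Longrightarrow> \<bar>f s - f u\<bar> \<le> C * \<bar>s - u\<bar> powr a * (G s + G u)"
proof -
  obtain S where S: "AE s in lborel. s \<in> {0..T} \<longrightarrow> s \<in> S" "\<forall>s\<in>S. \<bar>f0 s\<bar> \<le> C * G s"
      "\<forall>s\<in>S. \<forall>u\<in>S. \<bar>f0 s - f0 u\<bar> \<le> C * \<bar>s - u\<bar> powr a * (G s + G u)"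
    using b by (auto simp: increment_bound_def)
  have "AE s in lborel. s \<in> {0..T} \<longrightarrow> s \<in> {s \<in> S. f s = f0 s}" using S(1) ae by eventually_elim auto
  then show thesis by (rule that) (use S in auto)
qed

section \<open>Membership in the fractional Sobolev spaces\<close>

text \<open>Taking the p-th power of the increment bound leaves the kernel |r - s| powr ((a -
  \<beta>) p - 1), integrable because \<beta> < a, against G powr p, integrable by
  assumption.\<close>

lemma W_space_finite_exponent:
  assumes b: "increment_bound T a C G f0" and ae: "AE s in lborel. s \<in> {0..T} \<longrightarrow> f s = f0 s"
    and f: "f \<in> borel_measurable (lebesgue_on {0..T})" and p: "1 < p" and T: "0 \<le> T"
    and G: "(\<integral>\<^sup>+s. indicator {0..T} s * ennreal (G s powr p) \<partial>lborel) < \<infinity>" and \<beta>: "0 < \<beta>" "\<beta> < a"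
  shows "f \<in> W_space \<beta> (ennreal p) T"
proof -
  have [measurable]: "f0 \<in> borel_measurable borel" "G \<in> borel_measurable borel" and G0: "\<And>s. 0 \<le> G s" and C: "0 \<le> C"
    using b by (auto simp: increment_bound_def)
  obtain S where S: "AE s in lborel. s \<in> {0..T} \<longrightarrow> s \<in> S" "\<And>s. s \<in> S \<Longrightarrow> f s = f0 s" "\<And>s. s \<in> S \<Longrightarrow> \<bar>f s\<bar> \<le> C * G s"
    "\<And>s u. s \<in> S \<Longrightarrow> u \<in> S \<Longrightarrow> \<bar>f s - f u\<bar> \<le> C * \<bar>s - u\<bar> powr a * (G s + G u)"
    by (rule increment_bound_AE[OF b ae], rule that)
  have "(\<integral>\<^sup>+t. ennreal_powr (ennreal \<bar>f t\<bar>) p \<partial>lebesgue_on {0..T}) \<le> (\<integral>\<^sup>+s. ennreal (C powr p) * (indicator {0..T} s * ennreal (G s powr p)) \<partial>lborel)"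
    unfolding nn_integral_lebesgue_on_Icc
  proof (rule nn_integral_mono_AE, use S(1) in eventually_elim)
    case (elim s)
    show ?case
    proof (cases "s \<in> {0..T}")
      case True
      then have "\<bar>f s\<bar> powr p \<le> (C * G s) powr p" using elim S(3) p by (intro powr_mono2) auto
      also have "\<dots> = C powr p * G s powr p" using C G0 by (simp add: powr_mult)
      finally show ?thesis using True by (simp add: ennreal_powr_def ennreal_mult[symmetric] ennreal_leI)
    qed simp
  qed
  also have "\<dots> = ennreal (C powr p) * (\<integral>\<^sup>+s. indicator {0..T} s * ennreal (G s powr p) \<partial>lborel)"
    by (rule nn_integral_cmult) measurable
  also have "\<dots> < \<infinity>" using G by (simp add: ennreal_mult_less_top)
  finally have Lp: "Lp_norm T (ennreal p) (\<lambda>t. ennreal \<bar>f t\<bar>) < \<infinity>"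
    using p by (simp add: Lp_norm_def) (rule ennreal_powr_less_top[simplified])
  let ?k = "\<lambda>r s. indicator {0..T} r * indicator {0..T} s * ((ennreal (G r powr p) + ennreal (G s powr p)) * ennreal (\<bar>r - s\<bar> powr ((a - \<beta>) * p - 1)))"
  let ?c = "C powr p * 2 powr p"
  have km: "(\<lambda>(r, s). ?k r s) \<in> borel_measurable (lborel \<Otimes>\<^sub>M lborel)"
    unfolding indicator_def atLeastAtMost_iff by measurable
  have [measurable]: "(\<lambda>r. \<integral>\<^sup>+s. ?k r s \<partial>lborel) \<in> borel_measurable lborel"
    using lborel.borel_measurable_nn_integral_fst[OF km] by simp
  have "(\<integral>\<^sup>+t. (\<integral>\<^sup>+u. ennreal (\<bar>f t - f u\<bar> powr p / \<bar>t - u\<bar> powr (1 + \<beta> * p)) \<partial>lebesgue_on {0..T}) \<partial>lebesgue_on {0..T})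
    \<le> (\<integral>\<^sup>+r. ennreal ?c * (\<integral>\<^sup>+s. ?k r s \<partial>lborel) \<partial>lborel)"
    unfolding nn_integral_lebesgue_on_Icc
  proof (rule nn_integral_mono_AE, use S(1) in eventually_elim)
    case (elim r)
    show ?case
    proof (cases "r \<in> {0..T}")
      case r: True
      have "(\<integral>\<^sup>+s. indicator {0..T} s * ennreal (\<bar>f r - f s\<bar> powr p / \<bar>r - s\<bar> powr (1 + \<beta> * p)) \<partial>lborel) \<le> (\<integral>\<^sup>+s. ennreal ?c * ?k r s \<partial>lborel)"
      proof (rule nn_integral_mono_AE, use S(1) in eventually_elim)
        case s: (elim s)
        show ?case
        proof (cases "s \<in> {0..T} \<and> r \<noteq> s")
          case True
          then have rs: "r \<in> S" "s \<in> S" "0 < \<bar>r - s\<bar>" using s elim r by auto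
          have "\<bar>f r - f s\<bar> powr p \<le> (C * \<bar>r - s\<bar> powr a * (G r + G s)) powr p"
            using S(4)[OF rs(1,2)] p by (intro powr_mono2) auto
          also have "\<dots> = C powr p * \<bar>r - s\<bar> powr (a * p) * (G r + G s) powr p"
            using C G0 by (simp add: powr_mult powr_powr)
          also have "\<dots> \<le> C powr p * \<bar>r - s\<bar> powr (a * p) * (2 powr p * (G r powr p + G s powr p))"
            using p G0 by (intro mult_left_mono powr_add_le) auto
          finally have "\<bar>f r - f s\<bar> powr p / \<bar>r - s\<bar> powr (1 + \<beta> * p) \<le> C powr p * \<bar>r - s\<bar> powr (a * p) * (2 powr p * (G r powr p + G s powr p)) / \<bar>r - s\<bar> powr (1 + \<beta> * p)"
            by (rule divide_right_mono) simp
          also have "\<dots> = ?c * ((G r powr p + G s powr p) * (\<bar>r - s\<bar> powr (a * p) / \<bar>r - s\<bar> powr (1 + \<beta> * p)))"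
            by simp
          also have "\<bar>r - s\<bar> powr (a * p) / \<bar>r - s\<bar> powr (1 + \<beta> * p) = \<bar>r - s\<bar> powr ((a - \<beta>) * p - 1)"
            unfolding powr_diff[symmetric] by (simp add: algebra_simps)
          finally have "ennreal (\<bar>f r - f s\<bar> powr p / \<bar>r - s\<bar> powr (1 + \<beta> * p)) \<le> ennreal (?c * ((G r powr p + G s powr p) * \<bar>r - s\<bar> powr ((a - \<beta>) * p - 1)))"
            by (rule ennreal_leI)
          also have "\<dots> = ennreal ?c * ((ennreal (G r powr p) + ennreal (G s powr p)) * ennreal (\<bar>r - s\<bar> powr ((a - \<beta>) * p - 1)))"
            by (simp add: ennreal_mult ac_simps)
          finally show ?thesis using True r by simp
        next
          case False
          then show ?thesis using p by (cases "r = s") (auto simp: indicator_def)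
        qed
      qed
      also have "\<dots> = ennreal ?c * (\<integral>\<^sup>+s. ?k r s \<partial>lborel)"
        by (rule nn_integral_cmult) (unfold indicator_def atLeastAtMost_iff, measurable)
      finally show ?thesis using r by simp
    qed simp
  qed
  also have "\<dots> = ennreal ?c * (\<integral>\<^sup>+r. \<integral>\<^sup>+s. ?k r s \<partial>lborel \<partial>lborel)"
    by (rule nn_integral_cmult) measurable
  also have "\<dots> \<le> ennreal ?c * (ennreal (4 * (T powr ((a - \<beta>) * p - 1 + 1) / ((a - \<beta>) * p - 1 + 1))) * (\<integral>\<^sup>+r. indicator {0..T} r * ennreal (G r powr p) \<partial>lborel))"
    using \<beta> p T by (intro mult_left_mono nn_integral_power_kernel_le) auto
  also have "\<dots> < \<infinity>" using G by (simp add: ennreal_mult_less_top)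
  finally have "gagliardo \<beta> p T f < \<infinity>" unfolding gagliardo_def by (rule ennreal_powr_less_top)
  then show ?thesis using Lp f p by (simp add: W_space_def W_norm_def)
qed

text \<open>With G essentially bounded by M, the inner integral is at most a multiple of the
  integral of (t - u) powr (a - \<beta> - 1), uniformly in t.\<close>

lemma W_space_infinite_exponent:
  assumes b: "increment_bound T a C G f0" and ae: "AE s in lborel. s \<in> {0..T} \<longrightarrow> f s = f0 s"
    and f: "f \<in> borel_measurable (lebesgue_on {0..T})"
    and G: "AE s in lborel. s \<in> {0..T} \<longrightarrow> G s \<le> M" and \<beta>: "0 < \<beta>" "\<beta> < a" and M: "0 \<le> M"
  shows "f \<in> W_space \<beta> \<infinity> T"
proof -
  have [measurable]: "f0 \<in> borel_measurable borel" and C: "0 \<le> C" and G0: "\<And>s. 0 \<le> G s"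
    using b by (auto simp: increment_bound_def)
  obtain S where S: "AE s in lborel. s \<in> {0..T} \<longrightarrow> s \<in> S" "\<And>s. s \<in> S \<Longrightarrow> f s = f0 s" "\<And>s. s \<in> S \<Longrightarrow> \<bar>f s\<bar> \<le> C * G s"
    "\<And>s u. s \<in> S \<Longrightarrow> u \<in> S \<Longrightarrow> \<bar>f s - f u\<bar> \<le> C * \<bar>s - u\<bar> powr a * (G s + G u)"
    by (rule increment_bound_AE[OF b ae], rule that)
  have S': "AE s in lborel. s \<in> {0..T} \<longrightarrow> s \<in> S \<and> G s \<le> M" using S(1) G by eventually_elim auto
  have "esssup (lebesgue_on {0..T}) (\<lambda>t. ennreal \<bar>f t\<bar>) \<le> ennreal (C * M)"
  proof (rule esssup_I)
    show "(\<lambda>t. ennreal \<bar>f t\<bar>) \<in> borel_measurable (lebesgue_on {0..T})" using f by measurable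
    have "AE s in lborel. s \<in> {0..T} \<longrightarrow> ennreal \<bar>f s\<bar> \<le> ennreal (C * M)"
      using S'
    proof eventually_elim
      case (elim s)
      show ?case
      proof
        assume "s \<in> {0..T}"
        then have "\<bar>f s\<bar> \<le> C * G s" "C * G s \<le> C * M" using elim S(3) C by (auto intro: mult_left_mono)
        then show "ennreal \<bar>f s\<bar> \<le> ennreal (C * M)" by (intro ennreal_leI) simp
      qed
    qed
    then show "AE s in lebesgue_on {0..T}. ennreal \<bar>f s\<bar> \<le> ennreal (C * M)"
      by (simp add: AE_lebesgue_on_iff)
  qed
  also have "\<dots> < \<infinity>" by simp
  finally have L: "Lp_norm T \<infinity> (\<lambda>t. ennreal \<bar>f t\<bar>) < \<infinity>" by (simp add: Lp_norm_def)
  let ?J = "\<lambda>f t. \<integral>\<^sup>+u. indicator {0..t} u * ennreal (\<bar>f t - f u\<bar> / \<bar>t - u\<bar> powr (1 + \<beta>)) \<partial>lborel"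
  have "esssup (lebesgue_on {0..T}) (?J f) \<le> ennreal (C * (2 * M) * (T powr (a - \<beta>) / (a - \<beta>)))"
  proof (rule esssup_I)
    \<comment> \<open>An upper bound through \<open>esssup_I\<close> asks for measurability of the
      inner integral in t; it is obtained for the Borel representative and transferred almost
      everywhere.\<close>
    have m: "(\<lambda>(t, u). indicator {0..t} u * ennreal (\<bar>f0 t - f0 u\<bar> / \<bar>t - u\<bar> powr (1 + \<beta>))) \<in> borel_measurable (lborel \<Otimes>\<^sub>M lborel)"
      unfolding indicator_def atLeastAtMost_iff by measurable
    have J0: "?J f0 \<in> borel_measurable lborel"
      using lborel.borel_measurable_nn_integral_fst[OF m] by (simp only: prod.case)
    have "AE t in lborel. t \<in> {0..T} \<longrightarrow> ?J f t = ?J f0 t"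
      using ae
    proof eventually_elim
      case (elim t)
      show ?case
      proof
        assume t: "t \<in> {0..T}"
        show "?J f t = ?J f0 t"
          by (rule nn_integral_cong_AE, use ae in eventually_elim) (use t elim in \<open>auto simp: indicator_def\<close>)
      qed
    qed
    then have J1: "AE t in lebesgue_on {0..T}. ?J f t = ?J f0 t" by (subst AE_lebesgue_on_iff) simp
    have J2: "?J f0 \<in> borel_measurable (lebesgue_on {0..T})"
      using J0 by (intro measurable_restrict_space1 measurable_completion) simp
    show "?J f \<in> borel_measurable (lebesgue_on {0..T})"
      by (rule measurable_lebesgue_on_AE[OF _ J2 J1]) simp
    have "AE t in lborel. t \<in> {0..T} \<longrightarrow> ?J f t \<le> ennreal (C * (2 * M) * (T powr (a - \<beta>) / (a - \<beta>)))"
      using S'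
    proof eventually_elim
      case (elim t)
      show ?case
      proof
        assume t: "t \<in> {0..T}"
        have e: "- 1 < a - \<beta> - 1" using \<beta> by simp
        have "?J f t \<le> (\<integral>\<^sup>+u. ennreal (C * (2 * M)) * (indicator {0..t} u * ennreal ((t - u) powr (a - \<beta> - 1))) \<partial>lborel)"
        proof (rule nn_integral_mono_AE, use S' in eventually_elim)
          case u: (elim u)
          show ?case
          proof (cases "0 \<le> u \<and> u < t")
            case True
            then have tu: "t \<in> S" "u \<in> S" "0 < t - u" "G t \<le> M" "G u \<le> M" using t u elim by auto
            have "\<bar>f t - f u\<bar> \<le> C * \<bar>t - u\<bar> powr a * (G t + G u)" using S(4)[OF tu(1,2)] .
            also have "\<dots> \<le> C * \<bar>t - u\<bar> powr a * (2 * M)" using tu C by (intro mult_left_mono) auto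
            finally have "\<bar>f t - f u\<bar> / (t - u) powr (1 + \<beta>) \<le> C * \<bar>t - u\<bar> powr a * (2 * M) / (t - u) powr (1 + \<beta>)"
              by (rule divide_right_mono) simp
            also have "\<dots> = C * (2 * M) * (\<bar>t - u\<bar> powr a / \<bar>t - u\<bar> powr (1 + \<beta>))" using tu by simp
            also have "\<dots> = C * (2 * M) * (t - u) powr (a - \<beta> - 1)"
              using tu unfolding powr_diff[symmetric] by (simp add: diff_diff_eq add.commute)
            finally show ?thesis using True C M by (simp add: ennreal_mult[symmetric] ennreal_leI)
          qed (auto simp: indicator_def)
        qed
        also have "\<dots> = ennreal (C * (2 * M)) * ennreal ((t - 0) powr (a - \<beta> - 1 + 1) / (a - \<beta> - 1 + 1))"
          using t nn_integral_powr_right[OF e, of 0 t] by (subst nn_integral_cmult) auto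
        also have "\<dots> = ennreal (C * (2 * M) * (t powr (a - \<beta>) / (a - \<beta>)))"
          using C M \<beta> by (simp add: ennreal_mult[symmetric])
        also have "\<dots> \<le> ennreal (C * (2 * M) * (T powr (a - \<beta>) / (a - \<beta>)))"
          using C M \<beta> t by (intro ennreal_leI mult_left_mono divide_right_mono powr_mono2) auto
        finally show "?J f t \<le> ennreal (C * (2 * M) * (T powr (a - \<beta>) / (a - \<beta>)))" .
      qed
    qed
    then show "AE t in lebesgue_on {0..T}. ?J f t \<le> ennreal (C * (2 * M) * (T powr (a - \<beta>) / (a - \<beta>)))"
      by (simp add: AE_lebesgue_on_iff)
  qed
  also have "\<dots> < \<infinity>" by simp
  finally show ?thesis using L f by (simp add: W_space_def W_norm_def nn_integral_lebesgue_on_Icc)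
qed

section \<open>From variability to the composition and the integral\<close>

lemma borel_measurable_ennreal_powr [measurable]:
  assumes F: "F \<in> borel_measurable M"
  shows "(\<lambda>x. ennreal_powr (F x) a) \<in> borel_measurable M"
  unfolding ennreal_powr_def
proof (rule measurable_If)
  show "(\<lambda>x. ennreal (enn2real (F x) powr a)) \<in> borel_measurable M"
    using F by measurable
  show "{x \<in> space M. F x = \<infinity>} \<in> sets M"
    using measurable_sets[OF F, of "{\<infinity>}"] by (simp add: vimage_def Int_def conj_commute)
qed simp

lemma Lp_norm_finite_exponentD:
  assumes "Lp_norm T (ennreal p) F < \<infinity>" "0 \<le> p"
  shows "(\<integral>\<^sup>+t. ennreal_powr (F t) p \<partial>lebesgue_on {0..T}) < \<infinity>"
  using assms by (auto simp: Lp_norm_def ennreal_powr_def less_top split: if_splits)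

lemma Lp_norm_finite_imp_AE_finite:
  assumes F [measurable]: "F \<in> borel_measurable (lebesgue_on {0..T})" and L: "Lp_norm T p F < \<infinity>"
  shows "AE t in lebesgue_on {0..T}. F t < \<infinity>"
proof (cases p)
  case (real q)
  have "(\<integral>\<^sup>+t. ennreal_powr (F t) q \<partial>lebesgue_on {0..T}) < \<infinity>"
    using L real by (intro Lp_norm_finite_exponentD) auto
  then have "AE t in lebesgue_on {0..T}. ennreal_powr (F t) q \<noteq> \<infinity>"
    by (intro nn_integral_PInf_AE) auto
  then show ?thesis by eventually_elim (auto simp: ennreal_powr_def less_top split: if_splits)
next
  case top
  then have "esssup (lebesgue_on {0..T}) F < \<infinity>" using L by (simp add: Lp_norm_def)
  with esssup_AE[of F "lebesgue_on {0..T}"] show ?thesis by (auto elim: eventually_mono intro: le_less_trans)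
qed

text \<open>The point where the geometry of \<phi> and X is left behind: afterwards only an
  increment majorant G with the integrability of the potential along the path is used.\<close>

lemma variable_wrt_increment_bound:
  fixes \<phi> :: "'a::euclidean_space \<Rightarrow> real"
  assumes \<alpha>: "0 < \<alpha>" and s: "0 < s" and \<phi>: "\<phi> \<in> BV_loc" and X: "X \<in> holder_space \<alpha> T"
    and v: "variable_wrt s p T \<phi> X" and f: "f \<in> composition T \<phi> X"
  obtains C f0 G F where "F \<in> borel_measurable (lebesgue_on {0..T})" "Lp_norm T p F < \<infinity>" "AE t in lborel. t \<in> {0..T} \<longrightarrow> F t < \<infinity> \<and> G t = 1 + enn2real (F t)"
    "increment_bound T (\<alpha> * s) C G f0" "AE t in lborel. t \<in> {0..T} \<longrightarrow> f t = f0 t"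
proof -
  obtain U where U: "open U" "compact (closure U)" "X ` {0..T} \<subseteq> U"
    and "(\<lambda>t. riesz_potential \<phi> U s (X t)) \<in> borel_measurable (lebesgue_on {0..T})" "Lp_norm T p (\<lambda>t. riesz_potential \<phi> U s (X t)) < \<infinity>"
    using v unfolding variable_wrt_def Let_def riesz_potential_def[abs_def] by auto
  moreover define F where "F = (\<lambda>t. riesz_potential \<phi> U s (X t))"
  ultimately have F [measurable]: "F \<in> borel_measurable (lebesgue_on {0..T})" and L: "Lp_norm T p F < \<infinity>" by auto
  have Ub: "bounded U" using U(2) by (meson bounded_subset closure_subset compact_imp_bounded)
  have Fin: "AE t in lebesgue_on {0..T}. F t < \<infinity>" by (rule Lp_norm_finite_imp_AE_finite[OF F L])
  obtain C S where C: "0 \<le> C" and S: "AE t in lebesgue_on {0..T}. t \<in> S"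
    "\<And>t. t \<in> S \<Longrightarrow> \<bar>f t\<bar> \<le> C * (1 + enn2real (F t))"
    "\<And>t u. t \<in> S \<Longrightarrow> u \<in> S \<Longrightarrow> \<bar>f t - f u\<bar> \<le> C * \<bar>t - u\<bar> powr (\<alpha> * s) * ((1 + enn2real (F t)) + (1 + enn2real (F u)))"
    using composition_estimate[OF \<alpha> s \<phi> X U(1) Ub U(3) Fin[unfolded F_def] f] unfolding F_def by auto
  obtain f0 where f0 [measurable]: "f0 \<in> borel_measurable borel" and f0_eq: "AE t in lborel. t \<in> {0..T} \<longrightarrow> f t = f0 t"
    by (rule borel_representative[OF composition_measurable[OF holder_space_continuous[OF X \<alpha>] f]], rule that)
  have gm: "(\<lambda>t. 1 + enn2real (F t)) \<in> borel_measurable (lebesgue_on {0..T})" by measurable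
  obtain g where g [measurable]: "g \<in> borel_measurable borel" and g_eq: "AE t in lborel. t \<in> {0..T} \<longrightarrow> 1 + enn2real (F t) = g t"
    by (rule borel_representative[OF gm], rule that)
  \<comment> \<open>The Borel representative g is nonnegative only almost everywhere, while
    \<open>increment_bound\<close> asks for it everywhere; the absolute value repairs this.\<close>
  define G where "G t = \<bar>g t\<bar>" for t
  have G: "G \<in> borel_measurable borel" unfolding G_def by measurable
  have G_eq: "AE t in lborel. t \<in> {0..T} \<longrightarrow> G t = 1 + enn2real (F t)"
    using g_eq by eventually_elim (auto simp: G_def dest: sym)
  have "AE t in lborel. t \<in> {0..T} \<longrightarrow> t \<in> S" using S(1) by (subst (asm) AE_lebesgue_on_iff) auto
  then have "AE t in lborel. t \<in> {0..T} \<longrightarrow> t \<in> S \<and> f t = f0 t \<and> G t = 1 + enn2real (F t)"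
    using f0_eq G_eq by eventually_elim auto
  \<comment> \<open>The set S of \<open>composition_estimate\<close> is not known to be Borel.
    Removing one Borel null set gives a Borel set on which all the almost everywhere statements hold
    together.\<close>
  then obtain N where N: "N \<in> null_sets lborel" "{t. \<not> (t \<in> {0..T} \<longrightarrow> t \<in> S \<and> f t = f0 t \<and> G t = 1 + enn2real (F t))} \<subseteq> N"
    by (auto simp: eventually_ae_filter)
  have good: "t \<in> S" "f t = f0 t" "G t = 1 + enn2real (F t)" if "t \<in> {0..T} - N" for t using N(2) that by auto
  show thesis
  proof
    show "F \<in> borel_measurable (lebesgue_on {0..T})" by (rule F)
    show "Lp_norm T p F < \<infinity>" by (rule L)
    have "AE t in lborel. t \<in> {0..T} \<longrightarrow> F t < \<infinity>" using Fin by (subst (asm) AE_lebesgue_on_iff) auto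
    then show "AE t in lborel. t \<in> {0..T} \<longrightarrow> F t < \<infinity> \<and> G t = 1 + enn2real (F t)"
      using G_eq by eventually_elim auto
    show "AE t in lborel. t \<in> {0..T} \<longrightarrow> f t = f0 t" by (rule f0_eq)
    show "increment_bound T (\<alpha> * s) C G f0"
      unfolding increment_bound_def
    proof (intro conjI bexI[of _ "{0..T} - N"] ballI allI)
      show "AE t in lborel. t \<in> {0..T} \<longrightarrow> t \<in> {0..T} - N" using AE_not_in[OF N(1)] by eventually_elim auto
      show "\<bar>f0 t\<bar> \<le> C * G t" if "t \<in> {0..T} - N" for t using S(2)[OF good(1)[OF that]] good(2,3)[OF that] by simp
      show "\<bar>f0 t - f0 u\<bar> \<le> C * \<bar>t - u\<bar> powr (\<alpha> * s) * (G t + G u)" if t: "t \<in> {0..T} - N" and u: "u \<in> {0..T} - N" for t u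
        using S(3)[OF good(1)[OF t] good(1)[OF u]] good(2,3)[OF t] good(2,3)[OF u] by simp
      show "{0..T} - N \<in> sets borel" using N(1) by (auto simp: null_sets_def)
    qed (use C G in \<open>auto simp: G_def\<close>)
  qed
qed

text \<open>Adding 1 to F preserves p-integrability because [0,T] has finite measure.\<close>

lemma Lp_norm_finite_exponent_majorant:
  assumes L: "Lp_norm T (ennreal p) F < \<infinity>" and p: "1 \<le> p"
    and G: "AE t in lborel. t \<in> {0..T} \<longrightarrow> F t < \<infinity> \<and> G t = 1 + enn2real (F t)"
    and Fm: "F \<in> borel_measurable (lebesgue_on {0..T})"
  shows "(\<integral>\<^sup>+s. indicator {0..T} s * ennreal (G s powr p) \<partial>lborel) < \<infinity>"
proof -
  note [measurable] = Fm
  have "(\<integral>\<^sup>+s. indicator {0..T} s * ennreal (G s powr p) \<partial>lborel) \<le> (\<integral>\<^sup>+s. indicator {0..T} s * (ennreal (2 powr p) * (1 + ennreal_powr (F s) p)) \<partial>lborel)"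
  proof (rule nn_integral_mono_AE, use G in eventually_elim)
    case (elim s)
    show ?case
    proof (cases "s \<in> {0..T}")
      case True
      have "G s powr p \<le> 2 powr p * (1 powr p + enn2real (F s) powr p)"
        using powr_add_le[of 1 "enn2real (F s)" p] elim True p by simp
      then have "ennreal (G s powr p) \<le> ennreal (2 powr p * (1 + enn2real (F s) powr p))" by (intro ennreal_leI) simp
      then show ?thesis using True elim by (simp add: ennreal_powr_def ennreal_mult)
    qed simp
  qed
  also have "\<dots> = (\<integral>\<^sup>+s. ennreal (2 powr p) * (1 + ennreal_powr (F s) p) \<partial>lebesgue_on {0..T})"
    by (rule nn_integral_lebesgue_on_Icc[symmetric])
  also have "\<dots> = ennreal (2 powr p) * ((\<integral>\<^sup>+s. 1 \<partial>lebesgue_on {0..T}) + (\<integral>\<^sup>+s. ennreal_powr (F s) p \<partial>lebesgue_on {0..T}))"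
    by (simp add: nn_integral_cmult nn_integral_add)
  also have "\<dots> < \<infinity>"
    using Lp_norm_finite_exponentD[OF L] p
    by (simp add: ennreal_mult_less_top emeasure_restrict_space emeasure_lborel_Icc_eq)
  finally show ?thesis .
qed

lemma truncation_bound_W_norm:
  assumes T: "0 < T" and p: "1 < p" and \<theta>: "0 < \<theta>" "\<theta> < \<beta>" and \<beta>: "enn2real (inverse p) < 1 - \<beta>"
  shows "\<exists>c\<ge>0. \<forall>f f0 n u t. f0 \<in> borel_measurable borel \<longrightarrow> (AE s in lborel. s \<in> {0..T} \<longrightarrow> f s = f0 s) \<longrightarrow>
    0 \<le> n \<longrightarrow> W_norm \<beta> p T f \<le> ennreal n \<longrightarrow> 0 \<le> u \<longrightarrow> u \<le> t \<longrightarrow> t \<le> T \<longrightarrow>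
    truncation_bound \<theta> u t f0 \<le> ennreal (c * n * (t - u) powr (1 - \<beta> - enn2real (inverse p)))"
proof (cases p)
  case (real q)
  then have q: "1 < q" using p by simp
  have i: "enn2real (inverse p) = 1 / q" using q real by (simp add: inverse_ennreal inverse_eq_divide)
  have \<beta>': "1 / q < 1 - \<beta>" using \<beta> i by simp
  show ?thesis unfolding i unfolding real(2) by (rule truncation_bound_W_norm_finite_exponent[OF T q \<theta> \<beta>'])
next
  case top
  then show ?thesis using truncation_bound_W_norm_infinite_exponent[OF T \<theta>] \<beta> by simp
qed

text \<open>Formulated for every f in \<open>W_space\<close>, so the constant can depend on T, p,
  \<beta> and \<gamma> only.\<close>

lemma gls_integral_holder_bound:
  assumes T: "0 < T" and p: "1 < p" and \<beta>: "0 < \<beta>" "enn2real (inverse p) < 1 - \<beta>" "1 - \<beta> < \<gamma>" and \<gamma>: "\<gamma> < 1"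
  shows "\<exists>c>0. \<forall>f (Y :: real \<Rightarrow> real). f \<in> W_space \<beta> p T \<longrightarrow> Y \<in> holder_space \<gamma> T \<longrightarrow>
    (\<lambda>t. gls_integral T (restrict_to t f) Y) \<in> holder_space (1 - \<beta> - enn2real (inverse p)) T \<and>
    holder_norm (1 - \<beta> - enn2real (inverse p)) T (\<lambda>t. gls_integral T (restrict_to t f) Y)
      \<le> ennreal c * W_norm \<beta> p T f * holder_norm \<gamma> T Y"
proof -
  define \<eta> where "\<eta> = 1 - \<beta> - enn2real (inverse p)"
  \<comment> \<open>The midpoint of the interval from 1 - \<gamma> to \<beta>: above 1 - \<gamma>
    the integrator is admissible at order 1 - \<theta>, and below \<beta> the Sobolev norm of order
    \<beta> controls the truncations.\<close>
  define \<theta> where "\<theta> = (1 - \<gamma> + \<beta>) / 2"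
  have "0 \<le> enn2real (inverse p)" by simp
  then have "\<beta> < 1" "0 < \<gamma>" using \<beta> by linarith+
  then have \<theta>: "0 < \<theta>" "\<theta> < \<beta>" "\<theta> < 1" "1 - \<theta> < \<gamma>" using \<beta> \<gamma> by (auto simp: \<theta>_def field_simps)
  have \<eta>: "0 < \<eta>" using \<beta> by (simp add: \<eta>_def)
  define K where "K = T powr (\<gamma> + \<theta> - 1) * (1 + (1 - \<theta>) / (\<gamma> + \<theta> - 1)) / Gamma \<theta> / Gamma (1 - \<theta>)"
  have K: "0 \<le> K" unfolding K_def using \<theta> Gamma_real_pos[of \<theta>] Gamma_real_pos[of "1 - \<theta>"] by (auto intro!: mult_nonneg_nonneg divide_nonneg_nonneg add_nonneg_nonneg)
  obtain c where c: "0 \<le> c" and tb: "\<forall>f f0 n u t. f0 \<in> borel_measurable borel \<longrightarrow> (AE s in lborel. s \<in> {0..T} \<longrightarrow> f s = f0 s) \<longrightarrow>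
    0 \<le> n \<longrightarrow> W_norm \<beta> p T f \<le> ennreal n \<longrightarrow> 0 \<le> u \<longrightarrow> u \<le> t \<longrightarrow> t \<le> T \<longrightarrow>
    truncation_bound \<theta> u t f0 \<le> ennreal (c * n * (t - u) powr \<eta>)"
    using truncation_bound_W_norm[OF T p \<theta>(1,2) \<beta>(2), folded \<eta>_def] by (elim exE conjE) (rule that)
  \<comment> \<open>T powr \<eta> pays for the supremum, the inner 1 for the Hoelder quotient; the
    final 1 keeps A positive even if K or c vanishes.\<close>
  define A where "A = K * c * (T powr \<eta> + 1) + 1"
  have A: "0 < A" using K c by (simp add: A_def add_nonneg_pos)
  show ?thesis
    unfolding \<eta>_def[symmetric]
  proof (intro exI[of _ A] conjI[OF A] allI impI, rule conjI)
    fix f Y :: "real \<Rightarrow> real" assume f: "f \<in> W_space \<beta> p T" and Y: "Y \<in> holder_space \<gamma> T"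
    define n where "n = enn2real (W_norm \<beta> p T f)"
    have n: "0 \<le> n" "W_norm \<beta> p T f = ennreal n" using f by (auto simp: n_def W_space_def less_top)
    have fm: "f \<in> borel_measurable (lebesgue_on {0..T})" using f by (simp add: W_space_def)
    obtain f0 where f0: "f0 \<in> borel_measurable borel" "AE s in lborel. s \<in> {0..T} \<longrightarrow> f s = f0 s"
      by (rule borel_representative[OF fm], rule that)
    obtain H where H: "0 \<le> H" "\<And>u t. 0 \<le> u \<Longrightarrow> u \<le> T \<Longrightarrow> 0 \<le> t \<Longrightarrow> t \<le> T \<Longrightarrow> norm (Y t - Y u) \<le> H * \<bar>t - u\<bar> powr \<gamma>"
      "ennreal H \<le> holder_norm \<gamma> T Y"
      by (rule holder_space_bound[OF Y], rule that)
    have HY: "holder_bound T \<gamma> H Y" using H(1,2) by (auto simp: holder_bound_def)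
    have Yc: "continuous_on {0..T} Y" by (rule holder_space_continuous[OF Y \<open>0 < \<gamma>\<close>])
    note t = tb[rule_format, OF f0 n(1) eq_refl[OF n(2)]]
    let ?I = "\<lambda>t. gls_integral T (restrict_to t f) Y"
    have fin: "truncation_bound \<theta> u t f0 < \<infinity>" if "0 \<le> u" "u \<le> t" "t \<le> T" for u t
      using t[OF that] by (rule le_less_trans) simp
    have inc: "\<bar>?I t - ?I u\<bar> \<le> H * (K * c) * n * (t - u) powr \<eta>" if ut: "0 \<le> u" "u \<le> t" "t \<le> T" for u t
    proof -
      have "ennreal \<bar>?I t - ?I u\<bar> \<le> ennreal (H * K) * truncation_bound \<theta> u t f0"
        unfolding K_def using ut by (intro gls_integral_difference[OF T HY Yc \<theta>(1,3,4) f0] fin) auto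
      also have "\<dots> \<le> ennreal (H * K) * ennreal (c * n * (t - u) powr \<eta>)"
        by (intro mult_left_mono t ut) simp
      also have "\<dots> = ennreal (H * (K * c) * n * (t - u) powr \<eta>)"
        using H K c n by (simp add: ennreal_mult[symmetric] ac_simps)
      finally show ?thesis using H K c n by (subst (asm) ennreal_le_iff) auto
    qed
    have I0: "?I 0 = 0" by (rule gls_integral_0[OF T HY Yc \<theta>(1,3,4) f0])
    have sup: "\<bar>?I t\<bar> \<le> H * (K * c) * n * T powr \<eta>" if "t \<in> {0..T}" for t
    proof -
      have "\<bar>?I t\<bar> \<le> H * (K * c) * n * (t - 0) powr \<eta>" using inc[of 0 t] that I0 by simp
      also have "\<dots> \<le> H * (K * c) * n * T powr \<eta>"
        using that \<eta> H K c n by (intro mult_left_mono powr_mono2) auto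
      finally show ?thesis .
    qed
    have "holder_norm \<eta> T ?I \<le> ennreal (H * (K * c) * n * T powr \<eta>) + ennreal (H * (K * c) * n)"
      unfolding holder_norm_def
    proof (intro add_mono SUP_least)
      fix t assume "t \<in> {0..T}"
      then show "ennreal (norm (?I t)) \<le> ennreal (H * (K * c) * n * T powr \<eta>)"
        using sup by (auto intro!: ennreal_leI)
    next
      fix x assume "x \<in> {(u, t). 0 \<le> u \<and> u < t \<and> t \<le> T}"
      then obtain u t where x: "x = (u, t)" and ut: "0 \<le> u" "u < t" "t \<le> T" by auto
      have "\<bar>?I t - ?I u\<bar> / (t - u) powr \<eta> \<le> H * (K * c) * n"
        using inc[of u t] ut by (simp add: pos_divide_le_eq)
      then show "(case x of (u, t) \<Rightarrow> ennreal (norm (?I t - ?I u) / \<bar>t - u\<bar> powr \<eta>)) \<le> ennreal (H * (K * c) * n)"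
        using ut by (simp add: x ennreal_leI)
    qed
    also have "\<dots> = ennreal (H * n * (K * c * (T powr \<eta> + 1)))"
      using H K c n by (subst ennreal_plus[symmetric]) (auto simp: algebra_simps)
    also have "\<dots> \<le> ennreal (H * n * A)"
      using H n by (intro ennreal_leI mult_left_mono) (auto simp: A_def)
    finally have bound: "holder_norm \<eta> T ?I \<le> ennreal (H * n * A)" .
    then show "?I \<in> holder_space \<eta> T" by (auto simp: holder_space_def intro: le_less_trans)
    have "ennreal (H * n * A) = ennreal A * ennreal n * ennreal H"
      using H n A by (simp add: ennreal_mult[symmetric] ac_simps)
    also have "\<dots> \<le> ennreal A * ennreal n * holder_norm \<gamma> T Y"
      by (intro mult_left_mono H) simp
    finally show "holder_norm \<eta> T ?I \<le> ennreal A * W_norm \<beta> p T f * holder_norm \<gamma> T Y"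
      using bound unfolding n(2) by (rule order_trans[rotated])
  qed
qed

text \<open>Variability with exponent 1 is integrability of G, which controls the truncations at all
  orders below \<alpha> s. Both membership in \<open>W0_space\<close> and existence of the integral
  are read off from this.\<close>

lemma composition_truncation_bound:
  fixes \<phi> :: "'a::euclidean_space \<Rightarrow> real"
  assumes \<alpha>: "0 < \<alpha>" and s: "0 < s" and \<phi>: "\<phi> \<in> BV_loc" and X: "X \<in> holder_space \<alpha> T"
    and v: "variable_wrt s 1 T \<phi> X" and f: "f \<in> composition T \<phi> X"
  obtains f0 where "f0 \<in> borel_measurable borel" "AE t in lborel. t \<in> {0..T} \<longrightarrow> f t = f0 t"
    "\<And>\<theta> t. 0 < \<theta> \<Longrightarrow> \<theta> < 1 \<Longrightarrow> \<theta> < \<alpha> * s \<Longrightarrow> 0 \<le> t \<Longrightarrow> t \<le> T \<Longrightarrow> truncation_bound \<theta> 0 t f0 < \<infinity>"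
proof -
  obtain C f0 G F where F: "F \<in> borel_measurable (lebesgue_on {0..T})" "Lp_norm T 1 F < \<infinity>"
    "AE t in lborel. t \<in> {0..T} \<longrightarrow> F t < \<infinity> \<and> G t = 1 + enn2real (F t)"
    and b: "increment_bound T (\<alpha> * s) C G f0" and ae: "AE t in lborel. t \<in> {0..T} \<longrightarrow> f t = f0 t"
    by (rule variable_wrt_increment_bound[OF \<alpha> s \<phi> X v f], rule that)
  have L: "Lp_norm T (ennreal 1) F < \<infinity>" using F(2) by simp
  have "(\<integral>\<^sup>+t. indicator {0..T} t * ennreal (G t powr 1) \<partial>lborel) < \<infinity>"
    by (rule Lp_norm_finite_exponent_majorant[OF L order_refl F(3,1)])
  moreover have "G t powr 1 = G t" for t using b by (simp add: increment_bound_def)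
  ultimately have G: "(\<integral>\<^sup>+t. indicator {0..T} t * ennreal (G t) \<partial>lborel) < \<infinity>" by simp
  show thesis
  proof (rule that[OF _ ae])
    show "f0 \<in> borel_measurable borel" using b by (simp add: increment_bound_def)
    show "truncation_bound \<theta> 0 t f0 < \<infinity>" if "0 < \<theta>" "\<theta> < 1" "\<theta> < \<alpha> * s" "0 \<le> t" "t \<le> T" for \<theta> t
      by (rule truncation_bound_increment_bound[OF b G that])
  qed
qed

lemma composition_W_space:
  fixes \<phi> :: "'a::euclidean_space \<Rightarrow> real"
  assumes T: "0 < T" and \<alpha>: "0 < \<alpha>" and s: "0 < s" and \<phi>: "\<phi> \<in> BV_loc" and X: "X \<in> holder_space \<alpha> T"
    and v: "variable_wrt s p T \<phi> X" and f: "f \<in> composition T \<phi> X" and p: "1 < p" and \<beta>: "0 < \<beta>" "\<beta> < \<alpha> * s"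
  shows "f \<in> W_space \<beta> p T"
proof -
  obtain C f0 G F where F: "F \<in> borel_measurable (lebesgue_on {0..T})" and L: "Lp_norm T p F < \<infinity>"
    and G: "AE t in lborel. t \<in> {0..T} \<longrightarrow> F t < \<infinity> \<and> G t = 1 + enn2real (F t)"
    and b: "increment_bound T (\<alpha> * s) C G f0" and ae: "AE t in lborel. t \<in> {0..T} \<longrightarrow> f t = f0 t"
    by (rule variable_wrt_increment_bound[OF \<alpha> s \<phi> X v f], rule that)
  have fm: "f \<in> borel_measurable (lebesgue_on {0..T})"
    by (rule composition_measurable[OF holder_space_continuous[OF X \<alpha>] f])
  show ?thesis
  proof (cases p)
    case (real q)
    then have q: "1 < q" using p by simp
    have Lq: "Lp_norm T (ennreal q) F < \<infinity>" using L real by simp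
    show ?thesis unfolding real(2)
      using T by (intro W_space_finite_exponent[OF b ae fm q _ _ \<beta>] Lp_norm_finite_exponent_majorant[OF Lq less_imp_le[OF q] G F]) simp
  next
    case top
    define e where "e = esssup (lebesgue_on {0..T}) F"
    have e: "e < \<infinity>" using L top by (simp add: Lp_norm_def e_def)
    have "AE t in lborel. t \<in> {0..T} \<longrightarrow> F t \<le> e"
      using esssup_AE[of F "lebesgue_on {0..T}"] unfolding e_def by (subst (asm) AE_lebesgue_on_iff) simp
    then have "AE t in lborel. t \<in> {0..T} \<longrightarrow> G t \<le> 1 + enn2real e"
      using G by eventually_elim (use e in \<open>auto intro!: enn2real_mono simp: less_top\<close>)
    then show ?thesis unfolding top infinity_ennreal_def[symmetric]
      by (intro W_space_infinite_exponent[OF b ae fm _ \<beta>]) auto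
  qed
qed

theorem theorem2p12:
  fixes T \<alpha> :: real
  assumes "T > 0" and "0 < \<alpha>" and "\<alpha> < 1"
  shows
    "(\<forall>(s::real) (\<phi> :: real ^ 'n \<Rightarrow> real) (X :: real \<Rightarrow> real ^ 'n).
        0 < s \<and> s < 1 \<and> \<phi> \<in> BV_loc \<and> X \<in> holder_space \<alpha> T \<and> variable_wrt s 1 T \<phi> X \<longrightarrow>
        (\<forall>f\<in>composition T \<phi> X.
           (\<forall>\<beta>. 0 < \<beta> \<and> \<beta> < \<alpha> * s \<longrightarrow> f \<in> W0_space \<beta> T) \<and>
           (\<forall>(\<gamma>::real) (Y :: real \<Rightarrow> real) t.
              0 < \<gamma> \<and> \<gamma> < 1 \<and> Y \<in> holder_space \<gamma> T \<and> \<alpha> * s + \<gamma> > 1 \<and> t \<in> {0..T} \<longrightarrow>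
              gls_integrable T (restrict_to t f) Y) \<and>
           (\<forall>(p::ennreal) \<beta>.
              1 < p \<and> variable_wrt s p T \<phi> X \<and> 0 < \<beta> \<and> \<beta> < \<alpha> * s \<longrightarrow> f \<in> W_space \<beta> p T)))
     \<and>
     (\<forall>(p::ennreal) (\<beta>::real) (\<gamma>::real).
        1 < p \<and> 0 < \<beta> \<and> enn2real (inverse p) < 1 - \<beta> \<and> 1 - \<beta> < \<gamma> \<and> \<gamma> < 1 \<longrightarrow>
        (\<exists>c::real. c > 0 \<and>
           (\<forall>(s::real) (\<phi> :: real ^ 'n \<Rightarrow> real) (X :: real \<Rightarrow> real ^ 'n) (Y :: real \<Rightarrow> real).
              0 < s \<and> s < 1 \<and> \<beta> < \<alpha> * s \<and>
              \<phi> \<in> BV_loc \<and> X \<in> holder_space \<alpha> T \<and>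
              variable_wrt s 1 T \<phi> X \<and> variable_wrt s p T \<phi> X \<and>
              Y \<in> holder_space \<gamma> T \<longrightarrow>
              (\<forall>f\<in>composition T \<phi> X.
                 (\<lambda>t. gls_integral T (restrict_to t f) Y)
                   \<in> holder_space (1 - \<beta> - enn2real (inverse p)) T \<and>
                 holder_norm (1 - \<beta> - enn2real (inverse p)) T
                     (\<lambda>t. gls_integral T (restrict_to t f) Y)
                   \<le> ennreal c * W_norm \<beta> p T f * holder_norm \<gamma> T Y))))"
proof (intro conjI allI impI ballI; (elim conjE)?)
  fix s :: real and \<phi> :: "real ^ 'n \<Rightarrow> real" and X :: "real \<Rightarrow> real ^ 'n" and f
  assume s: "0 < s" "s < 1" and \<phi>: "\<phi> \<in> BV_loc" and X: "X \<in> holder_space \<alpha> T"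
    and v: "variable_wrt s 1 T \<phi> X" and f: "f \<in> composition T \<phi> X"
  \<comment> \<open>Every order below \<alpha> s is then below 1, as the Hardy inequality
    requires.\<close>
  have as: "\<alpha> * s < 1" using mult_strict_mono[of \<alpha> 1 s 1] assms(2,3) s by simp
  obtain f0 where f0: "f0 \<in> borel_measurable borel" "AE t in lborel. t \<in> {0..T} \<longrightarrow> f t = f0 t"
    and fin: "\<And>\<theta> t. 0 < \<theta> \<Longrightarrow> \<theta> < 1 \<Longrightarrow> \<theta> < \<alpha> * s \<Longrightarrow> 0 \<le> t \<Longrightarrow> t \<le> T \<Longrightarrow> truncation_bound \<theta> 0 t f0 < \<infinity>"
    by (rule composition_truncation_bound[OF assms(2) s(1) \<phi> X v f], rule that)
  show "f \<in> W0_space \<beta> T" if \<beta>: "0 < \<beta>" "\<beta> < \<alpha> * s" for \<beta>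
  proof (rule W0_space_truncate[OF f0(1) \<beta>(1)])
    show "truncation_bound \<beta> 0 T f0 < \<infinity>" using \<beta> as assms(1) by (intro fin) auto
    show "AE s in lborel. s \<in> {0..T} \<longrightarrow> f s = truncate 0 T f0 s"
      using f0(2) AE_lborel_singleton[of 0] by eventually_elim (auto simp: truncate_def indicator_def)
  qed (use assms(1) in auto)
  show "gls_integrable T (restrict_to t f) Y"
    if \<gamma>: "0 < \<gamma>" "\<gamma> < 1" and Y: "Y \<in> holder_space \<gamma> T" and ag: "\<alpha> * s + \<gamma> > 1" and t: "t \<in> {0..T}"
    for \<gamma> t :: real and Y :: "real \<Rightarrow> real"
  proof -
    \<comment> \<open>The midpoint of the interval from 1 - \<gamma> to \<alpha> s, which is
      nonempty exactly because \<alpha> s + \<gamma> > 1.\<close>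
    define \<theta> where "\<theta> = (\<alpha> * s + (1 - \<gamma>)) / 2"
    have \<theta>: "0 < \<theta>" "\<theta> < 1" "1 - \<theta> < \<gamma>" "\<theta> < \<alpha> * s"
      using \<gamma> ag as assms(2) s by (auto simp: \<theta>_def field_simps add_pos_pos)
    obtain H where H: "0 \<le> H" "\<And>u t. 0 \<le> u \<Longrightarrow> u \<le> T \<Longrightarrow> 0 \<le> t \<Longrightarrow> t \<le> T \<Longrightarrow> norm (Y t - Y u) \<le> H * \<bar>t - u\<bar> powr \<gamma>"
      by (rule holder_space_bound[OF Y], rule that)
    have "holder_bound T \<gamma> H Y" using H by (auto simp: holder_bound_def)
    then have "gls_admissible T (restrict_to t f) Y \<theta>"
      using t \<theta> by (intro gls_admissible_restrict_to[OF assms(1) _ holder_space_continuous[OF Y \<gamma>(1)] \<theta>(1-3) f0] fin) auto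
    then show ?thesis by (auto simp: gls_integrable_def)
  qed
  show "f \<in> W_space \<beta> p T" if "1 < p" "variable_wrt s p T \<phi> X" "0 < \<beta>" "\<beta> < \<alpha> * s" for p \<beta>
    by (rule composition_W_space[OF assms(1,2) s(1) \<phi> X that(2) f that(1,3,4)])
next
  fix p :: ennreal and \<beta> \<gamma> :: real
  assume p: "1 < p" and \<beta>: "0 < \<beta>" "enn2real (inverse p) < 1 - \<beta>" "1 - \<beta> < \<gamma>" "\<gamma> < 1"
  \<comment> \<open>The constant is fixed before s, \<phi>, X and Y are introduced; the composition
    enters only through its membership in \<open>W_space\<close>.\<close>
  obtain c where "0 < c" and c: "\<forall>f (Y :: real \<Rightarrow> real). f \<in> W_space \<beta> p T \<longrightarrow> Y \<in> holder_space \<gamma> T \<longrightarrow>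
    (\<lambda>t. gls_integral T (restrict_to t f) Y) \<in> holder_space (1 - \<beta> - enn2real (inverse p)) T \<and>
    holder_norm (1 - \<beta> - enn2real (inverse p)) T (\<lambda>t. gls_integral T (restrict_to t f) Y)
      \<le> ennreal c * W_norm \<beta> p T f * holder_norm \<gamma> T Y"
    using gls_integral_holder_bound[OF assms(1) p \<beta>] by (elim exE conjE) (rule that)
  show "\<exists>c>0. \<forall>(s::real) (\<phi> :: real ^ 'n \<Rightarrow> real) (X :: real \<Rightarrow> real ^ 'n) (Y :: real \<Rightarrow> real).
              0 < s \<and> s < 1 \<and> \<beta> < \<alpha> * s \<and>
              \<phi> \<in> BV_loc \<and> X \<in> holder_space \<alpha> T \<and>
              variable_wrt s 1 T \<phi> X \<and> variable_wrt s p T \<phi> X \<and>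
              Y \<in> holder_space \<gamma> T \<longrightarrow>
              (\<forall>f\<in>composition T \<phi> X.
                 (\<lambda>t. gls_integral T (restrict_to t f) Y)
                   \<in> holder_space (1 - \<beta> - enn2real (inverse p)) T \<and>
                 holder_norm (1 - \<beta> - enn2real (inverse p)) T
                     (\<lambda>t. gls_integral T (restrict_to t f) Y)
                   \<le> ennreal c * W_norm \<beta> p T f * holder_norm \<gamma> T Y)"
  proof (intro exI[of _ c] conjI[OF \<open>0 < c\<close>] allI impI ballI, elim conjE)
    fix s :: real and \<phi> :: "real ^ 'n \<Rightarrow> real" and X :: "real \<Rightarrow> real ^ 'n" and Y :: "real \<Rightarrow> real" and f
    assume f: "f \<in> composition T \<phi> X" and s: "0 < s" "\<beta> < \<alpha> * s" and \<phi>: "\<phi> \<in> BV_loc"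
      and X: "X \<in> holder_space \<alpha> T" and v: "variable_wrt s p T \<phi> X" and Y: "Y \<in> holder_space \<gamma> T"
    have "f \<in> W_space \<beta> p T"
      by (rule composition_W_space[OF assms(1,2) s(1) \<phi> X v f p \<beta>(1) s(2)])
    with c Y show "(\<lambda>t. gls_integral T (restrict_to t f) Y) \<in> holder_space (1 - \<beta> - enn2real (inverse p)) T \<and>
      holder_norm (1 - \<beta> - enn2real (inverse p)) T (\<lambda>t. gls_integral T (restrict_to t f) Y)
        \<le> ennreal c * W_norm \<beta> p T f * holder_norm \<gamma> T Y"
      by blast
  qed
qed

end
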